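(* Let $C_0$ be sufficiently large depending on $G$, $N_0$ a dyadic number sufficiently large depending on $G,C_0$, and $A$ a dyadic number sufficiently large depending on $G,C_0,N_0$. Let $0<\varepsilon\le1/A$. Then there exist maps $\phi_m:G\to\mathbb{R}^{128\cdot23^{n_h}}$, $m\in\mathbb{Z}$, such that for all $m\in\mathbb{Z}$ and $p\in G$: (1) $\|\phi_m\|_{C^{s^2+s}_{A^m}}\lesssim_{C_0}A^m$; in particular $X_{r,i}\phi_m(p)=O_{C_0}(A^{-m(r-1)})$ for all $r,i$; (2) $\sum_{m'>m}A^{-\varepsilon(m'-m)}B(\phi_m,\phi_{m'})=0$ identically on $G$ (the sum converges absolutely); (3) $|X_i\phi_m(p)|\gtrsim_{C_0}1$ for $i=1,\dots,k$, and, with $\phi_{(\ge m)}=\sum_{m'\ge m}A^{-\varepsilon(m'-m)}\phi_{m'}$, \[\Big|\bigwedge_{W\in\mathcal W}W\phi_{(\ge m)}(p)\Big|\gtrsim_{C_0}\prod_{W\in\mathcal W}|W\phi_{(\ge m)}(p)|.\]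
   Context: $G$ is a Carnot group of step $s\ge2$ (stratified Lie algebra $V_1\oplus\cdots\oplus V_s$ with $[V_1,V_r]=V_{r+1}$, $V_{s+1}=0$, inner product on $V_1$, Carnot–Carathéodory distance $d_G$); $k_r=\dim V_r$, $k=k_1$, $n_h=\sum_rrk_r$. $X_1,\dots,X_k$: orthonormal basis of $V_1$; $X_{r,1},\dots,X_{r,k_r}$: basis of $V_r$ with $X_{1,i}=X_i$; all left-invariant vector fields. $(r,i)\preceq(r',i')$ iff $r<r'$ or ($r=r'$, $i\le i'$). $\mathcal W$ = set of operators $X_{r_1,j_1}\cdots X_{r_m,j_m}$ with $1\le m\le s$, $(r_1,j_1)\preceq\cdots\preceq(r_m,j_m)$. $\nabla\phi=(X_1\phi,\dots,X_k\phi)$; $\|\phi\|_{C^m_R}=\sum_{j\le m}R^j\sup_G|\nabla^j\phi|$. Wedge norms are Euclidean norms on exterior powers. $B(\phi,\psi)$ is the $k\times k$ symmetric matrix with entries $\frac12(X_i\phi\cdot X_j\psi+X_j\phi\cdot X_i\psi)$. $\lesssim_{C_0}$: constants depending only on $G$ and $C_0$. *)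

theory Defs
  imports "HOL-Analysis.Analysis" "HOL-Combinatorics.Permutations"
begin

text \<open>A Carnot group is modelled (up to isomorphism) as a smooth group law on a
Euclidean space type; its Lie algebra is the tangent space at the identity,
i.e. the space itself, with left-invariant vector field
X_v f (p) = D(f o L_p)(e) v.\<close>

fun Cn :: "nat \<Rightarrow> ('a::euclidean_space \<Rightarrow> 'b::real_normed_vector) \<Rightarrow> bool" where
  "Cn 0 f = continuous_on UNIV f"
| "Cn (Suc n) f = ((\<forall>x. f differentiable (at x)) \<and>
        (\<forall>v. Cn n (\<lambda>x. frechet_derivative f (at x) v)))"

definition smooth :: "('a::euclidean_space \<Rightarrow> 'b::real_normed_vector) \<Rightarrow> bool" where
  "smooth f \<longleftrightarrow> (\<forall>n. Cn n f)"

definition Lder :: "('a::euclidean_space \<Rightarrow> 'a \<Rightarrow> 'a) \<Rightarrow> 'a \<Rightarrow> 'a \<Rightarrow> ('a \<Rightarrow> real) \<Rightarrow> 'a \<Rightarrow> real" where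
  "Lder mul e v f p = frechet_derivative (\<lambda>y. f (mul p y)) (at e) v"

fun Lword :: "('a::euclidean_space \<Rightarrow> 'a \<Rightarrow> 'a) \<Rightarrow> 'a \<Rightarrow> 'a list \<Rightarrow> ('a \<Rightarrow> real) \<Rightarrow> 'a \<Rightarrow> real" where
  "Lword mul e [] f = f"
| "Lword mul e (v # vs) f = Lder mul e v (Lword mul e vs f)"

definition Jm :: "('a::euclidean_space \<Rightarrow> 'a \<Rightarrow> 'a) \<Rightarrow> 'a \<Rightarrow> 'a \<Rightarrow> 'a \<Rightarrow> 'a" where
  "Jm mul e p = frechet_derivative (mul p) (at e)"

definition lie_br :: "('a::euclidean_space \<Rightarrow> 'a \<Rightarrow> 'a) \<Rightarrow> 'a \<Rightarrow> 'a \<Rightarrow> 'a \<Rightarrow> 'a" where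
  "lie_br mul e v w =
     frechet_derivative (\<lambda>p. Jm mul e p w) (at e) v - frechet_derivative (\<lambda>p. Jm mul e p v) (at e) w"

definition idx :: "nat \<Rightarrow> (nat \<Rightarrow> nat) \<Rightarrow> (nat \<times> nat) set" where
  "idx s kk = {(r, i). 1 \<le> r \<and> r \<le> s \<and> 1 \<le> i \<and> i \<le> kk r}"

definition Vsp :: "(nat \<Rightarrow> nat \<Rightarrow> 'a::euclidean_space) \<Rightarrow> (nat \<Rightarrow> nat) \<Rightarrow> nat \<Rightarrow> 'a set" where
  "Vsp Xb kk r = span (Xb r ` {1..kk r})"

(* Carnot group of step s, with basis X_{r,i} of V_r (X_{1,i}: orthonormal basis of V_1,
   which fixes the inner product on V_1) *)
definition carnot :: "('a::euclidean_space \<Rightarrow> 'a \<Rightarrow> 'a) \<Rightarrow> 'a \<Rightarrow> nat \<Rightarrow> (nat \<Rightarrow> nat)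
      \<Rightarrow> (nat \<Rightarrow> nat \<Rightarrow> 'a) \<Rightarrow> bool" where
  "carnot mul e s kk Xb \<longleftrightarrow>
     (\<forall>x y z. mul (mul x y) z = mul x (mul y z)) \<and>
     (\<forall>x. mul e x = x \<and> mul x e = x) \<and>
     (\<forall>x. \<exists>y. mul x y = e) \<and>
     smooth (\<lambda>z::'a \<times> 'a. mul (fst z) (snd z)) \<and>
     2 \<le> s \<and>
     (\<forall>r\<in>{1..s}. 1 \<le> kk r) \<and>
     inj_on (\<lambda>(r, i). Xb r i) (idx s kk) \<and>
     independent ((\<lambda>(r, i). Xb r i) ` idx s kk) \<and>
     span ((\<lambda>(r, i). Xb r i) ` idx s kk) = UNIV \<and>
     (\<forall>r. 1 \<le> r \<and> r < s \<longrightarrow>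
        Vsp Xb kk (Suc r) = span {lie_br mul e x y | x y. x \<in> Vsp Xb kk 1 \<and> y \<in> Vsp Xb kk r}) \<and>
     (\<forall>x\<in>Vsp Xb kk 1. \<forall>y\<in>Vsp Xb kk s. lie_br mul e x y = 0)"

definition nh :: "nat \<Rightarrow> (nat \<Rightarrow> nat) \<Rightarrow> nat" where
  "nh s kk = (\<Sum>r = 1..s. r * kk r)"

(* target dimension 128 * 23^{n_h}; vectors of R^D are nat => real, components c < D *)
definition Dim :: "nat \<Rightarrow> (nat \<Rightarrow> nat) \<Rightarrow> nat" where
  "Dim s kk = 128 * 23 ^ nh s kk"

definition vnorm :: "nat \<Rightarrow> (nat \<Rightarrow> real) \<Rightarrow> real" where
  "vnorm D v = sqrt (\<Sum>c<D. (v c)\<^sup>2)"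

definition vdot :: "nat \<Rightarrow> (nat \<Rightarrow> real) \<Rightarrow> (nat \<Rightarrow> real) \<Rightarrow> real" where
  "vdot D v w = (\<Sum>c<D. v c * w c)"

definition dyadic :: "real \<Rightarrow> bool" where
  "dyadic x \<longleftrightarrow> (\<exists>j::int. x = 2 powr (real_of_int j))"

definition nabla_norm :: "('a::euclidean_space \<Rightarrow> 'a \<Rightarrow> 'a) \<Rightarrow> 'a \<Rightarrow> (nat \<Rightarrow> nat \<Rightarrow> 'a) \<Rightarrow> nat \<Rightarrow> nat
     \<Rightarrow> nat \<Rightarrow> (nat \<Rightarrow> 'a \<Rightarrow> real) \<Rightarrow> 'a \<Rightarrow> real" where
  "nabla_norm mul e Xb k D j \<phi> p =
     sqrt (\<Sum>is \<in> {is. length is = j \<and> set is \<subseteq> {1..k}}.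
             \<Sum>c<D. (Lword mul e (map (Xb 1) is) (\<phi> c) p)\<^sup>2)"

definition Cnorm_le :: "('a::euclidean_space \<Rightarrow> 'a \<Rightarrow> 'a) \<Rightarrow> 'a \<Rightarrow> (nat \<Rightarrow> nat \<Rightarrow> 'a) \<Rightarrow> nat \<Rightarrow> nat
     \<Rightarrow> nat \<Rightarrow> real \<Rightarrow> (nat \<Rightarrow> 'a \<Rightarrow> real) \<Rightarrow> real \<Rightarrow> bool" where
  "Cnorm_le mul e Xb k D l R \<phi> M \<longleftrightarrow>
     (\<forall>j\<le>l. bdd_above (range (nabla_norm mul e Xb k D j \<phi>))) \<and>
     (\<Sum>j\<le>l. R ^ j * (SUP p. nabla_norm mul e Xb k D j \<phi> p)) \<le> M"

definition Bent :: "('a::euclidean_space \<Rightarrow> 'a \<Rightarrow> 'a) \<Rightarrow> 'a \<Rightarrow> (nat \<Rightarrow> nat \<Rightarrow> 'a) \<Rightarrow> nat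
     \<Rightarrow> (nat \<Rightarrow> 'a \<Rightarrow> real) \<Rightarrow> (nat \<Rightarrow> 'a \<Rightarrow> real) \<Rightarrow> nat \<Rightarrow> nat \<Rightarrow> 'a \<Rightarrow> real" where
  "Bent mul e Xb D \<phi> \<psi> i j p =
     (vdot D (\<lambda>c. Lder mul e (Xb 1 i) (\<phi> c) p) (\<lambda>c. Lder mul e (Xb 1 j) (\<psi> c) p)
    + vdot D (\<lambda>c. Lder mul e (Xb 1 j) (\<phi> c) p) (\<lambda>c. Lder mul e (Xb 1 i) (\<psi> c) p)) / 2"

definition pleq :: "nat \<times> nat \<Rightarrow> nat \<times> nat \<Rightarrow> bool" where
  "pleq a b \<longleftrightarrow> fst a < fst b \<or> (fst a = fst b \<and> snd a \<le> snd b)"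

(* the set \<W>, each operator represented by its index sequence *)
definition Wset :: "nat \<Rightarrow> (nat \<Rightarrow> nat) \<Rightarrow> (nat \<times> nat) list set" where
  "Wset s kk = {ws. 1 \<le> length ws \<and> length ws \<le> s \<and> set ws \<subseteq> idx s kk \<and> sorted_wrt pleq ws}"

definition Wop :: "('a::euclidean_space \<Rightarrow> 'a \<Rightarrow> 'a) \<Rightarrow> 'a \<Rightarrow> (nat \<Rightarrow> nat \<Rightarrow> 'a) \<Rightarrow> (nat \<times> nat) list
     \<Rightarrow> ('a \<Rightarrow> real) \<Rightarrow> 'a \<Rightarrow> real" where
  "Wop mul e Xb ws f = Lword mul e (map (\<lambda>(r, i). Xb r i) ws) f"

(* Euclidean norm of v_1 \<and> ... \<and> v_n (family indexed by finite S) in \<Lambda>^n R^D: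
   square root of the Gram determinant (the induced inner product on \<Lambda>^n) *)
definition wedge_norm :: "nat \<Rightarrow> 'i set \<Rightarrow> ('i \<Rightarrow> nat \<Rightarrow> real) \<Rightarrow> real" where
  "wedge_norm D S v =
     sqrt (\<Sum>\<pi>\<in>{\<pi>. \<pi> permutes S}. of_int (sign \<pi>) * (\<Prod>a\<in>S. vdot D (v a) (v (\<pi> a))))"

(* W phi_{(>= m)}(p) = sum_{m' >= m} A^{-eps (m'-m)} W phi_{m'}(p), componentwise *)
definition Wgeq :: "('a::euclidean_space \<Rightarrow> 'a \<Rightarrow> 'a) \<Rightarrow> 'a \<Rightarrow> (nat \<Rightarrow> nat \<Rightarrow> 'a) \<Rightarrow> real \<Rightarrow> real
     \<Rightarrow> (int \<Rightarrow> nat \<Rightarrow> 'a \<Rightarrow> real) \<Rightarrow> int \<Rightarrow> (nat \<times> nat) list \<Rightarrow> 'a \<Rightarrow> nat \<Rightarrow> real" where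
  "Wgeq mul e Xb A \<epsilon> \<phi> m ws p c =
     (\<Sum>n. A powr (- \<epsilon> * real n) * Wop mul e Xb ws (\<phi> (m + int n) c) p)"

definition thm62_concl :: "('a::euclidean_space \<Rightarrow> 'a \<Rightarrow> 'a) \<Rightarrow> 'a \<Rightarrow> nat \<Rightarrow> (nat \<Rightarrow> nat)
     \<Rightarrow> (nat \<Rightarrow> nat \<Rightarrow> 'a) \<Rightarrow> real \<Rightarrow> real \<Rightarrow> real \<Rightarrow> (int \<Rightarrow> nat \<Rightarrow> 'a \<Rightarrow> real) \<Rightarrow> bool" where
  "thm62_concl mul e s kk Xb K A \<epsilon> \<phi> \<longleftrightarrow>
    (let D = Dim s kk; k = kk 1 in
     (\<forall>m::int.
       \<comment> \<open>regularity needed for the norms to make sense\<close>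
       (\<forall>c<D. Cn (s\<^sup>2 + s) (\<phi> m c)) \<and>
       \<comment> \<open>(1)\<close>
       Cnorm_le mul e Xb k D (s\<^sup>2 + s) (A powr real_of_int m) (\<phi> m) (K * A powr real_of_int m) \<and>
       (\<forall>(r, i)\<in>idx s kk. \<forall>p.
          vnorm D (\<lambda>c. Lder mul e (Xb r i) (\<phi> m c) p)
            \<le> K * A powr (- real_of_int m * (real r - 1))) \<and>
       \<comment> \<open>(2)\<close>
       (\<forall>i\<in>{1..k}. \<forall>j\<in>{1..k}. \<forall>p.
          summable (\<lambda>n. \<bar>A powr (- \<epsilon> * real (n + 1)) * Bent mul e Xb D (\<phi> m) (\<phi> (m + 1 + int n)) i j p\<bar>) \<and>
          (\<Sum>n. A powr (- \<epsilon> * real (n + 1)) * Bent mul e Xb D (\<phi> m) (\<phi> (m + 1 + int n)) i j p) = 0) \<and>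
       \<comment> \<open>(3)\<close>
       (\<forall>p. (\<forall>i\<in>{1..k}. vnorm D (\<lambda>c. Lder mul e (Xb 1 i) (\<phi> m c) p) \<ge> 1 / K) \<and>
            wedge_norm D (Wset s kk) (\<lambda>ws. Wgeq mul e Xb A \<epsilon> \<phi> m ws p)
              \<ge> (1 / K) * (\<Prod>ws\<in>Wset s kk. vnorm D (Wgeq mul e Xb A \<epsilon> \<phi> m ws p)))))"

end

theory Submission
  imports Defs "HOL-Library.Multiset" "Jordan_Normal_Form.Determinant"
begin

text \<open>In graded coordinates the Lie algebra itself carries left-invariant frames \<open>Y b\<close> with polynomial
coefficients, dilations and affine left translations, and the group maps to it by a map \<open>c\<close> that
intertwines the left-invariant fields; \<open>c\<close> is built layer by layer from the Poincare lemma. So it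
suffices to construct functions on the Lie algebra.

At scale \<open>1\<close>, bump functions carried by a lattice and valued in orthogonal coordinate blocks give a
map whose derivatives along all words of \<open>\<W>\<close> are uniformly independent. Projecting it pointwise off
the normalized word derivatives of the sum \<open>U\<close> of the coarser scales, which vary slowly, changes
little and makes it orthogonal to those derivatives. Differentiating the orthogonality relation to
\<open>X\<^sub>i X\<^sub>j U\<close> makes the horizontal derivatives orthogonal, with no loss of derivatives since all bounds
are of the form \<open>C * B ^ (length w)\<^sup>2\<close> for words \<open>w\<close> of any length. Rescaling and iterating from a
coarsest scale \<open>M\<close> downwards, and letting \<open>M\<close> tend to infinity by compactness, yields the family.\<close>

section \<open>Calculus of smooth functions\<close>

text \<open>The obstacle is loss of derivatives: projecting off words of length up to
  \<open>s\<close> in \<open>U\<close> costs that many derivatives at every scale, and there are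
  infinitely many scales, so no fixed number of derivatives survives the iteration. The weight
  \<open>B ^ n\<^sup>2\<close> is stable under each operation. In the Leibniz rule a mixed term
  gains \<open>B ^ (2 * j * (n - j))\<close>, which pays for the binomials. Differentiating a word
  of length at most \<open>s\<close> another \<open>n\<close> times costs at most
  \<open>B ^ (2 * s * n + s\<^sup>2)\<close>, which the gain of one factor \<open>1 / A\<close> per
  derivative beats once \<open>A \<ge> B ^ (2 * s)\<close>. A second difficulty is that horizontal
  derivatives do not decay under rescaling, so those of \<open>U\<close> may grow as \<epsilon>
  tends to 0. Orthogonality makes their squares add, and the accumulated size \<open>S\<close> can
  be tracked and divided out. The range of \<epsilon> enters through
  \<open>1/2 \<le> A powr (- \<epsilon>) < 1\<close>. The dimension comes from the lattice: bumps
  meeting at one point have different parity vectors, so one coordinate block per parity vector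
  suffices, with room for the words as constraints and the test functions as values.\<close>

lemma fd_eqI: "(f has_derivative f') (at x) \<Longrightarrow> frechet_derivative f (at x) v = f' v"
  using frechet_derivative_at[of f f' x] by simp

lemma Cn_SucI:
  assumes "\<And>x. (f has_derivative f' x) (at x)" "\<And>v. Cn n (\<lambda>x. f' x v)"
  shows "Cn (Suc n) f"
proof -
  have "frechet_derivative f (at x) = f' x" for x
    by (rule ext) (rule fd_eqI[OF assms(1)])
  then show ?thesis using assms by (auto simp: differentiable_def)
qed

lemma Cn_imp_continuous: "Cn n f \<Longrightarrow> continuous_on UNIV f"
  by (cases n) (auto intro!: continuous_at_imp_continuous_on differentiable_imp_continuous_within)

lemma Cn_SucD: "Cn (Suc n) f \<Longrightarrow> Cn n f"
proof (induction n arbitrary: f)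
  case 0
  then show ?case using Cn_imp_continuous by (simp del: Cn.simps(2))
next
  case (Suc n)
  then show ?case unfolding Cn.simps(2)[of "Suc n"] Cn.simps(2)[of n] by blast
qed

lemma Cn_has_derivative: "Cn (Suc n) f \<Longrightarrow> (f has_derivative frechet_derivative f (at x)) (at x)"
  using frechet_derivative_works by auto

lemma Cn_const [simp]: "Cn n (\<lambda>x. c)"
  by (induction n arbitrary: c) auto

lemma Cn_bounded_linear:
  assumes "bounded_linear L" "Cn n f"
  shows "Cn n (\<lambda>x. L (f x))"
  using assms(2)
proof (induction n arbitrary: f)
  case 0
  then show ?case using assms(1) by (simp add: bounded_linear.continuous_on)
next
  case (Suc n)
  show ?case
  proof (rule Cn_SucI)
    show "((\<lambda>x. L (f x)) has_derivative (\<lambda>v. L (frechet_derivative f (at x) v))) (at x)" for x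
      by (rule bounded_linear.has_derivative[OF assms(1) Cn_has_derivative[OF Suc.prems]])
    show "Cn n (\<lambda>x. L (frechet_derivative f (at x) v))" for v
      using Suc by auto
  qed
qed

lemma Cn_add: "Cn n f \<Longrightarrow> Cn n g \<Longrightarrow> Cn n (\<lambda>x. f x + g x)"
proof (induction n arbitrary: f g)
  case 0
  then show ?case by (auto intro!: continuous_intros)
next
  case (Suc n)
  show ?case
    by (rule Cn_SucI[OF has_derivative_add[OF Cn_has_derivative[OF Suc.prems(1)] Cn_has_derivative[OF Suc.prems(2)]]])
      (use Suc in auto)
qed

lemma Cn_sum: "(\<And>i. i \<in> I \<Longrightarrow> Cn n (f i)) \<Longrightarrow> Cn n (\<lambda>x. \<Sum>i\<in>I. f i x)"
  by (induction I rule: infinite_finite_induct) (auto intro: Cn_add)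

lemma Cn_bilinear:
  assumes "bounded_bilinear pr" "Cn n f" "Cn n g"
  shows "Cn n (\<lambda>x. pr (f x) (g x))"
  using assms(2,3)
proof (induction n arbitrary: f g)
  case 0
  then show ?case using bounded_bilinear.continuous_on[OF assms(1)] by auto
next
  case (Suc n)
  have "Cn n f" "Cn n g" using Suc.prems Cn_SucD by blast+
  with Suc show ?case
    by (intro Cn_SucI[OF bounded_bilinear.FDERIV[OF assms(1) Cn_has_derivative[OF Suc.prems(1)] Cn_has_derivative[OF Suc.prems(2)]]])
      (auto intro!: Cn_add)
qed

lemma linear_euclidean_expand:
  fixes L :: "'a::euclidean_space \<Rightarrow> 'b::real_vector"
  assumes "linear L"
  shows "L v = (\<Sum>b\<in>Basis. inner v b *\<^sub>R L b)"
proof -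
  have "L v = L (\<Sum>b\<in>Basis. inner v b *\<^sub>R b)" by (simp add: euclidean_representation)
  then show ?thesis using assms by (simp add: linear_sum linear_scale)
qed

lemma Cn_compose:
  fixes f :: "'b::euclidean_space \<Rightarrow> 'c::real_normed_vector" and g :: "'a::euclidean_space \<Rightarrow> 'b"
  shows "Cn n f \<Longrightarrow> Cn n g \<Longrightarrow> Cn n (\<lambda>x. f (g x))"
proof (induction n arbitrary: f g)
  case 0
  then show ?case using continuous_on_compose2[of UNIV f UNIV g] by auto
next
  case (Suc n)
  have g: "Cn n g" using Suc.prems Cn_SucD by blast
  have lin: "linear (frechet_derivative f (at y))" for y
    using Suc.prems(1) by (auto intro: linear_frechet_derivative)
  show ?case
  proof (rule Cn_SucI)
    show "((\<lambda>x. f (g x)) has_derivative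
        (\<lambda>v. frechet_derivative f (at (g x)) (frechet_derivative g (at x) v))) (at x)" for x
      using has_derivative_compose[OF Cn_has_derivative[OF Suc.prems(2)] Cn_has_derivative[OF Suc.prems(1)]] .
    fix v
    have "Cn n (\<lambda>x. \<Sum>b\<in>Basis. inner (frechet_derivative g (at x) v) b *\<^sub>R frechet_derivative f (at (g x)) b)"
      using Suc.prems by (intro Cn_sum Cn_bilinear[OF bounded_bilinear_scaleR] Suc.IH g
         Cn_bounded_linear[OF bounded_linear_inner_left]) auto
    then show "Cn n (\<lambda>x. frechet_derivative f (at (g x)) (frechet_derivative g (at x) v))"
      by (subst linear_euclidean_expand[OF lin])
  qed
qed

lemma Cn_inverse:
  fixes f :: "'a::euclidean_space \<Rightarrow> real"
  assumes "\<And>x. f x \<noteq> 0"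
  shows "Cn n f \<Longrightarrow> Cn n (\<lambda>x. inverse (f x))"
proof (induction n)
  case 0
  then show ?case using assms by (auto intro!: continuous_intros)
next
  case (Suc n)
  have g: "Cn n f" using Suc.prems Cn_SucD by blast
  show ?case
  proof (rule Cn_SucI)
    show "((\<lambda>x. inverse (f x)) has_derivative
        (\<lambda>v. - (inverse (f x) * frechet_derivative f (at x) v * inverse (f x)))) (at x)" for x
      by (rule Deriv.has_derivative_inverse[OF assms Cn_has_derivative[OF Suc.prems]])
    show "Cn n (\<lambda>x. - (inverse (f x) * frechet_derivative f (at x) v * inverse (f x)))" for v
      using Suc g by (intro Cn_bounded_linear[OF bounded_linear_minus[OF bounded_linear_ident]]
         Cn_bilinear[OF bounded_bilinear_mult]) auto
  qed
qed

text \<open>Needed for sums over lattice points, which are finite only near each point and whose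
  index set moves with the point.\<close>

lemma Cn_local:
  assumes "\<And>x. \<exists>U g. open U \<and> x \<in> U \<and> Cn n g \<and> (\<forall>y\<in>U. f y = g y)"
  shows "Cn n f"
  using assms
proof (induction n arbitrary: f)
  case 0
  have "isCont f x" for x
  proof -
    obtain U g where *: "open U" "x \<in> U" "Cn 0 g" "\<forall>y\<in>U. f y = g y" using 0 by blast
    then have "isCont g x" by (auto simp: continuous_on_eq_continuous_at)
    moreover have "\<forall>\<^sub>F y in nhds x. f y = g y" using * eventually_nhds by blast
    ultimately show ?thesis using isCont_cong by blast
  qed
  then show ?case by (simp add: continuous_at_imp_continuous_on)
next
  case (Suc n)
  have D: "(f has_derivative frechet_derivative g (at y)) (at y)" 
    if "open U" "y \<in> U" "Cn (Suc n) g" "\<forall>y\<in>U. f y = g y" for U g y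
    by (rule has_derivative_transform_within_open[OF Cn_has_derivative[OF that(3)] that(1,2)]) (use that in auto)
  have d: "f differentiable (at y)" for y
    using Suc.prems[of y] D unfolding differentiable_def by blast
  have "Cn n (\<lambda>x. frechet_derivative f (at x) v)" for v
  proof (rule Suc.IH)
    fix x
    obtain U g where *: "open U" "x \<in> U" "Cn (Suc n) g" "\<forall>y\<in>U. f y = g y" using Suc.prems by blast
    have "frechet_derivative f (at y) v = frechet_derivative g (at y) v" if "y \<in> U" for y
      using frechet_derivative_at[OF D[OF *(1) that *(3,4)]] by simp
    with * show "\<exists>U g. open U \<and> x \<in> U \<and> Cn n g \<and> (\<forall>y\<in>U. frechet_derivative f (at y) v = g y)"
      by (intro exI[of _ U] exI[of _ "\<lambda>y. frechet_derivative g (at y) v"]) auto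
  qed
  with d show ?case by simp
qed

text \<open>Bootstrap: the members are differentiable, hence continuous, and their derivatives are
  combinations of members again, so the regularity of the whole family rises until that of the
  coefficients stops it. This makes pointwise limits of smooth functions smooth at the end.\<close>

lemma Cn_frame:
  fixes F :: "'i \<Rightarrow> 'a::euclidean_space \<Rightarrow> real"
  assumes D: "\<And>i x. i \<in> A \<Longrightarrow> (F i has_derivative (\<lambda>u. \<Sum>b\<in>S. co b x u * F (nx i b) x)) (at x)"
    and nx: "\<And>i b. i \<in> A \<Longrightarrow> b \<in> S \<Longrightarrow> nx i b \<in> A"
    and co: "\<And>b u. b \<in> S \<Longrightarrow> Cn n (\<lambda>x. co b x u)" and i: "i \<in> A"
  shows "Cn n (F i)"
  using co i
proof (induction n arbitrary: i)
  case 0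
  then show ?case
    using has_derivative_continuous[OF D] by (simp add: continuous_at_imp_continuous_on)
next
  case (Suc n)
  have c: "Cn n (\<lambda>x. co b x u)" if "b \<in> S" for b u
    by (rule Cn_SucD[OF Suc.prems(1)[OF that]])
  have IH: "Cn n (F j)" if "j \<in> A" for j
    by (rule Suc.IH[OF c that])
  show ?case
    by (rule Cn_SucI[OF D[OF Suc.prems(2)]], rule Cn_sum, rule Cn_bilinear[OF bounded_bilinear_mult])
      (use c IH nx[OF Suc.prems(2)] in auto)
qed

lemma smooth_Cn: "smooth f \<Longrightarrow> Cn n f" by (simp add: smooth_def)

lemma smooth_const [simp]: "smooth (\<lambda>x. c)" by (simp add: smooth_def)

lemma smooth_bounded_linear: "bounded_linear L \<Longrightarrow> smooth f \<Longrightarrow> smooth (\<lambda>x. L (f x))"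
  by (simp add: smooth_def Cn_bounded_linear)

lemma smooth_add: "smooth f \<Longrightarrow> smooth g \<Longrightarrow> smooth (\<lambda>x. f x + g x)"
  by (simp add: smooth_def Cn_add)

lemma smooth_sum: "(\<And>i. i \<in> I \<Longrightarrow> smooth (f i)) \<Longrightarrow> smooth (\<lambda>x. \<Sum>i\<in>I. f i x)"
  by (simp add: smooth_def Cn_sum)

lemma smooth_bilinear:
  "bounded_bilinear pr \<Longrightarrow> smooth f \<Longrightarrow> smooth g \<Longrightarrow> smooth (\<lambda>x. pr (f x) (g x))"
  by (simp add: smooth_def Cn_bilinear)

lemmas smooth_mult = smooth_bilinear[OF bounded_bilinear_mult]
lemmas smooth_scaleR = smooth_bilinear[OF bounded_bilinear_scaleR]
lemmas smooth_inner = smooth_bilinear[OF bounded_bilinear_inner]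
lemmas smooth_uminus = smooth_bounded_linear[OF bounded_linear_minus[OF bounded_linear_ident]]

lemma smooth_diff: "smooth f \<Longrightarrow> smooth g \<Longrightarrow> smooth (\<lambda>x. f x - g x)"
  using smooth_add[OF _ smooth_uminus, of f g] by simp

lemma smooth_compose: 
  fixes f :: "'b::euclidean_space \<Rightarrow> 'c::real_normed_vector" and g :: "'a::euclidean_space \<Rightarrow> 'b"
  shows "smooth f \<Longrightarrow> smooth g \<Longrightarrow> smooth (\<lambda>x. f (g x))"
  by (simp add: smooth_def Cn_compose)

lemma smooth_inverse:
  fixes f :: "'a::euclidean_space \<Rightarrow> real"
  shows "(\<And>x. f x \<noteq> 0) \<Longrightarrow> smooth f \<Longrightarrow> smooth (\<lambda>x. inverse (f x))"
  by (simp add: smooth_def Cn_inverse)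

lemma smooth_has_derivative: "smooth f \<Longrightarrow> (f has_derivative frechet_derivative f (at x)) (at x)"
  using Cn_has_derivative smooth_Cn by blast

lemma smooth_differentiable: "smooth f \<Longrightarrow> f differentiable (at x)"
  using smooth_has_derivative differentiable_def by blast

lemma smooth_linear_fd: "smooth f \<Longrightarrow> linear (frechet_derivative f (at x))"
  using linear_frechet_derivative smooth_differentiable by blast

lemma smooth_fd: "smooth f \<Longrightarrow> smooth (\<lambda>x. frechet_derivative f (at x) v)"
  unfolding smooth_def by (metis Cn.simps(2))

lemma smooth_continuous: "smooth f \<Longrightarrow> continuous_on A f"
  using Cn_imp_continuous smooth_Cn continuous_on_subset by blast

lemma smooth_id [simp]: "smooth (\<lambda>x. x)"
  unfolding smooth_def
proof
  show "Cn n (\<lambda>x. x)" for n by (cases n) (auto intro: Cn_SucI[OF has_derivative_ident])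
qed

lemma smooth_linear: "linear L \<Longrightarrow> smooth (L :: 'a::euclidean_space \<Rightarrow> 'b::real_normed_vector)"
  using smooth_bounded_linear[OF _ smooth_id] linear_conv_bounded_linear by blast

lemma smooth_fd_field:
  fixes f :: "'a::euclidean_space \<Rightarrow> 'b::real_normed_vector"
  assumes "smooth f" "smooth g" "smooth V"
  shows "smooth (\<lambda>x. frechet_derivative f (at (g x)) (V x))"
proof -
  have "smooth (\<lambda>x. \<Sum>b\<in>Basis. inner (V x) b *\<^sub>R frechet_derivative f (at (g x)) b)"
    using assms by (intro smooth_sum smooth_scaleR smooth_inner smooth_const
       smooth_compose[of "\<lambda>y. frechet_derivative f (at y) b" g for b] smooth_fd) auto
  then show ?thesis by (subst linear_euclidean_expand[OF smooth_linear_fd[OF assms(1)]])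
qed

lemma smooth_Pair: "smooth f \<Longrightarrow> smooth g \<Longrightarrow> smooth (\<lambda>x. (f x, g x))"
proof -
  assume "smooth f" "smooth g"
  moreover have "bounded_linear (\<lambda>x. (x, 0))" "bounded_linear (\<lambda>x. (0, x))"
    by (auto intro!: bounded_linear_Pair bounded_linear_ident bounded_linear_zero)
  ultimately have "smooth (\<lambda>x. (f x, 0) + (0, g x))"
    by (intro smooth_add smooth_bounded_linear[of "\<lambda>x. (x, 0)"] smooth_bounded_linear[of "\<lambda>x. (0, x)"])
  then show ?thesis by simp
qed

section \<open>Symmetry of second derivatives and commutators of vector fields\<close>

lemma mixed_difference_mvt:
  fixes f :: "'a::euclidean_space \<Rightarrow> real"
  assumes f: "smooth f" and t: "t > 0"
  shows "\<exists>\<xi> \<eta>. 0 < \<xi> \<and> \<xi> < t \<and> 0 < \<eta> \<and> \<eta> < t \<and>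
     f (x + t *\<^sub>R v + t *\<^sub>R w) - f (x + t *\<^sub>R v) - f (x + t *\<^sub>R w) + f x
     = t * (t * frechet_derivative (\<lambda>y. frechet_derivative f (at y) v) (at (x + \<xi> *\<^sub>R v + \<eta> *\<^sub>R w)) w)"
proof -
  have line: "((\<lambda>\<tau>. g (a + \<tau> *\<^sub>R u)) has_real_derivative frechet_derivative g (at (a + \<tau> *\<^sub>R u)) u) (at \<tau>)"
    if "smooth g" for g :: "'a \<Rightarrow> real" and a u \<tau>
  proof -
    have "((\<lambda>\<tau>. a + \<tau> *\<^sub>R u) has_derivative (\<lambda>h. h *\<^sub>R u)) (at \<tau>)"
      by (auto intro!: derivative_eq_intros)
    from has_derivative_compose[OF this smooth_has_derivative[OF that]]
    have "((\<lambda>\<tau>. g (a + \<tau> *\<^sub>R u)) has_derivative (\<lambda>h. h *\<^sub>R frechet_derivative g (at (a + \<tau> *\<^sub>R u)) u)) (at \<tau>)"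
      using linear_scale[OF smooth_linear_fd[OF that]] by simp
    then show ?thesis by (simp add: has_field_derivative_def mult_commute_abs)
  qed
  have fw: "smooth (\<lambda>y. f (y + t *\<^sub>R w))"
    by (intro smooth_compose[OF f] smooth_add smooth_id smooth_const)
  \<comment> \<open>The mean value theorem is applied to the increment in direction \<open>w\<close>
    as a function of the position along \<open>v\<close>, and then once more in direction
    \<open>w\<close>.\<close>
  define g where "g \<tau> = f (x + \<tau> *\<^sub>R v + t *\<^sub>R w) - f (x + \<tau> *\<^sub>R v)" for \<tau>
  have l2: "((\<lambda>\<tau>. f (x + \<tau> *\<^sub>R v + t *\<^sub>R w)) has_real_derivative frechet_derivative f (at (x + \<tau> *\<^sub>R v + t *\<^sub>R w)) v) (at \<tau>)" for \<tau>
    using line[OF f, of "x + t *\<^sub>R w" v \<tau>] by (simp add: algebra_simps)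
  have "\<exists>z. 0 < z \<and> z < t \<and> g t - g 0 = (t - 0) * (frechet_derivative f (at (x + z *\<^sub>R v + t *\<^sub>R w)) v - frechet_derivative f (at (x + z *\<^sub>R v)) v)"
    unfolding g_def
    by (rule MVT2[OF t]) (intro DERIV_diff l2 line f)
  then obtain \<xi> where \<xi>: "0 < \<xi>" "\<xi> < t" 
    "g t - g 0 = t * (frechet_derivative f (at (x + \<xi> *\<^sub>R v + t *\<^sub>R w)) v - frechet_derivative f (at (x + \<xi> *\<^sub>R v)) v)"
    by auto
  have "\<exists>z. 0 < z \<and> z < t \<and> frechet_derivative f (at (x + \<xi> *\<^sub>R v + t *\<^sub>R w)) v - frechet_derivative f (at (x + \<xi> *\<^sub>R v + 0 *\<^sub>R w)) v
     = (t - 0) * frechet_derivative (\<lambda>y. frechet_derivative f (at y) v) (at (x + \<xi> *\<^sub>R v + z *\<^sub>R w)) w"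
    by (rule MVT2[OF t]) (rule line[OF smooth_fd[OF f]])
  then obtain \<eta> where \<eta>: "0 < \<eta>" "\<eta> < t" "frechet_derivative f (at (x + \<xi> *\<^sub>R v + t *\<^sub>R w)) v - frechet_derivative f (at (x + \<xi> *\<^sub>R v)) v
     = t * frechet_derivative (\<lambda>y. frechet_derivative f (at y) v) (at (x + \<xi> *\<^sub>R v + \<eta> *\<^sub>R w)) w"
    by auto
  show ?thesis
    using \<xi> \<eta> by (intro exI[of _ \<xi>] exI[of _ \<eta>]) (simp add: g_def)
qed

text \<open>The mixed second difference is symmetric in \<open>v\<close> and \<open>w\<close>, so
  its two mean value expressions agree for each step \<open>t n\<close>; by continuity they tend to
  the two mixed derivatives.\<close>

lemma second_derivative_symmetric_real:
  fixes f :: "'a::euclidean_space \<Rightarrow> real"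
  assumes f: "smooth f"
  shows "frechet_derivative (\<lambda>y. frechet_derivative f (at y) v) (at x) w
       = frechet_derivative (\<lambda>y. frechet_derivative f (at y) w) (at x) v"
proof -
  define P where "P = (\<lambda>y. frechet_derivative (\<lambda>y. frechet_derivative f (at y) v) (at y) w)"
  define Q where "Q = (\<lambda>y. frechet_derivative (\<lambda>y. frechet_derivative f (at y) w) (at y) v)"
  have cont: "isCont P x" "isCont Q x"
    unfolding P_def Q_def using smooth_continuous[OF smooth_fd[OF smooth_fd[OF f]], of UNIV]
    by (auto simp: continuous_on_eq_continuous_at)
  define t where "t n = inverse (real (Suc n))" for n
  have t: "t n > 0" for n by (simp add: t_def)
  have t0: "t \<longlonglongrightarrow> 0" unfolding t_def by (rule LIMSEQ_inverse_real_of_nat)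
  have "\<exists>\<xi> \<eta> \<xi>' \<eta>'. 0 < \<xi> \<and> \<xi> < t n \<and> 0 < \<eta> \<and> \<eta> < t n \<and> 0 < \<xi>' \<and> \<xi>' < t n \<and> 0 < \<eta>' \<and> \<eta>' < t n \<and>
     P (x + \<xi> *\<^sub>R v + \<eta> *\<^sub>R w) = Q (x + \<xi>' *\<^sub>R w + \<eta>' *\<^sub>R v)" for n
  proof -
    obtain \<xi> \<eta> where 1: "0 < \<xi>" "\<xi> < t n" "0 < \<eta>" "\<eta> < t n"
       "f (x + t n *\<^sub>R v + t n *\<^sub>R w) - f (x + t n *\<^sub>R v) - f (x + t n *\<^sub>R w) + f x = t n * (t n * P (x + \<xi> *\<^sub>R v + \<eta> *\<^sub>R w))"
      using mixed_difference_mvt[OF f t[of n], of x v w] unfolding P_def by blast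
    obtain \<xi>' \<eta>' where 2: "0 < \<xi>'" "\<xi>' < t n" "0 < \<eta>'" "\<eta>' < t n"
       "f (x + t n *\<^sub>R w + t n *\<^sub>R v) - f (x + t n *\<^sub>R w) - f (x + t n *\<^sub>R v) + f x = t n * (t n * Q (x + \<xi>' *\<^sub>R w + \<eta>' *\<^sub>R v))"
      using mixed_difference_mvt[OF f t[of n], of x w v] unfolding Q_def by blast
    have "t n * (t n * P (x + \<xi> *\<^sub>R v + \<eta> *\<^sub>R w)) = t n * (t n * Q (x + \<xi>' *\<^sub>R w + \<eta>' *\<^sub>R v))"
      using 1(5) 2(5) by (simp add: algebra_simps)
    then have "P (x + \<xi> *\<^sub>R v + \<eta> *\<^sub>R w) = Q (x + \<xi>' *\<^sub>R w + \<eta>' *\<^sub>R v)" using t[of n] by simp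
    with 1 2 show ?thesis by blast
  qed
  then obtain a b c d where *: "\<And>n. 0 < a n \<and> a n < t n \<and> 0 < b n \<and> b n < t n \<and> 0 < c n \<and> c n < t n \<and> 0 < d n \<and> d n < t n \<and>
     P (x + a n *\<^sub>R v + b n *\<^sub>R w) = Q (x + c n *\<^sub>R w + d n *\<^sub>R v)" by metis
  have sq: "s \<longlonglongrightarrow> 0" if "\<And>n. 0 < s n \<and> s n < t n" for s
    by (rule tendsto_sandwich[OF _ _ tendsto_const t0]) (use that in \<open>auto intro!: always_eventually less_imp_le\<close>)
  have lim: "(\<lambda>n. x + s n *\<^sub>R y + r n *\<^sub>R z) \<longlonglongrightarrow> x" if "\<And>n. 0 < s n \<and> s n < t n" "\<And>n. 0 < r n \<and> r n < t n" for s r y z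
    using tendsto_add[OF tendsto_add[OF tendsto_const[of x] tendsto_scaleR[OF sq[OF that(1)] tendsto_const[of y]]] tendsto_scaleR[OF sq[OF that(2)] tendsto_const[of z]]]
    by simp
  have "(\<lambda>n. P (x + a n *\<^sub>R v + b n *\<^sub>R w)) \<longlonglongrightarrow> P x" using * by (intro isCont_tendsto_compose[OF cont(1)] lim) auto
  moreover have "(\<lambda>n. Q (x + c n *\<^sub>R w + d n *\<^sub>R v)) \<longlonglongrightarrow> Q x" using * by (intro isCont_tendsto_compose[OF cont(2)] lim) auto
  ultimately show ?thesis using * LIMSEQ_unique unfolding P_def Q_def by auto
qed

lemma fd_bounded_linear:
  "bounded_linear L \<Longrightarrow> smooth f \<Longrightarrow> frechet_derivative (\<lambda>x. L (f x)) (at x) v = L (frechet_derivative f (at x) v)"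
  by (rule fd_eqI[OF bounded_linear.has_derivative[OF _ smooth_has_derivative]])

lemma second_derivative_symmetric:
  fixes f :: "'a::euclidean_space \<Rightarrow> 'b::euclidean_space"
  assumes f: "smooth f"
  shows "frechet_derivative (\<lambda>y. frechet_derivative f (at y) v) (at x) w
       = frechet_derivative (\<lambda>y. frechet_derivative f (at y) w) (at x) v"
proof (rule euclidean_eqI)
  fix b :: 'b
  have bl: "bounded_linear (\<lambda>y. inner y b)" by (rule bounded_linear_inner_left)
  have *: "inner (frechet_derivative (\<lambda>y. frechet_derivative f (at y) v) (at x) w) b
     = frechet_derivative (\<lambda>y. frechet_derivative (\<lambda>y. inner (f y) b) (at y) v) (at x) w" for v w
    using fd_bounded_linear[OF bl f] fd_bounded_linear[OF bl smooth_fd[OF f, of v], of x w] by simp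
  show "inner (frechet_derivative (\<lambda>y. frechet_derivative f (at y) v) (at x) w) b
     = inner (frechet_derivative (\<lambda>y. frechet_derivative f (at y) w) (at x) v) b"
    unfolding * by (rule second_derivative_symmetric_real[OF smooth_bounded_linear[OF bl f]])
qed

text \<open>Chain rule for a differential applied to a moving vector: the first term moves the base
  point with the vector frozen at \<open>V x\<close>, the second moves the vector. Expansion in
  \<open>Basis\<close> reduces it to products of a real function with a fixed directional
  derivative.\<close>

lemma fd_field_derivative:
  fixes f :: "'a::euclidean_space \<Rightarrow> 'b::euclidean_space" and V :: "'c::euclidean_space \<Rightarrow> 'a"
  assumes f: "smooth f" and g: "smooth g" and V: "smooth V"
  shows "frechet_derivative (\<lambda>y. frechet_derivative f (at (g y)) (V y)) (at x) w
    = frechet_derivative (\<lambda>y. frechet_derivative f (at y) (V x)) (at (g x)) (frechet_derivative g (at x) w)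
      + frechet_derivative f (at (g x)) (frechet_derivative V (at x) w)"
proof -
  note lin = linear_euclidean_expand[OF smooth_linear_fd[OF f]]
  have eq: "(\<lambda>y. frechet_derivative f (at y) u) = (\<lambda>y. \<Sum>b\<in>Basis. inner u b *\<^sub>R frechet_derivative f (at y) b)" for u
    by (rule ext, rule lin)
  have eqg: "(\<lambda>y. frechet_derivative f (at (g y)) (V y)) = (\<lambda>y. \<Sum>b\<in>Basis. inner (V y) b *\<^sub>R frechet_derivative f (at (g y)) b)"
    by (rule ext, rule lin)
  have d1: "((\<lambda>y. frechet_derivative f (at (g y)) b) has_derivative (\<lambda>w. frechet_derivative (\<lambda>y. frechet_derivative f (at y) b) (at (g x)) (frechet_derivative g (at x) w))) (at x)" for b
    by (rule has_derivative_compose[OF smooth_has_derivative[OF g] smooth_has_derivative[OF smooth_fd[OF f]]])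
  have d2: "((\<lambda>y. inner (V y) b) has_derivative (\<lambda>w. inner (frechet_derivative V (at x) w) b)) (at x)" for b
    by (rule bounded_linear.has_derivative[OF bounded_linear_inner_left smooth_has_derivative[OF V]])
  have "((\<lambda>y. \<Sum>b\<in>Basis. inner (V y) b *\<^sub>R frechet_derivative f (at (g y)) b) has_derivative
    (\<lambda>w. \<Sum>b\<in>Basis. inner (V x) b *\<^sub>R frechet_derivative (\<lambda>y. frechet_derivative f (at y) b) (at (g x)) (frechet_derivative g (at x) w)
       + inner (frechet_derivative V (at x) w) b *\<^sub>R frechet_derivative f (at (g x)) b)) (at x)"
    by (intro has_derivative_sum has_derivative_scaleR d1 d2)
  then have 1: "frechet_derivative (\<lambda>y. frechet_derivative f (at (g y)) (V y)) (at x) w = 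
     (\<Sum>b\<in>Basis. inner (V x) b *\<^sub>R frechet_derivative (\<lambda>y. frechet_derivative f (at y) b) (at (g x)) (frechet_derivative g (at x) w))
       + (\<Sum>b\<in>Basis. inner (frechet_derivative V (at x) w) b *\<^sub>R frechet_derivative f (at (g x)) b)"
    unfolding eqg by (simp add: fd_eqI sum.distrib)
  have "((\<lambda>y. \<Sum>b\<in>Basis. inner (V x) b *\<^sub>R frechet_derivative f (at y) b) has_derivative
    (\<lambda>w. \<Sum>b\<in>Basis. inner (V x) b *\<^sub>R frechet_derivative (\<lambda>y. frechet_derivative f (at y) b) (at (g x)) w)) (at (g x))"
    by (intro has_derivative_sum bounded_linear.has_derivative[OF bounded_linear_scaleR_right] smooth_has_derivative smooth_fd f)
  then have 2: "frechet_derivative (\<lambda>y. frechet_derivative f (at y) (V x)) (at (g x)) u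
     = (\<Sum>b\<in>Basis. inner (V x) b *\<^sub>R frechet_derivative (\<lambda>y. frechet_derivative f (at y) b) (at (g x)) u)" for u
    by (subst eq) (rule fd_eqI)
  show ?thesis unfolding 1 2 by (subst (2) lin) simp
qed

text \<open>The second-order terms are symmetric and cancel, which leaves a first-order
  operator.\<close>

lemma field_commutator:
  fixes f :: "'a::euclidean_space \<Rightarrow> 'b::euclidean_space"
  assumes f: "smooth f" and V: "smooth V" and W: "smooth W"
  shows "frechet_derivative (\<lambda>y. frechet_derivative f (at y) (W y)) (at x) (V x)
       - frechet_derivative (\<lambda>y. frechet_derivative f (at y) (V y)) (at x) (W x)
       = frechet_derivative f (at x) (frechet_derivative W (at x) (V x) - frechet_derivative V (at x) (W x))"
  using fd_field_derivative[OF f smooth_id W, of x "V x"] fd_field_derivative[OF f smooth_id V, of x "W x"]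
    second_derivative_symmetric[OF f, of "W x" x "V x"] linear_diff[OF smooth_linear_fd[OF f]] by simp

section \<open>Graded Lie algebras and their affine group law\<close>

lemma idx_Sigma: "idx s kk = Sigma {1..s} (\<lambda>r. {1..kk r})"
  by (auto simp: idx_def)

lemma finite_idx [simp]: "finite (idx s kk)"
  by (simp add: idx_Sigma)

locale graded_lie =
  fixes br :: "'a::euclidean_space \<Rightarrow> 'a \<Rightarrow> 'a" and s :: nat and kk :: "nat \<Rightarrow> nat"
    and Xb :: "nat \<Rightarrow> nat \<Rightarrow> 'a"
  assumes br_lin1: "linear (\<lambda>x. br x y)" and br_lin2: "linear (br x)"
    and br_anti: "br x y = - br y x"
    and jacobi: "br x (br y z) = br (br x y) z + br y (br x z)"
    and s2: "2 \<le> s" and kk1: "r \<in> {1..s} \<Longrightarrow> 1 \<le> kk r"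
    and inj_Xb: "inj_on (\<lambda>(r, i). Xb r i) (idx s kk)"
    and indep_Xb: "independent ((\<lambda>(r, i). Xb r i) ` idx s kk)"
    and span_Xb: "span ((\<lambda>(r, i). Xb r i) ` idx s kk) = UNIV"
    and gen: "1 \<le> r \<Longrightarrow> r < s \<Longrightarrow>
        Vsp Xb kk (Suc r) = span {br x y | x y. x \<in> Vsp Xb kk 1 \<and> y \<in> Vsp Xb kk r}"
    and top: "x \<in> Vsp Xb kk 1 \<Longrightarrow> y \<in> Vsp Xb kk s \<Longrightarrow> br x y = 0"
begin

abbreviation "I \<equiv> idx s kk"
definition "E b = Xb (fst b) (snd b)"
definition "co b x = representation (E ` I) x (E b)"
definition "\<pi> r x = (\<Sum>b\<in>{b\<in>I. fst b = r}. co b x *\<^sub>R E b)"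
text \<open>The derivation generating the dilations \<open>Lam\<close>. Most identities below are
  proved by comparing how two expressions behave under \<open>Dg\<close>.\<close>

definition "Dg x = (\<Sum>b\<in>I. (real (fst b) * co b x) *\<^sub>R E b)"
definition "Lam t x = (\<Sum>b\<in>I. (t ^ fst b * co b x) *\<^sub>R E b)"

lemma E_case: "E = (\<lambda>(r, i). Xb r i)"
  by (auto simp: E_def fun_eq_iff)

lemma inj_E: "inj_on E I" and indep_E: "independent (E ` I)" and span_E: "span (E ` I) = UNIV"
  using inj_Xb indep_Xb span_Xb by (simp_all add: E_case)

lemma co_add [simp]: "co b (x + y) = co b x + co b y"
  unfolding co_def using indep_E span_E by (subst real_vector.representation_add) auto

lemma co_scale [simp]: "co b (c *\<^sub>R x) = c * co b x"
  unfolding co_def using indep_E span_E by (subst real_vector.representation_scale) auto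

lemma linear_co: "linear (co b)"
  by (rule linearI) auto

lemmas co_linear_simps [simp] = linear_0[OF linear_co] linear_diff[OF linear_co] linear_neg[OF linear_co]
  linear_sum[OF linear_co]

lemma co_E [simp]: "a \<in> I \<Longrightarrow> b \<in> I \<Longrightarrow> co b (E a) = (if a = b then 1 else 0)"
  unfolding co_def using inj_onD[OF inj_E] indep_E
  by (subst real_vector.representation_basis) auto

lemma expand: "x = (\<Sum>b\<in>I. co b x *\<^sub>R E b)"
proof -
  have "(\<Sum>v\<in>E ` I. representation (E ` I) x v *\<^sub>R v) = x"
    using indep_E span_E by (intro real_vector.sum_representation_eq) auto
  then show ?thesis by (simp add: sum.reindex[OF inj_E] co_def)
qed

lemma vec_eqI: "(\<And>b. b \<in> I \<Longrightarrow> co b x = co b y) \<Longrightarrow> x = y"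
  by (subst expand[of x], subst expand[of y]) simp

lemma co_comb [simp]: "b \<in> I \<Longrightarrow> co b (\<Sum>a\<in>I. f a *\<^sub>R E a) = f b"
  by (simp add: if_distrib cong: if_cong)

lemma co_pi [simp]: "b \<in> I \<Longrightarrow> co b (\<pi> r x) = (if fst b = r then co b x else 0)"
proof -
  assume b: "b \<in> I"
  have "co b (\<pi> r x) = (\<Sum>a\<in>I. if fst a = r then co a x * co b (E a) else 0)"
    unfolding \<pi>_def sum.inter_filter[OF finite_idx] co_linear_simps by (auto intro!: sum.cong)
  also have "\<dots> = (\<Sum>a\<in>I. if a = b then (if fst b = r then co b x else 0) else 0)"
    by (rule sum.cong) (use b in auto)
  finally show ?thesis using b by simp
qed

lemma co_Dg [simp]: "b \<in> I \<Longrightarrow> co b (Dg x) = real (fst b) * co b x"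
  unfolding Dg_def by (rule co_comb)

lemma co_Lam [simp]: "b \<in> I \<Longrightarrow> co b (Lam t x) = t ^ fst b * co b x"
  unfolding Lam_def by (rule co_comb)

lemma linear_pi: "linear (\<pi> r)" and linear_Dg: "linear Dg" and linear_Lam: "linear (Lam t)"
  by (auto intro!: linearI vec_eqI simp: algebra_simps)

lemmas pi_linear [simp] = linear_0[OF linear_pi] linear_diff[OF linear_pi] linear_neg[OF linear_pi]
  linear_sum[OF linear_pi] linear_add[OF linear_pi] linear_scale[OF linear_pi]
lemmas Dg_linear [simp] = linear_0[OF linear_Dg] linear_diff[OF linear_Dg] linear_neg[OF linear_Dg]
  linear_sum[OF linear_Dg] linear_add[OF linear_Dg] linear_scale[OF linear_Dg]
lemmas Lam_linear [simp] = linear_0[OF linear_Lam] linear_diff[OF linear_Lam] linear_neg[OF linear_Lam]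
  linear_sum[OF linear_Lam] linear_add[OF linear_Lam] linear_scale[OF linear_Lam]
lemmas br_left [simp] = linear_0[OF br_lin1] linear_diff[OF br_lin1] linear_neg[OF br_lin1]
  linear_sum[OF br_lin1] linear_add[OF br_lin1] linear_scale[OF br_lin1]
lemmas br_right [simp] = linear_0[OF br_lin2] linear_diff[OF br_lin2] linear_neg[OF br_lin2]
  linear_sum[OF br_lin2] linear_add[OF br_lin2] linear_scale[OF br_lin2]

lemma pi_pi [simp]: "\<pi> r (\<pi> q x) = (if r = q then \<pi> r x else 0)"
  by (rule vec_eqI) auto

lemma pi_outside: "r \<notin> {1..s} \<Longrightarrow> \<pi> r x = 0"
  by (rule vec_eqI) (auto simp: idx_def)

lemma pi_Dg [simp]: "\<pi> r (Dg x) = real r *\<^sub>R \<pi> r x"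
  and pi_Lam [simp]: "\<pi> r (Lam t x) = t ^ r *\<^sub>R \<pi> r x"
  and Dg_pi [simp]: "Dg (\<pi> r x) = real r *\<^sub>R \<pi> r x"
  and Lam_pi [simp]: "Lam t (\<pi> r x) = t ^ r *\<^sub>R \<pi> r x"
  by (auto intro!: vec_eqI)

lemma sum_pi: "(\<Sum>r\<in>{1..s}. \<pi> r x) = x"
proof (rule vec_eqI)
  fix b assume b: "b \<in> I"
  then have "fst b \<in> {1..s}" by (auto simp: idx_def)
  with b show "co b (\<Sum>r\<in>{1..s}. \<pi> r x) = co b x" by (simp add: sum.delta)
qed

lemma pi_eqI: "(\<And>r. r \<in> {1..s} \<Longrightarrow> \<pi> r x = \<pi> r y) \<Longrightarrow> x = y"
  by (subst sum_pi[symmetric, of x], subst sum_pi[symmetric, of y]) simp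

lemma pi_E [simp]: "b \<in> I \<Longrightarrow> \<pi> r (E b) = (if fst b = r then E b else 0)"
  by (rule vec_eqI) auto

lemma pi_in_Vsp: "r \<in> {1..s} \<Longrightarrow> \<pi> r x \<in> Vsp Xb kk r"
  unfolding \<pi>_def Vsp_def E_def
  by (intro span_sum span_scale span_base) (auto simp: idx_def)

lemma Vsp_pi: "r \<in> {1..s} \<Longrightarrow> x \<in> Vsp Xb kk r \<Longrightarrow> \<pi> r x = x"
proof -
  assume r: "r \<in> {1..s}" and "x \<in> Vsp Xb kk r"
  then have "x \<in> span (Xb r ` {1..kk r})" by (simp add: Vsp_def)
  moreover have "subspace {x. \<pi> r x = x}" by (auto simp: subspace_def)
  moreover have "Xb r ` {1..kk r} \<subseteq> {x. \<pi> r x = x}"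
    using pi_E[of "(r, i)" r for i] r by (auto simp: idx_def E_def)
  ultimately show ?thesis using span_induct by blast
qed

text \<open>Only brackets with the first layer are given. Since layer \<open>i + 1\<close> is
  spanned by brackets of layer 1 with layer \<open>i\<close>, the Jacobi identity moves the bracket
  with \<open>y\<close> inside and lowers \<open>i\<close>.\<close>

lemma br_Vsp:
  "1 \<le> i \<Longrightarrow> i \<le> s \<Longrightarrow> 1 \<le> j \<Longrightarrow> j \<le> s \<Longrightarrow> x \<in> Vsp Xb kk i \<Longrightarrow> y \<in> Vsp Xb kk j \<Longrightarrow>
    br x y \<in> (if i + j \<le> s then Vsp Xb kk (i + j) else {0})"
proof (induction i arbitrary: x y j)
  case 0 then show ?case by simp
next
  case (Suc i)
  \<comment> \<open>Layer \<open>k\<close>, and zero beyond the step, so that the two cases of the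
    claim become one.\<close>
  define W where "W k = (if k \<le> s then Vsp Xb kk k else {0})" for k
  have subW: "subspace (W k)" for k by (simp add: W_def Vsp_def)
  have one: "br a b \<in> W (Suc k)" if "a \<in> Vsp Xb kk 1" "b \<in> W k" "1 \<le> k" for a b k
  proof (cases "k < s")
    case True
    then have "br a b \<in> span {br x y | x y. x \<in> Vsp Xb kk 1 \<and> y \<in> Vsp Xb kk k}"
      using that by (intro span_base) (auto simp: W_def)
    then show ?thesis using gen[OF that(3) True] True by (simp add: W_def)
  next
    case False
    then have "b = 0 \<or> k = s" using that(2) by (auto simp: W_def split: if_splits)
    then have "br a b = 0" using top[OF that(1)] that(2) by (auto simp: W_def)
    then show ?thesis using subspace_0[OF subW] by simp
  qed
  have "br x y \<in> W (Suc i + j)"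
  proof (cases "i = 0")
    case True
    then show ?thesis using one[of x y j] Suc.prems by (simp add: W_def)
  next
    case False
    have sub: "subspace {x. br x y \<in> W (Suc i + j)}"
      using subW[of "Suc i + j"] by (auto simp: subspace_def)
    have "br (br a b) y \<in> W (Suc i + j)" if a: "a \<in> Vsp Xb kk 1" and b: "b \<in> Vsp Xb kk i" for a b
    proof -
      have "br b y \<in> W (i + j)" using Suc.IH[of j b y] Suc.prems b False by (auto simp: W_def)
      then have 1: "br a (br b y) \<in> W (Suc i + j)" using one[OF a, of "br b y" "i + j"] False by auto
      have ay: "br a y \<in> W (Suc j)" using one[OF a, of y j] Suc.prems by (auto simp: W_def)
      have 2: "br b (br a y) \<in> W (Suc i + j)"
      proof (cases "Suc j \<le> s")
        case True
        then show ?thesis using Suc.IH[of "Suc j" b "br a y"] Suc.prems b False ay by (auto simp: W_def)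
      next
        case F: False
        then show ?thesis using ay subspace_0[OF subW] by (auto simp: W_def)
      qed
      have "br (br a b) y = br a (br b y) - br b (br a y)" using jacobi[of a b y] by simp
      then show ?thesis using subspace_diff[OF subW 1 2] by simp
    qed
    then have "span {br x y | x y. x \<in> Vsp Xb kk 1 \<and> y \<in> Vsp Xb kk i} \<subseteq> {x. br x y \<in> W (Suc i + j)}"
      by (intro span_minimal sub) auto
    then show ?thesis using gen[of i] False Suc.prems by auto
  qed
  then show ?case by (simp only: W_def)
qed

lemma br_graded: "\<pi> q (br (\<pi> i x) (\<pi> j y)) = (if q = i + j then br (\<pi> i x) (\<pi> j y) else 0)"
proof (cases "i \<in> {1..s} \<and> j \<in> {1..s}")
  case True
  then have *: "br (\<pi> i x) (\<pi> j y) \<in> (if i + j \<le> s then Vsp Xb kk (i + j) else {0})"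
    by (intro br_Vsp pi_in_Vsp) auto
  show ?thesis
  proof (cases "i + j \<le> s")
    case T: True
    then have "\<pi> (i + j) (br (\<pi> i x) (\<pi> j y)) = br (\<pi> i x) (\<pi> j y)"
      using * True by (intro Vsp_pi) auto
    then show ?thesis by (metis pi_pi)
  qed (use * in auto)
next
  case False
  then show ?thesis using pi_outside[of i x] pi_outside[of j y] by auto
qed

lemma pi_br: "\<pi> q (br x y) = (\<Sum>i\<in>{1..s}. \<Sum>j\<in>{1..s}. if q = i + j then br (\<pi> i x) (\<pi> j y) else 0)"
proof -
  have "br x y = br (\<Sum>i\<in>{1..s}. \<pi> i x) (\<Sum>j\<in>{1..s}. \<pi> j y)" by (simp only: sum_pi)
  then have "br x y = (\<Sum>i\<in>{1..s}. \<Sum>j\<in>{1..s}. br (\<pi> i x) (\<pi> j y))" by (simp del: pi_linear) (rule sum.swap)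
  then show ?thesis by (simp add: br_graded)
qed

lemma Dg_br: "Dg (br x y) = br (Dg x) y + br x (Dg y)"
proof (rule pi_eqI)
  fix r
  show "\<pi> r (Dg (br x y)) = \<pi> r (br (Dg x) y + br x (Dg y))"
    by (auto simp: pi_br[of r] scaleR_sum_right sum.distrib[symmetric] algebra_simps intro!: sum.cong)
qed

lemma Lam_br: "Lam t (br x y) = br (Lam t x) (Lam t y)"
proof (rule pi_eqI)
  fix r
  show "\<pi> r (Lam t (br x y)) = \<pi> r (br (Lam t x) (Lam t y))"
    by (auto simp: pi_br[of r] scaleR_sum_right power_add algebra_simps intro!: sum.cong)
qed

text \<open>All identities for the operators \<open>M x\<close> below follow from this uniqueness principle.\<close>

lemma graded_unique:
  assumes "Dg v - real a *\<^sub>R v = br z v" "\<pi> a v = 0"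
  shows "v = 0"
proof -
  have "\<pi> r v = 0" for r
  proof (induction r rule: less_induct)
    case (less r)
    have "\<pi> r (br z v) = (\<Sum>i\<in>{1..s}. \<Sum>j\<in>{1..s}. if r = i + j then br (\<pi> i z) (\<pi> j v) else 0)" by (rule pi_br)
    also have "\<dots> = 0" using less by (intro sum.neutral ballI) auto
    finally have "\<pi> r (Dg v - real a *\<^sub>R v) = 0" using assms(1) by simp
    then have "(real r - real a) *\<^sub>R \<pi> r v = 0" by (simp add: algebra_simps)
    then show ?case using assms(2) by (cases "r = a") auto
  qed
  then show ?thesis using pi_eqI[of v 0] by simp
qed

text \<open>\<open>M x\<close> is to solve \<open>Dg (M x y) = M x (Dg y) + br x (M x y)\<close>
  with the identity as leading part; \<open>Mj j\<close> is the part raising degrees by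
  \<open>j\<close>, and comparing degrees gives this recursion. Replacing \<open>x\<close> by
  \<open>Lam t x\<close> turns the equation into an ordinary differential equation in
  \<open>t\<close> driven by \<open>br (Lam t x)\<close>, so \<open>M x\<close> is the adjoint
  action of a group element with coordinate \<open>x\<close>. The resulting product
  \<open>x + M x y\<close> is affine in \<open>y\<close>, unlike the one in exponential
  coordinates.\<close>

fun Mj :: "nat \<Rightarrow> 'a \<Rightarrow> 'a \<Rightarrow> 'a" where
  "Mj j x y = (if j = 0 then y else (1 / real j) *\<^sub>R (\<Sum>i\<in>{1..j}. br (\<pi> i x) (Mj (j - i) x y)))"

declare Mj.simps [simp del]

definition "M x y = (\<Sum>j\<in>{0..s}. Mj j x y)"

lemma Mj_0 [simp]: "Mj 0 x y = y" by (simp add: Mj.simps)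

lemma Mj_rec: "j > 0 \<Longrightarrow> real j *\<^sub>R Mj j x y = (\<Sum>i\<in>{1..j}. br (\<pi> i x) (Mj (j - i) x y))"
  by (subst Mj.simps) simp

lemma linear_Mj: "linear (Mj j x)"
proof (induction j rule: less_induct)
  case (less j)
  show ?case
  proof (cases "j = 0")
    case True
    then show ?thesis by (simp add: linear_iff)
  next
    case False
    have "linear (\<lambda>y. br (\<pi> i x) (Mj (j - i) x y))" if "i \<in> {1..j}" for i
      using linear_compose[OF less[of "j - i"] br_lin2[of "\<pi> i x"]] that False by (simp add: o_def)
    then have "linear (\<lambda>y. (1 / real j) *\<^sub>R (\<Sum>i\<in>{1..j}. br (\<pi> i x) (Mj (j - i) x y)))"
      by (intro linear_compose_scale_right linear_compose_sum) auto
    then show ?thesis using False by (subst Mj.simps[abs_def]) simp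
  qed
qed

lemmas Mj_linear [simp] = linear_0[OF linear_Mj] linear_diff[OF linear_Mj] linear_neg[OF linear_Mj]
  linear_sum[OF linear_Mj] linear_add[OF linear_Mj] linear_scale[OF linear_Mj]

lemma linear_M: "linear (M x)"
  unfolding M_def by (intro linear_compose_sum) (auto intro: linear_Mj)

lemmas M_linear [simp] = linear_0[OF linear_M] linear_diff[OF linear_M] linear_neg[OF linear_M]
  linear_sum[OF linear_M] linear_add[OF linear_M] linear_scale[OF linear_M]

lemma Mj_cong: "(\<And>i. i \<le> j \<Longrightarrow> \<pi> i x = \<pi> i x') \<Longrightarrow> Mj j x y = Mj j x' y"
proof (induction j rule: less_induct)
  case (less j)
  show ?case
    by (subst (1 2) Mj.simps) (use less in \<open>auto intro!: arg_cong2[of _ _ _ _ scaleR] sum.cong arg_cong2[of _ _ _ _ br]\<close>)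
qed

lemma Mj_graded: "\<pi> q (Mj j x (\<pi> a y)) = (if q = a + j then Mj j x (\<pi> a y) else 0)"
proof (induction j arbitrary: q rule: less_induct)
  case (less j)
  show ?case
  proof (cases "j = 0")
    case True
    then show ?thesis by auto
  next
    case False
    have *: "\<pi> (a + (j - i)) (Mj (j - i) x (\<pi> a y)) = Mj (j - i) x (\<pi> a y)" if "i \<in> {1..j}" for i
      using less[of "j - i" "a + (j - i)"] that False by simp
    have "\<pi> q (br (\<pi> i x) (Mj (j - i) x (\<pi> a y))) = (if q = a + j then br (\<pi> i x) (Mj (j - i) x (\<pi> a y)) else 0)" 
      if "i \<in> {1..j}" for i
      using br_graded[of q i x "a + (j - i)" "Mj (j - i) x (\<pi> a y)"] *[OF that] that by simp
    then show ?thesis using False by (subst (1 2) Mj.simps) simp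
  qed
qed

lemma Mj_vanish: "s < a + j \<Longrightarrow> Mj j x (\<pi> a y) = 0"
  using Mj_graded[of "a + j" j x a y] pi_outside[of "a + j"] by simp

lemma pi_M_pi: "\<pi> q (M x (\<pi> a y)) = (if a \<le> q then Mj (q - a) x (\<pi> a y) else 0)"
proof -
  have "\<pi> q (M x (\<pi> a y)) = (\<Sum>j\<in>{0..s}. if q = a + j then Mj j x (\<pi> a y) else 0)"
    by (simp add: M_def Mj_graded)
  also have "\<dots> = (\<Sum>j\<in>{0..s}. if j = q - a then (if a \<le> q then Mj (q - a) x (\<pi> a y) else 0) else 0)"
    by (rule sum.cong) auto
  also have "\<dots> = (if a \<le> q then Mj (q - a) x (\<pi> a y) else 0)"
    using Mj_vanish[of a "q - a" x y] by (auto simp: sum.delta)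
  finally show ?thesis .
qed

lemma pi_M: "\<pi> q (M x y) = (\<Sum>a\<in>{1..q}. Mj (q - a) x (\<pi> a y))"
proof -
  have "\<pi> q (M x y) = \<pi> q (M x (\<Sum>a\<in>{1..s}. \<pi> a y))" by (simp only: sum_pi)
  also have "\<dots> = (\<Sum>a\<in>{1..s}. if a \<le> q then Mj (q - a) x (\<pi> a y) else 0)"
    by (simp del: pi_linear add: pi_M_pi linear_sum[OF linear_pi])
  also have "\<dots> = (\<Sum>a\<in>{1..s} \<inter> {a. a \<le> q}. Mj (q - a) x (\<pi> a y))" by (simp add: sum.inter_restrict)
  also have "\<dots> = (\<Sum>a\<in>{1..q}. Mj (q - a) x (\<pi> a y))"
    by (rule sum.mono_neutral_left) (use pi_outside[of _ y] in force)+
  finally show ?thesis .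
qed

lemma pi_M_lead: "(\<And>r. r < a \<Longrightarrow> \<pi> r y = 0) \<Longrightarrow> \<pi> a (M x y) = \<pi> a y"
proof -
  assume *: "\<And>r. r < a \<Longrightarrow> \<pi> r y = 0"
  have "\<pi> a (M x y) = (\<Sum>r\<in>{1..a}. if r = a then \<pi> a y else 0)"
    unfolding pi_M by (rule sum.cong) (use * in auto)
  then show ?thesis using pi_outside[of 0 y] by (cases "a = 0") (auto simp: sum.delta)
qed

lemma pi_M_low: "(\<And>r. r \<le> a \<Longrightarrow> \<pi> r y = 0) \<Longrightarrow> \<pi> a (M x y) = 0"
  using pi_M_lead[of a y x] by simp

text \<open>The recursion for \<open>Mj\<close> collected over all layers: layer \<open>q\<close> of
  the bracket pairs layer \<open>i\<close> of \<open>x\<close> with layer \<open>q - i\<close> of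
  the solution, and the solution has no layers below \<open>a\<close>.\<close>

lemma Dg_M_pi: "Dg (M x (\<pi> a y)) - real a *\<^sub>R M x (\<pi> a y) = br x (M x (\<pi> a y))"
proof (rule pi_eqI)
  fix q assume q: "q \<in> {1..s}"
  let ?v = "M x (\<pi> a y)"
  have "\<pi> q (br x ?v) = (\<Sum>i\<in>{1..s}. \<Sum>j\<in>{1..s}. if q = i + j then br (\<pi> i x) (\<pi> j ?v) else 0)" by (rule pi_br)
  also have "\<dots> = (\<Sum>i\<in>{1..s}. if i \<le> q - a then br (\<pi> i x) (Mj (q - a - i) x (\<pi> a y)) else 0)"
  proof (rule sum.cong[OF refl])
    fix i assume i: "i \<in> {1..s}"
    have "(\<Sum>j\<in>{1..s}. if q = i + j then br (\<pi> i x) (\<pi> j ?v) else 0)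
      = (\<Sum>j\<in>{1..s}. if j = q - i then (if i \<le> q then br (\<pi> i x) (\<pi> (q - i) ?v) else 0) else 0)"
      by (rule sum.cong) auto
    also have "\<dots> = (if i \<le> q then br (\<pi> i x) (\<pi> (q - i) ?v) else 0)"
      using q pi_outside[of 0 ?v] by (cases "q - i = 0") (auto simp: sum.delta)
    also have "\<dots> = (if i \<le> q - a then br (\<pi> i x) (Mj (q - a - i) x (\<pi> a y)) else 0)"
    proof (cases "i \<le> q - a")
      case True
      then have "a \<le> q - i" "i \<le> q" "q - i - a = q - a - i" using i by auto
      then show ?thesis using True by (simp add: pi_M_pi)
    next
      case False
      then show ?thesis using i pi_outside[of a y] by (cases "a = 0") (auto simp: pi_M_pi)
    qed
    finally show "(\<Sum>j\<in>{1..s}. if q = i + j then br (\<pi> i x) (\<pi> j ?v) else 0)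
      = (if i \<le> q - a then br (\<pi> i x) (Mj (q - a - i) x (\<pi> a y)) else 0)" .
  qed
  also have "\<dots> = (\<Sum>i\<in>{1..s} \<inter> {i. i \<le> q - a}. br (\<pi> i x) (Mj (q - a - i) x (\<pi> a y)))"
    by (subst sum.inter_restrict) (auto intro!: sum.cong)
  also have "{1..s} \<inter> {i. i \<le> q - a} = {1..q - a}" using q by auto
  finally have 1: "\<pi> q (br x ?v) = (\<Sum>i\<in>{1..q - a}. br (\<pi> i x) (Mj (q - a - i) x (\<pi> a y)))" .
  show "\<pi> q (Dg ?v - real a *\<^sub>R ?v) = \<pi> q (br x ?v)"
  proof (cases "a < q")
    case True
    then show ?thesis unfolding 1 using Mj_rec[of "q - a" x "\<pi> a y"]
      by (simp add: pi_M_pi of_nat_diff algebra_simps)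
  next
    case False
    then show ?thesis unfolding 1 by (cases "a = q") (auto simp: pi_M_pi)
  qed
qed

lemma Dg_M: "Dg (M x y) = M x (Dg y) + br x (M x y)"
proof -
  have *: "Dg (M x (\<pi> a y)) = M x (Dg (\<pi> a y)) + br x (M x (\<pi> a y))" for a
    using Dg_M_pi[of x a y] by (simp add: algebra_simps)
  have "Dg (M x (\<Sum>a\<in>{1..s}. \<pi> a y)) = M x (Dg (\<Sum>a\<in>{1..s}. \<pi> a y)) + br x (M x (\<Sum>a\<in>{1..s}. \<pi> a y))"
    by (simp del: Dg_pi add: * sum.distrib)
  then show ?thesis by (simp only: sum_pi)
qed

lemma M_unique: 
  assumes "Dg v - real a *\<^sub>R v = br x v" "\<pi> a v = \<pi> a y"
  shows "v = M x (\<pi> a y)"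
proof -
  have "v - M x (\<pi> a y) = 0"
  proof (rule graded_unique)
    show "Dg (v - M x (\<pi> a y)) - real a *\<^sub>R (v - M x (\<pi> a y)) = br x (v - M x (\<pi> a y))"
      using assms(1) Dg_M_pi[of x a y] by (simp add: algebra_simps)
    show "\<pi> a (v - M x (\<pi> a y)) = 0" using assms(2) by (simp add: pi_M_pi)
  qed
  then show ?thesis by simp
qed

lemma linear_ext_pi: "linear f \<Longrightarrow> linear g \<Longrightarrow> (\<And>a. f (\<pi> a y) = g (\<pi> a y)) \<Longrightarrow> f y = g y"
  by (subst (1 2) sum_pi[symmetric]) (simp only: linear_sum)

text \<open>\<open>M x\<close> is an automorphism: since \<open>Dg\<close> is a derivation, the
  Jacobi identity shows that the right-hand side solves the equation determining the left one, with
  the same leading layer \<open>a + b\<close>.\<close>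

lemma M_br: "M x (br y z) = br (M x y) (M x z)"
proof -
  have *: "M x (br (\<pi> a y) (\<pi> b z)) = br (M x (\<pi> a y)) (M x (\<pi> b z))" for a b
  proof -
    let ?u = "br (M x (\<pi> a y)) (M x (\<pi> b z))"
    have eq: "br (\<pi> a y) (\<pi> b z) = \<pi> (a + b) (br (\<pi> a y) (\<pi> b z))" by (simp add: br_graded)
    have "Dg ?u - real (a + b) *\<^sub>R ?u = br (br x (M x (\<pi> a y))) (M x (\<pi> b z)) + br (M x (\<pi> a y)) (br x (M x (\<pi> b z)))"
      by (simp add: Dg_br Dg_M algebra_simps)
    also have "\<dots> = br x ?u" by (rule jacobi[symmetric])
    finally have 1: "Dg ?u - real (a + b) *\<^sub>R ?u = br x ?u" .
    have "\<pi> (a + b) ?u = (\<Sum>i\<in>{1..s}. \<Sum>j\<in>{1..s}. if a + b = i + j then br (\<pi> i (M x (\<pi> a y))) (\<pi> j (M x (\<pi> b z))) else 0)"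
      by (rule pi_br)
    also have "\<dots> = (\<Sum>i\<in>{1..s}. \<Sum>j\<in>{1..s}. if i = a then if j = b then br (\<pi> a y) (\<pi> b z) else 0 else 0)"
      by (intro sum.cong refl) (auto simp: pi_M_pi)
    also have "\<dots> = (\<Sum>i\<in>{1..s}. if i = a then (\<Sum>j\<in>{1..s}. if j = b then br (\<pi> a y) (\<pi> b z) else 0) else 0)"
      by (intro sum.cong refl) auto
    also have "\<dots> = br (\<pi> a y) (\<pi> b z)"
      using pi_outside[of a y] pi_outside[of b z] by (auto simp: sum.delta)
    finally have "\<pi> (a + b) ?u = \<pi> (a + b) (br (\<pi> a y) (\<pi> b z))" using eq by simp
    from M_unique[OF 1 this] eq show ?thesis by simp
  qed
  have l1: "linear (\<lambda>y. M x (br y z))" for z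
    using linear_compose[OF br_lin1 linear_M] by (simp add: o_def)
  have l2: "linear (\<lambda>z. M x (br y z))" for y
    using linear_compose[OF br_lin2 linear_M] by (simp add: o_def)
  have l3: "linear (\<lambda>y. br (M x y) z)" for z
    using linear_compose[OF linear_M br_lin1] by (simp add: o_def)
  have l4: "linear (\<lambda>z. br y (M x z))" for y
    using linear_compose[OF linear_M br_lin2] by (simp add: o_def)
  have "M x (br y (\<pi> b z)) = br (M x y) (M x (\<pi> b z))" for b
    by (rule linear_ext_pi[OF l1 l3]) (rule *)
  then show ?thesis by (rule linear_ext_pi[OF l2 l4])
qed

text \<open>Associativity of the product \<open>x + M x y\<close>: as the product is affine in its
  second factor, it amounts to \<open>M\<close> being multiplicative.\<close>

lemma M_assoc: "M (x + M x y) z = M x (M y z)"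
proof (rule linear_ext_pi[of "M (x + M x y)" "\<lambda>z. M x (M y z)"])
  show "linear (M (x + M x y))" by (rule linear_M)
  show "linear (\<lambda>z. M x (M y z))" using linear_compose[OF linear_M linear_M] by (simp add: o_def)
  fix a
  let ?v = "M x (M y (\<pi> a z))"
  have "?v = M (x + M x y) (\<pi> a z)"
  proof (rule M_unique)
    show "Dg ?v - real a *\<^sub>R ?v = br (x + M x y) ?v"
      by (simp add: Dg_M M_br algebra_simps)
    show "\<pi> a ?v = \<pi> a z" by (subst pi_M_lead) (auto simp: pi_M_pi)
  qed
  then show "M (x + M x y) (\<pi> a z) = ?v" ..
qed

lemma M_zero [simp]: "M 0 y = y"
proof -
  have "\<pi> a y = M 0 (\<pi> a y)" for a
    using M_unique[of "\<pi> a y" a 0 y] by simp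
  then have "y = M 0 y" by (rule linear_ext_pi[of "\<lambda>x. x" "M 0" y, OF linear_ident linear_M])
  then show ?thesis by (rule sym)
qed

lemma M_Lam: "M (Lam t x) (Lam t y) = Lam t (M x y)"
proof -
  have "Mj j (Lam t x) (Lam t y) = Lam t (Mj j x y)" for j
  proof (induction j rule: less_induct)
    case (less j)
    show ?case
    proof (cases "j = 0")
      case False
      have "br (\<pi> i (Lam t x)) (Mj (j - i) (Lam t x) (Lam t y)) = Lam t (br (\<pi> i x) (Mj (j - i) x y))"
        if "i \<in> {1..j}" for i
        using less[of "j - i"] that False by (simp add: Lam_br)
      then show ?thesis using False by (subst (1 2) Mj.simps) simp
    qed simp
  qed
  then show ?thesis by (simp add: M_def)
qed

subsection \<open>Inverse and smoothness\<close>

definition "Rm x y = M x y - y"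
text \<open>The inverse of \<open>M x\<close> as a Neumann series, which stops after
  \<open>s\<close> terms beyond the first because \<open>Rm x\<close> raises degrees. Being a finite
  sum, it is visibly smooth in \<open>x\<close>.\<close>

definition "N x y = (\<Sum>k\<in>{0..s}. (-1) ^ k *\<^sub>R (Rm x ^^ k) y)"

lemma linear_Rm: "linear (Rm x)"
  unfolding Rm_def by (rule linearI) (auto simp: algebra_simps)

lemma linear_Rm_pow: "linear (Rm x ^^ k)"
proof (induction k)
  case 0 then show ?case by (simp add: linear_ident id_def)
next
  case (Suc k)
  show ?case unfolding funpow.simps by (rule linear_compose[OF Suc linear_Rm])
qed

lemma Rm_pow_low: "r \<le> k \<Longrightarrow> \<pi> r ((Rm x ^^ k) y) = 0"
proof (induction k arbitrary: r)
  case 0 then show ?case using pi_outside[of 0] by simp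
next
  case (Suc k)
  have "\<pi> r (M x ((Rm x ^^ k) y)) = \<pi> r ((Rm x ^^ k) y)"
    by (rule pi_M_lead) (use Suc in auto)
  then show ?case by (simp add: Rm_def[of x "(Rm x ^^ k) y"])
qed

lemma Rm_pow_zero: "(Rm x ^^ Suc s) y = 0"
  by (rule pi_eqI) (subst Rm_pow_low, auto)

lemma linear_N: "linear (N x)"
  unfolding N_def by (intro linear_compose_sum ballI linear_compose_scale_right linear_Rm_pow)

lemma M_N [simp]: "M x (N x y) = y"
proof -
  have 1: "M x z = z + Rm x z" for z by (simp add: Rm_def)
  define f where "f k = (-1) ^ k *\<^sub>R (Rm x ^^ k) y" for k
  have R: "Rm x (f k) = - f (Suc k)" for k by (simp add: f_def linear_scale[OF linear_Rm])
  have "M x (N x y) = (\<Sum>k\<in>{0..s}. f k) + Rm x (\<Sum>k\<in>{0..s}. f k)" by (simp only: 1 N_def f_def)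
  also have "\<dots> = (\<Sum>k\<in>{0..s}. f k - f (Suc k))" by (simp add: linear_sum[OF linear_Rm] R sum.distrib sum_subtractf sum_negf)
  also have "\<dots> = f 0 - f (Suc s)" by (subst sum_telescope[symmetric]) (simp add: atLeast0AtMost)
  also have "\<dots> = y" using Rm_pow_zero[of x y] by (simp add: f_def)
  finally show ?thesis .
qed

lemma M_inj: "M x y = 0 \<Longrightarrow> y = 0"
proof -
  assume a: "M x y = 0"
  have "\<pi> r y = 0" for r
  proof (induction r rule: less_induct)
    case (less r)
    then show ?case using pi_M_lead[of r y x] a by simp
  qed
  then show ?thesis using pi_eqI[of y 0] by simp
qed

lemma N_M [simp]: "N x (M x y) = y"
  using M_inj[of x "N x (M x y) - y"] by simp

lemma bounded_bilinear_br: "bounded_bilinear br"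
  using br_lin1 br_lin2 bilinear_conv_bounded_bilinear bilinear_def by blast

lemma smooth_Mj: "smooth X \<Longrightarrow> smooth Y \<Longrightarrow> smooth (\<lambda>p. Mj j (X p) (Y p))"
  for X Y :: "'c::euclidean_space \<Rightarrow> 'a"
proof (induction j rule: less_induct)
  case (less j)
  show ?case
  proof (cases "j = 0")
    case False
    have "smooth (\<lambda>p. (1 / real j) *\<^sub>R (\<Sum>i\<in>{1..j}. br (\<pi> i (X p)) (Mj (j - i) (X p) (Y p))))"
      by (intro smooth_bounded_linear[OF bounded_linear_scaleR_right] smooth_sum smooth_bilinear[OF bounded_bilinear_br] 
          smooth_compose[OF smooth_linear[OF linear_pi]] less) (use False in auto)
    then show ?thesis using False by (subst Mj.simps) simp
  qed (use less in simp)
qed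

lemma smooth_M: "smooth X \<Longrightarrow> smooth Y \<Longrightarrow> smooth (\<lambda>p. M (X p) (Y p))"
  for X Y :: "'c::euclidean_space \<Rightarrow> 'a"
  unfolding M_def by (intro smooth_sum smooth_Mj)

lemma smooth_N: "smooth X \<Longrightarrow> smooth Y \<Longrightarrow> smooth (\<lambda>p. N (X p) (Y p))"
  for X Y :: "'c::euclidean_space \<Rightarrow> 'a"
proof -
  assume X: "smooth X" and Y: "smooth Y"
  have "smooth (\<lambda>p. (Rm (X p) ^^ k) (Y p))" for k
  proof (induction k)
    case (Suc k)
    have "smooth (\<lambda>p. M (X p) ((Rm (X p) ^^ k) (Y p)) - (Rm (X p) ^^ k) (Y p))"
      by (intro smooth_diff smooth_M X Suc)
    then show ?case by (simp add: Rm_def[of "X p" "(Rm (X p) ^^ k) (Y p)" for p])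
  qed (use Y in simp)
  then show ?thesis unfolding N_def
    by (intro smooth_sum smooth_bounded_linear[OF bounded_linear_scaleR_right])
qed

lemma smooth_co: "smooth f \<Longrightarrow> smooth (\<lambda>p. co b (f p))" for f :: "'c::euclidean_space \<Rightarrow> 'a"
  by (rule smooth_compose[OF smooth_linear[OF linear_co]])

text \<open>\<open>M x u\<close> is the derivative of \<open>x + M x y\<close> at
  \<open>y = 0\<close> in direction \<open>u\<close>, so these fields are left invariant. The choice
  \<open>u = Dg v\<close> is what makes their brackets reproduce \<open>br\<close>.\<close>

definition "Yv v x = M x (Dg v)"

lemma smooth_Yv: "smooth (Yv v)"
  unfolding Yv_def[abs_def] by (intro smooth_M) auto

text \<open>Differentiating the equation of \<open>M x z\<close> along \<open>Yv v\<close> gives an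
  inhomogeneous equation for the derivative. By the automorphism property
  \<open>M x (br v z)\<close> solves the same one, and neither has a component in the leading layer,
  so uniqueness applies to the difference.\<close>

lemma fd_M: "frechet_derivative (\<lambda>x. M x z) (at x) (Yv v x) = M x (br v z)"
proof -
  define T where "T z = frechet_derivative (\<lambda>x. M x z) (at x) (Yv v x)" for z
  have sm: "smooth (\<lambda>x. M x z)" for z by (intro smooth_M) auto
  have der: "((\<lambda>x. M x z) has_derivative frechet_derivative (\<lambda>x. M x z) (at x)) (at x)" for z
    by (rule smooth_has_derivative[OF sm])
  have T_lin: "linear T"
  proof (rule linearI)
    fix y z :: 'a and c :: real
    show "T (y + z) = T y + T z"
      unfolding T_def by (simp add: fd_eqI[OF has_derivative_add[OF der der]])
    show "T (c *\<^sub>R z) = c *\<^sub>R T z"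
      unfolding T_def by (simp add: fd_eqI[OF has_derivative_scaleR_right[OF der]])
  qed
  have R_lin: "linear (\<lambda>z. M x (br v z))"
    using linear_compose[OF br_lin2 linear_M] by (simp add: o_def)
  have "T (\<pi> a z) = M x (br v (\<pi> a z))" for a z
  proof -
    let ?z = "\<pi> a z" and ?w = "Yv v x"
    have f: "((\<lambda>x. Dg (M x ?z) - real a *\<^sub>R M x ?z) has_derivative (\<lambda>h. Dg (frechet_derivative (\<lambda>x. M x ?z) (at x) h) 
        - real a *\<^sub>R frechet_derivative (\<lambda>x. M x ?z) (at x) h)) (at x)"
      by (intro has_derivative_diff has_derivative_scaleR_right der
        bounded_linear.has_derivative[OF linear_Dg[unfolded linear_conv_bounded_linear]])
    have g: "((\<lambda>x. br x (M x ?z)) has_derivative (\<lambda>h. br x (frechet_derivative (\<lambda>x. M x ?z) (at x) h) + br h (M x ?z))) (at x)"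
      by (rule bounded_bilinear.FDERIV[OF bounded_bilinear_br has_derivative_ident der])
    have 1: "Dg (T ?z) - real a *\<^sub>R T ?z = br x (T ?z) + br ?w (M x ?z)"
      using fd_eqI[OF f, of ?w] fd_eqI[OF g, of ?w] unfolding Dg_M_pi T_def by simp
    let ?T' = "M x (br v ?z)"
    have 2: "Dg ?T' - real a *\<^sub>R ?T' = br x ?T' + br ?w (M x ?z)"
      unfolding Dg_M by (simp add: Dg_br Yv_def M_br)
    have 3: "\<pi> a (T ?z) = 0"
    proof -
      have "((\<lambda>x. \<pi> a (M x ?z)) has_derivative (\<lambda>h. \<pi> a (frechet_derivative (\<lambda>x. M x ?z) (at x) h))) (at x)"
        by (intro bounded_linear.has_derivative[OF linear_pi[unfolded linear_conv_bounded_linear]] der)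
      from fd_eqI[OF this, of ?w] show ?thesis unfolding T_def by (simp add: pi_M_pi)
    qed
    have 4: "\<pi> a ?T' = 0"
    proof (rule pi_M_low)
      fix r assume "r \<le> a"
      then show "\<pi> r (br v ?z) = 0" unfolding pi_br by (intro sum.neutral ballI) auto
    qed
    have "T ?z - ?T' = 0"
    proof (rule graded_unique)
      show "Dg (T ?z - ?T') - real a *\<^sub>R (T ?z - ?T') = br x (T ?z - ?T')" using 1 2 by (simp add: algebra_simps)
      show "\<pi> a (T ?z - ?T') = 0" using 3 4 by simp
    qed
    then show ?thesis by simp
  qed
  then have "T z = M x (br v z)" by (rule linear_ext_pi[OF T_lin R_lin])
  then show ?thesis by (simp add: T_def)
qed

text \<open>The two terms combine to \<open>M x (Dg (br v w))\<close> by the derivation property: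
  this is where the weight \<open>Dg\<close> in \<open>Yv\<close> is needed.\<close>

lemma Yv_bracket: "frechet_derivative (Yv w) (at x) (Yv v x) - frechet_derivative (Yv v) (at x) (Yv w x) = Yv (br v w) x"
proof -
  have *: "frechet_derivative (Yv w) (at x) (Yv v x) = M x (br v (Dg w))" for v w
    using fd_M[of "Dg w" x v] by (simp add: Yv_def[abs_def])
  show ?thesis unfolding * by (simp add: Yv_def Dg_br br_anti[of w "Dg v"])
qed

end

section \<open>From a Carnot group to the algebraic model\<close>

lemma fd_linear_field:
  fixes \<omega> :: "'a::euclidean_space \<Rightarrow> 'b::euclidean_space \<Rightarrow> 'c::euclidean_space" and V :: "'a \<Rightarrow> 'b"
  assumes lin: "\<And>x. linear (\<omega> x)" and sm: "\<And>u. smooth (\<lambda>x. \<omega> x u)" and V: "smooth V"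
  shows "frechet_derivative (\<lambda>y. \<omega> y (V y)) (at x) h
      = frechet_derivative (\<lambda>y. \<omega> y (V x)) (at x) h + \<omega> x (frechet_derivative V (at x) h)"
    and "smooth (\<lambda>y. \<omega> y (V y))"
proof -
  have eq: "(\<lambda>y. \<omega> y (V y)) = (\<lambda>y. \<Sum>b\<in>Basis. inner (V y) b *\<^sub>R \<omega> y b)"
    by (rule ext, rule linear_euclidean_expand[OF lin])
  have eq2: "(\<lambda>y. \<omega> y (V x)) = (\<lambda>y. \<Sum>b\<in>Basis. inner (V x) b *\<^sub>R \<omega> y b)"
    by (rule ext, rule linear_euclidean_expand[OF lin])
  have d2: "((\<lambda>y. inner (V y) b) has_derivative (\<lambda>w. inner (frechet_derivative V (at x) w) b)) (at x)" for b
    by (rule bounded_linear.has_derivative[OF bounded_linear_inner_left smooth_has_derivative[OF V]])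
  have "((\<lambda>y. \<Sum>b\<in>Basis. inner (V y) b *\<^sub>R \<omega> y b) has_derivative
    (\<lambda>w. \<Sum>b\<in>Basis. inner (V x) b *\<^sub>R frechet_derivative (\<lambda>y. \<omega> y b) (at x) w
       + inner (frechet_derivative V (at x) w) b *\<^sub>R \<omega> x b)) (at x)"
    by (intro has_derivative_sum has_derivative_scaleR smooth_has_derivative[OF sm] d2)
  then have 1: "frechet_derivative (\<lambda>y. \<omega> y (V y)) (at x) h =
     (\<Sum>b\<in>Basis. inner (V x) b *\<^sub>R frechet_derivative (\<lambda>y. \<omega> y b) (at x) h)
       + (\<Sum>b\<in>Basis. inner (frechet_derivative V (at x) h) b *\<^sub>R \<omega> x b)"
    unfolding eq by (simp add: fd_eqI sum.distrib)
  have "((\<lambda>y. \<Sum>b\<in>Basis. inner (V x) b *\<^sub>R \<omega> y b) has_derivative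
    (\<lambda>w. \<Sum>b\<in>Basis. inner (V x) b *\<^sub>R frechet_derivative (\<lambda>y. \<omega> y b) (at x) w)) (at x)"
    by (intro has_derivative_sum bounded_linear.has_derivative[OF bounded_linear_scaleR_right] smooth_has_derivative sm)
  then have 2: "frechet_derivative (\<lambda>y. \<omega> y (V x)) (at x) h
     = (\<Sum>b\<in>Basis. inner (V x) b *\<^sub>R frechet_derivative (\<lambda>y. \<omega> y b) (at x) h)"
    unfolding eq2 by (rule fd_eqI)
  show "frechet_derivative (\<lambda>y. \<omega> y (V y)) (at x) h
      = frechet_derivative (\<lambda>y. \<omega> y (V x)) (at x) h + \<omega> x (frechet_derivative V (at x) h)"
    unfolding 1 2 by (subst (3) linear_euclidean_expand[OF lin]) simp
  show "smooth (\<lambda>y. \<omega> y (V y))"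
    unfolding eq by (intro smooth_sum smooth_scaleR smooth_inner smooth_const sm V)
qed

lemma fd_compose:
  assumes "smooth f" "smooth g"
  shows "frechet_derivative (\<lambda>x. f (g x)) (at x) v = frechet_derivative f (at (g x)) (frechet_derivative g (at x) v)"
  by (rule fd_eqI[OF has_derivative_compose[OF smooth_has_derivative[OF assms(2)] smooth_has_derivative[OF assms(1)]]])

text \<open>The primitive integrates \<omega> along the segment from 0. Its derivative along a line
  comes from differentiating under the integral; the derivative at a point then follows from those
  along lines and the continuity of \<omega>.\<close>

lemma poincare_lemma:
  fixes \<omega> :: "'a::euclidean_space \<Rightarrow> 'a \<Rightarrow> 'b::euclidean_space"
  assumes lin: "\<And>x. linear (\<omega> x)" and sm: "\<And>u. smooth (\<lambda>x. \<omega> x u)"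
    and sym: "\<And>x u v. frechet_derivative (\<lambda>x. \<omega> x u) (at x) v = frechet_derivative (\<lambda>x. \<omega> x v) (at x) u"
  shows "\<exists>c. \<forall>x. (c has_derivative \<omega> x) (at x)"
proof -
  define c where "c x = integral (cbox 0 1) (\<lambda>t::real. \<omega> (t *\<^sub>R x) x)" for x
  have dir: "((\<lambda>\<tau>. c (x + \<tau> *\<^sub>R h)) has_vector_derivative \<omega> (x + \<tau> *\<^sub>R h) h) (at \<tau>)" for x h \<tau>
  proof -
    \<comment> \<open>Position on the line and integration parameter become one variable in the
      plane, so that smoothness of the integrand is a single composition.\<close>
    define Y where "Y z = x + fst z *\<^sub>R h" for z :: "real \<times> real"
    define F where "F z = \<omega> (snd z *\<^sub>R Y z) (Y z)" for z :: "real \<times> real"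
    have smf: "smooth (\<lambda>z. fst z)" "smooth (\<lambda>z. snd z)" for z :: "real \<times> real"
      by (intro smooth_linear bounded_linear.linear bounded_linear_fst bounded_linear_snd)+
    have smY: "smooth Y" unfolding Y_def[abs_def]
      by (intro smooth_add smooth_scaleR smooth_const smf)
    have smtY: "smooth (\<lambda>z. snd z *\<^sub>R Y z)" by (intro smooth_scaleR smY smf)
    have linF: "linear (\<omega> (snd z *\<^sub>R Y z))" for z by (rule lin)
    have smF': "smooth (\<lambda>z. \<omega> (snd z *\<^sub>R Y z) u)" for u
      by (rule smooth_compose[OF sm smtY])
    have smF: "smooth F" unfolding F_def[abs_def]
      by (rule fd_linear_field(2)[OF linF smF' smY])
    have dY: "frechet_derivative Y (at z) (1, 0) = h" for z
    proof -
      have "(Y has_derivative (\<lambda>w. fst w *\<^sub>R h)) (at z)"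
        unfolding Y_def[abs_def] by (auto intro!: derivative_eq_intros)
      from fd_eqI[OF this] show ?thesis by simp
    qed
    have dtY: "frechet_derivative (\<lambda>z. snd z *\<^sub>R Y z) (at z) (1, 0) = snd z *\<^sub>R h" for z
    proof -
      have "((\<lambda>z. snd z *\<^sub>R Y z) has_derivative (\<lambda>w. snd z *\<^sub>R frechet_derivative Y (at z) w + snd w *\<^sub>R Y z)) (at z)"
        by (intro has_derivative_scaleR smooth_has_derivative smY has_derivative_snd has_derivative_ident)
      from fd_eqI[OF this] dY show ?thesis by simp
    qed
    have dF: "frechet_derivative F (at (r, t)) (1, 0) =
       t *\<^sub>R frechet_derivative (\<lambda>x. \<omega> x (x' r)) (at (t *\<^sub>R x' r)) h + \<omega> (t *\<^sub>R x' r) h" 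
      if "x' = (\<lambda>r. x + r *\<^sub>R h)" for r t x'
      unfolding F_def[abs_def] fd_linear_field(1)[OF linF smF' smY]
      by (subst fd_compose[OF sm smtY], simp add: dY dtY linear_scale[OF smooth_linear_fd[OF sm]], simp add: Y_def that)
    define fx where "fx r t = frechet_derivative F (at (r, t)) (1, 0)" for r t
    have "((\<lambda>\<tau>. integral (cbox 0 1) (\<lambda>t. F (\<tau>, t))) has_vector_derivative integral (cbox 0 1) (fx \<tau>)) (at \<tau> within UNIV)"
    proof (rule leibniz_rule_vector_derivative)
      fix r t :: real
      have "((\<lambda>r. (r, t)) has_derivative (\<lambda>w. (w, 0))) (at r)" by (auto intro!: derivative_eq_intros)
      from has_derivative_compose[OF this smooth_has_derivative[OF smF]]
      have "((\<lambda>r. F (r, t)) has_derivative (\<lambda>w. frechet_derivative F (at (r, t)) (w, 0))) (at r)" .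
      moreover have "(\<lambda>w. frechet_derivative F (at (r, t)) (w, 0)) = (\<lambda>w. w *\<^sub>R fx r t)"
      proof
        fix w :: real
        have "(w, 0 :: real) = w *\<^sub>R (1, 0)" by simp
        then show "frechet_derivative F (at (r, t)) (w, 0) = w *\<^sub>R fx r t"
          unfolding fx_def by (simp only: linear_scale[OF smooth_linear_fd[OF smF]])
      qed
      ultimately show "((\<lambda>r. F (r, t)) has_vector_derivative fx r t) (at r within UNIV)"
        by (simp add: has_vector_derivative_def)
    next
      fix r :: real
      have "smooth (\<lambda>t::real. F (r, t))" by (intro smooth_compose[OF smF] smooth_Pair) auto
      then show "(\<lambda>t. F (r, t)) integrable_on cbox 0 1"
        by (intro integrable_continuous smooth_continuous)
    next
      have "continuous_on (UNIV \<times> cbox 0 1) (\<lambda>z. frechet_derivative F (at z) (1, 0))"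
        by (rule smooth_continuous[OF smooth_fd[OF smF]])
      then show "continuous_on (UNIV \<times> cbox 0 1) (\<lambda>(r, t). fx r t)"
        by (simp add: fx_def case_prod_unfold)
    qed auto
    moreover have "integral (cbox 0 1) (\<lambda>t. F (\<tau>, t)) = c (x + \<tau> *\<^sub>R h)" for \<tau>
      by (simp add: c_def F_def Y_def)
    \<comment> \<open>By closedness \<open>fx \<tau> t\<close> is the derivative in \<open>t\<close>
      of \<open>t *\<^sub>R \<omega> (t *\<^sub>R ?y) h\<close>.\<close>
    moreover have "integral (cbox 0 1) (fx \<tau>) = \<omega> (x + \<tau> *\<^sub>R h) h"
    proof -
      let ?y = "x + \<tau> *\<^sub>R h"
      have "(fx \<tau> has_integral (1 *\<^sub>R \<omega> (1 *\<^sub>R ?y) h - 0 *\<^sub>R \<omega> (0 *\<^sub>R ?y) h)) {0..1}"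
      proof (rule fundamental_theorem_of_calculus)
        fix t :: real
        have "((\<lambda>t. t *\<^sub>R ?y) has_derivative (\<lambda>w. w *\<^sub>R ?y)) (at t)" by (auto intro!: derivative_eq_intros)
        from has_derivative_compose[OF this smooth_has_derivative[OF sm]]
        have "((\<lambda>t. \<omega> (t *\<^sub>R ?y) h) has_derivative (\<lambda>w. w *\<^sub>R frechet_derivative (\<lambda>x. \<omega> x h) (at (t *\<^sub>R ?y)) ?y)) (at t)"
          by (simp add: linear_scale[OF smooth_linear_fd[OF sm]])
        from has_derivative_scaleR[OF has_derivative_ident this]
        have "((\<lambda>t. t *\<^sub>R \<omega> (t *\<^sub>R ?y) h) has_derivative
           (\<lambda>w. w *\<^sub>R (t *\<^sub>R frechet_derivative (\<lambda>x. \<omega> x h) (at (t *\<^sub>R ?y)) ?y + \<omega> (t *\<^sub>R ?y) h))) (at t)"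
          by (simp add: algebra_simps)
        then have "((\<lambda>t. t *\<^sub>R \<omega> (t *\<^sub>R ?y) h) has_vector_derivative fx \<tau> t) (at t)"
          by (simp add: has_vector_derivative_def fx_def dF[OF refl] sym[of h _ ?y])
        then show "((\<lambda>t. t *\<^sub>R \<omega> (t *\<^sub>R ?y) h) has_vector_derivative fx \<tau> t) (at t within {0..1})"
          by (rule has_vector_derivative_at_within)
      qed simp
      then show ?thesis by (simp add: integral_unique)
    qed
    ultimately show ?thesis by simp
  qed
  have "(c has_derivative \<omega> x) (at x)" for x
  \<comment> \<open>\<open>H\<close> bounds the difference quotient of the remainder by the
    oscillation of \<omega> on the segment from \<open>x\<close> to \<open>y\<close>, basis vector
    by basis vector.\<close>
  proof (rule has_derivativeI_sandwich[where e=1 and H="\<lambda>y. \<Sum>b\<in>Basis. SUP z\<in>closed_segment x y. norm (\<omega> z b - \<omega> x b)"])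
    show "bounded_linear (\<omega> x)" using lin linear_conv_bounded_linear by blast
    have bdd: "bdd_above ((\<lambda>z. norm (\<omega> z b - \<omega> x b)) ` closed_segment x y)" for y b
      by (intro compact_imp_bounded[THEN bounded_imp_bdd_above] compact_continuous_image compact_segment
          continuous_intros smooth_continuous[OF sm])
    have sup0: "(SUP z\<in>closed_segment x y. norm (\<omega> z b - \<omega> x b)) \<ge> 0" for y b
      by (rule cSUP_upper2[OF bdd, of x]) auto
    show "((\<lambda>y. \<Sum>b\<in>Basis. SUP z\<in>closed_segment x y. norm (\<omega> z b - \<omega> x b)) \<longlongrightarrow> 0) (at x)"
    proof (rule tendsto_null_sum)
      fix b :: 'a
      show "((\<lambda>y. SUP z\<in>closed_segment x y. norm (\<omega> z b - \<omega> x b)) \<longlongrightarrow> 0) (at x)"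
      proof (rule tendstoI)
        fix \<epsilon> :: real assume \<epsilon>: "\<epsilon> > 0"
        have "isCont (\<lambda>z. \<omega> z b) x" using smooth_continuous[OF sm, of UNIV] by (simp add: continuous_on_eq_continuous_at)
        then obtain d where d: "d > 0" "\<And>z. dist z x < d \<Longrightarrow> dist (\<omega> z b) (\<omega> x b) < \<epsilon> / 2"
          unfolding continuous_at_eps_delta using \<epsilon> by (metis half_gt_zero)
        have "dist (SUP z\<in>closed_segment x y. norm (\<omega> z b - \<omega> x b)) 0 < \<epsilon>" if "dist y x < d" for y
        proof -
          have "(SUP z\<in>closed_segment x y. norm (\<omega> z b - \<omega> x b)) \<le> \<epsilon> / 2"
          proof (rule cSUP_least)
            fix z assume "z \<in> closed_segment x y"
            then have "dist z x \<le> dist y x"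
              by (metis dist_commute dist_in_closed_segment(1))
            then show "norm (\<omega> z b - \<omega> x b) \<le> \<epsilon> / 2" using d(2)[of z] that by (simp add: dist_norm)
          qed auto
          then show ?thesis using sup0[of b y] \<epsilon> by (simp add: dist_norm)
        qed
        then show "\<forall>\<^sub>F y in at x. dist (SUP z\<in>closed_segment x y. norm (\<omega> z b - \<omega> x b)) 0 < \<epsilon>"
          unfolding eventually_at using d(1) by blast
      qed
    qed
    fix y assume y: "y \<noteq> x"
    let ?h = "y - x"
    let ?H = "\<Sum>b\<in>Basis. SUP z\<in>closed_segment x y. norm (\<omega> z b - \<omega> x b)"
    have "((\<lambda>\<tau>. \<omega> (x + \<tau> *\<^sub>R ?h) ?h) has_integral (c (x + 1 *\<^sub>R ?h) - c (x + 0 *\<^sub>R ?h))) {0..1}"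
      by (rule fundamental_theorem_of_calculus) (auto intro: has_vector_derivative_at_within dir)
    from has_integral_diff[OF this has_integral_const_real[of "\<omega> x ?h" 0 1]]
    have I: "((\<lambda>\<tau>. \<omega> (x + \<tau> *\<^sub>R ?h) ?h - \<omega> x ?h) has_integral (c y - c x - \<omega> x ?h)) (cbox 0 1)" by simp
    have "norm (c y - c x - \<omega> x ?h) \<le> (?H * norm ?h) * measure lborel (cbox 0 (1::real))"
    proof (rule has_integral_bound[OF _ I])
      show "0 \<le> ?H * norm ?h" by (intro mult_nonneg_nonneg sum_nonneg sup0) auto
      fix \<tau> :: real assume t: "\<tau> \<in> cbox 0 1"
      then have seg: "x + \<tau> *\<^sub>R ?h \<in> closed_segment x y"
        by (auto simp: in_segment algebra_simps intro!: exI[of _ \<tau>])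
      have "norm (\<omega> (x + \<tau> *\<^sub>R ?h) ?h - \<omega> x ?h) = norm (\<Sum>b\<in>Basis. inner ?h b *\<^sub>R (\<omega> (x + \<tau> *\<^sub>R ?h) b - \<omega> x b))"
        using linear_euclidean_expand[OF lin[of "x + \<tau> *\<^sub>R ?h"], of ?h] linear_euclidean_expand[OF lin[of x], of ?h]
        by (simp add: sum_subtractf scaleR_diff_right)
      also have "\<dots> \<le> (\<Sum>b\<in>Basis. norm ?h * (SUP z\<in>closed_segment x y. norm (\<omega> z b - \<omega> x b)))"
        by (intro sum_norm_le) (auto intro!: mult_mono Basis_le_norm cSUP_upper[OF seg bdd])
      finally show "norm (\<omega> (x + \<tau> *\<^sub>R ?h) ?h - \<omega> x ?h) \<le> ?H * norm ?h"
        by (simp add: sum_distrib_left[symmetric] mult.commute)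
    qed
    then have "norm (c y - c x - \<omega> x ?h) \<le> ?H * norm ?h" by simp
    then show "norm (c y - c x - \<omega> x (y - x)) / norm (y - x) \<le> ?H"
      using y by (simp add: divide_le_eq)
  qed auto
  then show ?thesis by blast
qed

text \<open>The map sending \<open>(p, v)\<close> to \<open>(p, J p v)\<close> is a smooth
  bijection, so its inverse is continuous by invariance of domain, which is what the rule for
  differentiating an inverse asks for. The resulting derivative of \<open>K p u\<close> contains
  only \<open>K\<close> and derivatives of \<open>J\<close>, so regularity climbs by
  induction.\<close>

lemma smooth_linear_inverse:
  fixes J K :: "'a::euclidean_space \<Rightarrow> 'a \<Rightarrow> 'a"
  assumes linJ: "\<And>p. linear (J p)" and smJ: "\<And>v. smooth (\<lambda>p. J p v)"
    and linK: "\<And>p. linear (K p)" and KJ: "\<And>p v. K p (J p v) = v" and JK: "\<And>p v. J p (K p v) = v"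
  shows "smooth (\<lambda>p. K p u)"
proof -
  define f where "f z = (fst z, J (fst z) (snd z))" for z :: "'a \<times> 'a"
  define g where "g z = (fst z, K (fst z) (snd z))" for z :: "'a \<times> 'a"
  have sf: "smooth (fst :: 'a \<times> 'a \<Rightarrow> 'a)" "smooth (snd :: 'a \<times> 'a \<Rightarrow> 'a)"
    by (intro smooth_linear bounded_linear.linear bounded_linear_fst bounded_linear_snd)+
  note field = fd_linear_field[of "\<lambda>z. J (fst z)" snd, OF linJ smooth_compose[OF smJ sf(1)] sf(2)]
  have smf: "smooth f" unfolding f_def[abs_def] by (intro smooth_Pair sf field(2))
  have fg: "f (g z) = z" and gf: "g (f z) = z" for z by (auto simp: f_def g_def JK KJ)
  have contg: "continuous_on UNIV g"
  proof -
    have inj: "inj_on f UNIV" using gf by (metis inj_on_inverseI)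
    have surj: "f ` UNIV = UNIV" using fg by (metis surjI)
    obtain h where "homeomorphism UNIV (f ` UNIV) f h"
      using invariance_of_domain_homeomorphism[OF open_UNIV smooth_continuous[OF smf] _ inj] by auto
    then have "continuous_on UNIV h" "\<And>x. h (f x) = x" using surj by (auto simp: homeomorphism_def)
    moreover have "h = g" using \<open>\<And>x. h (f x) = x\<close> fg by (metis ext)
    ultimately show ?thesis by simp
  qed
  \<comment> \<open>The copy \<open>p0\<close> of \<open>p\<close> keeps \<open>K p0 u\<close> fixed
    while \<open>J\<close> is differentiated.\<close>
  have der: "((\<lambda>p. K p u) has_derivative (\<lambda>h. - K p (frechet_derivative (\<lambda>p. J p (K p0 u)) (at p) h))) (at p)"
    if "p0 = p" for p p0 u
  proof -
    let ?w = "K p u"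
    let ?a = "\<lambda>h. frechet_derivative (\<lambda>p. J p ?w) (at p) h"
    have fst_snd: "frechet_derivative (fst :: 'a \<times> 'a \<Rightarrow> 'a) (at z) = fst" "frechet_derivative (snd :: 'a \<times> 'a \<Rightarrow> 'a) (at z) = snd" for z
      using fd_eqI[OF bounded_linear_imp_has_derivative[OF bounded_linear_fst]] fd_eqI[OF bounded_linear_imp_has_derivative[OF bounded_linear_snd]] by blast+
    have df: "(f has_derivative (\<lambda>w. (fst w, ?a (fst w) + J p (snd w)))) (at (g (p, u)))"
    proof -
      have "((\<lambda>z. J (fst z) (snd z)) has_derivative (\<lambda>w. ?a (fst w) + J p (snd w))) (at (g (p, u)))"
      proof -
        have "frechet_derivative (\<lambda>z. J (fst z) (snd z)) (at (g (p, u))) = (\<lambda>w. ?a (fst w) + J p (snd w))"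
          unfolding field(1)[abs_def] using fd_compose[OF smJ sf(1)]
          by (auto simp: fun_eq_iff fst_snd g_def)
        then show ?thesis using smooth_has_derivative[OF field(2)] by metis
      qed
      then show ?thesis unfolding f_def[abs_def]
        by (intro has_derivative_Pair has_derivative_fst has_derivative_ident)
    qed
    have blK: "bounded_linear (K p)" and bla: "bounded_linear ?a"
      using linK smooth_linear_fd[OF smJ] by (auto simp: linear_conv_bounded_linear)
    have "(g has_derivative (\<lambda>w. (fst w, K p (snd w - ?a (fst w))))) (at (p, u))"
    proof (rule has_derivative_inverse_basic[of f _ g "(p, u)", OF df])
      show "bounded_linear (\<lambda>w. (fst w, K p (snd w - ?a (fst w))))"
        by (intro bounded_linear_Pair bounded_linear_fst bounded_linear_compose[OF blK] bounded_linear_sub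
            bounded_linear_snd bounded_linear_compose[OF bla])
      show "(\<lambda>w. (fst w, K p (snd w - ?a (fst w)))) \<circ> (\<lambda>w. (fst w, ?a (fst w) + J p (snd w))) = id"
        by (auto simp: KJ)
      show "continuous (at (p, u)) g" using contg by (simp add: continuous_on_eq_continuous_at)
      show "open (UNIV :: ('a \<times> 'a) set)" "(p, u) \<in> UNIV" by auto
    qed (use fg in auto)
    moreover have "((\<lambda>p. (p, u)) has_derivative (\<lambda>h. (h, 0))) (at p)" by (auto intro!: derivative_eq_intros)
    ultimately have "((\<lambda>p. snd (g (p, u))) has_derivative (\<lambda>h. K p (0 - ?a h))) (at p)"
      using has_derivative_snd[OF has_derivative_compose[of "\<lambda>p. (p, u)"]] by fastforce
    then show ?thesis using that by (simp add: g_def linear_neg[OF linK])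
  qed
  have "Cn n (\<lambda>p. K p u)" for n u
  proof (induction n arbitrary: u)
    case 0
    have "continuous_on UNIV (\<lambda>p. snd (g (p, u)))"
      by (intro continuous_on_snd continuous_on_compose2[OF contg] continuous_intros) auto
    then show ?case by (simp add: g_def)
  next
    case (Suc n)
    show ?case
    proof (rule Cn_SucI[OF der[OF refl]])
      fix h
      have e1: "frechet_derivative (\<lambda>q. J q (K p u)) (at p) h = (\<Sum>b\<in>Basis. inner (K p u) b *\<^sub>R frechet_derivative (\<lambda>q. J q b) (at p) h)" for p
      proof -
        have "((\<lambda>q. \<Sum>b\<in>Basis. inner (K p u) b *\<^sub>R J q b) has_derivative
           (\<lambda>h. \<Sum>b\<in>Basis. inner (K p u) b *\<^sub>R frechet_derivative (\<lambda>q. J q b) (at p) h)) (at p)"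
          by (intro has_derivative_sum bounded_linear.has_derivative[OF bounded_linear_scaleR_right] smooth_has_derivative smJ)
        moreover have "(\<lambda>q. \<Sum>b\<in>Basis. inner (K p u) b *\<^sub>R J q b) = (\<lambda>q. J q (K p u))"
          using linear_euclidean_expand[OF linJ] by metis
        ultimately show ?thesis by (simp add: fd_eqI)
      qed
      have "Cn n (\<lambda>p. - (\<Sum>b\<in>Basis. inner (K p u) b *\<^sub>R (\<Sum>b'\<in>Basis. inner (frechet_derivative (\<lambda>q. J q b) (at p) h) b' *\<^sub>R K p b')))"
        by (intro Cn_bounded_linear[OF bounded_linear_minus[OF bounded_linear_ident]] Cn_sum
           Cn_bilinear[OF bounded_bilinear_scaleR] Cn_bounded_linear[OF bounded_linear_inner_left] Suc.IH
           smooth_Cn[OF smooth_fd[OF smJ]])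
      also have "(\<lambda>p. - (\<Sum>b\<in>Basis. inner (K p u) b *\<^sub>R (\<Sum>b'\<in>Basis. inner (frechet_derivative (\<lambda>q. J q b) (at p) h) b' *\<^sub>R K p b')))
        = (\<lambda>p. - K p (frechet_derivative (\<lambda>q. J q (K p u)) (at p) h))"
        unfolding e1 linear_euclidean_expand[OF linK, symmetric] by (simp add: linear_sum[OF linK] linear_scale[OF linK])
      finally show "Cn n (\<lambda>p. - K p (frechet_derivative (\<lambda>q. J q (K p u)) (at p) h))" .
    qed
  qed
  then show ?thesis by (simp add: smooth_def)
qed

section \<open>The Lie algebra of left-invariant fields of the group and the chart\<close>

locale carnot_group =
  fixes mul :: "'a::euclidean_space \<Rightarrow> 'a \<Rightarrow> 'a" and e :: 'a and s kk Xb
  assumes carnot: "carnot mul e s kk Xb"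
begin

abbreviation "J \<equiv> Jm mul e"

lemma assoc: "mul (mul x y) z = mul x (mul y z)" and e_left [simp]: "mul e x = x" and e_right [simp]: "mul x e = x"
  and right_inv: "\<exists>y. mul x y = e" and smooth_mul2: "smooth (\<lambda>z. mul (fst z) (snd z))"
  using carnot unfolding carnot_def by blast+

lemma left_inv: "\<exists>y. mul y x = e"
  using right_inv assoc e_left e_right by metis

lemma smooth_mul: "smooth f \<Longrightarrow> smooth g \<Longrightarrow> smooth (\<lambda>x. mul (f x) (g x))"
  using smooth_compose[OF smooth_mul2 smooth_Pair, of f g] by simp

lemma smooth_left: "smooth (mul p)"
  using smooth_mul[OF smooth_const smooth_id] .

lemma linear_J: "linear (J p)"
  unfolding Jm_def by (rule smooth_linear_fd[OF smooth_left])

lemma smooth_J: "smooth (\<lambda>p. J p v)"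
proof -
  have "J p v = frechet_derivative (\<lambda>z. mul (fst z) (snd z)) (at (p, e)) (0, v)" for p
  proof -
    have "((\<lambda>y. (p, y)) has_derivative (\<lambda>h. (0, h))) (at e)" by (auto intro!: derivative_eq_intros)
    from has_derivative_compose[OF this smooth_has_derivative[OF smooth_mul2]]
    have "((\<lambda>y. mul p y) has_derivative (\<lambda>h. frechet_derivative (\<lambda>z. mul (fst z) (snd z)) (at (p, e)) (0, h))) (at e)"
      by simp
    from fd_eqI[OF this] show ?thesis by (simp add: Jm_def)
  qed
  moreover have "smooth (\<lambda>p. frechet_derivative (\<lambda>z. mul (fst z) (snd z)) (at (p, e)) (0, v))"
    using smooth_compose[OF smooth_fd[OF smooth_mul2] smooth_Pair[OF smooth_id smooth_const]] by simp
  ultimately show ?thesis by simp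
qed

lemma J_mul: "J (mul p q) w = frechet_derivative (mul p) (at q) (J q w)"
  using fd_compose[OF smooth_left smooth_left, of p q e w] by (simp add: Jm_def assoc[abs_def])

lemma J_e [simp]: "J e w = w"
proof -
  have "mul e = (\<lambda>x. x)" by auto
  then show ?thesis by (simp add: Jm_def)
qed

text \<open>Left invariance carries the derivatives at \<open>p\<close> back to \<open>e\<close>
  through \<open>mul p\<close>. The second derivative of \<open>mul p\<close> occurs in both terms,
  is symmetric, and cancels.\<close>

lemma frame_bracket:
  "frechet_derivative (\<lambda>p. J p w) (at p) (J p v) - frechet_derivative (\<lambda>p. J p v) (at p) (J p w)
    = J p (lie_br mul e v w)"
proof -
  have *: "frechet_derivative (\<lambda>p. J p w) (at p) (J p v)
    = frechet_derivative (\<lambda>y. frechet_derivative (mul p) (at y) w) (at e) v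
      + J p (frechet_derivative (\<lambda>q. J q w) (at e) v)" for v w
  proof -
    have "frechet_derivative (\<lambda>p. J p w) (at p) (J p v) = frechet_derivative (\<lambda>q. J (mul p q) w) (at e) v"
      using fd_compose[OF smooth_J[of w] smooth_left[of p], of e v] by (simp add: Jm_def[of mul e p])
    also have "\<dots> = frechet_derivative (\<lambda>q. frechet_derivative (mul p) (at q) (J q w)) (at e) v"
      by (simp add: J_mul)
    also have "\<dots> = frechet_derivative (\<lambda>y. frechet_derivative (mul p) (at y) w) (at e) v
      + J p (frechet_derivative (\<lambda>q. J q w) (at e) v)"
      using fd_field_derivative[OF smooth_left smooth_id smooth_J, of p w e v] by (simp add: Jm_def[of mul e p])
    finally show ?thesis .
  qed
  show ?thesis
    unfolding *[of w v] *[of v w] lie_br_def linear_diff[OF linear_J]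
    using second_derivative_symmetric[OF smooth_left, of p w e v] by simp
qed

lemma fd_J_lin: 
  "frechet_derivative (\<lambda>p. J p (w + w')) (at x) v = frechet_derivative (\<lambda>p. J p w) (at x) v + frechet_derivative (\<lambda>p. J p w') (at x) v"
  "frechet_derivative (\<lambda>p. J p (r *\<^sub>R w)) (at x) v = r *\<^sub>R frechet_derivative (\<lambda>p. J p w) (at x) v"
  unfolding linear_add[OF linear_J] linear_scale[OF linear_J]
  by (rule fd_eqI[OF has_derivative_add[OF smooth_has_derivative smooth_has_derivative]], rule smooth_J, rule smooth_J)
     (rule fd_eqI[OF has_derivative_scaleR_right[OF smooth_has_derivative]], rule smooth_J)

text \<open>Brackets act as commutators of the first-order operators \<open>X v\<close>, for which
  the identity is formal; the identity map evaluated at \<open>e\<close> recovers a vector from its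
  operator.\<close>

lemma lie_jacobi:
  "lie_br mul e x (lie_br mul e y z) = lie_br mul e (lie_br mul e x y) z + lie_br mul e y (lie_br mul e x z)"
proof -
  define X where "X v f = (\<lambda>x. frechet_derivative f (at x) (J x v))" for v and f :: "'a \<Rightarrow> 'a"
  have smX: "smooth (X v f)" if "smooth f" for v f
    unfolding X_def by (rule smooth_fd_field[OF that smooth_id smooth_J])
  have comm: "X (lie_br mul e v w) f = (\<lambda>x. X v (X w f) x - X w (X v f) x)" if "smooth f" for v w f
    using field_commutator[OF that smooth_J smooth_J, of w _ v] by (simp add: X_def frame_bracket fun_eq_iff)
  have diff: "X v (\<lambda>x. f x - g x) = (\<lambda>x. X v f x - X v g x)" if "smooth f" "smooth g" for v f g
    using fd_eqI[OF has_derivative_diff[OF smooth_has_derivative[OF that(1)] smooth_has_derivative[OF that(2)]]]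
    by (simp add: X_def fun_eq_iff)
  have X_e: "X v (\<lambda>x. x) e = v" for v by (simp add: X_def)
  note s = smX smooth_id smooth_diff
  have "X (lie_br mul e x (lie_br mul e y z)) (\<lambda>x. x) e 
    = X (lie_br mul e (lie_br mul e x y) z) (\<lambda>x. x) e + X (lie_br mul e y (lie_br mul e x z)) (\<lambda>x. x) e"
    by (simp add: comm diff s)
  then show ?thesis by (simp add: X_e)
qed

sublocale graded_lie "lie_br mul e" s kk Xb
proof (rule graded_lie.intro)
  show "linear (\<lambda>x. lie_br mul e x y)" for y
    unfolding lie_br_def
    by (rule linearI) (simp_all add: fd_J_lin linear_add[OF smooth_linear_fd[OF smooth_J]] linear_scale[OF smooth_linear_fd[OF smooth_J]] algebra_simps)
  show "linear (lie_br mul e x)" for x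
    unfolding lie_br_def
    by (rule linearI) (simp_all add: fd_J_lin linear_add[OF smooth_linear_fd[OF smooth_J]] linear_scale[OF smooth_linear_fd[OF smooth_J]] algebra_simps)
  show "lie_br mul e x y = - lie_br mul e y x" for x y by (simp add: lie_br_def)
  show "lie_br mul e x (lie_br mul e y z) = lie_br mul e (lie_br mul e x y) z + lie_br mul e y (lie_br mul e x z)" for x y z
    by (rule lie_jacobi)
qed (use carnot in \<open>unfold carnot_def, blast+\<close>)

text \<open>\<open>K p\<close> is the differential of left translation by an inverse of
  \<open>p\<close>; in finite dimension a one-sided inverse is two-sided.\<close>

lemma J_inverse: "\<exists>K. (\<forall>p. linear (K p)) \<and> (\<forall>p v. K p (J p v) = v) \<and> (\<forall>p v. J p (K p v) = v)"
proof -
  obtain q where q: "\<And>p. mul (q p) p = e" using left_inv by metis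
  define K where "K p v = frechet_derivative (mul (q p)) (at p) v" for p v
  have linK: "linear (K p)" for p unfolding K_def by (rule smooth_linear_fd[OF smooth_left])
  have KJ: "K p (J p v) = v" for p v using J_mul[of "q p" p v] by (simp add: K_def q)
  have "J p (K p v) = v" for p v
    using linear_inverse_left[OF linear_J[of p] linK[of p]] KJ by (auto simp: fun_eq_iff)
  with linK KJ show ?thesis by blast
qed

text \<open>Layer \<open>q\<close> of \<open>M x y\<close> involves only the layers of
  \<open>x\<close> strictly below \<open>q\<close>. This triangularity lets the chart be found one
  layer at a time.\<close>

lemma pi_M_cong: "(\<And>i. i \<le> r \<Longrightarrow> \<pi> i x = \<pi> i x') \<Longrightarrow> q \<le> Suc r \<Longrightarrow> \<pi> q (M x y) = \<pi> q (M x' y)"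
  unfolding pi_M by (intro sum.cong refl Mj_cong) auto

lemma bl_pi: "bounded_linear (\<pi> r)"
  using linear_pi linear_conv_bounded_linear by blast

lemma fd_Yv_low:
  assumes "\<And>q. q \<le> r \<Longrightarrow> \<pi> q u = 0"
  shows "\<pi> (Suc r) (frechet_derivative (Yv v) (at x) u) = 0"
proof -
  have "\<pi> i (x + \<tau> *\<^sub>R u) = \<pi> i x" if "i \<le> r" for i and \<tau> :: real using assms[OF that] by simp
  note * = pi_M_cong[OF this]
  have const: "(\<lambda>\<tau>::real. \<pi> (Suc r) (Yv v (x + \<tau> *\<^sub>R u))) = (\<lambda>\<tau>. \<pi> (Suc r) (Yv v x))"
    unfolding Yv_def by (intro ext, rule *) auto
  have "((\<lambda>\<tau>. x + \<tau> *\<^sub>R u) has_derivative (\<lambda>h. h *\<^sub>R u)) (at 0)" by (auto intro!: derivative_eq_intros)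
  from bounded_linear.has_derivative[OF bl_pi has_derivative_compose[OF this smooth_has_derivative[OF smooth_Yv]]]
  have "((\<lambda>\<tau>. \<pi> (Suc r) (Yv v (x + \<tau> *\<^sub>R u))) has_derivative 
      (\<lambda>h. \<pi> (Suc r) (frechet_derivative (Yv v) (at (x + 0 *\<^sub>R u)) (h *\<^sub>R u)))) (at 0)" .
  from fd_eqI[OF this, of 1] show ?thesis unfolding const by simp
qed

text \<open>Layer \<open>r + 1\<close> of the required differential depends on \<open>c\<close> only
  through its layers up to \<open>r\<close>, so it is a known one-form. It is closed because the
  frames \<open>J\<close> and \<open>Yv\<close> have the same brackets, and its primitive supplies
  the next layer.\<close>

lemma partial_chart:
  "\<exists>c. smooth c \<and> (\<forall>q>r. \<forall>p. \<pi> q (c p) = 0) \<and>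
     (\<forall>q\<le>r. \<forall>p v. \<pi> q (frechet_derivative c (at p) (J p v)) = \<pi> q (Yv v (c p)))"
proof (induction r)
  case 0
  then show ?case by (intro exI[of _ "\<lambda>_. 0"]) (simp add: pi_outside)
next
  case (Suc r)
  then obtain c where c: "smooth c" "\<And>q p. q > r \<Longrightarrow> \<pi> q (c p) = 0"
    "\<And>q p v. q \<le> r \<Longrightarrow> \<pi> q (frechet_derivative c (at p) (J p v)) = \<pi> q (Yv v (c p))" by blast
  obtain K where linK: "\<And>p. linear (K p)" and KJ: "\<And>p v. K p (J p v) = v" and JK: "\<And>p v. J p (K p v) = v"
    using J_inverse by blast
  have smK: "smooth (\<lambda>p. K p u)" for u by (rule smooth_linear_inverse[OF linear_J smooth_J linK KJ JK])
  \<comment> \<open>The one-form with the prescribed values on the frame; \<open>K\<close> turns a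
    tangent vector into its frame coordinates.\<close>
  define \<omega> where "\<omega> p u = \<pi> (Suc r) (Yv (K p u) (c p))" for p u
  have linw: "linear (\<omega> p)" for p
    unfolding \<omega>_def Yv_def by (rule linearI) (simp_all add: linear_add[OF linK] linear_scale[OF linK])
  have smw: "smooth (\<lambda>p. \<omega> p u)" for u
    unfolding \<omega>_def Yv_def 
    by (intro smooth_bounded_linear[OF bl_pi] smooth_M c(1) smooth_compose[OF smooth_linear[OF linear_Dg]] smK)
  have wJ: "\<omega> p (J p v) = \<pi> (Suc r) (Yv v (c p))" for p v by (simp add: \<omega>_def KJ)
  have sym: "frechet_derivative (\<lambda>p. \<omega> p u) (at p) w = frechet_derivative (\<lambda>p. \<omega> p w) (at p) u" for p u w
  proof -
    define v v' where "v = K p u" and "v' = K p w"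
    have u: "u = J p v" and w: "w = J p v'" by (simp_all add: v_def v'_def JK)
    have 1: "frechet_derivative (\<lambda>p. \<omega> p (J p v)) (at p) (J p v') = 
      frechet_derivative (\<lambda>y. \<omega> y (J p v)) (at p) (J p v') + \<omega> p (frechet_derivative (\<lambda>p. J p v) (at p) (J p v'))" for v v'
      by (rule fd_linear_field(1)[OF linw smw smooth_J])
    have 2: "frechet_derivative (\<lambda>p. \<omega> p (J p v)) (at p) (J p v') = \<pi> (Suc r) (frechet_derivative (Yv v) (at (c p)) (Yv v' (c p)))" for v v'
    proof -
      have "frechet_derivative (\<lambda>p. \<omega> p (J p v)) (at p) (J p v') = \<pi> (Suc r) (frechet_derivative (Yv v) (at (c p)) (frechet_derivative c (at p) (J p v')))"
        unfolding wJ using fd_bounded_linear[OF bl_pi smooth_compose[OF smooth_Yv c(1)], of "Suc r" v p "J p v'"]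
        by (simp add: fd_compose[OF smooth_Yv c(1)])
      \<comment> \<open>\<open>c\<close> satisfies its equation only up to layer \<open>r\<close>;
        the error lives in higher layers and does not reach layer \<open>r + 1\<close> of
        \<open>Yv v\<close>.\<close>
      moreover have "\<pi> (Suc r) (frechet_derivative (Yv v) (at (c p)) (frechet_derivative c (at p) (J p v') - Yv v' (c p))) = 0"
        by (rule fd_Yv_low) (simp add: c(3))
      ultimately show ?thesis by (simp add: linear_diff[OF smooth_linear_fd[OF smooth_Yv]])
    qed
    have "\<omega> p (frechet_derivative (\<lambda>p. J p v) (at p) (J p v')) - \<omega> p (frechet_derivative (\<lambda>p. J p v') (at p) (J p v))
      = \<pi> (Suc r) (Yv (lie_br mul e v' v) (c p))"
      unfolding linear_diff[OF linw, symmetric] frame_bracket wJ ..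
    also have "\<dots> = \<pi> (Suc r) (frechet_derivative (Yv v) (at (c p)) (Yv v' (c p))) - \<pi> (Suc r) (frechet_derivative (Yv v') (at (c p)) (Yv v (c p)))"
      unfolding Yv_bracket[symmetric] by simp
    finally show ?thesis unfolding u w using 1[of v v'] 1[of v' v] 2[of v v'] 2[of v' v] by simp
  qed
  obtain h where h: "\<And>x. (h has_derivative \<omega> x) (at x)" using poincare_lemma[OF linw smw sym] by blast
  define c' where "c' p = c p + \<pi> (Suc r) (h p)" for p
  have pw: "\<pi> q (\<omega> p u) = (if q = Suc r then \<omega> p u else 0)" for q p u by (simp add: \<omega>_def)
  have smh: "smooth h" unfolding smooth_def
  proof
    show "Cn n h" for n by (rule Cn_SucD, rule Cn_SucI[OF h smooth_Cn[OF smw]])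
  qed
  have smc': "smooth c'" unfolding c'_def[abs_def] by (intro smooth_add c(1) smooth_bounded_linear[OF bl_pi] smh)
  have fdc': "frechet_derivative c' (at p) u = frechet_derivative c (at p) u + \<omega> p u" for p u
  proof -
    have "(c' has_derivative (\<lambda>u. frechet_derivative c (at p) u + \<pi> (Suc r) (\<omega> p u))) (at p)"
      unfolding c'_def[abs_def] by (intro has_derivative_add smooth_has_derivative c(1) bounded_linear.has_derivative[OF bl_pi h])
    from fd_eqI[OF this, of u] show ?thesis by (simp add: pw)
  qed
  have low: "\<pi> i (c' p) = \<pi> i (c p)" if "i \<le> r" for i p using that by (simp add: c'_def)
  have Y': "\<pi> q (Yv v (c' p)) = \<pi> q (Yv v (c p))" if "q \<le> Suc r" for q v p
    unfolding Yv_def by (rule pi_M_cong[OF low that])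
  show ?case
  proof (intro exI[of _ c'] conjI allI impI smc')
    show "\<pi> q (c' p) = 0" if "q > Suc r" for q p using that c(2) by (simp add: c'_def)
    fix q p v assume q: "q \<le> Suc r"
    show "\<pi> q (frechet_derivative c' (at p) (J p v)) = \<pi> q (Yv v (c' p))"
    proof (cases "q = Suc r")
      case True
      have "\<pi> (Suc r) (frechet_derivative c (at p) (J p v)) = frechet_derivative (\<lambda>p. \<pi> (Suc r) (c p)) (at p) (J p v)"
        by (rule fd_bounded_linear[OF bl_pi c(1), symmetric])
      also have "\<dots> = 0" by (simp add: c(2))
      finally show ?thesis unfolding fdc' Y'[OF q] using True by (simp add: wJ)
    next
      case False
      then show ?thesis unfolding fdc' Y'[OF q] using q c(3) by (simp add: pw)
    qed
  qed
qed

lemma chart: "\<exists>c. smooth c \<and> (\<forall>p v. frechet_derivative c (at p) (J p v) = Yv v (c p))"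
proof -
  obtain c where c: "smooth c" "\<And>q p v. q \<le> s \<Longrightarrow> \<pi> q (frechet_derivative c (at p) (J p v)) = \<pi> q (Yv v (c p))"
    using partial_chart[of s] by blast
  have "frechet_derivative c (at p) (J p v) = Yv v (c p)" for p v
    by (rule pi_eqI) (auto intro: c(2))
  with c(1) show ?thesis by blast
qed

end

section \<open>Words in vector fields and jet bounds\<close>

fun fw :: "('i \<Rightarrow> 'a::euclidean_space \<Rightarrow> 'a) \<Rightarrow> 'i list \<Rightarrow> ('a \<Rightarrow> real) \<Rightarrow> 'a \<Rightarrow> real" where
  "fw V [] f = f"
| "fw V (b # w) f = (\<lambda>x. frechet_derivative (fw V w f) (at x) (V b x))"

lemma fw_append: "fw V (u @ w) f = fw V u (fw V w f)"
  by (induction u) auto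

text \<open>Used with \<open>c b = 1\<close> for left translations and with
  \<open>c b = t ^ fst b\<close> for dilations.\<close>

lemma fw_related:
  assumes V': "\<And>b. smooth (V' b)"
    and T: "smooth T" and rel: "\<And>b p. b \<in> A \<Longrightarrow> frechet_derivative T (at p) (V b p) = c b *\<^sub>R V' b (T p)"
    and w: "w \<in> lists A" and f: "smooth f"
  shows "fw V w (\<lambda>x. f (T x)) = (\<lambda>x. prod_list (map c w) * fw V' w f (T x))"
proof -
  have sm: "smooth (fw V' w f)" for w
    by (induction w) (auto intro: f smooth_fd_field[OF _ smooth_id V'])
  show ?thesis using w
  proof (induction w)
    case (Cons b w)
    have *: "((\<lambda>x. prod_list (map c w) * fw V' w f (T x)) has_derivative
        (\<lambda>h. prod_list (map c w) * frechet_derivative (fw V' w f) (at (T x)) (frechet_derivative T (at x) h))) (at x)" for x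
      by (intro has_derivative_mult_right has_derivative_compose[OF smooth_has_derivative[OF T] smooth_has_derivative[OF sm]])
    have IH: "fw V w (\<lambda>x. f (T x)) = (\<lambda>x. prod_list (map c w) * fw V' w f (T x))" and b: "b \<in> A" using Cons by auto
    show ?case unfolding fw.simps IH
      by (rule ext) (simp add: fd_eqI[OF *] rel[OF b] linear_scale[OF smooth_linear_fd[OF sm]])
  qed auto
qed

lemma binomial_convolution_Suc:
  fixes \<alpha> \<beta> :: "nat \<Rightarrow> real"
  shows "(\<Sum>j\<le>n. real (n choose j) * \<alpha> (Suc j) * \<beta> (n - j)) + (\<Sum>j\<le>n. real (n choose j) * \<alpha> j * \<beta> (Suc (n - j)))
    = (\<Sum>j\<le>Suc n. real (Suc n choose j) * \<alpha> j * \<beta> (Suc n - j))"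
proof -
  have "(\<Sum>j\<le>Suc n. real (Suc n choose j) * \<alpha> j * \<beta> (Suc n - j))
     = \<alpha> 0 * \<beta> (Suc n) + (\<Sum>j\<le>n. real (Suc n choose Suc j) * \<alpha> (Suc j) * \<beta> (n - j))"
    by (subst sum.atMost_Suc_shift) simp
  also have "\<dots> = \<alpha> 0 * \<beta> (Suc n) + (\<Sum>j\<le>n. real (n choose Suc j) * \<alpha> (Suc j) * \<beta> (n - j)) 
      + (\<Sum>j\<le>n. real (n choose j) * \<alpha> (Suc j) * \<beta> (n - j))"
    by (simp add: sum.distrib[symmetric] algebra_simps)
  also have "\<alpha> 0 * \<beta> (Suc n) + (\<Sum>j\<le>n. real (n choose Suc j) * \<alpha> (Suc j) * \<beta> (n - j))
      = (\<Sum>j\<le>Suc n. real (n choose j) * \<alpha> j * \<beta> (Suc n - j))"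
    by (subst sum.atMost_Suc_shift) simp
  also have "\<dots> = (\<Sum>j\<le>n. real (n choose j) * \<alpha> j * \<beta> (Suc (n - j)))"
    by (simp add: Suc_diff_le)
  finally show ?thesis by simp
qed

text \<open>The reason for the squared exponent. For \<open>0 < j < n\<close> one has
  \<open>j * (n - j) \<ge> n - 1\<close>, so each mixed term falls short of
  \<open>B ^ n\<^sup>2\<close> by a factor \<open>B ^ (2 * (n - 1))\<close>, and that absorbs the
  binomials, at most \<open>2 ^ n\<close>, and the number \<open>n - 1\<close> of terms, already for
  \<open>B = 2\<close>.\<close>

lemma square_weight_convolution:
  fixes B :: real
  assumes B: "B \<ge> 2"
  shows "(\<Sum>j\<in>{1..<n}. real (n choose j) * B ^ j\<^sup>2 * B ^ (n - j)\<^sup>2) \<le> B ^ n\<^sup>2"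
proof (cases "n \<ge> 2")
  case False
  then have "{1..<n} = {}" by auto
  then show ?thesis using B by simp
next
  case True
  have tm: "real (n choose j) * B ^ j\<^sup>2 * B ^ (n - j)\<^sup>2 \<le> 2 ^ n * B ^ (n\<^sup>2 - 2 * (n - 1))" if j: "j \<in> {1..<n}" for j
  proof -
    obtain i where n: "n = j + i" "i \<ge> 1" using j le_Suc_ex[of j n] by (auto simp: less_imp_le)
    have "n - 1 \<le> j * i"
    proof -
      obtain a b where "j = Suc a" "i = Suc b" using j n by (cases j; cases i) auto
      then show ?thesis using n by simp
    qed
    then have e: "j\<^sup>2 + (n - j)\<^sup>2 \<le> n\<^sup>2 - 2 * (n - 1)" using n by (simp add: power2_eq_square algebra_simps)
    have "real (n choose j) * (B ^ j\<^sup>2 * B ^ (n - j)\<^sup>2) \<le> 2 ^ n * B ^ (n\<^sup>2 - 2 * (n - 1))"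
      unfolding power_add[symmetric]
    proof (rule mult_mono)
      show "real (n choose j) \<le> 2 ^ n" using binomial_le_pow2[of n j] by (metis of_nat_le_iff of_nat_numeral of_nat_power)
      show "B ^ (j\<^sup>2 + (n - j)\<^sup>2) \<le> B ^ (n\<^sup>2 - 2 * (n - 1))" using e B by (intro power_increasing) auto
    qed (use B in auto)
    then show ?thesis by (simp add: mult.assoc)
  qed
  have le: "real (n - 1) * 2 ^ n \<le> B ^ (2 * (n - 1))"
  proof -
    obtain m where m: "n = Suc (Suc m)" using True by (metis Suc_le_D numeral_2_eq_2 Suc_le_mono)
    have "Suc m \<le> 2 ^ m" by (induction m) auto
    then have "real (Suc m) \<le> 2 ^ m" by (metis of_nat_le_iff of_nat_numeral of_nat_power)
    then have "real (n - 1) * 2 ^ n \<le> 2 ^ m * 2 ^ n" unfolding m by (intro mult_right_mono) auto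
    also have "\<dots> = 2 ^ (2 * (n - 1))" unfolding m power_add[symmetric] by (rule arg_cong[of _ _ "\<lambda>k. 2 ^ k"]) simp
    also have "\<dots> \<le> B ^ (2 * (n - 1))" using B by (intro power_mono) auto
    finally show ?thesis .
  qed
  have "(\<Sum>j\<in>{1..<n}. real (n choose j) * B ^ j\<^sup>2 * B ^ (n - j)\<^sup>2) \<le> (\<Sum>j\<in>{1..<n}. 2 ^ n * B ^ (n\<^sup>2 - 2 * (n - 1)))"
    by (intro sum_mono tm)
  also have "\<dots> = (real (n - 1) * 2 ^ n) * B ^ (n\<^sup>2 - 2 * (n - 1))" by simp
  also have "\<dots> \<le> B ^ (2 * (n - 1)) * B ^ (n\<^sup>2 - 2 * (n - 1))" using B by (intro mult_right_mono le) auto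
  also have "\<dots> = B ^ n\<^sup>2"
  proof -
    have "2 * (n - 1) \<le> n\<^sup>2"
    proof -
      obtain m where "n = Suc m" using True by (cases n) auto
      then show ?thesis by (simp add: power2_eq_square)
    qed
    then show ?thesis by (simp add: power_add[symmetric])
  qed
  finally show ?thesis .
qed

section \<open>Bounds with squared exponents for words of derivatives\<close>

locale fields =
  fixes V :: "'i \<Rightarrow> 'a::euclidean_space \<Rightarrow> 'a" and A :: "'i set"
  assumes smooth_V: "smooth (V b)" and finA: "finite A"
begin

lemma smooth_fw: "smooth f \<Longrightarrow> smooth (fw V w f)"
  by (induction w) (auto intro: smooth_fd_field[OF _ smooth_id smooth_V])

lemma fw_add: "smooth f \<Longrightarrow> smooth g \<Longrightarrow> fw V w (\<lambda>x. f x + g x) = (\<lambda>x. fw V w f x + fw V w g x)"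
proof (induction w)
  case (Cons b w)
  show ?case unfolding fw.simps Cons.IH[OF Cons.prems]
    by (intro ext fd_eqI[OF has_derivative_add[OF smooth_has_derivative[OF smooth_fw[OF Cons.prems(1)]] smooth_has_derivative[OF smooth_fw[OF Cons.prems(2)]]]])
qed auto

lemma fw_cmult: "smooth f \<Longrightarrow> fw V w (\<lambda>x. c * f x) = (\<lambda>x. c * fw V w f x)"
proof (induction w)
  case (Cons b w)
  show ?case unfolding fw.simps Cons.IH[OF Cons.prems]
    by (intro ext fd_eqI[OF has_derivative_mult_right[OF smooth_has_derivative[OF smooth_fw[OF Cons.prems(1)]]]])
qed auto

lemma fw_const: "w \<noteq> [] \<Longrightarrow> fw V w (\<lambda>x. c) = (\<lambda>x. 0)"
proof (induction w)
  case (Cons b w)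
  then show ?case by (cases "w = []") auto
qed auto

lemma fw_sum: "(\<And>i. i \<in> S \<Longrightarrow> smooth (f i)) \<Longrightarrow> fw V w (\<lambda>x. \<Sum>i\<in>S. f i x) = (\<lambda>x. \<Sum>i\<in>S. fw V w (f i) x)"
proof (induction S rule: infinite_finite_induct)
  case (insert i S)
  then show ?case using fw_add[of "f i" "\<lambda>x. \<Sum>i\<in>S. f i x" w] by (simp add: smooth_sum)
next
  case empty
  show ?case by (cases "w = []") (auto simp: fw_const)
next
  case (infinite S)
  show ?case using infinite(1) by (cases "w = []") (auto simp: fw_const)
qed

lemma fw_diff: "smooth f \<Longrightarrow> smooth g \<Longrightarrow> fw V w (\<lambda>x. f x - g x) = (\<lambda>x. fw V w f x - fw V w g x)"
  using fw_add[of f "\<lambda>x. -1 * g x" w] fw_cmult[of g w "-1"] smooth_uminus[of g] by simp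

lemma fw_mult1:
  assumes "smooth f" "smooth g"
  shows "fw V [b] (\<lambda>x. f x * g x) = (\<lambda>x. fw V [b] f x * g x + f x * fw V [b] g x)"
  using fd_eqI[OF has_derivative_mult[OF smooth_has_derivative[OF assms(1)] smooth_has_derivative[OF assms(2)]]]
  by (auto simp: fun_eq_iff)

lemma fw_local:
  assumes "open U" "\<And>y. y \<in> U \<Longrightarrow> f y = g y" "smooth g" "x \<in> U"
  shows "fw V w f x = fw V w g x"
  using assms(4)
proof (induction w arbitrary: x)
  case (Cons b w)
  have "(fw V w f has_derivative frechet_derivative (fw V w g) (at x)) (at x)"
    by (rule has_derivative_transform_within_open[OF smooth_has_derivative[OF smooth_fw[OF assms(3)]] assms(1) Cons.prems])
       (use Cons in auto)
  then show ?case by (simp add: fd_eqI)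
qed (use assms in auto)

text \<open>The induction peels off the innermost letter, because bounds for
  \<open>fw V [b] f\<close> are those for \<open>f\<close> shifted by one; the two resulting sums
  merge by Pascal's rule.\<close>

lemma fw_mult_bound:
  assumes "smooth f" "smooth g" "w \<in> lists A"
    and "\<And>u. u \<in> lists A \<Longrightarrow> length u \<le> length w \<Longrightarrow> \<bar>fw V u f p\<bar> \<le> \<alpha> (length u)"
    and "\<And>u. u \<in> lists A \<Longrightarrow> length u \<le> length w \<Longrightarrow> \<bar>fw V u g p\<bar> \<le> \<beta> (length u)"
  shows "\<bar>fw V w (\<lambda>x. f x * g x) p\<bar> \<le> (\<Sum>j\<le>length w. real (length w choose j) * \<alpha> j * \<beta> (length w - j))"
  using assms
proof (induction w arbitrary: f g \<alpha> \<beta> rule: rev_induct)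
  case Nil
  have "\<bar>f p\<bar> \<le> \<alpha> 0" "\<bar>g p\<bar> \<le> \<beta> 0" using Nil(4)[of "[]"] Nil(5)[of "[]"] by auto
  then have "\<bar>f p\<bar> * \<bar>g p\<bar> \<le> \<alpha> 0 * \<beta> 0" by (intro mult_mono) auto
  then show ?case by (simp add: abs_mult)
next
  case (snoc b w)
  let ?n = "length w"
  have b: "b \<in> A" "w \<in> lists A" using snoc.prems(3) by auto
  have sm: "smooth (fw V [b] f)" "smooth (fw V [b] g)" using smooth_fw snoc.prems by blast+
  have "fw V (w @ [b]) (\<lambda>x. f x * g x) p = fw V w (\<lambda>x. fw V [b] f x * g x) p + fw V w (\<lambda>x. f x * fw V [b] g x) p"
    unfolding fw_append fw_mult1[OF snoc.prems(1,2)]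
    by (subst fw_add) (use sm snoc.prems in \<open>auto intro!: smooth_mult\<close>)
  moreover have "\<bar>fw V w (\<lambda>x. fw V [b] f x * g x) p\<bar> \<le> (\<Sum>j\<le>?n. real (?n choose j) * \<alpha> (Suc j) * \<beta> (?n - j))"
  proof (rule snoc.IH[OF sm(1) snoc.prems(2) b(2)])
    fix u assume u: "u \<in> lists A" "length u \<le> ?n"
    show "\<bar>fw V u (fw V [b] f) p\<bar> \<le> \<alpha> (Suc (length u))"
      using snoc.prems(4)[of "u @ [b]"] u b by (simp add: fw_append)
    show "\<bar>fw V u g p\<bar> \<le> \<beta> (length u)" using snoc.prems(5)[of u] u by simp
  qed
  moreover have "\<bar>fw V w (\<lambda>x. f x * fw V [b] g x) p\<bar> \<le> (\<Sum>j\<le>?n. real (?n choose j) * \<alpha> j * \<beta> (Suc (?n - j)))"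
  proof (rule snoc.IH[OF snoc.prems(1) sm(2) b(2), where \<beta> = "\<lambda>j. \<beta> (Suc j)"])
    fix u assume u: "u \<in> lists A" "length u \<le> ?n"
    show "\<bar>fw V u (fw V [b] g) p\<bar> \<le> \<beta> (Suc (length u))"
      using snoc.prems(5)[of "u @ [b]"] u b by (simp add: fw_append)
    show "\<bar>fw V u f p\<bar> \<le> \<alpha> (length u)" using snoc.prems(4)[of u] u by simp
  qed
  ultimately show ?case using binomial_convolution_Suc[of ?n \<alpha> \<beta>] by simp
qed

text \<open>Value and derivatives are bounded separately because a slowly varying function has
  \<open>\<eta>\<close> much smaller than \<open>C\<close>. One \<open>\<eta>\<close> serves words
  of every length.\<close>

definition jet :: "real \<Rightarrow> real \<Rightarrow> real \<Rightarrow> ('a \<Rightarrow> real) \<Rightarrow> 'a \<Rightarrow> bool" where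
  "jet B C \<eta> f p \<longleftrightarrow> \<bar>f p\<bar> \<le> C \<and> (\<forall>w\<in>lists A. w \<noteq> [] \<longrightarrow> \<bar>fw V w f p\<bar> \<le> \<eta> * B ^ (length w)\<^sup>2)"

lemma jetD: "jet B C \<eta> f p \<Longrightarrow> w \<in> lists A \<Longrightarrow> w \<noteq> [] \<Longrightarrow> \<bar>fw V w f p\<bar> \<le> \<eta> * B ^ (length w)\<^sup>2"
  by (simp add: jet_def)

lemma jet_val: "jet B C \<eta> f p \<Longrightarrow> \<bar>f p\<bar> \<le> C"
  by (simp add: jet_def)

lemma jet_mono: "jet B C \<eta> f p \<Longrightarrow> C \<le> C' \<Longrightarrow> \<eta> \<le> \<eta>' \<Longrightarrow> B \<ge> 0 \<Longrightarrow> jet B C' \<eta>' f p"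
  unfolding jet_def using mult_right_mono[of \<eta> \<eta>' "B ^ k" for k] by (smt (verit) zero_le_power)

lemma jet_const: "\<bar>c\<bar> \<le> C \<Longrightarrow> 0 \<le> \<eta> \<Longrightarrow> B \<ge> 0 \<Longrightarrow> jet B C \<eta> (\<lambda>x. c) p"
  by (auto simp: jet_def fw_const)

lemma jet_add:
  assumes "smooth f" "smooth g" "jet B C \<eta> f p" "jet B C' \<eta>' g p"
  shows "jet B (C + C') (\<eta> + \<eta>') (\<lambda>x. f x + g x) p"
  unfolding jet_def fw_add[OF assms(1,2)]
proof (intro conjI ballI impI)
  show "\<bar>f p + g p\<bar> \<le> C + C'" using jet_val[OF assms(3)] jet_val[OF assms(4)] by linarith
  fix w assume w: "w \<in> lists A" "w \<noteq> []"
  show "\<bar>fw V w f p + fw V w g p\<bar> \<le> (\<eta> + \<eta>') * B ^ (length w)\<^sup>2"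
    using jetD[OF assms(3) w] jetD[OF assms(4) w] by (simp add: distrib_right)
qed

lemma jet_cmult:
  assumes "smooth f" "jet B C \<eta> f p"
  shows "jet B (\<bar>c\<bar> * C) (\<bar>c\<bar> * \<eta>) (\<lambda>x. c * f x) p"
  using assms(2) unfolding jet_def fw_cmult[OF assms(1)]
  by (auto simp: abs_mult mult.assoc intro!: mult_left_mono)

text \<open>The extreme terms of the Leibniz sum give \<open>C * \<eta>'\<close> and
  \<open>C' * \<eta>\<close>; all mixed terms together give only
  \<open>\<eta> * \<eta>'\<close>.\<close>

lemma jet_mult:
  assumes B: "B \<ge> 2" and sm: "smooth f" "smooth g" and f: "jet B C \<eta> f p" and g: "jet B C' \<eta>' g p"
    and nn: "\<eta> \<ge> 0" "\<eta>' \<ge> 0"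
  shows "jet B (C * C') (C * \<eta>' + C' * \<eta> + \<eta> * \<eta>') (\<lambda>x. f x * g x) p"
proof -
  have C: "C \<ge> 0" "C' \<ge> 0" using jet_val[OF f] jet_val[OF g] by linarith+
  have "\<bar>fw V w (\<lambda>x. f x * g x) p\<bar> \<le> (C * \<eta>' + C' * \<eta> + \<eta> * \<eta>') * B ^ (length w)\<^sup>2"
    if w: "w \<in> lists A" "w \<noteq> []" for w
  proof -
    define n where "n = length w"
    have n: "n \<ge> 1" using w by (cases w) (auto simp: n_def)
    define \<alpha> where "\<alpha> j = (if j = 0 then C else \<eta> * B ^ j\<^sup>2)" for j :: nat
    define \<beta> where "\<beta> j = (if j = 0 then C' else \<eta>' * B ^ j\<^sup>2)" for j :: nat
    have "\<bar>fw V w (\<lambda>x. f x * g x) p\<bar> \<le> (\<Sum>j\<le>n. real (n choose j) * \<alpha> j * \<beta> (n - j))"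
      unfolding n_def
    proof (rule fw_mult_bound[OF sm w(1)])
      fix u assume "u \<in> lists A"
      then show "\<bar>fw V u f p\<bar> \<le> \<alpha> (length u)" "\<bar>fw V u g p\<bar> \<le> \<beta> (length u)"
        using jetD[OF f] jetD[OF g] jet_val[OF f] jet_val[OF g] by (auto simp: \<alpha>_def \<beta>_def)
    qed
    also have "{..n} = insert 0 (insert n {1..<n})" using n by auto
    also have "(\<Sum>j\<in>insert 0 (insert n {1..<n}). real (n choose j) * \<alpha> j * \<beta> (n - j))
      = \<alpha> 0 * \<beta> n + \<alpha> n * \<beta> 0 + (\<Sum>j\<in>{1..<n}. real (n choose j) * \<alpha> j * \<beta> (n - j))"
      using n by simp
    also have "(\<Sum>j\<in>{1..<n}. real (n choose j) * \<alpha> j * \<beta> (n - j)) = \<eta> * \<eta>' * (\<Sum>j\<in>{1..<n}. real (n choose j) * B ^ j\<^sup>2 * B ^ (n - j)\<^sup>2)"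
      unfolding sum_distrib_left by (rule sum.cong) (auto simp: \<alpha>_def \<beta>_def)
    also have "\<alpha> 0 * \<beta> n + \<alpha> n * \<beta> 0 + \<dots> \<le> C * (\<eta>' * B ^ n\<^sup>2) + (\<eta> * B ^ n\<^sup>2) * C' + \<eta> * \<eta>' * B ^ n\<^sup>2"
      using n nn square_weight_convolution[OF B, of n] by (intro add_mono mult_left_mono) (auto simp: \<alpha>_def \<beta>_def)
    finally show ?thesis by (simp add: n_def algebra_simps)
  qed
  moreover have "\<bar>f p * g p\<bar> \<le> C * C'" using jet_val[OF f] jet_val[OF g] C by (simp add: abs_mult mult_mono)
  ultimately show ?thesis by (simp add: jet_def)
qed

text \<open>A slowly varying factor may be frozen under derivatives: the product bound is applied to
  \<open>f - f p\<close>, whose value at \<open>p\<close> is 0, so no term with \<open>C\<close>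
  survives.\<close>

lemma fw_mult_freeze:
  assumes B: "B \<ge> 2" and sm: "smooth f" "smooth g" and f: "jet B C \<eta> f p" and g: "jet B C' \<eta>' g p"
    and nn: "\<eta> \<ge> 0" "\<eta>' \<ge> 0" and w: "w \<in> lists A"
  shows "\<bar>fw V w (\<lambda>x. f x * g x) p - f p * fw V w g p\<bar> \<le> (C' * \<eta> + \<eta> * \<eta>') * B ^ (length w)\<^sup>2"
proof (cases "w = []")
  case True
  have "C' \<ge> 0" using jet_val[OF g] by linarith
  then show ?thesis using True nn B by simp
next
  case False
  have f0: "jet B 0 \<eta> (\<lambda>x. f x - f p) p"
    using f by (auto simp: jet_def fw_diff[OF sm(1) smooth_const] fw_const)
  have "fw V w (\<lambda>x. f x * g x) p - f p * fw V w g p = fw V w (\<lambda>x. (f x - f p) * g x) p"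
    using fw_diff[OF smooth_mult[OF sm] smooth_mult[OF smooth_const sm(2)], of w "f p"] fw_cmult[OF sm(2), of w "f p"]
    by (simp add: left_diff_distrib)
  then show ?thesis
    using jetD[OF jet_mult[OF B smooth_diff[OF sm(1) smooth_const] sm(2) f0 g nn] w False] by simp
qed

text \<open>Differentiate \<open>f * inverse f = 1\<close> and induct on the length. The mixed terms
  contribute \<open>\<eta> * (2 / c\<^sup>2 * \<eta>)\<close>, and \<open>2 * \<eta> \<le> c\<close>
  keeps them below the leading term \<open>\<eta> / c\<close>; this explains the factor 2 in the
  conclusion.\<close>

lemma jet_inverse:
  assumes B: "B \<ge> 2" and sm: "smooth f" and nz: "\<And>x. f x \<noteq> 0" and f: "jet B C \<eta> f p"
    and c: "c > 0" "\<bar>f p\<bar> \<ge> c" and eta: "\<eta> \<ge> 0" "2 * \<eta> \<le> c"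
  shows "jet B (1 / c) (2 / c\<^sup>2 * \<eta>) (\<lambda>x. inverse (f x)) p"
proof -
  let ?g = "\<lambda>x. inverse (f x)"
  have smg: "smooth ?g" by (rule smooth_inverse[OF nz sm])
  have g0: "\<bar>?g p\<bar> \<le> 1 / c" using c nz by (simp add: inverse_eq_divide abs_divide frac_le)
  have "\<bar>fw V w ?g p\<bar> \<le> 2 / c\<^sup>2 * \<eta> * B ^ (length w)\<^sup>2" if "w \<in> lists A" "w \<noteq> []" for w
    using that
  proof (induction "length w" arbitrary: w rule: less_induct)
    case less
    define n where "n = length w"
    have n: "n \<ge> 1" using less.prems by (cases w) (auto simp: n_def)
    have f0: "jet B 0 \<eta> (\<lambda>x. f x - f p) p"
      using f by (auto simp: jet_def fw_diff[OF sm smooth_const] fw_const)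
    have "(\<lambda>x. f p * ?g x + (f x - f p) * ?g x) = (\<lambda>x. 1)" using nz by (auto simp: fun_eq_iff left_diff_distrib)
    then have "fw V w (\<lambda>x. f p * ?g x + (f x - f p) * ?g x) p = 0" using less.prems fw_const by simp
    then have eq: "f p * fw V w ?g p + fw V w (\<lambda>x. (f x - f p) * ?g x) p = 0"
      using fw_add[OF smooth_mult[OF smooth_const smg] smooth_mult[OF smooth_diff[OF sm smooth_const] smg], of w "f p" "f p"] 
        fw_cmult[OF smg, of w "f p"] by simp
    define \<alpha> where "\<alpha> j = (if j = 0 then 0 else \<eta> * B ^ j\<^sup>2)" for j :: nat
    define S where "S = {u. set u \<subseteq> A \<and> length u = n}"
    have finS: "finite S" unfolding S_def by (rule finite_lists_length_eq[OF finA])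
    \<comment> \<open>At full length no bound is available yet, so the sum over all words of that
      length stands in; it only ever meets the factor \<open>\<alpha> 0 = 0\<close>.\<close>
    define \<beta> where "\<beta> j = (if j = 0 then 1 / c else if j < n then 2 / c\<^sup>2 * \<eta> * B ^ j\<^sup>2 else (\<Sum>u\<in>S. \<bar>fw V u ?g p\<bar>))" for j :: nat
    have "\<bar>fw V w (\<lambda>x. (f x - f p) * ?g x) p\<bar> \<le> (\<Sum>j\<le>n. real (n choose j) * \<alpha> j * \<beta> (n - j))"
      unfolding n_def
    proof (rule fw_mult_bound[OF smooth_diff[OF sm smooth_const] smg less.prems(1)])
      fix u assume u: "u \<in> lists A" "length u \<le> length w"
      show "\<bar>fw V u (\<lambda>x. f x - f p) p\<bar> \<le> \<alpha> (length u)" using jetD[OF f0 u(1)] by (auto simp: \<alpha>_def)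
      show "\<bar>fw V u ?g p\<bar> \<le> \<beta> (length u)"
      proof (cases "length u < n")
        case True
        then show ?thesis using less.hyps[of u] u g0 by (auto simp: \<beta>_def n_def)
      next
        case False
        then have "u \<in> S" using u by (auto simp: S_def n_def)
        then have "\<bar>fw V u ?g p\<bar> \<le> (\<Sum>u\<in>S. \<bar>fw V u ?g p\<bar>)" by (intro member_le_sum finS) auto
        then show ?thesis using False n by (auto simp: \<beta>_def)
      qed
    qed
    also have "{..n} = insert 0 (insert n {1..<n})" using n by auto
    also have "(\<Sum>j\<in>insert 0 (insert n {1..<n}). real (n choose j) * \<alpha> j * \<beta> (n - j))
      = \<alpha> 0 * \<beta> n + \<alpha> n * \<beta> 0 + (\<Sum>j\<in>{1..<n}. real (n choose j) * \<alpha> j * \<beta> (n - j))"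
      using n by simp
    also have "(\<Sum>j\<in>{1..<n}. real (n choose j) * \<alpha> j * \<beta> (n - j)) = \<eta> * (2 / c\<^sup>2 * \<eta>) * (\<Sum>j\<in>{1..<n}. real (n choose j) * B ^ j\<^sup>2 * B ^ (n - j)\<^sup>2)"
      unfolding sum_distrib_left by (rule sum.cong) (auto simp: \<alpha>_def \<beta>_def)
    also have "\<alpha> 0 * \<beta> n + \<alpha> n * \<beta> 0 + \<dots> \<le> 0 + (\<eta> * B ^ n\<^sup>2) * (1 / c) + \<eta> * (2 / c\<^sup>2 * \<eta>) * B ^ n\<^sup>2"
      using n eta c square_weight_convolution[OF B, of n] by (intro add_mono mult_left_mono) (auto simp: \<alpha>_def \<beta>_def)
    also have "\<dots> = \<eta> * B ^ n\<^sup>2 * (1 / c + (2 * \<eta>) / c\<^sup>2)" by (simp add: algebra_simps)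
    also have "\<dots> \<le> \<eta> * B ^ n\<^sup>2 * (1 / c + c / c\<^sup>2)"
      using eta c B by (intro mult_left_mono add_left_mono divide_right_mono) auto
    also have "\<dots> = \<eta> * B ^ n\<^sup>2 * (2 / c)" using c by (simp add: power2_eq_square)
    finally have 1: "\<bar>fw V w (\<lambda>x. (f x - f p) * ?g x) p\<bar> \<le> \<eta> * B ^ n\<^sup>2 * (2 / c)" .
    have "c * \<bar>fw V w ?g p\<bar> \<le> \<bar>f p\<bar> * \<bar>fw V w ?g p\<bar>" using c by (intro mult_right_mono) auto
    also have "\<dots> = \<bar>fw V w (\<lambda>x. (f x - f p) * ?g x) p\<bar>" using eq by (metis abs_minus_cancel abs_mult eq_neg_iff_add_eq_0)
    finally have "c * \<bar>fw V w ?g p\<bar> \<le> \<eta> * B ^ n\<^sup>2 * (2 / c)" using 1 by linarith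
    then have "\<bar>fw V w ?g p\<bar> \<le> \<eta> * B ^ n\<^sup>2 * (2 / c) / c" using c by (simp add: pos_le_divide_eq mult.commute)
    then show ?case by (simp add: n_def power2_eq_square algebra_simps)
  qed
  with g0 show ?thesis by (simp add: jet_def)
qed

end

text \<open>The homogeneous degree of a word: under \<open>Lam t\<close> its derivative picks up
  \<open>t ^ wt w\<close>.\<close>

definition wt :: "(nat \<times> nat) list \<Rightarrow> nat" where "wt w = sum_list (map fst w)"

lemma wt_simps [simp]: "wt [] = 0" "wt (b # w) = fst b + wt w" "wt (u @ w) = wt u + wt w"
  by (auto simp: wt_def)

lemma prod_list_power: "prod_list (map (\<lambda>b. (t::real) ^ fst b) w) = t ^ wt w"
  by (induction w) (auto simp: power_add)

section \<open>The left-invariant frame of the model group\<close>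

context graded_lie
begin

definition "Y b = Yv (E b)"

lemma smooth_Y: "smooth (Y b)" by (simp add: Y_def smooth_Yv)

sublocale fields Y I
  by unfold_locales (auto simp: smooth_Y)

lemma wt_ge_length: "w \<in> lists I \<Longrightarrow> length w \<le> wt w"
  by (induction w) (auto simp: idx_def)

text \<open>Left division: the solution \<open>y\<close> of \<open>g + M g y = p\<close>. It is
  affine in \<open>p\<close>, so it maps polynomials to polynomials of the same degree.\<close>

definition "ld g p = N g (p - g)"

lemma ld_eq: "g + M g (ld g p) = p" by (simp add: ld_def)
lemma ld_left [simp]: "ld g (g + M g y) = y" by (simp add: ld_def)
lemma ld_right: "ld g (p + M p w) = ld g p + M (ld g p) w"
proof -
  have "M p w = M g (M (ld g p) w)" using M_assoc[of g "ld g p" w] by (simp add: ld_eq)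
  then have "p + M p w = g + M g (ld g p + M (ld g p) w)"
    by (simp only: M_linear add.assoc[symmetric] ld_eq)
  then show ?thesis by (simp only: ld_left)
qed

lemma smooth_ld: "smooth (ld g)"
  unfolding ld_def[abs_def] by (intro smooth_compose[OF smooth_linear[OF linear_N]] smooth_diff smooth_id smooth_const)

lemma fw_ld: 
  assumes "w \<in> lists I" "smooth f"
  shows "fw Y w (\<lambda>x. f (ld g x)) = (\<lambda>x. fw Y w f (ld g x))"
proof -
  have "frechet_derivative (ld g) (at p) (Y b p) = 1 *\<^sub>R Y b (ld g p)" for b p
  proof -
    have "(ld g has_derivative (\<lambda>h. N g (h - 0))) (at p)"
      unfolding ld_def[abs_def]
      by (intro bounded_linear.has_derivative[OF linear_N[unfolded linear_conv_bounded_linear]] derivative_intros)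
    from fd_eqI[OF this] have "frechet_derivative (ld g) (at p) (Y b p) = N g (M p (Dg (E b)))"
      by (simp add: Y_def Yv_def)
    also have "M p (Dg (E b)) = M g (M (ld g p) (Dg (E b)))"
      using M_assoc[of g "ld g p"] ld_eq[of g p] by simp
    finally show ?thesis by (simp add: Y_def Yv_def)
  qed
  from fw_related[OF smooth_Y smooth_ld this assms] show ?thesis
    using prod_list_power[of 1 w] by simp
qed

lemma fw_Lam:
  assumes "w \<in> lists I" "smooth f"
  shows "fw Y w (\<lambda>x. f (Lam t x)) = (\<lambda>x. t ^ wt w * fw Y w f (Lam t x))"
proof -
  have sm: "smooth (Lam t)" by (rule smooth_linear[OF linear_Lam])
  have "frechet_derivative (Lam t) (at p) (Y b p) = t ^ fst b *\<^sub>R Y b (Lam t p)" if "b \<in> I" for b p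
  proof -
    have "(Lam t has_derivative Lam t) (at p)"
      by (rule bounded_linear_imp_has_derivative[OF linear_Lam[unfolded linear_conv_bounded_linear]])
    from fd_eqI[OF this] have "frechet_derivative (Lam t) (at p) (Y b p) = M (Lam t p) (Lam t (Dg (E b)))"
      by (simp add: Y_def Yv_def M_Lam)
    also have "Lam t (Dg (E b)) = t ^ fst b *\<^sub>R Dg (E b)"
      by (rule vec_eqI) (use that in auto)
    finally show ?thesis by (simp add: Y_def Yv_def)
  qed
  from fw_related[OF smooth_Y sm this assms] show ?thesis by (simp add: prod_list_power)
qed

text \<open>The dual coframe; the division by \<open>fst b\<close> undoes the \<open>Dg\<close> in
  \<open>Y b\<close>.\<close>

definition "fr b x u = co b (N x u) / real (fst b)"

lemma frame: "u = (\<Sum>b\<in>I. fr b x u *\<^sub>R Y b x)"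
proof -
  have "(\<Sum>b\<in>I. fr b x u *\<^sub>R Y b x) = M x (\<Sum>b\<in>I. fr b x u *\<^sub>R Dg (E b))"
    by (simp add: Y_def Yv_def)
  also have "(\<Sum>b\<in>I. fr b x u *\<^sub>R Dg (E b)) = N x u"
  proof -
    have "fr b x u *\<^sub>R Dg (E b) = co b (N x u) *\<^sub>R E b" if "b \<in> I" for b
    proof -
      have "Dg (E b) = real (fst b) *\<^sub>R E b" by (rule vec_eqI) (use that in auto)
      moreover have "fst b \<ge> 1" using that by (auto simp: idx_def)
      ultimately show ?thesis by (simp add: fr_def)
    qed
    then have "(\<Sum>b\<in>I. fr b x u *\<^sub>R Dg (E b)) = (\<Sum>b\<in>I. co b (N x u) *\<^sub>R E b)" by (rule sum.cong[OF refl])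
    then show ?thesis using expand[of "N x u"] by simp
  qed
  finally show ?thesis by simp
qed

lemma fd_frame: "smooth f \<Longrightarrow> frechet_derivative f (at x) u = (\<Sum>b\<in>I. fr b x u * fw Y [b] f x)"
  by (subst frame[of u x]) (simp add: linear_sum[OF smooth_linear_fd] linear_scale[OF smooth_linear_fd])

lemma smooth_fr: "smooth (\<lambda>x. fr b x u)"
  unfolding fr_def divide_inverse by (intro smooth_mult smooth_co smooth_N) auto

lemma linear_fr: "linear (fr b x)"
  unfolding fr_def by (rule linearI) (auto simp: linear_add[OF linear_N] linear_scale[OF linear_N] add_divide_distrib)

text \<open>A bracket of two vectors of layer 1 lies in layer 2, so exchanging two horizontal
  letters costs only constant multiples of single letters of weight 2.\<close>

lemma horizontal_commutator:
  assumes b: "b \<in> I" "b' \<in> I" "fst b = 1" "fst b' = 1"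
  shows "\<exists>k. \<forall>f x. smooth f \<longrightarrow> fw Y [b, b'] f x - fw Y [b', b] f x = (\<Sum>a\<in>{a\<in>I. fst a = 2}. k a * fw Y [a] f x)"
proof (intro exI allI impI)
  fix f :: "'a \<Rightarrow> real" and x assume f: "smooth f"
  let ?v = "br (E b) (E b')"
  have v2: "\<pi> 2 ?v = ?v" using br_graded[of 2 1 "E b" 1 "E b'"] b by simp
  have "fw Y [b, b'] f x - fw Y [b', b] f x = frechet_derivative f (at x) (Yv ?v x)"
    using field_commutator[OF f smooth_Y smooth_Y, of b' x b] by (simp add: Y_def Yv_bracket)
  also have "Yv ?v x = Yv (\<Sum>a\<in>I. co a ?v *\<^sub>R E a) x" using expand[of ?v] by simp
  also have "\<dots> = (\<Sum>a\<in>I. co a ?v *\<^sub>R Y a x)" by (simp add: Yv_def Y_def)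
  also have "frechet_derivative f (at x) \<dots> = (\<Sum>a\<in>I. co a ?v * fw Y [a] f x)"
    by (simp add: linear_sum[OF smooth_linear_fd[OF f]] linear_scale[OF smooth_linear_fd[OF f]])
  also have "\<dots> = (\<Sum>a\<in>{a\<in>I. fst a = 2}. co a ?v * fw Y [a] f x)"
  proof (rule sum.mono_neutral_right)
    show "\<forall>a\<in>I - {a \<in> I. fst a = 2}. co a ?v * fw Y [a] f x = 0"
    proof
      fix a assume "a \<in> I - {a \<in> I. fst a = 2}"
      then have "co a (\<pi> 2 ?v) = 0" by simp
      then show "co a ?v * fw Y [a] f x = 0" by (simp add: v2)
    qed
  qed auto
  finally show "fw Y [b, b'] f x - fw Y [b', b] f x = (\<Sum>a\<in>{a\<in>I. fst a = 2}. co a ?v * fw Y [a] f x)" .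
qed

end

lemma (in carnot_group) Lword_chart:
  assumes c: "smooth c" "\<And>p v. frechet_derivative c (at p) (J p v) = Yv v (c p)"
    and f: "smooth f" and w: "w \<in> lists I"
  shows "Lword mul e (map (\<lambda>(r, i). Xb r i) w) (\<lambda>p. f (c p)) = (\<lambda>p. fw Y w f (c p))"
  using w
proof (induction w)
  case (Cons b w)
  have E: "(case b of (r, i) \<Rightarrow> Xb r i) = E b" by (simp add: E_case)
  have sm: "smooth (\<lambda>p. fw Y w f (c p))" by (intro smooth_compose[OF _ c(1)] smooth_fw f)
  have "Lder mul e v (\<lambda>p. fw Y w f (c p)) p = frechet_derivative (fw Y w f) (at (c p)) (Yv v (c p))" for v p
  proof -
    have "Lder mul e v (\<lambda>p. fw Y w f (c p)) p = frechet_derivative (\<lambda>p. fw Y w f (c p)) (at p) (J p v)"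
      unfolding Lder_def using fd_compose[OF sm smooth_left[of p], of e v] by (simp add: Jm_def)
    also have "\<dots> = frechet_derivative (fw Y w f) (at (c p)) (Yv v (c p))"
      by (subst fd_compose[OF smooth_fw[OF f] c(1)]) (simp add: c(2))
    finally show ?thesis .
  qed
  moreover have "Lword mul e (map (\<lambda>(r, i). Xb r i) w) (\<lambda>p. f (c p)) = (\<lambda>p. fw Y w f (c p))"
    using Cons by simp
  ultimately show ?case by (simp only: list.map Lword.simps fw.simps E) (simp add: Y_def[of b] fun_eq_iff)
qed simp

section \<open>Compactly supported test functions\<close>

lemma compact_PiE_UNIV: "(\<And>i. compact (Z i)) \<Longrightarrow> compact (PiE UNIV Z :: ('i \<Rightarrow> 'b::topological_space) set)"
  using compactin_PiE[of "\<lambda>i. euclidean" UNIV Z] by (simp add: euclidean_product_topology)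

lemma unit_normalize:
  fixes t :: "'i \<Rightarrow> real"
  assumes S: "finite S" and N: "(\<Sum>i\<in>S. (t i)\<^sup>2) = N" "N > 0"
  shows "(\<lambda>i. if i \<in> S then t i / sqrt N else 0)
    \<in> PiE UNIV (\<lambda>i. if i \<in> S then {-1..1} else {0}) \<inter> {t. (\<Sum>i\<in>S. (t i)\<^sup>2) = 1}"
proof -
  have "-1 \<le> t i / sqrt N \<and> t i / sqrt N \<le> 1" if "i \<in> S" for i
  proof -
    have "(t i)\<^sup>2 \<le> N" unfolding N(1)[symmetric] using that S by (intro member_le_sum) auto
    then have "\<bar>t i\<bar> \<le> sqrt N" using real_sqrt_le_mono by fastforce
    then show ?thesis using N(2) by (auto simp: divide_simps)
  qed
  moreover have "(\<Sum>i\<in>S. ((if i \<in> S then t i / sqrt N else 0))\<^sup>2) = (\<Sum>i\<in>S. (t i)\<^sup>2) / N"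
    unfolding sum_divide_distrib by (rule sum.cong) (use N(2) in \<open>auto simp: power_divide\<close>)
  ultimately show ?thesis using N by auto
qed

text \<open>Pointwise injectivity becomes uniform by minimising the quadratic form over
  \<open>K\<close> times the unit sphere. Coefficients outside \<open>S\<close> are pinned to 0 to
  make that sphere compact in the product topology.\<close>

lemma coercive_compact:
  fixes F :: "'l \<Rightarrow> 'i \<Rightarrow> 'a::euclidean_space \<Rightarrow> real"
  assumes K: "compact K" and S: "finite S" and cont: "\<And>l i. continuous_on K (F l i)"
    and inj: "\<And>y t. y \<in> K \<Longrightarrow> (\<And>l. l \<in> L \<Longrightarrow> (\<Sum>i\<in>S. t i * F l i y) = 0) \<Longrightarrow> \<forall>i\<in>S. t i = 0"
    and L: "finite L"
  shows "\<exists>c>0. \<forall>y\<in>K. \<forall>t. c * (\<Sum>i\<in>S. (t i)\<^sup>2) \<le> (\<Sum>l\<in>L. (\<Sum>i\<in>S. t i * F l i y)\<^sup>2)"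
proof -
  define T where "T = PiE UNIV (\<lambda>i. if i \<in> S then {-1..1} else {0}) \<inter> {t :: 'i \<Rightarrow> real. (\<Sum>i\<in>S. (t i)\<^sup>2) = 1}"
  have "closed {t :: 'i \<Rightarrow> real. (\<Sum>i\<in>S. (t i)\<^sup>2) = 1}"
    by (intro closed_Collect_eq continuous_intros continuous_on_product_coordinates)
  then have cT: "compact T" unfolding T_def
    by (intro compact_Int_closed compact_PiE_UNIV) auto
  define Q where "Q z = (\<Sum>l\<in>L. (\<Sum>i\<in>S. snd z i * F l i (fst z))\<^sup>2)" for z :: "'a \<times> ('i \<Rightarrow> real)"
  have contQ: "continuous_on (K \<times> T) Q"
    unfolding Q_def
    by (intro continuous_intros continuous_on_compose2[OF continuous_on_product_coordinates, of _ snd]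
        continuous_on_compose2[OF cont, of _ fst]) auto
  have unit: "t \<in> T \<Longrightarrow> (\<Sum>i\<in>S. (t i)\<^sup>2) = 1" for t by (simp add: T_def)
  show ?thesis
  proof (cases "K \<times> T = {}")
    case True
    have "(\<Sum>i\<in>S. (t i)\<^sup>2) = 0" if "y \<in> K" for y and t :: "'i \<Rightarrow> real"
    proof (rule ccontr)
      assume nz: "(\<Sum>i\<in>S. (t i)\<^sup>2) \<noteq> 0"
      let ?N = "\<Sum>i\<in>S. (t i)\<^sup>2"
      have N: "?N > 0" using nz sum_nonneg[of S "\<lambda>i. (t i)\<^sup>2"] by fastforce
      have "(\<lambda>i. if i \<in> S then t i / sqrt ?N else 0) \<in> T"
        unfolding T_def by (rule unit_normalize[OF S refl N])
      then show False using True that by blast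
    qed
    then show ?thesis by (intro exI[of _ 1]) (auto intro!: sum_nonneg)
  next
    case False
    obtain z where z: "z \<in> K \<times> T" "\<And>z'. z' \<in> K \<times> T \<Longrightarrow> Q z \<le> Q z'"
      using continuous_attains_inf[OF compact_Times[OF K cT] False contQ] by auto
    have "Q z \<noteq> 0"
    proof
      assume "Q z = 0"
      then have "(\<Sum>i\<in>S. snd z i * F l i (fst z)) = 0" if "l \<in> L" for l
        using that L unfolding Q_def by (simp add: sum_nonneg_eq_0_iff)
      then have "\<forall>i\<in>S. snd z i = 0" using inj[of "fst z" "snd z"] z(1) by auto
      then show False using unit[of "snd z"] z(1) by auto
    qed
    then have pos: "Q z > 0" unfolding Q_def using sum_nonneg[of L "\<lambda>l. (\<Sum>i\<in>S. snd z i * F l i (fst z))\<^sup>2"] by (simp add: less_le)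
    have "Q z * (\<Sum>i\<in>S. (t i)\<^sup>2) \<le> (\<Sum>l\<in>L. (\<Sum>i\<in>S. t i * F l i y)\<^sup>2)" if y: "y \<in> K" for y t
    proof (cases "(\<Sum>i\<in>S. (t i)\<^sup>2) = 0")
      case True
      then show ?thesis by (simp add: sum_nonneg)
    next
      case nz: False
      let ?N = "\<Sum>i\<in>S. (t i)\<^sup>2"
      have N: "?N > 0" using nz sum_nonneg[of S "\<lambda>i. (t i)\<^sup>2"] by fastforce
      define t' where "t' = (\<lambda>i. if i \<in> S then t i / sqrt ?N else 0)"
      have "t' \<in> T"
        unfolding T_def t'_def by (rule unit_normalize[OF S refl N])
      then have "Q z \<le> Q (y, t')" using y z by auto
      also have "Q (y, t') = (\<Sum>l\<in>L. (\<Sum>i\<in>S. t i * F l i y)\<^sup>2 / ?N)"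
      proof -
        have "(\<Sum>i\<in>S. t' i * F l i y) = (\<Sum>i\<in>S. t i * F l i y) / sqrt ?N" for l
          unfolding sum_divide_distrib by (rule sum.cong) (auto simp: t'_def)
        then show ?thesis using N by (simp add: Q_def power_divide)
      qed
      finally show ?thesis using N by (simp add: sum_divide_distrib[symmetric] pos_le_divide_eq)
    qed
    with pos show ?thesis by blast
  qed
qed

text \<open>\<open>flat j k\<close> is the \<open>j\<close>-th derivative of \<open>x ^ (-k) * exp (- 1 / x)\<close>, extended by \<open>0\<close>.\<close>

fun flat :: "nat \<Rightarrow> nat \<Rightarrow> real \<Rightarrow> real" where
  "flat 0 k x = (if x > 0 then exp (- 1 / x) / x ^ k else 0)"
| "flat (Suc j) k x = - real k * flat j (Suc k) x + flat j (k + 2) x"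

text \<open>With \<open>y = 1 / x\<close> the claim compares \<open>y ^ k / fact k\<close>, one term
  of the exponential series, with \<open>exp y\<close>.\<close>

lemma flat0_bound: "\<bar>flat 0 k x\<bar> \<le> fact k"
proof (cases "x > 0")
  case True
  define y where "y = 1 / x"
  have y: "y > 0" using True by (simp add: y_def)
  have "y ^ k / fact k \<le> exp y"
  proof -
    have "(\<lambda>n. y ^ n / fact n) sums exp y" using exp_converges[of y] by (simp add: divide_inverse mult.commute)
    then show ?thesis using sum_le_suminf[of "\<lambda>n. y ^ n / fact n" "{k}"] y by (auto simp: sums_iff)
  qed
  then have "y ^ k * exp (- y) \<le> fact k" by (simp add: exp_minus divide_simps mult.commute)
  moreover have "flat 0 k x = y ^ k * exp (- y)" using True by (simp add: y_def power_one_over divide_simps)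
  ultimately show ?thesis using y by simp
qed simp

lemma flat0_deriv: "(flat 0 k has_real_derivative flat 1 k x) (at x)"
proof -
  consider "x > 0" | "x < 0" | "x = 0" by linarith
  then show ?thesis
  proof cases
    case 1
    have "((\<lambda>x. exp (- 1 / x) * inverse x ^ k) has_real_derivative
       (exp (- 1 / x) * (1 / x\<^sup>2)) * inverse x ^ k + exp (- 1 / x) * (real k * inverse x ^ (k - 1) * (- 1 / x\<^sup>2))) (at x)"
      using 1 by (auto intro!: derivative_eq_intros simp: power2_eq_square divide_inverse algebra_simps)
    moreover have "(exp (- 1 / x) * (1 / x\<^sup>2)) * inverse x ^ k + exp (- 1 / x) * (real k * inverse x ^ (k - 1) * (- 1 / x\<^sup>2)) = flat 1 k x"
      using 1 by (cases k) (auto simp: divide_inverse power2_eq_square power_inverse algebra_simps)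
    ultimately have "((\<lambda>x. exp (- 1 / x) * inverse x ^ k) has_real_derivative flat 1 k x) (at x)" by simp
    then show ?thesis
      by (rule has_field_derivative_transform_within_open[where S="{0<..}"])
         (use 1 in \<open>auto simp: divide_inverse power_inverse\<close>)
  next
    case 2
    have "((\<lambda>x. 0) has_real_derivative flat 1 k x) (at x)" using 2 by simp
    then show ?thesis
      by (rule has_field_derivative_transform_within_open[where S="{..<0}"]) (use 2 in auto)
  next
    case 3
    have "((\<lambda>h. (flat 0 k (0 + h) - flat 0 k 0) / h) \<longlongrightarrow> 0) (at 0)"
    proof (rule Lim_null_comparison)
      show "\<forall>\<^sub>F h in at 0. norm ((flat 0 k (0 + h) - flat 0 k 0) / h) \<le> fact (k + 2) * \<bar>h\<bar>"
      proof (intro always_eventually allI)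
        fix h :: real
        show "norm ((flat 0 k (0 + h) - flat 0 k 0) / h) \<le> fact (k + 2) * \<bar>h\<bar>"
        proof (cases "h > 0")
          case True
          \<comment> \<open>Raising the exponent by 2 pays for the division by \<open>h\<close> and
            leaves a factor \<open>h\<close>, which forces the limit 0.\<close>
          then have "norm ((flat 0 k (0 + h) - flat 0 k 0) / h) = \<bar>flat 0 (k + 2) h\<bar> * \<bar>h\<bar>"
            by (simp add: power_add power2_eq_square)
          then show ?thesis using mult_right_mono[OF flat0_bound[of "k + 2" h], of "\<bar>h\<bar>"] by simp
        next
          case False
          then have "norm ((flat 0 k (0 + h) - flat 0 k 0) / h) = 0" by simp
          moreover have "(0::real) \<le> fact (k + 2) * \<bar>h\<bar>" by (intro mult_nonneg_nonneg) auto
          ultimately show ?thesis by linarith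
        qed
      qed
      show "((\<lambda>h::real. fact (k + 2) * \<bar>h\<bar>) \<longlongrightarrow> 0) (at 0)"
        by (rule tendsto_mult_right_zero) (rule tendsto_rabs_zero[OF tendsto_ident_at])
    qed
    then show ?thesis using 3 by (simp add: DERIV_def)
  qed
qed

lemma flat_deriv: "(flat j k has_real_derivative flat (Suc j) k x) (at x)"
proof (induction j arbitrary: k)
  case 0
  show ?case using flat0_deriv by (simp only: One_nat_def)
next
  case (Suc j)
  show ?case unfolding flat.simps(2)[of j k, abs_def] flat.simps(2)[of "Suc j" k]
    by (intro derivative_intros Suc[of "Suc k"] Suc[of "k + 2"] | rule DERIV_add DERIV_cmult)+
qed

lemma flat_bound: "\<bar>flat j k x\<bar> \<le> 2 ^ j * fact (k + 2 * j)"
proof (induction j arbitrary: k)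
  case 0
  then show ?case using flat0_bound by simp
next
  case (Suc j)
  have "\<bar>flat (Suc j) k x\<bar> \<le> \<bar>- real k * flat j (Suc k) x\<bar> + \<bar>flat j (k + 2) x\<bar>"
    unfolding flat.simps by (rule abs_triangle_ineq)
  also have "\<bar>- real k * flat j (Suc k) x\<bar> = real k * \<bar>flat j (Suc k) x\<bar>" by (simp add: abs_mult)
  also have "\<dots> + \<bar>flat j (k + 2) x\<bar> \<le> real k * (2 ^ j * fact (Suc k + 2 * j)) + 2 ^ j * fact (k + 2 + 2 * j)"
    by (intro add_mono mult_left_mono Suc) auto
  also have "real k * (2 ^ j * fact (Suc k + 2 * j)) \<le> real (k + 2 * j + 2) * (2 ^ j * fact (Suc k + 2 * j))"
    by (intro mult_right_mono) auto
  also have "\<dots> = 2 ^ j * fact (k + 2 + 2 * j)"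
    by (simp add: algebra_simps)
  finally show ?case by (simp add: algebra_simps)
qed

text \<open>\<open>2 ^ j * fact (2 * j)\<close> grows in one step by at most
  \<open>8 * (j + 1)\<^sup>2\<close>, the right-hand side by \<open>32 ^ (2 * j + 1)\<close>. The
  base 32 of all coordinate bounds below stems from here.\<close>

lemma flat_weight: "\<bar>flat j 0 x\<bar> \<le> 32 ^ j\<^sup>2"
proof -
  have "2 ^ j * fact (2 * j) \<le> (32::real) ^ j\<^sup>2"
  proof (induction j)
    case (Suc j)
    have "Suc j \<le> 2 ^ j" by (induction j) auto
    then have j: "real (Suc j) \<le> 2 ^ j" by (metis of_nat_le_iff of_nat_numeral of_nat_power)
    have "2 * ((2 * real j + 2) * (2 * real j + 1)) \<le> 8 * (real (Suc j) * real (Suc j))"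
      by (simp add: algebra_simps)
    also have "\<dots> \<le> 8 * (2 ^ j * 2 ^ j)" by (intro mult_left_mono mult_mono j) auto
    also have "\<dots> = 8 * 4 ^ j" by (simp add: power_mult_distrib[symmetric])
    also have "\<dots> \<le> 32 * 32 ^ (2 * j)"
    proof -
      have "(32::real) ^ (2 * j) = 1024 ^ j" by (simp add: power_mult)
      moreover have "(4::real) ^ j \<le> 1024 ^ j" by (intro power_mono) auto
      moreover have "(0::real) \<le> 1024 ^ j" by simp
      ultimately show ?thesis by linarith
    qed
    finally have a: "2 * ((2 * real j + 2) * (2 * real j + 1)) \<le> 32 * 32 ^ (2 * j)" .
    have "2 ^ Suc j * fact (2 * Suc j) = (2 * ((2 * real j + 2) * (2 * real j + 1))) * (2 ^ j * fact (2 * j))"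
      by (simp add: algebra_simps)
    also have "\<dots> \<le> (32 * 32 ^ (2 * j)) * 32 ^ j\<^sup>2" by (intro mult_mono a Suc) auto
    also have "\<dots> = 32 ^ (Suc j)\<^sup>2" by (simp add: power_add[symmetric] power2_eq_square power_Suc[symmetric] del: power_Suc) 
    finally show ?case .
  qed simp
  then show ?thesis using flat_bound[of j 0 x] by simp
qed

lemma smooth_flat: "smooth (flat j k)"
  unfolding smooth_def
proof
  have D: "(flat j k has_derivative (\<lambda>v. flat (Suc j) k x * v)) (at x)" for j k x
    using flat_deriv[of j k x] by (simp add: has_field_derivative_def del: flat.simps)
  show "Cn n (flat j k)" for n
  proof (induction n arbitrary: j k)
    case 0
    show ?case using has_derivative_continuous[OF D] by (simp add: continuous_at_imp_continuous_on del: flat.simps)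
  next
    case (Suc n)
    show ?case by (rule Cn_SucI[OF D Cn_bilinear[OF bounded_bilinear_mult Suc Cn_const]])
  qed
qed

declare flat.simps [simp del]

text \<open>Distinct words of \<open>Wset s kk\<close> therefore have distinct multisets of letters,
  as in a Poincare-Birkhoff-Witt basis.\<close>

lemma sorted_pleq_unique:
  "sorted_wrt pleq xs \<Longrightarrow> sorted_wrt pleq ys \<Longrightarrow> mset xs = mset ys \<Longrightarrow> xs = ys"
proof (induction xs arbitrary: ys)
  case (Cons x xs)
  then obtain y ys' where ys: "ys = y # ys'" by (cases ys) auto
  have "pleq x y" using Cons.prems ys by (metis mset_eq_setD list.set_intros(1) set_ConsD sorted_wrt.simps(2) pleq_def order_refl)
  moreover have "pleq y x" using Cons.prems ys by (metis mset_eq_setD list.set_intros(1) set_ConsD sorted_wrt.simps(2) pleq_def order_refl)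
  ultimately have "x = y" by (auto simp: pleq_def prod_eq_iff)
  with Cons ys show ?case by auto
qed simp

text \<open>The value at a common zero of a word applied to a product with as many factors: each
  letter has to hit a factor of its own kind, for which there are \<open>count B b\<close> choices,
  and yields \<open>fst b\<close>.\<close>

fun ncount :: "(nat \<times> nat) list \<Rightarrow> (nat \<times> nat) multiset \<Rightarrow> real" where
  "ncount [] B = 1"
| "ncount (b # v) B = real (count B b) * real (fst b) * ncount v (B - {#b#})"

lemma ncount_pos: "(\<forall>b\<in>set v. 0 < fst b) \<Longrightarrow> mset v = B \<Longrightarrow> ncount v B > 0"
  by (induction v arbitrary: B) auto

lemma ncount_zero: "length v = size B \<Longrightarrow> mset v \<noteq> B \<Longrightarrow> ncount v B = 0"
proof (induction v arbitrary: B)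
  case (Cons b v)
  show ?case
  proof (cases "b \<in># B")
    case True
    then have "length v = size (B - {#b#})" "mset v \<noteq> B - {#b#}" using Cons.prems by (auto simp: size_Diff_singleton)
    with Cons.IH show ?thesis by simp
  qed (simp add: not_in_iff)
qed simp

section \<open>Derivative bounds in linear coordinates\<close>

context graded_lie
begin

definition "cube r = {y. \<forall>b\<in>I. \<bar>co b y\<bar> \<le> r}"

lemma compact_cube: "compact (cube r)"
proof -
  have "cube r = (\<Inter>b\<in>I. {y. \<bar>co b y\<bar> \<le> r})" by (auto simp: cube_def)
  then have "closed (cube r)"
    using smooth_continuous[OF smooth_co[OF smooth_id]]
    by (auto intro!: closed_INT closed_Collect_le continuous_on_rabs continuous_on_const)
  moreover have "norm y \<le> (\<Sum>b\<in>I. r * norm (E b))" if "y \<in> cube r" for y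
  proof -
    have "norm y = norm (\<Sum>b\<in>I. co b y *\<^sub>R E b)" using expand[of y] by simp
    also have "\<dots> \<le> (\<Sum>b\<in>I. r * norm (E b))"
      using that by (intro sum_norm_le) (auto simp: cube_def intro!: mult_right_mono)
    finally show ?thesis .
  qed
  ultimately show ?thesis by (auto simp: compact_eq_bounded_closed bounded_iff)
qed

interpretation c: fields "\<lambda>b x. E b" I
  by unfold_locales auto

text \<open>An algebra containing the coordinates and the functions \<open>flat\<close> of an affine
  coordinate, hence also the bumps and the polynomial coefficients of \<open>Y\<close>.\<close>

definition "pbd f \<longleftrightarrow> smooth f \<and> (\<exists>C\<ge>0. \<forall>p\<in>cube 1. c.jet 32 C C f p)"

lemma pbd_smooth: "pbd f \<Longrightarrow> smooth f" by (simp add: pbd_def)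

lemma pbd_const: "pbd (\<lambda>x. r)"
  unfolding pbd_def by (auto intro!: exI[of _ "\<bar>r\<bar>"] c.jet_const)

lemma pbd_add: assumes "pbd f" "pbd g" shows "pbd (\<lambda>x. f x + g x)"
proof -
  obtain C C' where "C \<ge> 0" "C' \<ge> 0" "\<And>p. p \<in> cube 1 \<Longrightarrow> c.jet 32 C C f p" "\<And>p. p \<in> cube 1 \<Longrightarrow> c.jet 32 C' C' g p"
    using assms unfolding pbd_def by blast
  with assms show ?thesis
    unfolding pbd_def by (auto intro!: smooth_add exI[of _ "C + C'"] c.jet_add)
qed

lemma pbd_mult: assumes "pbd f" "pbd g" shows "pbd (\<lambda>x. f x * g x)"
proof -
  obtain C C' where C: "C \<ge> 0" "C' \<ge> 0" "\<And>p. p \<in> cube 1 \<Longrightarrow> c.jet 32 C C f p" "\<And>p. p \<in> cube 1 \<Longrightarrow> c.jet 32 C' C' g p"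
    using assms unfolding pbd_def by blast
  have "c.jet 32 (3 * (C * C')) (3 * (C * C')) (\<lambda>x. f x * g x) p" if "p \<in> cube 1" for p
    by (rule c.jet_mono[OF c.jet_mult[OF _ pbd_smooth[OF assms(1)] pbd_smooth[OF assms(2)] C(3)[OF that] C(4)[OF that] C(1,2)]])
      (use C in \<open>auto simp: algebra_simps\<close>)
  with assms C show ?thesis
    unfolding pbd_def by (auto intro!: smooth_mult exI[of _ "3 * (C * C')"])
qed

lemma pbd_sum: "(\<And>i. i \<in> S \<Longrightarrow> pbd (f i)) \<Longrightarrow> pbd (\<lambda>x. \<Sum>i\<in>S. f i x)"
  by (induction S rule: infinite_finite_induct) (auto intro: pbd_const pbd_add)

lemma pbd_prod: "(\<And>i. i \<in> S \<Longrightarrow> pbd (f i)) \<Longrightarrow> pbd (\<lambda>x. \<Prod>i\<in>S. f i x)"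
  by (induction S rule: infinite_finite_induct) (auto intro: pbd_const pbd_mult)

lemma pbd_co: assumes "a \<in> I" shows "pbd (co a)"
proof -
  have d: "fw (\<lambda>b x. E b) [b] (co a) = (\<lambda>x. co a (E b))" for b
    using fd_eqI[OF bounded_linear_imp_has_derivative[OF linear_co[unfolded linear_conv_bounded_linear]]]
    by (auto simp: fun_eq_iff)
  have "\<bar>fw (\<lambda>b x. E b) w (co a) p\<bar> \<le> 1 * 32 ^ (length w)\<^sup>2" if w: "w \<in> lists I" "w \<noteq> []" for w p
  proof -
    obtain v b where v: "w = v @ [b]" using w(2) rev_exhaust by blast
    then have "fw (\<lambda>b x. E b) w (co a) p = (if v = [] then co a (E b) else 0)"
      using c.fw_const[of v] by (auto simp: fw_append d simp del: fw.simps(2))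
    moreover have "\<bar>co a (E b)\<bar> \<le> 1" using w(1) v assms by auto
    moreover have "1 \<le> (32::real) ^ (length w)\<^sup>2" by simp
    ultimately show ?thesis by (auto intro: order_trans)
  qed
  then have "c.jet 32 1 1 (co a) p" if "p \<in> cube 1" for p
    using that assms by (auto simp: c.jet_def cube_def)
  then show ?thesis unfolding pbd_def using smooth_co[OF smooth_id] by (auto intro!: exI[of _ 1])
qed

lemma pbd_flat: assumes "a \<in> I" "\<bar>\<sigma>\<bar> \<le> 1" shows "pbd (\<lambda>x. flat 0 0 (r + \<sigma> * co a x))"
proof -
  let ?l = "\<lambda>x. r + \<sigma> * co a x"
  have sm: "smooth (\<lambda>x. flat j 0 (?l x))" for j
    by (intro smooth_compose[OF smooth_flat] smooth_add smooth_mult smooth_co smooth_const smooth_id)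
  have "\<exists>\<kappa>. \<bar>\<kappa>\<bar> \<le> 1 \<and> fw (\<lambda>b x. E b) w (\<lambda>x. flat 0 0 (?l x)) = (\<lambda>x. \<kappa> * flat (length w) 0 (?l x))" if "w \<in> lists I" for w
    using that
  proof (induction w rule: list.induct)
    case Nil
    then show ?case by (intro exI[of _ 1]) auto
  next
    case (Cons b w)
    then obtain \<kappa> where k: "\<bar>\<kappa>\<bar> \<le> 1" "fw (\<lambda>b x. E b) w (\<lambda>x. flat 0 0 (?l x)) = (\<lambda>x. \<kappa> * flat (length w) 0 (?l x))" by auto
    have l: "(?l has_derivative (\<lambda>h. \<sigma> * co a h)) (at x)" for x
      by (auto intro!: derivative_eq_intros bounded_linear_imp_has_derivative[OF linear_co[unfolded linear_conv_bounded_linear]])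
    have f: "(flat (length w) 0 has_derivative (\<lambda>v. flat (Suc (length w)) 0 x * v)) (at x)" for x
      using flat_deriv[of "length w" 0 x] by (simp add: has_field_derivative_def)
    have "((\<lambda>x. \<kappa> * flat (length w) 0 (?l x)) has_derivative (\<lambda>h. \<kappa> * (flat (Suc (length w)) 0 (?l x) * (\<sigma> * co a h)))) (at x)" for x
      by (intro has_derivative_mult_right has_derivative_compose[OF l f])
    from fd_eqI[OF this] have "fw (\<lambda>b x. E b) (b # w) (\<lambda>x. flat 0 0 (?l x)) = (\<lambda>x. (\<kappa> * (\<sigma> * co a (E b))) * flat (length (b # w)) 0 (?l x))"
      by (simp add: k(2) fun_eq_iff)
    moreover have "\<bar>\<kappa> * (\<sigma> * co a (E b))\<bar> \<le> 1"
      using k(1) assms Cons.prems by (auto simp: abs_mult mult_le_one)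
    ultimately show ?case by blast
  qed
  then have b: "\<bar>fw (\<lambda>b x. E b) w (\<lambda>x. flat 0 0 (?l x)) p\<bar> \<le> 1 * 32 ^ (length w)\<^sup>2" if "w \<in> lists I" for w p
    using flat_weight[of "length w" "?l p"] that by (fastforce simp: abs_mult intro!: mult_mono order_trans[OF mult_left_le_one_le])
  have "c.jet 32 1 1 (\<lambda>x. flat 0 0 (?l x)) p" for p
    using b[of _ p] b[of "[]" p] by (auto simp: c.jet_def)
  then show ?thesis unfolding pbd_def using sm by (auto intro!: exI[of _ 1])
qed

lemma pbd_co_Mj: "b \<in> I \<Longrightarrow> pbd (\<lambda>x. co b (Mj j x y))"
proof (induction j arbitrary: b rule: less_induct)
  case (less j)
  show ?case
  proof (cases "j = 0")
    case False
    have "co b (br (\<pi> i x) z) = (\<Sum>a\<in>I. \<Sum>a'\<in>I. ((if fst a = i then 1 else 0) * co b (br (E a) (E a'))) * (co a x * co a' z))" for x z i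
    proof -
      have 1: "br y z = (\<Sum>a\<in>I. co a y *\<^sub>R br (E a) z)" for y z
        by (subst expand[of y]) (simp only: br_left)
      have 2: "br y z = (\<Sum>a'\<in>I. co a' z *\<^sub>R br y (E a'))" for y z
        by (subst expand[of z]) (simp only: br_right)
      have "br (\<pi> i x) z = (\<Sum>a\<in>I. \<Sum>a'\<in>I. (co a (\<pi> i x) * co a' z) *\<^sub>R br (E a) (E a'))"
        unfolding 1[of "\<pi> i x"] by (intro sum.cong refl) (subst 2, simp add: scaleR_sum_right)
      then show ?thesis by (simp only: co_linear_simps co_scale) (auto intro!: sum.cong)
    qed
    then have "co b (Mj j x y) = (1 / real j) * (\<Sum>i\<in>{1..j}. \<Sum>a\<in>I. \<Sum>a'\<in>I. ((if fst a = i then 1 else 0) * co b (br (E a) (E a'))) * (co a x * co a' (Mj (j - i) x y)))" for x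
      using False by (subst Mj.simps) simp
    moreover have "pbd (\<lambda>x. (1 / real j) * (\<Sum>i\<in>{1..j}. \<Sum>a\<in>I. \<Sum>a'\<in>I. ((if fst a = i then 1 else 0) * co b (br (E a) (E a'))) * (co a x * co a' (Mj (j - i) x y))))"
      by (intro pbd_mult pbd_const pbd_sum pbd_co less) (use False in auto)
    ultimately show ?thesis by simp
  qed (simp add: pbd_const)
qed

lemma pbd_co_Y: "b \<in> I \<Longrightarrow> pbd (\<lambda>x. co b (Y a x))"
  unfolding Y_def Yv_def M_def co_linear_simps by (intro pbd_sum pbd_co_Mj)

text \<open>Every letter of \<open>w\<close> is a combination of coordinate derivatives with
  controlled coefficients. Letting \<open>u\<close> and \<open>w\<close> share one exponent
  \<open>(length u + length w)\<^sup>2\<close> makes the induction close: a letter costs just the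
  factor \<open>2 * card I * Q\<close>.\<close>

lemma fw_coordinate_bound:
  assumes f: "smooth f" and fb: "\<And>u. u \<in> lists I \<Longrightarrow> \<bar>fw (\<lambda>b x. E b) u f p\<bar> \<le> C * 32 ^ (length u)\<^sup>2"
    and q: "\<And>a b. a \<in> I \<Longrightarrow> b \<in> I \<Longrightarrow> c.jet 32 Q Q (\<lambda>x. co b (Y a x)) p" and w: "w \<in> lists I" and u: "u \<in> lists I"
    and Q: "Q \<ge> 0" and C: "C \<ge> 0"
  shows "\<bar>fw (\<lambda>b x. E b) u (fw Y w f) p\<bar> \<le> C * (2 * real (card I) * Q) ^ length w * 32 ^ (length u + length w)\<^sup>2"
  using w u
proof (induction w arbitrary: u rule: list.induct)
  case Nil
  then show ?case using fb by simp
next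
  case (Cons a w)
  let ?D = "\<lambda>b x. E b" and ?G = "fw Y w f" and ?i = "length u"
  define N where "N = Suc (length u + length w)"
  define K where "K = C * (2 * real (card I) * Q) ^ length w"
  have K: "K \<ge> 0" using C Q by (simp add: K_def)
  have smG: "smooth ?G" by (rule smooth_fw[OF f])
  have qsm: "smooth (\<lambda>x. co b (Y a x))" for b by (rule smooth_co[OF smooth_Y])
  have "fw Y (a # w) f = (\<lambda>x. \<Sum>b\<in>I. co b (Y a x) * fw ?D [b] ?G x)"
  proof
    fix x
    have "frechet_derivative ?G (at x) (Y a x) = frechet_derivative ?G (at x) (\<Sum>b\<in>I. co b (Y a x) *\<^sub>R E b)"
      using expand[of "Y a x"] by simp
    then show "fw Y (a # w) f x = (\<Sum>b\<in>I. co b (Y a x) * fw ?D [b] ?G x)"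
      by (simp add: linear_sum[OF smooth_linear_fd[OF smG]] linear_scale[OF smooth_linear_fd[OF smG]])
  qed
  then have eq: "fw ?D u (fw Y (a # w) f) p = (\<Sum>b\<in>I. fw ?D u (\<lambda>x. co b (Y a x) * fw ?D [b] ?G x) p)"
    by (simp only: c.fw_sum[of I "\<lambda>b x. co b (Y a x) * fw ?D [b] ?G x" u, OF smooth_mult[OF qsm c.smooth_fw[OF smG]]])
  have "\<bar>fw ?D u (fw Y (a # w) f) p\<bar> \<le> (\<Sum>b\<in>I. Q * K * (2 * 32 ^ N\<^sup>2))"
    unfolding eq
  proof (intro order_trans[OF sum_abs] sum_mono)
    fix b assume b: "b \<in> I"
    have "\<bar>fw ?D u (\<lambda>x. co b (Y a x) * fw ?D [b] ?G x) p\<bar>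
      \<le> (\<Sum>j\<le>?i. real (?i choose j) * (Q * 32 ^ j\<^sup>2) * (K * 32 ^ (?i - j + 1 + length w)\<^sup>2))"
    proof (rule c.fw_mult_bound[OF qsm c.smooth_fw[OF smG] Cons.prems(2)])
      fix v assume v: "v \<in> lists I"
      have j: "c.jet 32 Q Q (\<lambda>x. co b (Y a x)) p" using q[of a b] Cons.prems b by simp
      show "\<bar>fw ?D v (\<lambda>x. co b (Y a x)) p\<bar> \<le> Q * 32 ^ (length v)\<^sup>2"
        using c.jetD[OF j v] c.jet_val[OF j] by (cases "v = []") auto
      have "\<bar>fw ?D (v @ [b]) ?G p\<bar> \<le> K * 32 ^ (length (v @ [b]) + length w)\<^sup>2"
        unfolding K_def by (rule Cons.IH) (use Cons.prems v b in auto)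
      then show "\<bar>fw ?D v (fw ?D [b] ?G) p\<bar> \<le> K * 32 ^ (length v + 1 + length w)\<^sup>2"
        by (simp add: fw_append)
    qed
    also have "\<dots> = Q * K * (\<Sum>j\<le>?i. real (?i choose j) * 32 ^ j\<^sup>2 * 32 ^ (N - j)\<^sup>2)"
      unfolding sum_distrib_left
    proof (rule sum.cong[OF refl])
      fix j assume "j \<in> {..?i}"
      then have "?i - j + 1 + length w = N - j" by (auto simp: N_def)
      then show "real (?i choose j) * (Q * 32 ^ j\<^sup>2) * (K * 32 ^ (?i - j + 1 + length w)\<^sup>2) = Q * K * (real (?i choose j) * 32 ^ j\<^sup>2 * 32 ^ (N - j)\<^sup>2)"
        by simp
    qed
    also have "\<dots> \<le> Q * K * (2 * 32 ^ N\<^sup>2)"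
    proof (intro mult_left_mono)
      \<comment> \<open>Replacing \<open>?i choose j\<close> by \<open>N choose j\<close> completes
        the convolution; the term \<open>j = 0\<close> is estimated apart, whence the factor
        2.\<close>
      have "(\<Sum>j\<le>?i. real (?i choose j) * 32 ^ j\<^sup>2 * 32 ^ (N - j)\<^sup>2) \<le> (\<Sum>j\<in>{..<N}. real (N choose j) * 32 ^ j\<^sup>2 * 32 ^ (N - j)\<^sup>2)"
      proof (rule sum_mono2[OF _ _ _, THEN order_trans[rotated]])
        show "(\<Sum>j\<le>?i. real (?i choose j) * 32 ^ j\<^sup>2 * 32 ^ (N - j)\<^sup>2) \<le> (\<Sum>j\<le>?i. real (N choose j) * 32 ^ j\<^sup>2 * (32::real) ^ (N - j)\<^sup>2)"
          by (intro sum_mono mult_right_mono) (auto simp: N_def intro!: binomial_right_mono)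
      qed (auto simp: N_def)
      also have "{..<N} = insert 0 {1..<N}" by (auto simp: N_def)
      also have "(\<Sum>j\<in>insert 0 {1..<N}. real (N choose j) * 32 ^ j\<^sup>2 * 32 ^ (N - j)\<^sup>2) \<le> 32 ^ N\<^sup>2 + 32 ^ N\<^sup>2"
        using square_weight_convolution[of 32 N] by simp
      finally show "(\<Sum>j\<le>?i. real (?i choose j) * 32 ^ j\<^sup>2 * 32 ^ (N - j)\<^sup>2) \<le> 2 * (32::real) ^ N\<^sup>2" by simp
    qed (use Q K in auto)
    finally show "\<bar>fw ?D u (\<lambda>x. co b (Y a x) * fw ?D [b] ?G x) p\<bar> \<le> Q * K * (2 * 32 ^ N\<^sup>2)" .
  qed
  then show ?case by (simp add: K_def N_def algebra_simps)
qed

subsection \<open>The test functions\<close>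

text \<open>Positive on \<open>cube (1/2)\<close>, whose translates by lattice points cover the
  group, and supported in \<open>cube (3/4)\<close>, well inside the open unit cube that defines
  \<open>near\<close>.\<close>

definition "chi x = (\<Prod>b\<in>I. flat 0 0 (3/4 + 1 * co b x) * flat 0 0 (3/4 + (-1) * co b x))"
definition "cmon l x = prod_list (map (\<lambda>b. co b x) l)"
definition "tf l x = chi x * cmon l x"
text \<open>Words are not sorted, so a monomial occurs several times; what counts is that the
  monomials span the polynomials of degree at most \<open>s\<close>.\<close>

definition "Ls = {l \<in> lists I. length l \<le> s}"

lemma finite_Ls: "finite Ls"
  unfolding Ls_def using finite_lists_length_le[OF finite_idx, of s kk s] by (simp add: lists_eq_set conj_commute)

lemma finite_Wset [simp]: "finite (Wset s kk)"
  by (rule finite_subset[OF _ finite_lists_length_le[OF finite_idx, of s kk s]]) (auto simp: Wset_def)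

lemma Wset_lists: "w \<in> Wset s kk \<Longrightarrow> w \<in> lists I \<and> w \<noteq> [] \<and> length w \<le> s"
  by (auto simp: Wset_def)

lemma pbd_mon: "l \<in> lists I \<Longrightarrow> pbd (cmon l)"
  unfolding cmon_def by (induction l) (auto intro: pbd_const pbd_mult pbd_co)

lemma pbd_chi: "pbd chi"
  unfolding chi_def by (intro pbd_prod pbd_mult pbd_flat) auto

lemma pbd_f: "l \<in> lists I \<Longrightarrow> pbd (tf l)"
  unfolding tf_def by (intro pbd_mult pbd_chi pbd_mon)

lemma smooth_f: "l \<in> lists I \<Longrightarrow> smooth (tf l)" and smooth_chi: "smooth chi" and smooth_mon: "l \<in> lists I \<Longrightarrow> smooth (cmon l)"
  using pbd_f pbd_chi pbd_mon pbd_smooth by auto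

lemma chi_pos: "x \<in> cube (1/2) \<Longrightarrow> chi x > 0"
  unfolding chi_def by (intro prod_pos) (force simp: cube_def flat.simps abs_le_iff intro!: mult_pos_pos)

lemma chi_support: "x \<notin> cube (3/4) \<Longrightarrow> chi x = 0"
  unfolding chi_def by (force simp: cube_def flat.simps abs_le_iff prod_zero_iff)

lemma fw_f_outside: "l \<in> lists I \<Longrightarrow> x \<notin> cube (3/4) \<Longrightarrow> fw Y w (tf l) x = 0"
proof -
  assume l: "l \<in> lists I" and x: "x \<notin> cube (3/4)"
  have "fw Y w (tf l) x = fw Y w (\<lambda>x. 0) x"
    by (rule fw_local[of "- cube (3/4)"]) (use x chi_support in \<open>auto simp: tf_def compact_imp_closed[OF compact_cube]\<close>)
  then show ?thesis by (cases "w = []") (auto simp: fw_const)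
qed

text \<open>The cost \<open>R\<close> per letter goes into the base, since
  \<open>R ^ n \<le> (1 + R) ^ n\<^sup>2\<close>. Outside the support all derivatives vanish, so the
  bound on the unit cube is global.\<close>

lemma f_jet_bound: "\<exists>B Ca. B \<ge> 2 \<and> Ca > 0 \<and> (\<forall>l\<in>Ls. \<forall>w\<in>lists I. \<forall>p. \<bar>fw Y w (tf l) p\<bar> \<le> Ca * B ^ (length w)\<^sup>2)"
proof -
  have "\<forall>a\<in>I. \<forall>b\<in>I. \<exists>Q\<ge>0. \<forall>p\<in>cube 1. c.jet 32 Q Q (\<lambda>x. co b (Y a x)) p"
    using pbd_co_Y unfolding pbd_def by blast
  then obtain q where q: "\<And>a b. a \<in> I \<Longrightarrow> b \<in> I \<Longrightarrow> q a b \<ge> 0 \<and> (\<forall>p\<in>cube 1. c.jet 32 (q a b) (q a b) (\<lambda>x. co b (Y a x)) p)"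
    by metis
  define Q where "Q = 1 + (\<Sum>a\<in>I. \<Sum>b\<in>I. q a b)"
  have qQ: "q a b \<le> Q" if "a \<in> I" "b \<in> I" for a b
  proof -
    have "q a b \<le> (\<Sum>b\<in>I. q a b)" using that q by (intro member_le_sum) auto
    also have "\<dots> \<le> (\<Sum>a\<in>I. \<Sum>b\<in>I. q a b)" using that q by (intro member_le_sum[of a I "\<lambda>a. \<Sum>b\<in>I. q a b"] sum_nonneg) auto
    finally show ?thesis by (simp add: Q_def)
  qed
  have Q: "Q \<ge> 1" unfolding Q_def using q by (auto intro!: sum_nonneg)
  have jQ: "c.jet 32 Q Q (\<lambda>x. co b (Y a x)) p" if "a \<in> I" "b \<in> I" "p \<in> cube 1" for a b p
    using q[OF that(1,2)] qQ[OF that(1,2)] that(3) by (blast intro: c.jet_mono zero_le_numeral)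
  have "\<forall>l\<in>Ls. \<exists>C\<ge>0. \<forall>p\<in>cube 1. c.jet 32 C C (tf l) p"
    using pbd_f unfolding pbd_def Ls_def by blast
  then obtain cf where cf: "\<And>l. l \<in> Ls \<Longrightarrow> cf l \<ge> 0 \<and> (\<forall>p\<in>cube 1. c.jet 32 (cf l) (cf l) (tf l) p)" by metis
  define C where "C = 1 + (\<Sum>l\<in>Ls. cf l)"
  have C: "C \<ge> 1" unfolding C_def using cf by (auto intro!: sum_nonneg)
  have cfC: "cf l \<le> C" if "l \<in> Ls" for l
    using member_le_sum[of l Ls cf] that cf finite_Ls by (auto simp: C_def)
  define R where "R = 2 * real (card I) * Q"
  have R: "R \<ge> 0" using Q by (simp add: R_def)
  have "\<bar>fw Y w (tf l) p\<bar> \<le> C * (32 * (1 + R)) ^ (length w)\<^sup>2" if l: "l \<in> Ls" and w: "w \<in> lists I" for l w p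
  proof (cases "p \<in> cube (3/4)")
    case False
    then show ?thesis using fw_f_outside[of l p w] l R C by (auto simp: Ls_def)
  next
    case True
    then have p: "p \<in> cube 1" by (force simp: cube_def)
    have j: "c.jet 32 C C (tf l) p" using cf[OF l] cfC[OF l] p by (blast intro: c.jet_mono zero_le_numeral)
    have "\<bar>fw (\<lambda>b x. E b) [] (fw Y w (tf l)) p\<bar> \<le> C * (2 * real (card I) * Q) ^ length w * 32 ^ (length ([] :: (nat \<times> nat) list) + length w)\<^sup>2"
    proof (rule fw_coordinate_bound[OF _ _ jQ w])
      show "smooth (tf l)" using l smooth_f by (auto simp: Ls_def)
      fix u assume u: "u \<in> lists I"
      show "\<bar>fw (\<lambda>b x. E b) u (tf l) p\<bar> \<le> C * 32 ^ (length u)\<^sup>2"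
        using c.jetD[OF j u] c.jet_val[OF j] by (cases "u = []") auto
    qed (use p Q C in auto)
    then have "\<bar>fw Y w (tf l) p\<bar> \<le> C * (R ^ length w * 32 ^ (length w)\<^sup>2)" by (simp add: R_def mult.assoc)
    also have "\<dots> \<le> C * ((1 + R) ^ (length w)\<^sup>2 * 32 ^ (length w)\<^sup>2)"
    proof (intro mult_left_mono mult_right_mono)
      have "R ^ length w \<le> (1 + R) ^ length w" using R by (intro power_mono) auto
      also have "\<dots> \<le> (1 + R) ^ (length w)\<^sup>2" using R by (intro power_increasing) (auto simp: power2_eq_square Suc_le_eq)
      finally show "R ^ length w \<le> (1 + R) ^ (length w)\<^sup>2" .
    qed (use C in auto)
    finally show ?thesis unfolding power_mult_distrib by (simp only: mult.commute)
  qed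
  moreover have "32 * (1 + R) \<ge> 2" using R by simp
  ultimately show ?thesis using C by (intro exI[of _ "32 * (1 + R)"] exI[of _ C]) auto
qed

lemma fw_prod_mset:
  assumes h: "\<And>a. smooth (h a)" and B: "set_mset B \<subseteq> I"
  shows "smooth (\<lambda>x. \<Prod>a\<in>#B. h a x)"
    and "fw Y [b] (\<lambda>x. \<Prod>a\<in>#B. h a x) x = (\<Sum>a\<in>I. real (count B a) * (fw Y [b] (h a) x * (\<Prod>a'\<in>#(B - {#a#}). h a' x)))"
proof -
  show sm: "smooth (\<lambda>x. \<Prod>a\<in>#B. h a x)" for B by (induction B) (auto intro: smooth_mult h)
  show "fw Y [b] (\<lambda>x. \<Prod>a\<in>#B. h a x) x = (\<Sum>a\<in>I. real (count B a) * (fw Y [b] (h a) x * (\<Prod>a'\<in>#(B - {#a#}). h a' x)))"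
    using B
  proof (induction B)
    case empty
    then show ?case using fw_const[of "[b]" 1] by simp
  next
    case (add c B)
    let ?P = "\<lambda>B. \<Prod>a\<in>#B. h a x" and ?D = "\<lambda>a. fw Y [b] (h a) x"
    have "fw Y [b] (\<lambda>x. \<Prod>a\<in>#add_mset c B. h a x) x = ?D c * ?P B + h c x * (\<Sum>a\<in>I. real (count B a) * (?D a * ?P (B - {#a#})))"
      using add fw_mult1[OF h sm, of b c B] by (simp del: fw.simps)
    also have "h c x * (\<Sum>a\<in>I. real (count B a) * (?D a * ?P (B - {#a#}))) = (\<Sum>a\<in>I. real (count B a) * (?D a * ?P (add_mset c B - {#a#})))"
      unfolding sum_distrib_left
    proof (rule sum.cong[OF refl])
      fix a
      show "h c x * (real (count B a) * (?D a * ?P (B - {#a#}))) = real (count B a) * (?D a * ?P (add_mset c B - {#a#}))"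
      proof (cases "a \<in># B")
        case True
        then have "add_mset c B - {#a#} = add_mset c (B - {#a#})" by (metis add_mset_remove_trivial insert_DiffM2 diff_union_swap2 multi_self_add_other_not_self union_mset_add_mset_right)
        then show ?thesis by simp
      qed (simp add: not_in_iff)
    qed
    also have "?D c * ?P B = (\<Sum>a\<in>I. if a = c then ?D a * ?P (add_mset c B - {#a#}) else 0)"
      using add.prems by (subst sum.delta) auto
    also have "\<dots> + (\<Sum>a\<in>I. real (count B a) * (?D a * ?P (add_mset c B - {#a#})))
      = (\<Sum>a\<in>I. real (count (add_mset c B) a) * (?D a * ?P (add_mset c B - {#a#})))"
      unfolding sum.distrib[symmetric] by (rule sum.cong) (auto simp: algebra_simps)
    finally show ?case .
  qed
qed

text \<open>A product of \<open>size B\<close> factors vanishing at \<open>y\<close> is killed by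
  shorter words. At equal length each letter must fall on a factor, and \<open>hd\<close> leaves
  only pairings of equal letters. The word is reversed because its last letter acts first.\<close>

lemma fw_vanishing_product:
  assumes h: "\<And>a. smooth (h a)" and h0: "\<And>a. a \<in> I \<Longrightarrow> h a y = 0"
    and hd: "\<And>a b. a \<in> I \<Longrightarrow> b \<in> I \<Longrightarrow> fw Y [b] (h a) y = (if a = b then real (fst b) else 0)"
    and w: "w \<in> lists I" and B: "set_mset B \<subseteq> I" and u: "smooth u" and le: "length w \<le> size B"
  shows "fw Y w (\<lambda>x. u x * (\<Prod>a\<in>#B. h a x)) y = (if length w = size B then u y * ncount (rev w) B else 0)"
  using w B u le
proof (induction w arbitrary: B u rule: rev_induct)
  case Nil
  show ?case
  proof (cases "B = {#}")
    case False
    then obtain a where "a \<in># B" by blast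
    then have "a \<in># B" "h a y = 0" using h0[of a] Nil by auto
    then have "(\<Prod>a\<in>#B. h a y) = 0" by (force simp: prod_mset_zero_iff)
    then show ?thesis using False by simp
  qed simp
next
  case (snoc b w)
  have b: "b \<in> I" "w \<in> lists I" using snoc.prems by auto
  let ?P = "\<lambda>B x. \<Prod>a\<in>#B. h a x"
  have smP: "smooth (?P B')" if "set_mset B' \<subseteq> I" for B' by (rule fw_prod_mset(1)[OF h that])
  have sub: "set_mset (B - {#a#}) \<subseteq> I" for a using snoc.prems(2) by (meson in_diffD subset_iff)
  have smh: "smooth (fw Y [b] (h a))" for a by (rule smooth_fw[OF h])
  have smu: "smooth (fw Y [b] u)" by (rule smooth_fw[OF snoc.prems(3)])
  have e: "fw Y [b] (\<lambda>x. u x * ?P B x) = (\<lambda>x. fw Y [b] u x * ?P B x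
     + (\<Sum>a\<in>I. real (count B a) * ((u x * fw Y [b] (h a) x) * ?P (B - {#a#}) x)))"
    unfolding fw_mult1[OF snoc.prems(3) smP[OF snoc.prems(2)]] fw_prod_mset(2)[OF h snoc.prems(2)] sum_distrib_left
    by (simp add: algebra_simps)
  have "fw Y (w @ [b]) (\<lambda>x. u x * ?P B x) y = fw Y w (\<lambda>x. fw Y [b] u x * ?P B x) y
     + (\<Sum>a\<in>I. real (count B a) * fw Y w (\<lambda>x. (u x * fw Y [b] (h a) x) * ?P (B - {#a#}) x) y)"
  proof -
    have s1: "smooth (\<lambda>x. (u x * fw Y [b] (h a) x) * ?P (B - {#a#}) x)" for a
      by (intro smooth_mult snoc.prems smh smP sub)
    have s2: "smooth (\<lambda>x. real (count B a) * ((u x * fw Y [b] (h a) x) * ?P (B - {#a#}) x))" for a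
      by (intro smooth_mult[OF smooth_const s1])
    have s3: "smooth (\<lambda>x. fw Y [b] u x * ?P B x)" by (intro smooth_mult smu smP snoc.prems)
    show ?thesis unfolding fw_append e
      by (subst fw_add[OF s3 smooth_sum[OF s2]], subst fw_sum[OF s2], subst fw_cmult[OF s1]) simp
  qed
  also have "fw Y w (\<lambda>x. fw Y [b] u x * ?P B x) y = 0"
    using snoc.IH[OF b(2) snoc.prems(2) smu] snoc.prems(4) by simp
  also have "(\<Sum>a\<in>I. real (count B a) * fw Y w (\<lambda>x. (u x * fw Y [b] (h a) x) * ?P (B - {#a#}) x) y)
     = (\<Sum>a\<in>I. if a = b then (if Suc (length w) = size B then u y * (real (count B b) * real (fst b) * ncount (rev w) (B - {#b#})) else 0) else 0)"
  proof (rule sum.cong[OF refl])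
    fix a assume a: "a \<in> I"
    show "real (count B a) * fw Y w (\<lambda>x. (u x * fw Y [b] (h a) x) * ?P (B - {#a#}) x) y
     = (if a = b then (if Suc (length w) = size B then u y * (real (count B b) * real (fst b) * ncount (rev w) (B - {#b#})) else 0) else 0)"
    proof (cases "a \<in># B")
      case True
      then have sz: "Suc (size (B - {#a#})) = size B" by (metis insert_DiffM size_add_mset)
      have "fw Y w (\<lambda>x. (u x * fw Y [b] (h a) x) * ?P (B - {#a#}) x) y
        = (if length w = size (B - {#a#}) then (u y * fw Y [b] (h a) y) * ncount (rev w) (B - {#a#}) else 0)"
        by (rule snoc.IH[OF b(2) sub smooth_mult[OF snoc.prems(3) smh]]) (use snoc.prems(4) sz in auto)
      then show ?thesis using sz hd[OF a b(1)] by auto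
    qed (auto simp: not_in_iff)
  qed
  also have "\<dots> = (if Suc (length w) = size B then u y * (real (count B b) * real (fst b) * ncount (rev w) (B - {#b#})) else 0)"
    using b by (subst sum.delta) auto
  finally show ?case by simp
qed

text \<open>The Poincare-Birkhoff-Witt argument. A longest word \<open>\<alpha>0\<close> with
  nonzero coefficient is tested against \<open>chi\<close> times the product of the coordinates
  centred at \<open>y\<close> named by its letters. Shorter words give 0, and so do words of the
  same length with other letters; sortedness leaves only \<open>\<alpha>0\<close>.\<close>

lemma f_nondegenerate:
  assumes y: "y \<in> cube (1/2)" and T0: "\<And>l. l \<in> Ls \<Longrightarrow> (\<Sum>\<alpha>\<in>Wset s kk. t \<alpha> * fw Y \<alpha> (tf l) y) = 0"
  shows "\<forall>\<alpha>\<in>Wset s kk. t \<alpha> = 0"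
proof (rule ccontr)
  assume "\<not> (\<forall>\<alpha>\<in>Wset s kk. t \<alpha> = 0)"
  then have ne: "{\<alpha> \<in> Wset s kk. t \<alpha> \<noteq> 0} \<noteq> {}" by blast
  define T where "T h = (\<Sum>\<alpha>\<in>Wset s kk. t \<alpha> * fw Y \<alpha> h y)" for h
  define h where "h a x = co a (ld y x)" for a x
  have smh: "smooth (h a)" for a unfolding h_def[abs_def] by (rule smooth_co[OF smooth_ld])
  have Tadd: "T (\<lambda>x. g x + g' x) = T g + T g'" if "smooth g" "smooth g'" for g g'
    using that by (simp add: T_def fw_add sum.distrib algebra_simps)
  have Tc: "T (\<lambda>x. r * g x) = r * T g" if "smooth g" for g r
    using that by (simp add: T_def fw_cmult sum_distrib_left algebra_simps)
  have Tsum: "T (\<lambda>x. \<Sum>b\<in>I. g b x) = (\<Sum>b\<in>I. T (g b))" if "\<And>b. b \<in> I \<Longrightarrow> smooth (g b)" for g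
    using that by (simp add: T_def fw_sum sum_distrib_left sum.swap[of _ I])
  have smP: "smooth (\<lambda>x. prod_list (map (\<lambda>a. h a x) bs))" for bs
    by (induction bs) (auto intro: smooth_mult smh)
  \<comment> \<open>Coordinates centred at \<open>y\<close> are affine in the original ones, because
    \<open>ld y\<close> is affine. Products of at most \<open>s\<close> of them therefore expand
    into the available test functions.\<close>
  have kill: "T (\<lambda>x. tf l x * prod_list (map (\<lambda>a. h a x) bs)) = 0" 
    if "l \<in> lists I" "bs \<in> lists I" "length l + length bs \<le> s" for l bs
    using that
  proof (induction bs arbitrary: l rule: list.induct)
    case Nil
    then show ?case using T0[of l] by (simp add: T_def Ls_def)
  next
    case (Cons a bs)
    let ?P = "\<lambda>x. prod_list (map (\<lambda>a. h a x) bs)"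
    have "h a x = co a (N y (- y)) + (\<Sum>b\<in>I. co a (N y (E b)) * co b x)" for x
    proof -
      have "h a x = co a (N y (- y)) + co a (N y x)" by (simp add: h_def ld_def linear_diff[OF linear_N] linear_neg[OF linear_N])
      also have "N y x = N y (\<Sum>b\<in>I. co b x *\<^sub>R E b)" using expand[of x] by simp
      also have "\<dots> = (\<Sum>b\<in>I. co b x *\<^sub>R N y (E b))" by (simp add: linear_sum[OF linear_N] linear_scale[OF linear_N])
      finally show ?thesis by (simp add: mult.commute)
    qed
    then have "(\<lambda>x. tf l x * prod_list (map (\<lambda>a. h a x) (a # bs)))
      = (\<lambda>x. co a (N y (- y)) * (tf l x * ?P x) + (\<Sum>b\<in>I. co a (N y (E b)) * (tf (b # l) x * ?P x)))"
      by (simp add: tf_def cmon_def algebra_simps sum_distrib_left sum_distrib_right)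
    moreover have s1: "smooth (\<lambda>x. tf l x * ?P x)" using Cons.prems by (intro smooth_mult smooth_f smP) 
    moreover have s2: "smooth (\<lambda>x. tf (b # l) x * ?P x)" if "b \<in> I" for b
      using Cons.prems that by (intro smooth_mult smooth_f smP) auto
    ultimately have "T (\<lambda>x. tf l x * prod_list (map (\<lambda>a. h a x) (a # bs)))
       = co a (N y (- y)) * T (\<lambda>x. tf l x * ?P x) + (\<Sum>b\<in>I. co a (N y (E b)) * T (\<lambda>x. tf (b # l) x * ?P x))"
      by (simp add: Tadd Tsum Tc smooth_sum smooth_mult)
    also have "\<dots> = 0" using Cons by simp
    finally show ?case .
  qed
  define m where "m = Max (length ` {\<alpha> \<in> Wset s kk. t \<alpha> \<noteq> 0})"
  have fin: "finite {\<alpha> \<in> Wset s kk. t \<alpha> \<noteq> 0}" by simp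
  have "m \<in> length ` {\<alpha> \<in> Wset s kk. t \<alpha> \<noteq> 0}" unfolding m_def using ne fin by (intro Max_in) auto
  then obtain \<alpha>0 where a0: "\<alpha>0 \<in> Wset s kk" "t \<alpha>0 \<noteq> 0" "length \<alpha>0 = m" by auto
  have le: "length \<alpha> \<le> m" if "\<alpha> \<in> Wset s kk" "t \<alpha> \<noteq> 0" for \<alpha>
    unfolding m_def using that fin by (intro Max_ge) auto
  have a0': "\<alpha>0 \<in> lists I" "length \<alpha>0 \<le> s" using Wset_lists[OF a0(1)] by auto
  have h0: "h a y = 0" for a by (simp add: h_def ld_def linear_0[OF linear_N])
  have hd: "fw Y [b] (h a) y = (if a = b then real (fst b) else 0)" if "a \<in> I" "b \<in> I" for a b
  proof -
    have "fw Y [b] (h a) y = fw Y [b] (co a) (ld y y)"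
      unfolding h_def[abs_def] using fw_ld[of "[b]" "co a" y] that smooth_co[OF smooth_id] by (simp del: fw.simps)
    also have "ld y y = 0" by (simp add: ld_def linear_0[OF linear_N])
    also have "fw Y [b] (co a) 0 = co a (Y b 0)"
      using fd_eqI[OF bounded_linear_imp_has_derivative[OF linear_co[unfolded linear_conv_bounded_linear]]] by simp
    also have "\<dots> = (if a = b then real (fst b) else 0)" using that by (simp add: Y_def Yv_def)
    finally show ?thesis .
  qed
  have "T (\<lambda>x. tf [] x * prod_list (map (\<lambda>a. h a x) \<alpha>0)) = 0" by (rule kill) (use a0' in auto)
  moreover have "(\<lambda>x. tf [] x * prod_list (map (\<lambda>a. h a x) \<alpha>0)) = (\<lambda>x. chi x * (\<Prod>a\<in>#mset \<alpha>0. h a x))"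
    by (simp add: tf_def cmon_def prod_mset_prod_list flip: mset_map)
  moreover have "T (\<lambda>x. chi x * (\<Prod>a\<in>#mset \<alpha>0. h a x)) = (\<Sum>\<alpha>\<in>Wset s kk. if \<alpha> = \<alpha>0 then t \<alpha>0 * (chi y * ncount (rev \<alpha>0) (mset \<alpha>0)) else 0)"
    unfolding T_def
  proof (rule sum.cong[OF refl])
    fix \<alpha> assume a: "\<alpha> \<in> Wset s kk"
    show "t \<alpha> * fw Y \<alpha> (\<lambda>x. chi x * (\<Prod>a\<in>#mset \<alpha>0. h a x)) y = (if \<alpha> = \<alpha>0 then t \<alpha>0 * (chi y * ncount (rev \<alpha>0) (mset \<alpha>0)) else 0)"
    proof (cases "t \<alpha> = 0")
      case True
      then show ?thesis using a0 by auto
    next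
      case False
      have "fw Y \<alpha> (\<lambda>x. chi x * (\<Prod>a\<in>#mset \<alpha>0. h a x)) y = (if length \<alpha> = size (mset \<alpha>0) then chi y * ncount (rev \<alpha>) (mset \<alpha>0) else 0)"
        by (rule fw_vanishing_product[OF smh h0 hd]) (use Wset_lists[OF a] a0' a0 le[OF a False] smooth_chi in auto)
      moreover have "ncount (rev \<alpha>) (mset \<alpha>0) = 0" if "length \<alpha> = m" "\<alpha> \<noteq> \<alpha>0"
      proof (rule ncount_zero)
        show "length (rev \<alpha>) = size (mset \<alpha>0)" using that a0 by simp
        show "mset (rev \<alpha>) \<noteq> mset \<alpha>0" using sorted_pleq_unique[of \<alpha> \<alpha>0] a a0 that by (auto simp: Wset_def)
      qed
      ultimately show ?thesis using a0 by auto
    qed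
  qed
  ultimately have "t \<alpha>0 * (chi y * ncount (rev \<alpha>0) (mset \<alpha>0)) = 0" using a0 by (simp add: sum.delta)
  moreover have "ncount (rev \<alpha>0) (mset \<alpha>0) > 0" by (rule ncount_pos) (use a0' in \<open>auto simp: idx_def\<close>)
  ultimately show False using a0 chi_pos[OF y] by simp
qed

lemma f_coercive: "\<exists>ca>0. \<forall>y\<in>cube (1/2). \<forall>t. ca * (\<Sum>\<alpha>\<in>Wset s kk. (t \<alpha>)\<^sup>2) \<le> (\<Sum>l\<in>Ls. (\<Sum>\<alpha>\<in>Wset s kk. t \<alpha> * fw Y \<alpha> (tf l) y)\<^sup>2)"
proof -
  \<comment> \<open>The zero function for other indices provides continuity for every
    \<open>l\<close>.\<close>
  define F where "F l \<alpha> = (if l \<in> lists I then fw Y \<alpha> (tf l) else (\<lambda>x. 0))" for l \<alpha>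
  have eq: "F l \<alpha> = fw Y \<alpha> (tf l)" if "l \<in> Ls" for l \<alpha> using that by (simp add: F_def Ls_def)
  have "\<exists>c>0. \<forall>y\<in>cube (1/2). \<forall>t. c * (\<Sum>i\<in>Wset s kk. (t i)\<^sup>2) \<le> (\<Sum>l\<in>Ls. (\<Sum>i\<in>Wset s kk. t i * F l i y)\<^sup>2)"
  proof (rule coercive_compact[OF compact_cube finite_Wset _ _ finite_Ls])
    show "continuous_on (cube (1/2)) (F l i)" for l i
      unfolding F_def by (auto intro!: smooth_continuous smooth_fw smooth_f)
    show "\<forall>i\<in>Wset s kk. t i = 0" if "y \<in> cube (1/2)" "\<And>l. l \<in> Ls \<Longrightarrow> (\<Sum>i\<in>Wset s kk. t i * F l i y) = 0" for y t
      using f_nondegenerate[OF that(1)] that(2) by (simp add: eq)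
  qed
  then show ?thesis by (simp add: eq cong: sum.cong)
qed

end

section \<open>The lattice and the unprojected field\<close>

text \<open>Gaussian elimination: with pivot \<open>v j\<close> the coordinate \<open>j\<close> is
  removed from the other vectors, the smaller system is solved, and \<open>t\<close> restores the
  orthogonality to \<open>v\<close>.\<close>

lemma orthogonal_vector_exists:
  fixes vs :: "('c \<Rightarrow> real) list"
  assumes "finite J" "length vs < card J"
  shows "\<exists>u. (\<forall>c. c \<notin> J \<longrightarrow> u c = 0) \<and> (\<exists>c\<in>J. u c \<noteq> 0) \<and> (\<forall>v\<in>set vs. (\<Sum>c\<in>J. v c * u c) = 0)"
  using assms
proof (induction vs arbitrary: J rule: length_induct)
  case (1 vs)
  show ?case
  proof (cases vs)
    case Nil
    then obtain j where "j \<in> J" using 1(2,3) by fastforce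
    then show ?thesis using Nil by (intro exI[of _ "\<lambda>c. if c = j then 1 else 0"]) auto
  next
    case (Cons v vs')
    show ?thesis
    proof (cases "\<forall>c\<in>J. v c = 0")
      case True
      obtain u where "(\<forall>c. c \<notin> J \<longrightarrow> u c = 0)" "(\<exists>c\<in>J. u c \<noteq> 0)" "(\<forall>v\<in>set vs'. (\<Sum>c\<in>J. v c * u c) = 0)"
        using 1(1)[rule_format, of vs' J] 1(2,3) Cons by auto
      then show ?thesis using True Cons by (intro exI[of _ u]) auto
    next
      case False
      then obtain j where j: "j \<in> J" "v j \<noteq> 0" by blast
      define J' where "J' = J - {j}"
      define red where "red x = (\<lambda>c. x c - (x j / v j) * v c)" for x
      have J: "J = insert j J'" "j \<notin> J'" "finite J'" using j 1(2) by (auto simp: J'_def)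
      have "length (map red vs') < card J'" using 1(3) Cons j by (simp add: J'_def)
      then obtain u where u: "(\<forall>c. c \<notin> J' \<longrightarrow> u c = 0)" "(\<exists>c\<in>J'. u c \<noteq> 0)" "(\<forall>x\<in>set (map red vs'). (\<Sum>c\<in>J'. x c * u c) = 0)"
        using 1(1)[rule_format, of "map red vs'" J'] J Cons by auto
      define t where "t = - (\<Sum>c\<in>J'. v c * u c) / v j"
      define u' where "u' = (\<lambda>c. if c = j then t else u c)"
      have s: "(\<Sum>c\<in>J. x c * u' c) = x j * t + (\<Sum>c\<in>J'. x c * u c)" for x
      proof -
        have "(\<Sum>c\<in>J'. x c * u' c) = (\<Sum>c\<in>J'. x c * u c)" by (rule sum.cong) (use J in \<open>auto simp: u'_def\<close>)
        then show ?thesis using J by (simp add: u'_def)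
      qed
      have "(\<Sum>c\<in>J. x c * u' c) = 0" if x: "x \<in> set vs" for x
      proof (cases "x = v")
        case True
        then show ?thesis using s[of v] j by (simp add: t_def)
      next
        case False
        then have "(\<Sum>c\<in>J'. red x c * u c) = 0" using u(3) x Cons by auto
        then have "(\<Sum>c\<in>J'. x c * u c) = (x j / v j) * (\<Sum>c\<in>J'. v c * u c)"
          by (simp add: red_def left_diff_distrib sum_subtractf sum_distrib_left mult.assoc)
        then show ?thesis using s[of x] j by (simp add: t_def)
      qed
      moreover obtain c0 where "c0 \<in> J'" "u c0 \<noteq> 0" using u(2) by blast
      then have "c0 \<in> J" "u' c0 \<noteq> 0" using J by (auto simp: u'_def)
      moreover have "\<forall>c. c \<notin> J \<longrightarrow> u' c = 0" using u(1) J by (auto simp: u'_def)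
      ultimately show ?thesis by blast
    qed
  qed
qed

lemma orthonormal_family_exists:
  fixes vs :: "('c \<Rightarrow> real) list"
  assumes "finite J" "finite L" "length vs + card L \<le> card J"
  shows "\<exists>e. (\<forall>l\<in>L. (\<forall>c. c \<notin> J \<longrightarrow> e l c = 0) \<and> (\<forall>v\<in>set vs. (\<Sum>c\<in>J. v c * e l c) = 0)) \<and>
     (\<forall>l\<in>L. \<forall>l'\<in>L. (\<Sum>c\<in>J. e l c * e l' c) = (if l = l' then 1 else 0))"
  using assms(2,3)
proof (induction L)
  case empty
  then show ?case by auto
next
  case (insert l0 L)
  then have "length vs + card L \<le> card J" by simp
  from insert.IH[OF this] obtain e where "\<forall>l\<in>L. (\<forall>c. c \<notin> J \<longrightarrow> e l c = 0) \<and> (\<forall>v\<in>set vs. (\<Sum>c\<in>J. v c * e l c) = 0)"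
     "\<forall>l\<in>L. \<forall>l'\<in>L. (\<Sum>c\<in>J. e l c * e l' c) = (if l = l' then 1 else 0)" by blast
  then have e: "\<And>l c. l \<in> L \<Longrightarrow> c \<notin> J \<Longrightarrow> e l c = 0" 
    "\<And>l v. l \<in> L \<Longrightarrow> v \<in> set vs \<Longrightarrow> (\<Sum>c\<in>J. v c * e l c) = 0"
    "\<And>l l'. l \<in> L \<Longrightarrow> l' \<in> L \<Longrightarrow> (\<Sum>c\<in>J. e l c * e l' c) = (if l = l' then 1 else 0)" by blast+
  obtain ls where ls: "set ls = L" "distinct ls" using insert(1) finite_distinct_list by blast
  have "length (vs @ map e ls) < card J" using insert ls distinct_card[OF ls(2)] by simp
  then obtain u where u: "\<And>c. c \<notin> J \<Longrightarrow> u c = 0" "\<exists>c\<in>J. u c \<noteq> 0"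
    "\<And>v. v \<in> set (vs @ map e ls) \<Longrightarrow> (\<Sum>c\<in>J. v c * u c) = 0"
    using orthogonal_vector_exists[OF assms(1)] by blast
  define n where "n = sqrt (\<Sum>c\<in>J. (u c)\<^sup>2)"
  have "(\<Sum>c\<in>J. (u c)\<^sup>2) > 0"
  proof -
    obtain c where "c \<in> J" "u c \<noteq> 0" using u(2) by blast
    then show ?thesis using assms(1) by (intro sum_pos2[of J c]) auto
  qed
  then have n: "n > 0" "n * n = (\<Sum>c\<in>J. (u c)\<^sup>2)" by (auto simp: n_def)
  define e' where "e' = (\<lambda>l. if l = l0 then (\<lambda>c. u c / n) else e l)"
  have el: "e' l = e l" if "l \<in> L" for l using that insert(2) by (auto simp: e'_def)
  have e0: "e' l0 = (\<lambda>c. u c / n)" by (simp add: e'_def)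
  have o: "(\<Sum>c\<in>J. v c * e' l0 c) = 0" if "v \<in> set (vs @ map e ls)" for v
    using u(3)[OF that] by (simp add: e0 sum_divide_distrib[symmetric])
  have o2: "(\<Sum>c\<in>J. e l c * e' l0 c) = 0" "(\<Sum>c\<in>J. e' l0 c * e l c) = 0" if "l \<in> L" for l
    using o[of "e l"] that ls by (auto simp: mult.commute)
  have o3: "(\<Sum>c\<in>J. e' l0 c * e' l0 c) = 1"
  proof -
    have "(\<Sum>c\<in>J. e' l0 c * e' l0 c) = (\<Sum>c\<in>J. (u c)\<^sup>2) / (n * n)"
      by (simp add: e0 sum_divide_distrib power2_eq_square)
    then show ?thesis unfolding n(2)[symmetric] using n(1) by simp
  qed
  show ?case
  proof (intro exI[of _ e'] conjI ballI allI impI)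
    fix l c assume "l \<in> insert l0 L" "c \<notin> J"
    then show "e' l c = 0" using e(1) u(1) by (auto simp: e'_def)
  next
    fix l v assume "l \<in> insert l0 L" "v \<in> set vs"
    then show "(\<Sum>c\<in>J. v c * e' l c) = 0" using e(2) el o by auto
  next
    fix l l' assume "l \<in> insert l0 L" "l' \<in> insert l0 L"
    then show "(\<Sum>c\<in>J. e' l c * e' l' c) = (if l = l' then 1 else 0)"
      using e(3) el o2 o3 insert(2) by auto
  qed
qed

lemma fact_le_two_power: "(fact s :: nat) \<le> 2 ^ (\<Sum>r = 1..s. r - 1)"
proof (induction s)
  case (Suc s)
  have "Suc s \<le> 2 ^ s" by (induction s) auto
  then have "Suc s * fact s \<le> 2 ^ s * 2 ^ (\<Sum>r = 1..s. r - 1)" using Suc by (intro mult_mono) auto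
  then show ?case by (simp add: power_add mult.commute)
qed simp

text \<open>With \<open>n = card (idx s kk)\<close> the sum is at most
  \<open>(n + 1) ^ s \<le> fact s * exp (n + 1)\<close>, and \<open>fact s\<close> is at most 2 to
  the power of the sum of all \<open>r - 1\<close>. Since every layer is nonzero, \<open>n\<close>
  plus that sum is at most \<open>nh s kk\<close>; the left-hand side is then at most
  \<open>6 * 6 ^ nh s kk\<close>, well inside \<open>Dim s kk\<close>.\<close>

lemma dimension_count:
  assumes "\<And>r. r \<in> {1..s} \<Longrightarrow> 1 \<le> kk r"
  shows "2 ^ card (idx s kk) * (2 * (\<Sum>i\<le>s. card (idx s kk) ^ i)) \<le> Dim s kk"
proof -
  define n where "n = card (idx s kk)"
  have n: "n = (\<Sum>r = 1..s. kk r)" unfolding n_def idx_Sigma by simp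
  have nh: "n + (\<Sum>r = 1..s. r - 1) \<le> nh s kk"
    unfolding n nh_def sum.distrib[symmetric]
  proof (rule sum_mono)
    fix r assume r: "r \<in> {1..s}"
    obtain a where "r = Suc a" using r by (cases r) auto
    moreover have "a * 1 \<le> a * kk r" using assms[OF r] by (intro mult_left_mono) auto
    ultimately show "kk r + (r - 1) \<le> r * kk r" by simp
  qed
  have "real (\<Sum>i\<le>s. n ^ i) \<le> real (Suc n ^ s)"
  proof -
    have "(\<Sum>i\<le>s. n ^ i) \<le> (\<Sum>i\<le>s. (s choose i) * n ^ i)"
      by (intro sum_mono) (auto simp: Suc_le_eq)
    also have "\<dots> = (n + 1) ^ s" using binomial[of n 1 s] by simp
    finally show ?thesis by (simp only: of_nat_le_iff Suc_eq_plus1)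
  qed
  also have "real (Suc n ^ s) \<le> fact s * 3 ^ Suc n"
  proof -
    have "(\<lambda>k. real (Suc n) ^ k / fact k) sums exp (real (Suc n))" using exp_converges[of "real (Suc n)"] by (simp add: divide_inverse mult.commute)
    then have "real (Suc n) ^ s / fact s \<le> exp (real (Suc n))"
      using sum_le_suminf[of "\<lambda>k. real (Suc n) ^ k / fact k" "{s}"] by (auto simp: sums_iff)
    also have "\<dots> = exp 1 ^ Suc n" by (metis exp_of_nat_mult mult.right_neutral)
    also have "\<dots> \<le> 3 ^ Suc n" using exp_le by (intro power_mono) auto
    finally show ?thesis by (simp add: divide_le_eq mult.commute)
  qed
  also have "\<dots> \<le> 2 ^ (\<Sum>r = 1..s. r - 1) * 3 ^ Suc n"
    using fact_le_two_power[of s] by (intro mult_right_mono) (metis of_nat_fact of_nat_le_iff of_nat_numeral of_nat_power, simp)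
  finally have "real (2 ^ n * (2 * (\<Sum>i\<le>s. n ^ i))) \<le> 2 ^ n * (2 * (2 ^ (\<Sum>r = 1..s. r - 1) * 3 ^ Suc n))"
    by (simp add: ac_simps)
  also have "\<dots> = 6 * (6 ^ n * 2 ^ (\<Sum>r = 1..s. r - 1))"
    using power_mult_distrib[of "2::real" 3 n] by simp
  also have "\<dots> \<le> 6 * (6 ^ n * 6 ^ (\<Sum>r = 1..s. r - 1))"
    by (intro mult_left_mono power_mono) auto
  also have "\<dots> \<le> 128 * 23 ^ nh s kk"
  proof -
    have "(6::real) ^ n * 6 ^ (\<Sum>r = 1..s. r - 1) \<le> 6 ^ nh s kk" unfolding power_add[symmetric] by (rule power_increasing[OF nh]) simp
    also have "\<dots> \<le> 23 ^ nh s kk" by (intro power_mono) auto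
    finally show ?thesis by (intro mult_mono) auto
  qed
  finally have "real (2 ^ n * (2 * (\<Sum>i\<le>s. n ^ i))) \<le> real (Dim s kk)" by (simp add: Dim_def)
  then show ?thesis unfolding n_def[symmetric] by (simp only: of_nat_le_iff)
qed

section \<open>The coloured integer points and the field of bumps\<close>

context graded_lie
begin

text \<open>Integer points in the chosen coordinates, in general not a subgroup. The product is
  triangular in the layers, so covering and separation can be checked one layer at a time.\<close>

definition "Gam = {g. \<forall>b\<in>I. co b g \<in> \<int>}"
text \<open>The colour of \<open>g\<close>. Open unit cubes around different points of one colour
  are disjoint.\<close>

definition "parity g = {b\<in>I. odd \<lfloor>co b g\<rfloor>}"
definition "near p = {g \<in> Gam. \<forall>b\<in>I. \<bar>co b (ld g p)\<bar> < 1}"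

lemma pi_M_Suc: "\<pi> (Suc r) (M g y) = \<pi> (Suc r) y + (\<Sum>a\<in>{1..r}. Mj (Suc r - a) g (\<pi> a y))"
proof -
  have "{1..Suc r} = insert (Suc r) {1..r}" by auto
  then show ?thesis unfolding pi_M by simp
qed

lemma pi_M_cong2:
  assumes "\<And>q. q \<le> r \<Longrightarrow> \<pi> q g = \<pi> q g'" "\<And>q. q \<le> r \<Longrightarrow> \<pi> q y = \<pi> q y'"
  shows "(\<Sum>a\<in>{1..r}. Mj (Suc r - a) g (\<pi> a y)) = (\<Sum>a\<in>{1..r}. Mj (Suc r - a) g' (\<pi> a y'))"
    and "q \<le> r \<Longrightarrow> \<pi> q (g + M g y) = \<pi> q (g' + M g' y')"
proof -
  have *: "Mj j g (\<pi> a y) = Mj j g' (\<pi> a y')" if "j \<le> r" "a \<le> r" for j a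
    using assms that Mj_cong[of j g g'] by auto
  show "(\<Sum>a\<in>{1..r}. Mj (Suc r - a) g (\<pi> a y)) = (\<Sum>a\<in>{1..r}. Mj (Suc r - a) g' (\<pi> a y'))"
    by (intro sum.cong refl *) auto
  assume "q \<le> r"
  then have "\<pi> q (M g y) = \<pi> q (M g' y')" unfolding pi_M by (intro sum.cong refl *) auto
  then show "\<pi> q (g + M g y) = \<pi> q (g' + M g' y')" using assms(1)[OF \<open>q \<le> r\<close>] by simp
qed

text \<open>Layer \<open>r + 1\<close> of \<open>g + M g y\<close> is that of \<open>g + y\<close>
  plus a term fixed by the lower layers. After subtracting this term from \<open>p\<close>, rounding
  gives the new coordinates of \<open>g\<close>, and the remainders, at most 1/2, those of
  \<open>y\<close>.\<close>

lemma lattice_cover: "\<exists>g\<in>Gam. ld g p \<in> cube (1/2)"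
proof -
  have "\<exists>g\<in>Gam. \<exists>y\<in>cube (1/2). \<forall>q\<le>r. \<pi> q (g + M g y) = \<pi> q p" for r
  proof (induction r)
    case 0
    show ?case by (rule bexI[of _ 0], rule bexI[of _ 0]) (auto simp: cube_def Gam_def pi_outside)
  next
    case (Suc r)
    then obtain g y where g: "g \<in> Gam" "y \<in> cube (1/2)" "\<And>q. q \<le> r \<Longrightarrow> \<pi> q (g + M g y) = \<pi> q p" by blast
    define \<tau> where "\<tau> = \<pi> (Suc r) p - (\<Sum>a\<in>{1..r}. Mj (Suc r - a) g (\<pi> a y))"
    define g' where "g' = (\<Sum>b\<in>I. (if fst b \<le> r then co b g else of_int (round (co b \<tau>))) *\<^sub>R E b)"
    define y' where "y' = (\<Sum>b\<in>I. (if fst b \<le> r then co b y else co b \<tau> - of_int (round (co b \<tau>))) *\<^sub>R E b)"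
    have cg: "co b g' = (if fst b \<le> r then co b g else of_int (round (co b \<tau>)))" if "b \<in> I" for b
      unfolding g'_def using that by (rule co_comb)
    have cy: "co b y' = (if fst b \<le> r then co b y else co b \<tau> - of_int (round (co b \<tau>)))" if "b \<in> I" for b
      unfolding y'_def using that by (rule co_comb)
    have lowg: "\<pi> q g' = \<pi> q g" if "q \<le> r" for q using that by (intro vec_eqI) (auto simp: cg)
    have lowy: "\<pi> q y' = \<pi> q y" if "q \<le> r" for q using that by (intro vec_eqI) (auto simp: cy)
    have "g' \<in> Gam" using g(1) by (auto simp: Gam_def cg)
    moreover have "y' \<in> cube (1/2)"
    proof -
      have "\<bar>co b \<tau> - of_int (round (co b \<tau>))\<bar> \<le> 1/2" for b
        using of_int_round_abs_le[of "co b \<tau>"] by (simp add: abs_minus_commute)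
      then show ?thesis using g(2) by (auto simp: cube_def cy)
    qed
    moreover have "\<pi> q (g' + M g' y') = \<pi> q p" if q: "q \<le> Suc r" for q
    proof (cases "q = Suc r")
      case True
      have "\<pi> (Suc r) g' + \<pi> (Suc r) y' = \<pi> (Suc r) \<tau>" by (rule vec_eqI) (auto simp: cg cy)
      moreover have "\<pi> (Suc r) \<tau> = \<tau>"
      proof -
        have "\<pi> (Suc r) (Mj (Suc r - a) g (\<pi> a y)) = Mj (Suc r - a) g (\<pi> a y)" if "a \<in> {1..r}" for a
          using that by (subst Mj_graded) auto
        then show ?thesis by (simp add: \<tau>_def)
      qed
      moreover have "(\<Sum>a\<in>{1..r}. Mj (Suc r - a) g' (\<pi> a y')) = (\<Sum>a\<in>{1..r}. Mj (Suc r - a) g (\<pi> a y))"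
        by (rule pi_M_cong2(1)[OF lowg lowy])
      ultimately show ?thesis using True by (simp add: pi_M_Suc \<tau>_def algebra_simps)
    next
      case False
      then show ?thesis using pi_M_cong2(2)[OF lowg lowy, of q] g(3)[of q] q by simp
    qed
    ultimately show ?case by blast
  qed
  then obtain g y where g: "g \<in> Gam" "y \<in> cube (1/2)" "\<And>q. q \<le> s \<Longrightarrow> \<pi> q (g + M g y) = \<pi> q p" by blast
  have "g + M g y = p" by (rule pi_eqI) (use g(3) in auto)
  then have "ld g p = y" by (metis ld_left)
  with g show ?thesis by blast
qed

text \<open>Agreement in the lower layers reduces the next layer to \<open>g + y = g' + y'\<close>;
  there integer coordinates of equal parity differ by less than 2, so they coincide.\<close>

lemma lattice_separated:
  assumes g: "g \<in> Gam" "g' \<in> Gam" "parity g = parity g'" and eq: "g + M g y = g' + M g' y'"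
    and y: "\<And>b. b \<in> I \<Longrightarrow> \<bar>co b y\<bar> < 1" "\<And>b. b \<in> I \<Longrightarrow> \<bar>co b y'\<bar> < 1"
  shows "g = g'"
proof -
  have "\<forall>q\<le>r. \<pi> q g = \<pi> q g' \<and> \<pi> q y = \<pi> q y'" for r
  proof (induction r)
    case 0
    then show ?case by (simp add: pi_outside)
  next
    case (Suc r)
    then have low: "\<And>q. q \<le> r \<Longrightarrow> \<pi> q g = \<pi> q g'" "\<And>q. q \<le> r \<Longrightarrow> \<pi> q y = \<pi> q y'" by auto
    have "\<pi> (Suc r) (g + M g y) = \<pi> (Suc r) (g' + M g' y')" by (simp only: eq)
    then have e: "\<pi> (Suc r) (g + y) = \<pi> (Suc r) (g' + y')"
      using pi_M_cong2(1)[OF low] by (simp add: pi_M_Suc algebra_simps)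
    have same: "co b g = co b g' \<and> co b y = co b y'" if b: "b \<in> I" "fst b = Suc r" for b
    proof -
      have "co b (\<pi> (Suc r) (g + y)) = co b (\<pi> (Suc r) (g' + y'))" by (simp only: e)
      then have s: "co b g + co b y = co b g' + co b y'" using b by simp
      obtain m m' where m: "co b g = of_int m" "co b g' = of_int m'" using g b unfolding Gam_def Ints_def by blast
      have "b \<in> parity g \<longleftrightarrow> b \<in> parity g'" using g(3) by simp
      then have "odd m \<longleftrightarrow> odd m'" using b m by (simp add: parity_def)
      moreover have "\<bar>m - m'\<bar> < 2"
      proof -
        have "\<bar>of_int m - of_int m' :: real\<bar> < 2" using s y[OF b(1)] m by linarith
        then show ?thesis by linarith
      qed
      ultimately have "m = m'" by presburger
      then show ?thesis using s m by simp
    qed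
    have "\<pi> (Suc r) g = \<pi> (Suc r) g'" "\<pi> (Suc r) y = \<pi> (Suc r) y'"
      by (auto intro!: vec_eqI simp: same)
    with low show ?case by (auto simp: le_Suc_eq)
  qed
  then show ?thesis by (intro pi_eqI[of g g']) auto
qed

lemma inj_parity_near: "inj_on parity (near p)"
proof (rule inj_onI)
  fix g g' assume "g \<in> near p" "g' \<in> near p" "parity g = parity g'"
  then show "g = g'"
    using lattice_separated[of g g' "ld g p" "ld g' p"] unfolding near_def ld_eq by blast
qed

lemma finite_near: "finite (near p)" and card_near: "card (near p) \<le> 2 ^ card I"
proof -
  have sub: "parity ` near p \<subseteq> Pow I" by (auto simp: parity_def)
  have fin: "finite (parity ` near p)" by (rule finite_subset[OF sub]) simp
  then show "finite (near p)" using finite_image_iff[OF inj_parity_near] by simp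
  show "card (near p) \<le> 2 ^ card I"
    using card_mono[OF _ sub] card_image[OF inj_parity_near, of p] by (simp add: card_Pow)
qed

lemma near_cube: "g \<in> near p \<Longrightarrow> ld g p \<in> cube 1"
  by (auto simp: near_def cube_def intro: less_imp_le)

text \<open>Local finiteness with a margin. Passing from \<open>p'\<close> to \<open>p\<close>
  changes the coordinates relative to \<open>g\<close> by \<open>M (ld g p') w\<close> with
  \<open>w\<close> small and \<open>ld g p'\<close> in a compact cube, hence by less than 1/4
  uniformly in \<open>g\<close>: the gap between 3/4 and 1.\<close>

lemma near_stable: "\<exists>r>0. \<forall>p'\<in>ball p r. \<forall>g\<in>Gam. ld g p' \<in> cube (3/4) \<longrightarrow> g \<in> near p"
proof -
  define H where "H z = (\<Sum>b\<in>I. \<bar>co b (M (snd z) (N (fst z) (p - fst z)))\<bar>)" for z :: "'a \<times> 'a"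
  have sf: "smooth (fst :: 'a \<times> 'a \<Rightarrow> 'a)" "smooth (snd :: 'a \<times> 'a \<Rightarrow> 'a)"
    by (intro smooth_linear bounded_linear.linear bounded_linear_fst bounded_linear_snd)+
  have "continuous_on UNIV (\<lambda>z. \<bar>co b (M (snd z) (N (fst z) (p - fst z)))\<bar>)" for b
    by (intro continuous_on_rabs smooth_continuous smooth_co smooth_M smooth_N smooth_diff smooth_const sf)
  then have "continuous_on (cball p 1 \<times> cube (3/4)) H"
    unfolding H_def by (intro continuous_on_sum) (auto intro: continuous_on_subset)
  then have "uniformly_continuous_on (cball p 1 \<times> cube (3/4)) H"
    by (intro compact_uniformly_continuous compact_Times compact_cball compact_cube)
  then obtain d where d: "d > 0" "\<And>z z'. z \<in> cball p 1 \<times> cube (3/4) \<Longrightarrow> z' \<in> cball p 1 \<times> cube (3/4) \<Longrightarrow> dist z' z < d \<Longrightarrow> dist (H z') (H z) < 1/4"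
    unfolding uniformly_continuous_on_def by (metis zero_less_divide_1_iff zero_less_numeral)
  have "g \<in> near p" if p': "p' \<in> ball p (min d 1)" and g: "g \<in> Gam" and y: "ld g p' \<in> cube (3/4)" for p' g
  proof -
    let ?y = "ld g p'" and ?w = "N p' (p - p')"
    have "dist (H (p', ?y)) (H (p, ?y)) < 1/4"
      by (rule d(2)) (use p' y in \<open>auto simp: dist_Pair_Pair dist_commute\<close>)
    moreover have "H (p, ?y) = 0" by (simp add: H_def linear_0[OF linear_N])
    ultimately have H: "H (p', ?y) < 1/4" by (simp add: dist_norm)
    have p: "p = p' + M p' ?w" by simp
    have "ld g p = ?y + M ?y ?w" using ld_right[of g p' ?w] p by simp
    moreover have "\<bar>co b (M ?y ?w)\<bar> < 1/4" if "b \<in> I" for b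
    proof -
      have "\<bar>co b (M ?y ?w)\<bar> \<le> H (p', ?y)" unfolding H_def fst_conv snd_conv
        by (rule member_le_sum[of b I "\<lambda>b. \<bar>co b (M ?y ?w)\<bar>"]) (use that in auto)
      then show ?thesis using H by linarith
    qed
    ultimately have "\<bar>co b (ld g p)\<bar> < 1" if "b \<in> I" for b
      using y that by (fastforce simp: cube_def)
    then show ?thesis using g by (simp add: near_def)
  qed
  then show ?thesis using d(1) by (intro exI[of _ "min d 1"]) auto
qed

text \<open>Lattice points outside \<open>near p\<close> would contribute nothing, as
  \<open>tf l\<close> is supported in \<open>cube (3/4)\<close>; restricting the sum makes it
  finite.\<close>

definition "afield \<epsilon> p = (\<Sum>g\<in>near p. \<Sum>l\<in>Ls. tf l (ld g p) * \<epsilon> g l)"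

lemma afield_local: "\<exists>r>0. \<forall>p'\<in>ball p r. afield \<epsilon> p' = (\<Sum>g\<in>near p. \<Sum>l\<in>Ls. tf l (ld g p') * \<epsilon> g l)"
proof -
  obtain r where r: "r > 0" "\<And>p' g. p' \<in> ball p r \<Longrightarrow> g \<in> Gam \<Longrightarrow> ld g p' \<in> cube (3/4) \<Longrightarrow> g \<in> near p"
    using near_stable by blast
  have "afield \<epsilon> p' = (\<Sum>g\<in>near p. \<Sum>l\<in>Ls. tf l (ld g p') * \<epsilon> g l)" if p': "p' \<in> ball p r" for p'
  proof -
    let ?S = "\<lambda>g. \<Sum>l\<in>Ls. tf l (ld g p') * \<epsilon> g l"
    have z: "?S g = 0" if "ld g p' \<notin> cube (3/4)" for g
      using chi_support[OF that] by (simp add: tf_def)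
    have "sum ?S (near p') = sum ?S (near p' \<union> near p)"
    proof (rule sum.mono_neutral_left)
      show "\<forall>g\<in>near p' \<union> near p - near p'. ?S g = 0"
      proof
        fix g assume "g \<in> near p' \<union> near p - near p'"
        then obtain b where "b \<in> I" "\<not> \<bar>co b (ld g p')\<bar> < 1" by (auto simp: near_def)
        then show "?S g = 0" by (intro z) (force simp: cube_def)
      qed
    qed (auto simp: finite_near)
    also have "\<dots> = sum ?S (near p)"
    proof (rule sum.mono_neutral_right)
      show "\<forall>g\<in>near p' \<union> near p - near p. ?S g = 0"
      proof
        fix g assume "g \<in> near p' \<union> near p - near p"
        then have "g \<in> Gam" "g \<notin> near p" by (auto simp: near_def)
        then show "?S g = 0" using r(2)[OF p', of g] by (intro z) auto
      qed
    qed (auto simp: finite_near)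
    finally show ?thesis by (simp add: afield_def)
  qed
  with r(1) show ?thesis by blast
qed

lemma smooth_tf_ld: "l \<in> Ls \<Longrightarrow> smooth (\<lambda>x. tf l (ld g x) * k)"
  by (intro smooth_mult smooth_const smooth_compose[OF smooth_f smooth_ld]) (auto simp: Ls_def)

lemma smooth_afield: "smooth (afield \<epsilon>)"
  unfolding smooth_def
proof (intro allI Cn_local)
  fix n p
  obtain r where r: "r > 0" "\<And>p'. p' \<in> ball p r \<Longrightarrow> afield \<epsilon> p' = (\<Sum>g\<in>near p. \<Sum>l\<in>Ls. tf l (ld g p') * \<epsilon> g l)"
    using afield_local by blast
  have "smooth (\<lambda>p'. \<Sum>g\<in>near p. \<Sum>l\<in>Ls. tf l (ld g p') * \<epsilon> g l)"
    by (intro smooth_sum smooth_tf_ld)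
  with r show "\<exists>U g. open U \<and> p \<in> U \<and> Cn n g \<and> (\<forall>y\<in>U. afield \<epsilon> y = g y)"
    by (intro exI[of _ "ball p r"] exI[of _ "\<lambda>p'. \<Sum>g\<in>near p. \<Sum>l\<in>Ls. tf l (ld g p') * \<epsilon> g l"]) (auto intro: smooth_Cn)
qed

lemma fw_afield:
  assumes w: "w \<in> lists I"
  shows "fw Y w (afield \<epsilon>) p = (\<Sum>g\<in>near p. \<Sum>l\<in>Ls. fw Y w (tf l) (ld g p) * \<epsilon> g l)"
proof -
  obtain r where r: "r > 0" "\<And>p'. p' \<in> ball p r \<Longrightarrow> afield \<epsilon> p' = (\<Sum>g\<in>near p. \<Sum>l\<in>Ls. tf l (ld g p') * \<epsilon> g l)"
    using afield_local by blast
  have sm: "smooth (tf l)" if "l \<in> Ls" for l using that smooth_f by (auto simp: Ls_def)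
  have "fw Y w (afield \<epsilon>) p = fw Y w (\<lambda>p'. \<Sum>g\<in>near p. \<Sum>l\<in>Ls. tf l (ld g p') * \<epsilon> g l) p"
    by (rule fw_local[of "ball p r"]) (use r in \<open>auto intro!: smooth_sum smooth_tf_ld\<close>)
  also have "\<dots> = (\<Sum>g\<in>near p. \<Sum>l\<in>Ls. fw Y w (\<lambda>p'. tf l (ld g p') * \<epsilon> g l) p)"
    by (subst fw_sum, intro smooth_sum smooth_tf_ld, assumption, intro sum.cong refl, subst fw_sum, rule smooth_tf_ld, assumption, rule refl)
  also have "\<dots> = (\<Sum>g\<in>near p. \<Sum>l\<in>Ls. fw Y w (tf l) (ld g p) * \<epsilon> g l)"
  proof (intro sum.cong refl)
    fix g l assume l: "l \<in> Ls"
    have "fw Y w (\<lambda>p'. tf l (ld g p') * \<epsilon> g l) p = fw Y w (\<lambda>p'. tf l (ld g p')) p * \<epsilon> g l"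
      using fw_cmult[OF smooth_compose[OF sm[OF l] smooth_ld], of w "\<epsilon> g l"] by (simp add: mult.commute)
    then show "fw Y w (\<lambda>p'. tf l (ld g p') * \<epsilon> g l) p = fw Y w (tf l) (ld g p) * \<epsilon> g l"
      using fw_ld[OF w sm[OF l]] by simp
  qed
  finally show ?thesis .
qed

lemma card_Ls: "card Ls = (\<Sum>i\<le>s. card I ^ i)"
  unfolding Ls_def using card_lists_length_le[OF finite_idx, of s kk s] by (simp add: lists_eq_set)

lemma card_Wset_le: "card (Wset s kk) \<le> card Ls"
  by (rule card_mono[OF finite_Ls]) (auto simp: Wset_def Ls_def)

text \<open>One block per colour, with room for \<open>card (Wset s kk)\<close> orthogonality
  constraints and \<open>card Ls\<close> orthonormal vectors. Since sorted words are words,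
  \<open>2 * card Ls\<close> coordinates suffice.\<close>

lemma blocks_exist:
  "\<exists>blk. (\<forall>\<kappa>\<subseteq>I. blk \<kappa> \<subseteq> {..<Dim s kk} \<and> card (Wset s kk) + card Ls \<le> card (blk \<kappa>)) \<and>
     (\<forall>\<kappa>\<subseteq>I. \<forall>\<kappa>'\<subseteq>I. \<kappa> \<noteq> \<kappa>' \<longrightarrow> blk \<kappa> \<inter> blk \<kappa>' = ({} :: nat set))"
proof -
  define m where "m = 2 * card Ls"
  obtain h where h: "bij_betw h (Pow I) {0..<card (Pow I)}"
    using ex_bij_betw_finite_nat[of "Pow I"] by auto
  define blk where "blk \<kappa> = {h \<kappa> * m..<h \<kappa> * m + m}" for \<kappa>
  have D: "2 ^ card I * m \<le> Dim s kk"
    using dimension_count[OF kk1] by (simp add: m_def card_Ls)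
  have hk: "h \<kappa> < 2 ^ card I" if "\<kappa> \<subseteq> I" for \<kappa>
    using bij_betw_apply[OF h, of \<kappa>] that by (simp add: card_Pow)
  have 1: "blk \<kappa> \<subseteq> {..<Dim s kk}" if "\<kappa> \<subseteq> I" for \<kappa>
  proof -
    have "Suc (h \<kappa>) * m \<le> 2 ^ card I * m" using hk[OF that] by (intro mult_right_mono) auto
    then show ?thesis using D by (auto simp: blk_def)
  qed
  have 2: "blk \<kappa> \<inter> blk \<kappa>' = {}" if k: "\<kappa> \<subseteq> I" "\<kappa>' \<subseteq> I" "\<kappa> \<noteq> \<kappa>'" for \<kappa> \<kappa>'
  proof -
    have "h \<kappa> \<noteq> h \<kappa>'" using bij_betw_imp_inj_on[OF h] k by (auto dest: inj_onD)
    moreover have "x \<notin> {j * m..<j * m + m}" if "x \<in> {i * m..<i * m + m}" "i < j" for i j x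
    proof -
      have "Suc i * m \<le> j * m" using that by (intro mult_right_mono) auto
      then show ?thesis using that by auto
    qed
    ultimately show ?thesis unfolding blk_def by (metis disjoint_iff linorder_neqE_nat)
  qed
  have 3: "card (Wset s kk) + card Ls \<le> card (blk \<kappa>)" for \<kappa>
    using card_Wset_le by (simp add: blk_def m_def)
  show ?thesis using 1 2 3 by (intro exI[of _ blk]) auto
qed

end

section \<open>Projection off a family of vector fields\<close>

text \<open>Gram-Schmidt as a recursion: the result is a rational expression in the entries, so slow
  variation of the input passes to it. The denominators are controlled by
  \<open>coer\<close>.\<close>

fun poff :: "nat \<Rightarrow> (nat \<Rightarrow> real) list \<Rightarrow> (nat \<Rightarrow> real) \<Rightarrow> nat \<Rightarrow> real" where
  "poff D [] a = a"
| "poff D (b # bs) a = (\<lambda>c. poff D bs a c -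
     vdot D (poff D bs a) (poff D bs b) / vdot D (poff D bs b) (poff D bs b) * poff D bs b c)"

definition lincomb :: "(nat \<Rightarrow> real) list \<Rightarrow> (nat \<Rightarrow> real) \<Rightarrow> nat \<Rightarrow> real" where
  "lincomb bs t c = (\<Sum>i<length bs. t i * (bs ! i) c)"

text \<open>A lower bound \<open>k\<close> for the Gram matrix of the list.\<close>

definition coer :: "nat \<Rightarrow> real \<Rightarrow> (nat \<Rightarrow> real) list \<Rightarrow> bool" where
  "coer D k bs \<longleftrightarrow> (\<forall>t. k * (\<Sum>i<length bs. (t i)\<^sup>2) \<le> vdot D (lincomb bs t) (lincomb bs t))"

lemma vdot_commute: "vdot D v w = vdot D w v"
  by (simp add: vdot_def mult.commute)

lemma vdot_add_left: "vdot D (\<lambda>c. x c + y c) w = vdot D x w + vdot D y w"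
  by (simp add: vdot_def algebra_simps sum.distrib)

lemma vdot_cmult_left: "vdot D (\<lambda>c. k * x c) w = k * vdot D x w"
  by (simp add: vdot_def algebra_simps sum_distrib_left)

lemma vdot_diff_left: "vdot D (\<lambda>c. x c - k * y c) w = vdot D x w - k * vdot D y w"
  by (simp add: vdot_def algebra_simps sum_subtractf sum_distrib_left)

lemma vdot_lincomb: "vdot D v (lincomb bs t) = (\<Sum>i<length bs. t i * vdot D v (bs ! i))"
  unfolding vdot_def lincomb_def sum_distrib_left by (subst sum.swap) (simp add: algebra_simps)

lemma vdot_self_nonneg: "vdot D v v \<ge> 0"
  by (simp add: vdot_def sum_nonneg)

lemma lincomb_Cons: "lincomb (b # bs) t = (\<lambda>c. t 0 * b c + lincomb bs (\<lambda>i. t (Suc i)) c)"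
  unfolding lincomb_def length_Cons sum.lessThan_Suc_shift by simp

lemma poff_linear: 
  "poff D bs (\<lambda>c. x c + y c) = (\<lambda>c. poff D bs x c + poff D bs y c)"
  "poff D bs (\<lambda>c. k * x c) = (\<lambda>c. k * poff D bs x c)"
  by (induction bs arbitrary: x y k)
    (auto simp: vdot_add_left vdot_cmult_left algebra_simps add_divide_distrib)

lemma poff_zero: "poff D bs (\<lambda>c. 0) = (\<lambda>c. 0)"
  using poff_linear(2)[of D bs 0 "\<lambda>c. 0"] by simp

lemma poff_sum: "finite S \<Longrightarrow> poff D bs (\<lambda>c. \<Sum>i\<in>S. k i * x i c) = (\<lambda>c. \<Sum>i\<in>S. k i * poff D bs (x i) c)"
  by (induction S rule: finite_induct) (auto simp: poff_zero poff_linear)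

lemma poff_decomp: "\<exists>t. poff D bs a = (\<lambda>c. a c + lincomb bs t c)"
proof (induction bs arbitrary: a)
  case Nil
  then show ?case by (auto simp: lincomb_def)
next
  case (Cons b bs)
  obtain t where t: "poff D bs a = (\<lambda>c. a c + lincomb bs t c)" using Cons by blast
  obtain u where u: "poff D bs b = (\<lambda>c. b c + lincomb bs u c)" using Cons by blast
  define k where "k = vdot D (poff D bs a) (poff D bs b) / vdot D (poff D bs b) (poff D bs b)"
  have "poff D (b # bs) a = (\<lambda>c. poff D bs a c - k * poff D bs b c)" by (simp add: k_def)
  also have "\<dots> = (\<lambda>c. a c + lincomb (b # bs) (\<lambda>i. case i of 0 \<Rightarrow> - k | Suc j \<Rightarrow> t j - k * u j) c)"
    unfolding lincomb_Cons t u
    by (rule ext) (simp add: lincomb_def algebra_simps sum_subtractf sum_distrib_left)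
  finally show ?case by blast
qed

lemma coer_tail: "coer D k (b # bs) \<Longrightarrow> coer D k bs"
  unfolding coer_def
proof
  fix t assume "\<forall>t. k * (\<Sum>i<length (b # bs). (t i)\<^sup>2) \<le> vdot D (lincomb (b # bs) t) (lincomb (b # bs) t)"
  from spec[OF this, of "\<lambda>i. case i of 0 \<Rightarrow> 0 | Suc j \<Rightarrow> t j"]
  show "k * (\<Sum>i<length bs. (t i)\<^sup>2) \<le> vdot D (lincomb bs t) (lincomb bs t)"
    by (simp add: lincomb_Cons sum.lessThan_Suc_shift del: sum.lessThan_Suc)
qed

text \<open>The projection of \<open>b\<close> is a linear combination in which \<open>b\<close>
  itself has coefficient 1.\<close>

lemma coer_head:
  assumes "coer D k (b # bs)" "k > 0"
  shows "vdot D (poff D bs b) (poff D bs b) \<ge> k"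
proof -
  obtain u where u: "poff D bs b = (\<lambda>c. b c + lincomb bs u c)" using poff_decomp by blast
  let ?t = "\<lambda>i. case i of 0 \<Rightarrow> 1 | Suc j \<Rightarrow> u j"
  have 1: "poff D bs b = lincomb (b # bs) ?t" unfolding u lincomb_Cons by simp
  have 2: "k * (\<Sum>i<length (b # bs). (?t i)\<^sup>2) \<ge> k * 1"
    using assms(2) by (intro mult_left_mono) (auto simp: sum.lessThan_Suc_shift sum_nonneg simp del: sum.lessThan_Suc)
  show ?thesis unfolding 1 using 2 spec[OF assms(1)[unfolded coer_def], of ?t] by linarith
qed

lemma poff_orth:
  assumes "coer D k bs" "k > 0" "b \<in> set bs"
  shows "vdot D (poff D bs a) b = 0"
  using assms(1,3)
proof (induction bs arbitrary: a b)
  case (Cons x bs)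
  have c: "coer D k bs" by (rule coer_tail[OF Cons.prems(1)])
  have nz: "vdot D (poff D bs x) (poff D bs x) \<noteq> 0" using coer_head[OF Cons.prems(1) assms(2)] assms(2) by linarith
  have old: "vdot D (poff D (x # bs) a) y = 0" if "y \<in> set bs" for y
    unfolding poff.simps vdot_diff_left using Cons.IH[OF c that] by simp
  show ?case
  proof (cases "b \<in> set bs")
    case False
    then have b: "b = x" using Cons.prems by simp
    obtain u where u: "poff D bs x = (\<lambda>c. x c + lincomb bs u c)" using poff_decomp by blast
    let ?p = "poff D (x # bs) a"
    have "vdot D ?p (poff D bs x) = vdot D ?p x + vdot D ?p (lincomb bs u)"
      unfolding u by (simp only: vdot_commute[of D ?p] vdot_add_left)
    also have "vdot D ?p (lincomb bs u) = 0" unfolding vdot_lincomb using old by (intro sum.neutral) auto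
    finally have "vdot D ?p x = vdot D ?p (poff D bs x)" by simp
    also have "\<dots> = 0" unfolding poff.simps vdot_diff_left using nz by simp
    finally show ?thesis by (simp only: b)
  qed (rule old)
qed simp

lemma poff_id:
  assumes "\<And>b. b \<in> set bs \<Longrightarrow> vdot D a b = 0"
  shows "poff D bs a = a"
  using assms
proof (induction bs)
  case (Cons x bs)
  obtain u where u: "poff D bs x = (\<lambda>c. x c + lincomb bs u c)" using poff_decomp by blast
  have a: "poff D bs a = a" using Cons by simp
  have "vdot D a (poff D bs x) = vdot D a x + vdot D a (lincomb bs u)"
    unfolding u by (simp only: vdot_commute[of D a] vdot_add_left)
  also have "\<dots> = 0" unfolding vdot_lincomb using Cons.prems by (simp add: sum.neutral)
  finally show ?case by (simp add: a)
qed simp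

lemma poff_norm:
  assumes "coer D k bs" "k > 0"
  shows "vdot D (poff D bs a) (poff D bs a) \<le> vdot D a a"
proof -
  let ?p = "poff D bs a"
  obtain t where t: "?p = (\<lambda>c. a c + lincomb bs t c)" using poff_decomp by blast
  have "vdot D ?p (lincomb bs t) = 0" unfolding vdot_lincomb using poff_orth[OF assms] by (intro sum.neutral) auto
  moreover have "vdot D a a = vdot D ?p ?p - 2 * vdot D ?p (lincomb bs t) + vdot D (lincomb bs t) (lincomb bs t)"
    unfolding t by (simp add: vdot_def algebra_simps sum.distrib sum_distrib_left)
  ultimately show ?thesis using vdot_self_nonneg[of D "lincomb bs t"] by simp
qed

section \<open>Slowly varying functions\<close>

context graded_lie
begin

text \<open>One constant bounds the values and, divided by \<open>A\<close>, all derivatives, so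
  only \<open>k\<close> has to be followed through the algebra.\<close>

definition "slow B A k h \<longleftrightarrow> smooth h \<and> (\<forall>p. jet B k (k / A) h p)"

lemma slow_nonneg: "slow B A k h \<Longrightarrow> k \<ge> 0"
  unfolding slow_def using jet_val by (metis abs_ge_zero order_trans)

lemma slow_smooth: "slow B A k h \<Longrightarrow> smooth h" by (simp add: slow_def)

lemma slow_mono: "slow B A k h \<Longrightarrow> k \<le> k' \<Longrightarrow> A \<ge> 1 \<Longrightarrow> B \<ge> 2 \<Longrightarrow> slow B A k' h"
  unfolding slow_def using jet_mono[of B k "k / A" h _ k' "k' / A"] divide_right_mono[of k k' A] by auto

lemma slow_const: "\<bar>r\<bar> \<le> k \<Longrightarrow> A \<ge> 1 \<Longrightarrow> B \<ge> 2 \<Longrightarrow> slow B A k (\<lambda>x. r)"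
  unfolding slow_def by (auto intro!: jet_const divide_nonneg_nonneg)

lemma slow_add: "slow B A k h \<Longrightarrow> slow B A k' h' \<Longrightarrow> slow B A (k + k') (\<lambda>x. h x + h' x)"
  unfolding slow_def using jet_add[of h h' B k "k / A" _ k' "k' / A"] by (auto intro: smooth_add simp: add_divide_distrib)

lemma slow_uminus: "slow B A k h \<Longrightarrow> slow B A k (\<lambda>x. -1 * h x)"
  unfolding slow_def using jet_cmult[of h B k "k / A" _ "-1"] smooth_mult[OF smooth_const, of h "-1"] by auto

lemma slow_mult:
  assumes "slow B A k h" "slow B A k' h'" "A \<ge> 1" "B \<ge> 2"
  shows "slow B A (3 * (k * k')) (\<lambda>x. h x * h' x)"
proof -
  have k: "k \<ge> 0" "k' \<ge> 0" using assms slow_nonneg by blast+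
  have "jet B (3 * (k * k')) (3 * (k * k') / A) (\<lambda>x. h x * h' x) p" for p
  proof (rule jet_mono[OF jet_mult[OF assms(4)]])
    show "smooth h" "smooth h'" "jet B k (k / A) h p" "jet B k' (k' / A) h' p" using assms by (auto simp: slow_def)
    have "k / A * (k' / A) \<le> k * k' / A"
      using k assms(3) mult_left_le[of "1 / A" "k * k' / A"] by simp
    moreover have e: "k * (k' / A) = k * k' / A" "k' * (k / A) = k * k' / A" "3 * (k * k') / A = k * k' / A + k * k' / A + k * k' / A"
      by (simp_all add: mult.commute)
    ultimately show "k * (k' / A) + k' * (k / A) + k / A * (k' / A) \<le> 3 * (k * k') / A"
      unfolding e by (intro add_left_mono)
  qed (use k assms in auto)
  then show ?thesis using assms by (auto simp: slow_def intro: smooth_mult)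
qed

lemma slow_sum:
  assumes "\<And>i. i \<in> S \<Longrightarrow> slow B A k (h i)" "A \<ge> 1" "B \<ge> 2" "finite S"
  shows "slow B A (real (card S) * k) (\<lambda>x. \<Sum>i\<in>S. h i x)"
  using assms(4,1)
proof (induction S rule: finite_induct)
  case empty
  then show ?case using slow_const[of 0 0] assms by simp
next
  case (insert i S)
  then show ?case using slow_add[of B A k "h i" "real (card S) * k" "\<lambda>x. \<Sum>i\<in>S. h i x"] by (simp add: algebra_simps)
qed

lemma slow_inverse:
  assumes "slow B A k h" "A \<ge> 1" "B \<ge> 2" "m > 0" "\<And>x. h x \<ge> m" "A \<ge> 2 * k / m"
  shows "slow B A (1 / m + 2 * k / m\<^sup>2) (\<lambda>x. inverse (h x))"
proof -
  have k: "k \<ge> 0" using assms slow_nonneg by blast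
  have nz: "h x \<noteq> 0" for x using assms(4) assms(5)[of x] by auto
  have "jet B (1 / m + 2 * k / m\<^sup>2) ((1 / m + 2 * k / m\<^sup>2) / A) (\<lambda>x. inverse (h x)) p" for p
  proof (rule jet_mono[OF jet_inverse[OF assms(3)]])
    show "smooth h" "jet B k (k / A) h p" using assms by (auto simp: slow_def)
    show "2 * (k / A) \<le> m" using assms by (simp add: divide_simps mult.commute)
    show "m \<le> \<bar>h p\<bar>" using assms(5)[of p] by linarith
    show "2 / m\<^sup>2 * (k / A) \<le> (1 / m + 2 * k / m\<^sup>2) / A"
      using assms by (simp add: add_divide_distrib)
  qed (use k assms nz in auto)
  then show ?thesis using assms nz by (auto simp: slow_def intro: smooth_inverse)
qed

text \<open>A step of the recursion uses scalar products, one inverse and further products, each of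
  which changes the constant independently of \<open>A\<close>; largeness of \<open>A\<close> is
  what the inverse requires.\<close>

lemma slow_poff:
  assumes B: "B \<ge> 2" and m: "m > 0" and k: "k > 0"
  shows "\<exists>k'>0. \<exists>A0\<ge>1. \<forall>A\<ge>A0. \<forall>bs a. length bs = n \<longrightarrow>
     (\<forall>b\<in>set bs. \<forall>d<D. slow B A k (\<lambda>p. b p d)) \<longrightarrow> (\<forall>p. coer D m (map (\<lambda>b. b p) bs)) \<longrightarrow>
     (\<forall>d<D. slow B A k (\<lambda>p. a p d)) \<longrightarrow>
     (\<forall>d<D. slow B A k' (\<lambda>p. poff D (map (\<lambda>b. b p) bs) (a p) d))"
proof (induction n)
  case 0
  then show ?case using k by (intro exI[of _ k] conjI exI[of _ 1]) auto
next
  case (Suc n)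
  then obtain k1 A1 where k1: "k1 > 0" "A1 \<ge> 1" and IH: "\<And>A bs a. A \<ge> A1 \<Longrightarrow> length bs = n \<Longrightarrow>
     (\<forall>b\<in>set bs. \<forall>d<D. slow B A k (\<lambda>p. b p d)) \<Longrightarrow> (\<forall>p. coer D m (map (\<lambda>b. b p) bs)) \<Longrightarrow>
     (\<forall>d<D. slow B A k (\<lambda>p. a p d)) \<Longrightarrow>
     (\<forall>d<D. slow B A k1 (\<lambda>p. poff D (map (\<lambda>b. b p) bs) (a p) d))" by blast
  define k2 where "k2 = real D * (3 * (k1 * k1))"
  define k3 where "k3 = 1 / m + 2 * k2 / m\<^sup>2"
  define k4 where "k4 = 3 * (3 * (k2 * k3) * k1)"
  have k2: "k2 \<ge> 0" using k1 by (simp add: k2_def)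
  have k3: "k3 \<ge> 0" using k2 m by (simp add: k3_def)
  have k4: "k4 \<ge> 0" using k2 k3 k1 by (simp add: k4_def)
  define A0 where "A0 = max A1 (2 * k2 / m)"
  have main: "slow B A (k1 + k4) (\<lambda>p. poff D (map (\<lambda>b. b p) bs) (a p) d)"
    if A: "A \<ge> A0" and len: "length bs = Suc n" and sl: "\<forall>b\<in>set bs. \<forall>d<D. slow B A k (\<lambda>p. b p d)"
      and co: "\<forall>p. coer D m (map (\<lambda>b. b p) bs)" and a: "\<forall>d<D. slow B A k (\<lambda>p. a p d)" and d: "d < D" for A bs a d
  proof -
    obtain b bs' where bs: "bs = b # bs'" using len by (cases bs) auto
    have A': "A \<ge> A1" "A \<ge> 1" "A \<ge> 2 * k2 / m" using A k1 by (auto simp: A0_def)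
    let ?L = "\<lambda>p. map (\<lambda>b. b p) bs'"
    have co': "\<forall>p. coer D m (?L p)" using co coer_tail bs by fastforce
    have IH': "slow B A k1 (\<lambda>p. poff D (?L p) (a p) d)" if "\<forall>d<D. slow B A k (\<lambda>p. a p d)" "d < D" for a d
      using IH[OF A'(1) _ _ co' that(1)] len sl bs that(2) by auto
    have pa: "slow B A k1 (\<lambda>p. poff D (?L p) (a p) d)" if "d < D" for d by (rule IH'[OF a that])
    have pb: "slow B A k1 (\<lambda>p. poff D (?L p) (b p) d)" if "d < D" for d by (rule IH'[OF _ that]) (use sl bs in auto)
    have dot: "slow B A k2 (\<lambda>p. vdot D (x p) (y p))"
      if "\<And>d. d < D \<Longrightarrow> slow B A k1 (\<lambda>p. x p d)" "\<And>d. d < D \<Longrightarrow> slow B A k1 (\<lambda>p. y p d)" for x y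
      using slow_sum[of "{..<D}" B A "3 * (k1 * k1)" "\<lambda>d p. x p d * y p d"] slow_mult[OF that(1) that(2) A'(2) B] A'(2) B
      by (simp add: vdot_def k2_def)
    have "vdot D (poff D (?L p) (b p)) (poff D (?L p) (b p)) \<ge> m" for p
      using co bs by (intro coer_head[OF _ m]) auto
    then have inv: "slow B A k3 (\<lambda>p. inverse (vdot D (poff D (?L p) (b p)) (poff D (?L p) (b p))))"
      unfolding k3_def by (intro slow_inverse[OF dot[OF pb pb] A'(2) B m]) (use A'(3) in auto)
    have s1: "slow B A (1 * k4) (\<lambda>p. -1 * (vdot D (poff D (?L p) (a p)) (poff D (?L p) (b p)) * inverse (vdot D (poff D (?L p) (b p)) (poff D (?L p) (b p))) * poff D (?L p) (b p) d))"
    proof -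
      have "slow B A k4 (\<lambda>p. vdot D (poff D (?L p) (a p)) (poff D (?L p) (b p)) * inverse (vdot D (poff D (?L p) (b p)) (poff D (?L p) (b p))) * poff D (?L p) (b p) d)"
        unfolding k4_def by (rule slow_mult[OF slow_mult[OF dot[OF pa pb] inv A'(2) B] pb[OF d] A'(2) B])
      from slow_uminus[OF this] show ?thesis by simp
    qed
    show ?thesis using slow_add[OF pa[OF d] s1] by (simp add: bs divide_inverse)
  qed
  show ?case
    by (intro exI[of _ "k1 + k4"] conjI exI[of _ A0] allI impI main) (use k1 k4 in \<open>auto simp: A0_def\<close>)
qed

text \<open>Translation by \<open>g\<close> preserves the bounds along the frame and moves the base
  point to 0. The mean value theorem on the ray to \<open>ld g p\<close> then needs only the coframe
  on a fixed compact cube.\<close>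

lemma slow_lipschitz:
  assumes B: "B \<ge> 2"
  shows "\<exists>K2>0. \<forall>A k h g p. A \<ge> 1 \<longrightarrow> slow B A k h \<longrightarrow> ld g p \<in> cube 1 \<longrightarrow> \<bar>h p - h g\<bar> \<le> K2 * k / A"
proof -
  define F where "F z = (\<Sum>b\<in>I. \<bar>fr b (fst z) (snd z)\<bar>)" for z :: "'a \<times> 'a"
  have sf: "smooth (fst :: 'a \<times> 'a \<Rightarrow> 'a)" "smooth (snd :: 'a \<times> 'a \<Rightarrow> 'a)"
    by (intro smooth_linear bounded_linear.linear bounded_linear_fst bounded_linear_snd)+
  have "continuous_on UNIV (\<lambda>z::'a \<times> 'a. \<bar>fr b (fst z) (snd z)\<bar>)" for b
    unfolding fr_def divide_inverse
    by (intro continuous_on_rabs smooth_continuous smooth_mult smooth_const smooth_co smooth_N sf)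
  then have "continuous_on (cube 1 \<times> cube 1) F"
    unfolding F_def by (intro continuous_on_sum) (auto intro: continuous_on_subset)
  then have "compact (F ` (cube 1 \<times> cube 1))"
    by (intro compact_continuous_image compact_Times compact_cube)
  from compact_imp_bounded[OF this] obtain K where "\<forall>x\<in>F ` (cube 1 \<times> cube 1). norm x \<le> K"
    unfolding bounded_iff by blast
  then have K: "\<bar>F z\<bar> \<le> K" if "z \<in> cube 1 \<times> cube 1" for z using that by force
  have "\<bar>h p - h g\<bar> \<le> ((\<bar>K\<bar> + 1) * B) * k / A" if A: "A \<ge> 1" and sl: "slow B A k h" and y: "ld g p \<in> cube 1" for A k h g p
  proof -
    let ?y = "ld g p"
    define h' where "h' z = h (g + M g z)" for z
    have k: "k \<ge> 0" by (rule slow_nonneg[OF sl])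
    have smh: "smooth h" by (rule slow_smooth[OF sl])
    have smh': "smooth h'" unfolding h'_def[abs_def]
      by (intro smooth_compose[OF smh] smooth_add smooth_const smooth_M smooth_id)
    have hh: "h = (\<lambda>x. h' (ld g x))" by (simp add: h'_def ld_eq)
    have fwh: "fw Y [b] h' z = fw Y [b] h (g + M g z)" if "b \<in> I" for b z
    proof -
      have "fw Y [b] (\<lambda>x. h' (ld g x)) = (\<lambda>x. fw Y [b] h' (ld g x))"
        by (rule fw_ld) (use that smh' in auto)
      from fun_cong[OF this, of "g + M g z"] show ?thesis
        unfolding hh[symmetric] ld_left by (rule sym)
    qed
    have bd: "\<bar>fw Y [b] h' z\<bar> \<le> k / A * B" if "b \<in> I" for b z
      using sl that jetD[of B k "k / A" h "g + M g z" "[b]"] fwh[OF that] by (simp add: slow_def)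
    have der: "((\<lambda>t. h' (t *\<^sub>R ?y)) has_real_derivative frechet_derivative h' (at (t *\<^sub>R ?y)) ?y) (at t)" for t
    proof -
      have "((\<lambda>t. t *\<^sub>R ?y) has_derivative (\<lambda>r. r *\<^sub>R ?y)) (at t)" by (auto intro!: derivative_eq_intros)
      from has_derivative_compose[OF this smooth_has_derivative[OF smh']]
      show ?thesis by (simp add: has_field_derivative_def linear_scale[OF smooth_linear_fd[OF smh']] mult_commute_abs)
    qed
    obtain z where z: "0 < z" "z < 1" "h' (1 *\<^sub>R ?y) - h' (0 *\<^sub>R ?y) = (1 - 0) * frechet_derivative h' (at (z *\<^sub>R ?y)) ?y"
      using MVT2[of 0 1 "\<lambda>t. h' (t *\<^sub>R ?y)", OF _ der] by auto
    have zy: "z *\<^sub>R ?y \<in> cube 1"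
      using y z by (auto simp: cube_def abs_mult mult_le_one)
    have "\<bar>h p - h g\<bar> = \<bar>\<Sum>b\<in>I. fr b (z *\<^sub>R ?y) ?y * fw Y [b] h' (z *\<^sub>R ?y)\<bar>"
      using z(3) fd_frame[OF smh', of "z *\<^sub>R ?y" ?y] by (simp add: h'_def ld_eq del: fw.simps)
    also have "\<dots> \<le> (\<Sum>b\<in>I. \<bar>fr b (z *\<^sub>R ?y) ?y\<bar> * (k / A * B))"
      by (intro order_trans[OF sum_abs] sum_mono, unfold abs_mult) (intro mult_left_mono bd abs_ge_zero, assumption)
    also have "\<dots> = F (z *\<^sub>R ?y, ?y) * (k / A * B)" unfolding F_def fst_conv snd_conv by (rule sum_distrib_right[symmetric])
    also have "\<dots> \<le> (\<bar>K\<bar> + 1) * (k / A * B)"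
      using K[of "(z *\<^sub>R ?y, ?y)"] zy y k A B by (intro mult_right_mono) auto
    finally show ?thesis by (simp add: algebra_simps)
  qed
  moreover have "(\<bar>K\<bar> + 1) * B > 0" using B by (intro mult_pos_pos) auto
  ultimately show ?thesis by (intro exI[of _ "(\<bar>K\<bar> + 1) * B"]) auto
qed

end

section \<open>Construction of a single scale\<close>

locale test_bounds = graded_lie +
  fixes B Ca ca :: real
  assumes B2: "B \<ge> 2" and Ca: "Ca > 0" and ca: "ca > 0"
    and tf_bound: "\<And>l w p. l \<in> Ls \<Longrightarrow> w \<in> lists I \<Longrightarrow> \<bar>fw Y w (tf l) p\<bar> \<le> Ca * B ^ (length w)\<^sup>2"
    and tf_coercive: "\<And>y t. y \<in> cube (1/2) \<Longrightarrow>
        ca * (\<Sum>\<alpha>\<in>Wset s kk. (t \<alpha>)\<^sup>2) \<le> (\<Sum>l\<in>Ls. (\<Sum>\<alpha>\<in>Wset s kk. t \<alpha> * fw Y \<alpha> (tf l) y)\<^sup>2)"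
begin

abbreviation "DD \<equiv> Dim s kk"
abbreviation "WW \<equiv> Wset s kk"

lemma B_ge1: "1 \<le> B ^ n"
  using B2 by (simp add: one_le_power)

definition "K1 = real (2 ^ card I * card Ls) * Ca"

lemma K1_nonneg: "K1 \<ge> 0" using Ca by (simp add: K1_def)

lemma sum_near_bound:
  assumes "\<And>g l. g \<in> near p \<Longrightarrow> l \<in> Ls \<Longrightarrow> \<bar>h g l\<bar> \<le> K" "K \<ge> 0"
  shows "\<bar>\<Sum>g\<in>near p. \<Sum>l\<in>Ls. h g l\<bar> \<le> real (2 ^ card I * card Ls) * K"
proof -
  have "\<bar>\<Sum>g\<in>near p. \<Sum>l\<in>Ls. h g l\<bar> \<le> (\<Sum>g\<in>near p. \<Sum>l\<in>Ls. K)"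
    by (intro order_trans[OF sum_abs] sum_mono) (use assms in auto)
  also have "\<dots> = real (card (near p) * card Ls) * K" by simp
  also have "\<dots> \<le> real (2 ^ card I * card Ls) * K"
    using card_near[of p] assms(2) by (intro mult_right_mono of_nat_mono) auto
  finally show ?thesis .
qed

lemma afield_bound:
  assumes "\<And>g l. l \<in> Ls \<Longrightarrow> \<bar>\<epsilon> g l\<bar> \<le> 1" "w \<in> lists I"
  shows "\<bar>fw Y w (afield \<epsilon>) p\<bar> \<le> K1 * B ^ (length w)\<^sup>2"
proof -
  have "\<bar>fw Y w (tf l) (ld g p) * \<epsilon> g l\<bar> \<le> Ca * B ^ (length w)\<^sup>2" if "l \<in> Ls" for g l
    using mult_mono[OF tf_bound[OF that assms(2)] assms(1)[OF that]] Ca B_ge1[of "(length w)\<^sup>2"]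
    by (simp add: abs_mult)
  then show ?thesis unfolding fw_afield[OF assms(2)] K1_def mult.assoc
    using sum_near_bound[of p _ "Ca * B ^ (length w)\<^sup>2"] Ca B_ge1[of "(length w)\<^sup>2"] by (simp add: mult.assoc)
qed

text \<open>\<open>Cp\<close> is chosen before \<open>k\<close> and \<open>m\<close>, which in the
  induction depend on \<open>Cp\<close>. This is possible because a projection has entries at most 1
  and, for large \<open>A\<close>, derivatives below the weight, so the size of \<phi> is that of
  the unprojected field. The bound on \<open>n\<close> is what the blocks can accommodate.\<close>

lemma step_field:
  "\<exists>Cp>0. \<forall>n\<le>card WW. \<forall>k>0. \<forall>m>0. \<exists>A0\<ge>1. \<exists>C'>0. \<forall>A\<ge>A0. \<forall>bs. length bs = n \<longrightarrow>
     (\<forall>b\<in>set bs. \<forall>d<DD. slow B A k (\<lambda>p. b p d)) \<longrightarrow> (\<forall>p. coer DD m (map (\<lambda>b. b p) bs)) \<longrightarrow>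
     (\<exists>\<phi>. (\<forall>d. smooth (\<phi> d)) \<and>
       (\<forall>d<DD. \<forall>w\<in>lists I. \<forall>p. \<bar>fw Y w (\<phi> d) p\<bar> \<le> Cp * B ^ (length w)\<^sup>2) \<and>
       (\<forall>b\<in>set bs. \<forall>p. (\<Sum>d<DD. \<phi> d p * b p d) = 0) \<and>
       (\<forall>b\<in>set bs. \<forall>w\<in>lists I. \<forall>p. \<bar>\<Sum>d<DD. fw Y w (\<phi> d) p * b p d\<bar> \<le> C' / A * B ^ (length w)\<^sup>2) \<and>
       (\<forall>p t. ca / 4 * (\<Sum>\<alpha>\<in>WW. (t \<alpha>)\<^sup>2) \<le> (\<Sum>d<DD. (\<Sum>\<alpha>\<in>WW. t \<alpha> * fw Y \<alpha> (\<phi> d) p)\<^sup>2)))"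
proof (rule exI[of _ "3 * real DD * K1 + 1"], intro conjI allI impI)
  show "0 < 3 * real DD * K1 + 1" using K1_nonneg by (intro add_nonneg_pos mult_nonneg_nonneg) auto
  fix n and k m :: real assume n: "n \<le> card WW" and k: "0 < k" and m: "0 < m"
  obtain blk where bb: "(\<forall>\<kappa>\<subseteq>I. blk \<kappa> \<subseteq> {..<DD} \<and> card WW + card Ls \<le> card (blk \<kappa>)) \<and>
     (\<forall>\<kappa>\<subseteq>I. \<forall>\<kappa>'\<subseteq>I. \<kappa> \<noteq> \<kappa>' \<longrightarrow> blk \<kappa> \<inter> blk \<kappa>' = ({} :: nat set))"
    using blocks_exist by (rule exE)
  have blk: "\<And>\<kappa>. \<kappa> \<subseteq> I \<Longrightarrow> blk \<kappa> \<subseteq> {..<DD}" "\<And>\<kappa>. \<kappa> \<subseteq> I \<Longrightarrow> card WW + card Ls \<le> card (blk \<kappa>)"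
    "\<And>\<kappa> \<kappa>'. \<kappa> \<subseteq> I \<Longrightarrow> \<kappa>' \<subseteq> I \<Longrightarrow> \<kappa> \<noteq> \<kappa>' \<Longrightarrow> blk \<kappa> \<inter> blk \<kappa>' = {}"
    using bb by simp_all
  \<comment> \<open>At least 1, so that the constant unit vectors, whose projections form the matrix
    \<open>P\<close>, are slow with the same constant.\<close>
  define k0 where "k0 = max k 1"
  have k0: "k0 > 0" "k \<le> k0" "1 \<le> k0" by (auto simp: k0_def)
  obtain k1 A1 where k1: "k1 > 0" "A1 \<ge> 1" and slowP: "\<And>A bs a. A \<ge> A1 \<Longrightarrow> length bs = n \<Longrightarrow>
     (\<forall>b\<in>set bs. \<forall>d<DD. slow B A k0 (\<lambda>p. b p d)) \<Longrightarrow> (\<forall>p. coer DD m (map (\<lambda>b. b p) bs)) \<Longrightarrow>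
     (\<forall>d<DD. slow B A k0 (\<lambda>p. a p d)) \<Longrightarrow>
     (\<forall>d<DD. slow B A k1 (\<lambda>p. poff DD (map (\<lambda>b. b p) bs) (a p) d))"
    using slow_poff[OF B2 m k0(1), of n DD] by blast
  obtain K2 where K2: "K2 > 0" "\<And>A k h g p. A \<ge> 1 \<Longrightarrow> slow B A k h \<Longrightarrow> ld g p \<in> cube 1 \<Longrightarrow> \<bar>h p - h g\<bar> \<le> K2 * k / A"
    using slow_lipschitz[OF B2] by blast
  define C4 where "C4 = K1 * (real DD * (K2 * k1)) + real DD * (2 * K1 * k1)"
  have C4: "C4 \<ge> 0" using K1_nonneg K2 k1 by (simp add: C4_def)
  define \<eta> where "\<eta> = real DD * (real (card WW) * (C4 * B ^ s\<^sup>2)\<^sup>2)"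
  have eta: "\<eta> \<ge> 0" by (simp add: \<eta>_def)
  define A0 where "A0 = max (max A1 k1) (4 * \<eta> / ca)"
  define C' where "C' = real DD * (real DD * (2 * K1 * k1) * k0) + 1"
  have C': "C' > 0" unfolding C'_def using K1_nonneg k1 k0 by (intro add_nonneg_pos mult_nonneg_nonneg) auto
  show "\<exists>A0\<ge>1. \<exists>C'>0. \<forall>A\<ge>A0. \<forall>bs. length bs = n \<longrightarrow>
     (\<forall>b\<in>set bs. \<forall>d<DD. slow B A k (\<lambda>p. b p d)) \<longrightarrow> (\<forall>p. coer DD m (map (\<lambda>b. b p) bs)) \<longrightarrow>
     (\<exists>\<phi>. (\<forall>d. smooth (\<phi> d)) \<and>
       (\<forall>d<DD. \<forall>w\<in>lists I. \<forall>p. \<bar>fw Y w (\<phi> d) p\<bar> \<le> (3 * real DD * K1 + 1) * B ^ (length w)\<^sup>2) \<and>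
       (\<forall>b\<in>set bs. \<forall>p. (\<Sum>d<DD. \<phi> d p * b p d) = 0) \<and>
       (\<forall>b\<in>set bs. \<forall>w\<in>lists I. \<forall>p. \<bar>\<Sum>d<DD. fw Y w (\<phi> d) p * b p d\<bar> \<le> C' / A * B ^ (length w)\<^sup>2) \<and>
       (\<forall>p t. ca / 4 * (\<Sum>\<alpha>\<in>WW. (t \<alpha>)\<^sup>2) \<le> (\<Sum>d<DD. (\<Sum>\<alpha>\<in>WW. t \<alpha> * fw Y \<alpha> (\<phi> d) p)\<^sup>2)))"
  proof (rule exI[of _ A0], intro conjI, goal_cases)
    case 1
    show ?case using k1 by (simp add: A0_def)
  next
    case 2
    show ?case
    proof (rule exI[of _ C'], intro conjI allI impI)
      show "0 < C'" by (rule C')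
      fix A and bs :: "('a \<Rightarrow> nat \<Rightarrow> real) list"
      assume A: "A0 \<le> A" and len: "length bs = n"
        and sl: "\<forall>b\<in>set bs. \<forall>d<DD. slow B A k (\<lambda>p. b p d)" and co: "\<forall>p. coer DD m (map (\<lambda>b. b p) bs)"
      have A': "A \<ge> A1" "A \<ge> 1" "A \<ge> k1" "A \<ge> 4 * \<eta> / ca" using A k1 by (auto simp: A0_def)
      let ?bs = "\<lambda>p. map (\<lambda>b. b p) bs"
      \<comment> \<open>At each lattice point the values are orthonormal vectors in the block of its
        colour, orthogonal to the given fields at that very point.\<close>
      have "\<exists>e. (\<forall>l\<in>Ls. (\<forall>c. c \<notin> blk (parity g) \<longrightarrow> e l c = 0) \<and> (\<forall>v\<in>set (?bs g). (\<Sum>c\<in>blk (parity g). v c * e l c) = 0)) \<and>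
         (\<forall>l\<in>Ls. \<forall>l'\<in>Ls. (\<Sum>c\<in>blk (parity g). e l c * e l' c) = (if l = l' then 1 else 0))" for g
      proof (rule orthonormal_family_exists)
        have p: "parity g \<subseteq> I" by (auto simp: parity_def)
        show "finite (blk (parity g))" using blk(1)[OF p] finite_subset by blast
        show "length (?bs g) + card Ls \<le> card (blk (parity g))" using blk(2)[OF p] len n by simp
      qed (rule finite_Ls)
      then have ex: "\<forall>g. \<exists>e. (\<forall>l\<in>Ls. (\<forall>c. c \<notin> blk (parity g) \<longrightarrow> e l c = 0) \<and> (\<forall>v\<in>set (?bs g). (\<Sum>c\<in>blk (parity g). v c * e l c) = 0)) \<and>
         (\<forall>l\<in>Ls. \<forall>l'\<in>Ls. (\<Sum>c\<in>blk (parity g). e l c * e l' c) = (if l = l' then 1 else 0))" by (rule allI)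
      obtain e where ee: "\<forall>g. (\<forall>l\<in>Ls. (\<forall>c. c \<notin> blk (parity g) \<longrightarrow> e g l c = 0) \<and> (\<forall>v\<in>set (?bs g). (\<Sum>c\<in>blk (parity g). v c * e g l c) = 0)) \<and>
         (\<forall>l\<in>Ls. \<forall>l'\<in>Ls. (\<Sum>c\<in>blk (parity g). e g l c * e g l' c) = (if l = l' then 1 else 0))"
        using choice[OF ex] by (rule exE)
      have e: "\<And>g l c. l \<in> Ls \<Longrightarrow> c \<notin> blk (parity g) \<Longrightarrow> e g l c = 0"
        "\<And>g l v. l \<in> Ls \<Longrightarrow> v \<in> set (?bs g) \<Longrightarrow> (\<Sum>c\<in>blk (parity g). v c * e g l c) = 0"
        "\<And>g l l'. l \<in> Ls \<Longrightarrow> l' \<in> Ls \<Longrightarrow> (\<Sum>c\<in>blk (parity g). e g l c * e g l' c) = (if l = l' then 1 else 0)"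
        using ee by (simp, blast, simp)
      have par: "parity g \<subseteq> I" for g by (auto simp: parity_def)
      have eD: "(\<Sum>c<DD. v c * e g l c) = (\<Sum>c\<in>blk (parity g). v c * e g l c)" if "l \<in> Ls" for v g l
        by (rule sum.mono_neutral_right) (use blk(1)[OF par] e(1)[OF that] in auto)
      have e1: "\<bar>e g l c\<bar> \<le> 1" if l: "l \<in> Ls" for g l c
      proof (cases "c \<in> blk (parity g)")
        case True
        have "(e g l c)\<^sup>2 \<le> (\<Sum>c\<in>blk (parity g). e g l c * e g l c)"
          unfolding power2_eq_square using True finite_subset[OF blk(1)[OF par]] by (intro member_le_sum) auto
        then show ?thesis using e(3)[OF l l] by (simp add: abs_square_le_1)
      qed (use e(1)[OF l] in auto)
      \<comment> \<open>\<open>a\<close> is the unprojected field, \<open>P\<close> the matrix of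
        the projection at \<open>p\<close>, and \<phi> the product of the two.\<close>
      define a where "a d = afield (\<lambda>g l. e g l d)" for d
      define P where "P d d' p = poff DD (?bs p) (\<lambda>c. if c = d' then 1 else 0) d" for d d' p
      define \<phi> where "\<phi> d p = (if d < DD then (\<Sum>d'<DD. P d d' p * a d' p) else 0)" for d p
      have sma: "smooth (a d)" for d unfolding a_def by (rule smooth_afield)
      have ja: "jet B K1 K1 (a d) p" for d p
        using afield_bound[of "\<lambda>g l. e g l d" _ p] afield_bound[of "\<lambda>g l. e g l d" "[]" p] e1 
        by (auto simp: jet_def a_def)
      have slb: "\<forall>b\<in>set bs. \<forall>d<DD. slow B A k0 (\<lambda>p. b p d)" using sl slow_mono[OF _ k0(2) A'(2) B2] by blast
      have slP: "slow B A k1 (P d d')" if "d < DD" for d d'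
      proof -
        have "\<forall>d<DD. slow B A k0 (\<lambda>p. (\<lambda>c. if c = d' then 1 else (0::real)) d)"
          using k0 by (auto intro!: slow_const A' B2)
        from slowP[OF A'(1) len slb co this] show ?thesis using that by (simp add: P_def[abs_def])
      qed
      have smP: "smooth (P d d')" if "d < DD" for d d' using slow_smooth[OF slP[OF that]] .
      have P1: "\<bar>P d d' p\<bar> \<le> 1" if "d < DD" "d' < DD" for d d' p
      proof -
        have "(P d d' p)\<^sup>2 \<le> vdot DD (poff DD (?bs p) (\<lambda>c. if c = d' then 1 else 0)) (poff DD (?bs p) (\<lambda>c. if c = d' then 1 else 0))"
          unfolding vdot_def P_def power2_eq_square using that by (intro member_le_sum) auto
        also have "\<dots> \<le> vdot DD (\<lambda>c. if c = d' then 1 else 0) (\<lambda>c. if c = d' then 1 else 0)"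
          by (rule poff_norm[OF _ m]) (use co in auto)
        also have "\<dots> = 1" using that by (simp add: vdot_def if_distrib cong: if_cong)
        finally show ?thesis by (simp add: abs_square_le_1)
      qed
      have jP: "jet B 1 (k1 / A) (P d d') p" if "d < DD" "d' < DD" for d d' p
        using slP[OF that(1)] P1[OF that] by (auto simp: slow_def jet_def)
      have Pcomb: "(\<Sum>d'<DD. P d d' p * v d') = poff DD (?bs p) v d" if v: "\<And>c. c \<ge> DD \<Longrightarrow> v c = 0" for d p v
      proof -
        have "v = (\<lambda>c. \<Sum>d'\<in>{..<DD}. v d' * (if c = d' then 1 else 0))"
          using v by (auto simp: fun_eq_iff if_distrib not_less cong: if_cong)
        then have "poff DD (?bs p) v = (\<lambda>c. \<Sum>d'\<in>{..<DD}. v d' * poff DD (?bs p) (\<lambda>c. if c = d' then 1 else 0) c)"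
          using poff_sum[of "{..<DD}" DD "?bs p" v "\<lambda>d' c. if c = d' then 1 else 0"] by simp
        then show ?thesis by (simp add: P_def mult.commute)
      qed
      have Porth: "(\<Sum>d<DD. P d d' p * b p d) = 0" if "b \<in> set bs" for d' p b
        using poff_orth[of DD m "?bs p" "b p" "\<lambda>c. if c = d' then 1 else 0"] co m that by (auto simp: vdot_def P_def)
      have sm: "smooth (\<phi> d)" for d
        unfolding \<phi>_def[abs_def] by (cases "d < DD") (auto intro!: smooth_sum smooth_mult smP sma)
      have k1A: "k1 / A \<le> 1" "k1 / A \<ge> 0" using A' k1 by auto
      have fwphi: "fw Y w (\<phi> d) p = (\<Sum>d'<DD. fw Y w (\<lambda>x. P d d' x * a d' x) p)" if "d < DD" for w d p
        unfolding \<phi>_def[abs_def] using that by (simp add: fw_sum smooth_mult smP sma)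
      have bound: "\<bar>fw Y w (\<phi> d) p\<bar> \<le> (3 * real DD * K1 + 1) * B ^ (length w)\<^sup>2" if d: "d < DD" and w: "w \<in> lists I" for d w p
      proof -
        have "\<bar>fw Y w (\<lambda>x. P d d' x * a d' x) p\<bar> \<le> 3 * K1 * B ^ (length w)\<^sup>2" if d': "d' < DD" for d'
        proof -
          have j: "jet B (1 * K1) (1 * K1 + K1 * (k1 / A) + k1 / A * K1) (\<lambda>x. P d d' x * a d' x) p"
            by (rule jet_mult[OF B2 smP[OF d] sma jP[OF d d'] ja k1A(2) K1_nonneg])
          have le: "1 * K1 + K1 * (k1 / A) + k1 / A * K1 \<le> 3 * K1"
            using mult_left_le[OF k1A(1) K1_nonneg] by (simp add: mult.commute)
          have "jet B (3 * K1) (3 * K1) (\<lambda>x. P d d' x * a d' x) p"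
            by (rule jet_mono[OF j _ le]) (use K1_nonneg B2 in auto)
          then show ?thesis using w by (cases "w = []") (auto simp: jet_def)
        qed
        then have "\<bar>fw Y w (\<phi> d) p\<bar> \<le> (\<Sum>d'<DD. 3 * K1 * B ^ (length w)\<^sup>2)"
          unfolding fwphi[OF d] by (intro order_trans[OF sum_abs] sum_mono) auto
        also have "\<dots> \<le> (3 * real DD * K1 + 1) * B ^ (length w)\<^sup>2"
          using B_ge1[of "(length w)\<^sup>2"] by (simp add: algebra_simps)
        finally show ?thesis .
      qed
      have orth: "(\<Sum>d<DD. \<phi> d p * b p d) = 0" if b: "b \<in> set bs" for b p
      proof -
        have "(\<Sum>d<DD. \<phi> d p * b p d) = (\<Sum>d<DD. \<Sum>d'<DD. a d' p * (P d d' p * b p d))"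
          by (rule sum.cong) (auto simp: \<phi>_def sum_distrib_left sum_distrib_right algebra_simps)
        also have "\<dots> = (\<Sum>d'<DD. a d' p * (\<Sum>d<DD. P d d' p * b p d))"
          by (subst sum.swap) (simp add: sum_distrib_left)
        finally show ?thesis using Porth[OF b] by simp
      qed
      \<comment> \<open>The error of letting the derivatives fall on \<open>a\<close> only, with
        \<open>P\<close> frozen at \<open>p\<close>; it is of order \<open>1 / A\<close>.\<close>
      define R where "R w d p = fw Y w (\<phi> d) p - (\<Sum>d'<DD. P d d' p * fw Y w (a d') p)" for w d p
      have R: "\<bar>R w d p\<bar> \<le> real DD * (2 * K1 * k1) / A * B ^ (length w)\<^sup>2" if d: "d < DD" and w: "w \<in> lists I" for w d p
      proof -
        have "\<bar>fw Y w (\<lambda>x. P d d' x * a d' x) p - P d d' p * fw Y w (a d') p\<bar> \<le> (2 * K1 * k1) / A * B ^ (length w)\<^sup>2" if "d' < DD" for d'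
          using fw_mult_freeze[OF B2 smP[OF d] sma jP[OF d that] ja k1A(2) K1_nonneg w] by (simp add: algebra_simps)
        then have "\<bar>R w d p\<bar> \<le> (\<Sum>d'<DD. (2 * K1 * k1) / A * B ^ (length w)\<^sup>2)"
          unfolding R_def fwphi[OF d] sum_subtractf[symmetric] by (intro order_trans[OF sum_abs] sum_mono) auto
        then show ?thesis by (simp add: algebra_simps)
      qed
      \<comment> \<open>With \<open>P\<close> frozen the derivatives would be exactly orthogonal, so
        only \<open>R\<close> contributes.\<close>
      have near_orth: "\<bar>\<Sum>d<DD. fw Y w (\<phi> d) p * b p d\<bar> \<le> C' / A * B ^ (length w)\<^sup>2" if b: "b \<in> set bs" and w: "w \<in> lists I" for b w p
      proof -
        have "(\<Sum>d<DD. fw Y w (\<phi> d) p * b p d) = (\<Sum>d<DD. R w d p * b p d) + (\<Sum>d<DD. \<Sum>d'<DD. fw Y w (a d') p * (P d d' p * b p d))"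
          unfolding sum.distrib[symmetric] by (rule sum.cong) (auto simp: R_def algebra_simps sum_distrib_left sum_distrib_right)
        also have "(\<Sum>d<DD. \<Sum>d'<DD. fw Y w (a d') p * (P d d' p * b p d)) = 0"
          by (subst sum.swap) (simp add: sum_distrib_left[symmetric] Porth[OF b])
        finally have "\<bar>\<Sum>d<DD. fw Y w (\<phi> d) p * b p d\<bar> \<le> (\<Sum>d<DD. \<bar>R w d p\<bar> * \<bar>b p d\<bar>)"
          using sum_abs[of "\<lambda>d. R w d p * b p d" "{..<DD}"] by (simp add: abs_mult)
        also have "\<dots> \<le> (\<Sum>d<DD. (real DD * (2 * K1 * k1) / A * B ^ (length w)\<^sup>2) * k0)"
        proof (intro sum_mono mult_mono)
          fix d assume d: "d \<in> {..<DD}"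
          then show "\<bar>R w d p\<bar> \<le> real DD * (2 * K1 * k1) / A * B ^ (length w)\<^sup>2" using R w by simp
          show "\<bar>b p d\<bar> \<le> k0" using slb b d by (auto simp: slow_def jet_def)
          show "0 \<le> real DD * (2 * K1 * k1) / A * B ^ (length w)\<^sup>2" using K1_nonneg k1 A' B2 by simp
        qed auto
        also have "\<dots> = (real DD * (real DD * (2 * K1 * k1) * k0)) / A * B ^ (length w)\<^sup>2" by (simp add: algebra_simps)
        also have "\<dots> \<le> C' / A * B ^ (length w)\<^sup>2"
          using A' B2 by (intro mult_right_mono divide_right_mono) (auto simp: C'_def)
        finally show ?thesis .
      qed
      \<comment> \<open>The projection at \<open>g\<close> fixes each \<open>e g l\<close>, and
        \<open>P\<close> varies by order \<open>1 / A\<close> between \<open>g\<close> and a nearby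
        \<open>p\<close>; hence projecting hardly changes any derivative.\<close>
      have diff: "\<bar>fw Y w (\<phi> d) p - fw Y w (a d) p\<bar> \<le> C4 / A * B ^ (length w)\<^sup>2" if d: "d < DD" and w: "w \<in> lists I" for w d p
      proof -
        let ?F = "\<lambda>g l. fw Y w (tf l) (ld g p)"
        have av: "fw Y w (a d') p = (\<Sum>g\<in>near p. \<Sum>l\<in>Ls. ?F g l * e g l d')" for d'
          unfolding a_def by (rule fw_afield[OF w])
        have fixe: "(\<Sum>d'<DD. P d d' g * e g l d') = e g l d" if l: "l \<in> Ls" for g l
        proof -
          have z: "e g l c = 0" if "c \<ge> DD" for c using e(1)[OF l] blk(1)[OF par[of g]] that by fastforce
          have "vdot DD (e g l) v = 0" if "v \<in> set (?bs g)" for v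
            using e(2)[OF l that] eD[OF l, of v g] by (simp add: vdot_def mult.commute)
          then show ?thesis using Pcomb[OF z] poff_id[of "?bs g" DD "e g l"] by simp
        qed
        have "(\<Sum>d'<DD. P d d' p * fw Y w (a d') p) - fw Y w (a d) p
          = (\<Sum>g\<in>near p. \<Sum>l\<in>Ls. ?F g l * ((\<Sum>d'<DD. P d d' p * e g l d') - e g l d))"
          unfolding av right_diff_distrib sum_subtractf sum_distrib_left
          by (subst sum.swap, subst (2) sum.swap) (simp add: algebra_simps)
        also have "\<dots> = (\<Sum>g\<in>near p. \<Sum>l\<in>Ls. ?F g l * (\<Sum>d'<DD. (P d d' p - P d d' g) * e g l d'))"
          by (intro sum.cong refl) (simp add: left_diff_distrib sum_subtractf fixe)
        finally have eqd: "(\<Sum>d'<DD. P d d' p * fw Y w (a d') p) - fw Y w (a d) p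
          = (\<Sum>g\<in>near p. \<Sum>l\<in>Ls. ?F g l * (\<Sum>d'<DD. (P d d' p - P d d' g) * e g l d'))" .
        have "\<bar>\<Sum>g\<in>near p. \<Sum>l\<in>Ls. ?F g l * (\<Sum>d'<DD. (P d d' p - P d d' g) * e g l d')\<bar> \<le> real (2 ^ card I * card Ls) * ((Ca * B ^ (length w)\<^sup>2) * (real DD * (K2 * k1 / A)))"
        proof (rule sum_near_bound)
          fix g l assume g: "g \<in> near p" and l: "l \<in> Ls"
          have "\<bar>\<Sum>d'<DD. (P d d' p - P d d' g) * e g l d'\<bar> \<le> (\<Sum>d'<DD. (K2 * k1 / A) * 1)"
          proof (intro order_trans[OF sum_abs] sum_mono)
            fix d' assume "d' \<in> {..<DD}"
            show "\<bar>(P d d' p - P d d' g) * e g l d'\<bar> \<le> (K2 * k1 / A) * 1"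
              unfolding abs_mult using K2(2)[OF A'(2) slP[OF d] near_cube[OF g]] e1[OF l] K2(1) k1 A'
              by (intro mult_mono) auto
          qed
          then have "\<bar>\<Sum>d'<DD. (P d d' p - P d d' g) * e g l d'\<bar> \<le> real DD * (K2 * k1 / A)" by simp
          then show "\<bar>?F g l * (\<Sum>d'<DD. (P d d' p - P d d' g) * e g l d')\<bar> \<le> (Ca * B ^ (length w)\<^sup>2) * (real DD * (K2 * k1 / A))"
            unfolding abs_mult[of "?F g l"] using tf_bound[OF l w] Ca B2 by (intro mult_mono) auto
        qed (use Ca B2 K2 k1 A' in auto)
        also have "\<dots> = K1 * (real DD * (K2 * k1)) / A * B ^ (length w)\<^sup>2" by (simp add: K1_def algebra_simps)
        finally have "\<bar>(\<Sum>d'<DD. P d d' p * fw Y w (a d') p) - fw Y w (a d) p\<bar> \<le> K1 * (real DD * (K2 * k1)) / A * B ^ (length w)\<^sup>2"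
          unfolding eqd .
        then show ?thesis using R[OF d w, of p]
          unfolding C4_def R_def add_divide_distrib distrib_right by linarith
      qed
      \<comment> \<open>Choose \<open>g0\<close> with \<open>p\<close> in its cube of half-width
        1/2. No other nearby lattice point has its colour, so within its block only its own bumps
        are seen, and orthonormality reduces the norm to \<open>tf_coercive\<close>.\<close>
      have coera: "ca * (\<Sum>\<alpha>\<in>WW. (t \<alpha>)\<^sup>2) \<le> (\<Sum>d<DD. (\<Sum>\<alpha>\<in>WW. t \<alpha> * fw Y \<alpha> (a d) p)\<^sup>2)" for p t
      proof -
        obtain g0 where g0: "g0 \<in> Gam" "ld g0 p \<in> cube (1/2)" using lattice_cover by blast
        then have near0: "g0 \<in> near p" by (force simp: near_def cube_def)
        define x where "x l = (\<Sum>\<alpha>\<in>WW. t \<alpha> * fw Y \<alpha> (tf l) (ld g0 p))" for l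
        have X: "(\<Sum>\<alpha>\<in>WW. t \<alpha> * fw Y \<alpha> (a d) p) = (\<Sum>l\<in>Ls. x l * e g0 l d)" if d: "d \<in> blk (parity g0)" for d
        proof -
          have "fw Y \<alpha> (a d) p = (\<Sum>l\<in>Ls. fw Y \<alpha> (tf l) (ld g0 p) * e g0 l d)" if "\<alpha> \<in> WW" for \<alpha>
          proof -
            have "fw Y \<alpha> (a d) p = (\<Sum>g\<in>near p. if g = g0 then (\<Sum>l\<in>Ls. fw Y \<alpha> (tf l) (ld g0 p) * e g0 l d) else 0)"
              unfolding a_def fw_afield[OF Wset_lists[OF that, THEN conjunct1]]
            proof (rule sum.cong[OF refl])
              fix g assume g: "g \<in> near p"
              show "(\<Sum>l\<in>Ls. fw Y \<alpha> (tf l) (ld g p) * e g l d) = (if g = g0 then (\<Sum>l\<in>Ls. fw Y \<alpha> (tf l) (ld g0 p) * e g0 l d) else 0)"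
              proof (cases "g = g0")
                case False
                then have "parity g \<noteq> parity g0" using inj_parity_near g near0 by (auto dest: inj_onD)
                then have "d \<notin> blk (parity g)" using blk(3)[OF par par, of g g0] d by blast
                then show ?thesis using False e(1) by (simp add: sum.neutral)
              qed simp
            qed
            then show ?thesis using near0 finite_near by simp
          qed
          then have "(\<Sum>\<alpha>\<in>WW. t \<alpha> * fw Y \<alpha> (a d) p) = (\<Sum>\<alpha>\<in>WW. \<Sum>l\<in>Ls. (t \<alpha> * fw Y \<alpha> (tf l) (ld g0 p)) * e g0 l d)"
            by (intro sum.cong refl) (simp add: sum_distrib_left mult.assoc)
          then show ?thesis by (subst (asm) sum.swap) (simp add: x_def sum_distrib_right)
        qed
        have "ca * (\<Sum>\<alpha>\<in>WW. (t \<alpha>)\<^sup>2) \<le> (\<Sum>l\<in>Ls. (x l)\<^sup>2)" unfolding x_def by (rule tf_coercive[OF g0(2)])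
        also have "\<dots> = (\<Sum>l\<in>Ls. \<Sum>l'\<in>Ls. x l * x l' * (if l = l' then 1 else 0))"
          by (simp add: finite_Ls power2_eq_square if_distrib cong: if_cong)
        also have "\<dots> = (\<Sum>l\<in>Ls. \<Sum>l'\<in>Ls. x l * x l' * (\<Sum>d\<in>blk (parity g0). e g0 l d * e g0 l' d))"
          by (intro sum.cong refl) (simp add: e(3))
        also have "\<dots> = (\<Sum>d\<in>blk (parity g0). \<Sum>l\<in>Ls. \<Sum>l'\<in>Ls. (x l * e g0 l d) * (x l' * e g0 l' d))"
          unfolding sum_distrib_left
          by (subst sum.swap[of _ "blk (parity g0)"], subst (2) sum.swap) (simp add: algebra_simps)
        also have "\<dots> = (\<Sum>d\<in>blk (parity g0). (\<Sum>l\<in>Ls. x l * e g0 l d)\<^sup>2)"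
          by (simp add: power2_eq_square sum_product)
        also have "\<dots> = (\<Sum>d\<in>blk (parity g0). (\<Sum>\<alpha>\<in>WW. t \<alpha> * fw Y \<alpha> (a d) p)\<^sup>2)"
          by (intro sum.cong refl) (simp add: X)
        also have "\<dots> \<le> (\<Sum>d<DD. (\<Sum>\<alpha>\<in>WW. t \<alpha> * fw Y \<alpha> (a d) p)\<^sup>2)"
          using blk(1)[OF par[of g0]] by (intro sum_mono2) auto
        finally show ?thesis .
      qed
      \<comment> \<open>Comparing squares through \<open>(X d)\<^sup>2 \<le> 2 * (Z d)\<^sup>2 + 2 *
        (Z d - X d)\<^sup>2\<close> loses a factor 2, and the error takes half of \<open>ca\<close>;
        this leaves \<open>ca / 4\<close>.\<close>
      have coerphi: "ca / 4 * (\<Sum>\<alpha>\<in>WW. (t \<alpha>)\<^sup>2) \<le> (\<Sum>d<DD. (\<Sum>\<alpha>\<in>WW. t \<alpha> * fw Y \<alpha> (\<phi> d) p)\<^sup>2)" for p t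
      proof -
        let ?T = "\<Sum>\<alpha>\<in>WW. (t \<alpha>)\<^sup>2"
        have T: "?T \<ge> 0" by (intro sum_nonneg) auto
        define X where "X d = (\<Sum>\<alpha>\<in>WW. t \<alpha> * fw Y \<alpha> (a d) p)" for d
        define Z where "Z d = (\<Sum>\<alpha>\<in>WW. t \<alpha> * fw Y \<alpha> (\<phi> d) p)" for d
        define \<delta> where "\<delta> = C4 * B ^ s\<^sup>2 / A"
        have XZ: "(X d)\<^sup>2 \<le> 2 * (Z d)\<^sup>2 + 2 * (?T * (real (card WW) * \<delta>\<^sup>2))" if d: "d < DD" for d
        proof -
          have "Z d - X d = (\<Sum>\<alpha>\<in>WW. t \<alpha> * (fw Y \<alpha> (\<phi> d) p - fw Y \<alpha> (a d) p))"
            by (simp add: X_def Z_def right_diff_distrib sum_subtractf)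
          then have "(Z d - X d)\<^sup>2 \<le> ?T * (\<Sum>\<alpha>\<in>WW. (fw Y \<alpha> (\<phi> d) p - fw Y \<alpha> (a d) p)\<^sup>2)"
            using Cauchy_Schwarz_ineq_sum[of t "\<lambda>\<alpha>. fw Y \<alpha> (\<phi> d) p - fw Y \<alpha> (a d) p" WW] by simp
          also have "\<dots> \<le> ?T * (\<Sum>\<alpha>\<in>WW. \<delta>\<^sup>2)"
          proof (intro mult_left_mono sum_mono T)
            fix \<alpha> assume al: "\<alpha> \<in> WW"
            have "\<bar>fw Y \<alpha> (\<phi> d) p - fw Y \<alpha> (a d) p\<bar> \<le> C4 / A * B ^ (length \<alpha>)\<^sup>2" by (rule diff[OF d]) (use Wset_lists[OF al] in auto)
            also have "\<dots> \<le> C4 / A * B ^ s\<^sup>2"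
              using Wset_lists[OF al] B2 C4 A' by (intro mult_left_mono power_increasing power_mono) auto
            finally show "(fw Y \<alpha> (\<phi> d) p - fw Y \<alpha> (a d) p)\<^sup>2 \<le> \<delta>\<^sup>2"
              unfolding \<delta>_def by (intro power2_le_iff_abs_le[THEN iffD2]) (use C4 A' B2 in auto)
          qed
          finally have "(Z d - X d)\<^sup>2 \<le> ?T * (real (card WW) * \<delta>\<^sup>2)" by simp
          moreover have "(X d)\<^sup>2 \<le> 2 * (Z d)\<^sup>2 + 2 * (Z d - X d)\<^sup>2"
            using zero_le_power2[of "2 * Z d - X d"] by (simp add: power2_eq_square algebra_simps)
          ultimately show ?thesis by linarith
        qed
        have "ca * ?T \<le> (\<Sum>d<DD. (X d)\<^sup>2)" unfolding X_def by (rule coera)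
        also have "\<dots> \<le> (\<Sum>d<DD. 2 * (Z d)\<^sup>2 + 2 * (?T * (real (card WW) * \<delta>\<^sup>2)))" by (intro sum_mono XZ) auto
        also have "\<dots> = 2 * (\<Sum>d<DD. (Z d)\<^sup>2) + 2 * ?T * (real DD * (real (card WW) * \<delta>\<^sup>2))"
          by (simp add: sum.distrib sum_distrib_left[symmetric] algebra_simps)
        finally have 1: "ca * ?T \<le> 2 * (\<Sum>d<DD. (Z d)\<^sup>2) + 2 * ?T * (real DD * (real (card WW) * \<delta>\<^sup>2))" .
        have 2: "real DD * (real (card WW) * \<delta>\<^sup>2) \<le> ca / 4"
        proof -
          have "real DD * (real (card WW) * \<delta>\<^sup>2) = \<eta> / A\<^sup>2" by (simp add: \<eta>_def \<delta>_def power_divide)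
          also have "\<dots> \<le> \<eta> / A" using eta A' by (intro divide_left_mono) (auto simp: power2_eq_square)
          also have "\<dots> \<le> ca / 4" using A' ca by (simp add: divide_simps mult.commute)
          finally show ?thesis .
        qed
        have "2 * ?T * (real DD * (real (card WW) * \<delta>\<^sup>2)) \<le> 2 * ?T * (ca / 4)"
          using T by (intro mult_left_mono 2) auto
        with 1 have "ca / 4 * ?T \<le> (\<Sum>d<DD. (Z d)\<^sup>2)" by (simp add: algebra_simps)
        then show ?thesis unfolding Z_def .
      qed
      show "\<exists>\<phi>. (\<forall>d. smooth (\<phi> d)) \<and>
       (\<forall>d<DD. \<forall>w\<in>lists I. \<forall>p. \<bar>fw Y w (\<phi> d) p\<bar> \<le> (3 * real DD * K1 + 1) * B ^ (length w)\<^sup>2) \<and>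
       (\<forall>b\<in>set bs. \<forall>p. (\<Sum>d<DD. \<phi> d p * b p d) = 0) \<and>
       (\<forall>b\<in>set bs. \<forall>w\<in>lists I. \<forall>p. \<bar>\<Sum>d<DD. fw Y w (\<phi> d) p * b p d\<bar> \<le> C' / A * B ^ (length w)\<^sup>2) \<and>
       (\<forall>p t. ca / 4 * (\<Sum>\<alpha>\<in>WW. (t \<alpha>)\<^sup>2) \<le> (\<Sum>d<DD. (\<Sum>\<alpha>\<in>WW. t \<alpha> * fw Y \<alpha> (\<phi> d) p)\<^sup>2))"
        using sm bound orth near_orth coerphi by (intro exI[of _ \<phi>]) blast
    qed
  qed
qed

end

section \<open>The induction step over scales\<close>

lemma sum_cross_bound:
  fixes t u :: "'i \<Rightarrow> real"
  assumes "finite S" "S' \<subseteq> S" "\<And>\<alpha> \<beta>. \<alpha> \<in> S' \<Longrightarrow> \<beta> \<in> S \<Longrightarrow> \<bar>G \<alpha> \<beta>\<bar> \<le> K" "K \<ge> 0"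
  shows "\<bar>\<Sum>\<alpha>\<in>S'. \<Sum>\<beta>\<in>S. t \<alpha> * t \<beta> * G \<alpha> \<beta>\<bar> \<le> K * (real (card S) * (\<Sum>\<alpha>\<in>S. (t \<alpha>)\<^sup>2))"
proof -
  have "\<bar>\<Sum>\<alpha>\<in>S'. \<Sum>\<beta>\<in>S. t \<alpha> * t \<beta> * G \<alpha> \<beta>\<bar> \<le> (\<Sum>\<alpha>\<in>S'. \<Sum>\<beta>\<in>S. \<bar>t \<alpha>\<bar> * \<bar>t \<beta>\<bar> * K)"
    by (intro order_trans[OF sum_abs] sum_mono) (use assms in \<open>auto simp: abs_mult intro!: mult_left_mono\<close>)
  also have "\<dots> \<le> (\<Sum>\<alpha>\<in>S. \<Sum>\<beta>\<in>S. \<bar>t \<alpha>\<bar> * \<bar>t \<beta>\<bar> * K)"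
    using assms by (intro sum_mono2 sum_nonneg) auto
  also have "\<dots> = K * (\<Sum>\<alpha>\<in>S. \<bar>t \<alpha>\<bar>)\<^sup>2"
    by (simp add: power2_eq_square sum_product sum_distrib_left algebra_simps)
  also have "(\<Sum>\<alpha>\<in>S. \<bar>t \<alpha>\<bar>)\<^sup>2 \<le> real (card S) * (\<Sum>\<alpha>\<in>S. (t \<alpha>)\<^sup>2)"
    using Cauchy_Schwarz_ineq_sum[of "\<lambda>_. 1" "\<lambda>\<alpha>. \<bar>t \<alpha>\<bar>" S] by simp
  finally show ?thesis using assms(4) by (simp add: mult_left_mono)
qed

text \<open>This is \<open>(a + z)\<^sup>2 \<ge> a\<^sup>2 / 2 - z\<^sup>2\<close> with
  \<open>a = x + y\<close>.\<close>

lemma sum_sq_three: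
  fixes x y z :: "nat \<Rightarrow> real"
  shows "(\<Sum>d<D. (x d + y d + z d)\<^sup>2) \<ge> 1/2 * ((\<Sum>d<D. (x d)\<^sup>2) + (\<Sum>d<D. (y d)\<^sup>2) + 2 * (\<Sum>d<D. x d * y d)) - (\<Sum>d<D. (z d)\<^sup>2)"
proof -
  have "1/2 * ((x d)\<^sup>2 + (y d)\<^sup>2 + 2 * (x d * y d)) - (z d)\<^sup>2 \<le> (x d + y d + z d)\<^sup>2" for d
    using zero_le_power2[of "x d + y d + 2 * z d"] by (simp add: power2_eq_square algebra_simps)
  then have "(\<Sum>d<D. 1/2 * ((x d)\<^sup>2 + (y d)\<^sup>2 + 2 * (x d * y d)) - (z d)\<^sup>2) \<le> (\<Sum>d<D. (x d + y d + z d)\<^sup>2)" by (intro sum_mono)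
  then show ?thesis by (simp add: sum_subtractf sum.distrib sum_distrib_left sum_divide_distrib algebra_simps)
qed

section \<open>The invariant carried from scale to scale\<close>

context test_bounds
begin

text \<open>Weight 1 forces a single horizontal letter. Exactly these derivatives keep their size
  under rescaling, up to the damping factor.\<close>

definition "W1 = {\<alpha>\<in>WW. wt \<alpha> = 1}"

lemma W1_single: "\<alpha> \<in> W1 \<Longrightarrow> \<exists>b\<in>I. fst b = 1 \<and> \<alpha> = [b]"
proof -
  assume a: "\<alpha> \<in> W1"
  then have "\<alpha> \<in> lists I" "\<alpha> \<noteq> []" "wt \<alpha> = 1" using Wset_lists by (auto simp: W1_def)
  then have "length \<alpha> \<le> 1" using wt_ge_length by fastforce
  with \<open>\<alpha> \<noteq> []\<close> obtain b where "\<alpha> = [b]" by (cases \<alpha>) auto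
  with \<open>\<alpha> \<in> lists I\<close> \<open>wt \<alpha> = 1\<close> show ?thesis by auto
qed

lemma W1_sub: "W1 \<subseteq> WW" and fin_W1: "finite W1"
  by (auto simp: W1_def)

lemma WW_wt: "\<alpha> \<in> WW \<Longrightarrow> \<alpha> \<notin> W1 \<Longrightarrow> 2 \<le> wt \<alpha>"
proof -
  assume a: "\<alpha> \<in> WW" "\<alpha> \<notin> W1"
  then have "\<alpha> \<in> lists I" "\<alpha> \<noteq> []" "wt \<alpha> \<noteq> 1" using Wset_lists by (auto simp: W1_def)
  then have "1 \<le> wt \<alpha>" using wt_ge_length[of \<alpha>] by (cases \<alpha>) auto
  with \<open>wt \<alpha> \<noteq> 1\<close> show ?thesis by linarith
qed

text \<open>\<open>S\<close> is the squared size of the horizontal derivatives of the sum \<open>U\<close> of the coarser scales, and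
the factors \<open>kap\<close> bring all its word derivatives to unit size.\<close>

definition "kap A S \<alpha> = (if \<alpha> \<in> W1 then 1 / sqrt S else A ^ (wt \<alpha> - 1))"

text \<open>Rescaling multiplies a word of weight \<open>k\<close> by \<open>A ^ (1 - k)\<close>, so
  weights of at least 2 give convergent sums with bounds independent of \<open>S\<close>. Horizontal
  derivatives do not decay: \<open>S\<close> is a sum of powers of \<open>\<rho>\<^sup>2\<close> and
  can be large when \<rho> is close to 1, so for them the bounds from both sides are kept
  proportional to \<open>S\<close>.\<close>

definition sinv :: "real \<Rightarrow> real \<Rightarrow> real \<Rightarrow> (nat \<Rightarrow> 'a \<Rightarrow> real) \<Rightarrow> bool" where
  "sinv Cp A S U \<longleftrightarrow> (\<forall>d. smooth (U d)) \<and>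
    (\<forall>d<DD. \<forall>w\<in>lists I. 2 \<le> wt w \<longrightarrow> (\<forall>p. \<bar>fw Y w (U d) p\<bar> \<le> 2 * Cp / A ^ (wt w - 1) * B ^ (length w)\<^sup>2)) \<and>
    (\<forall>p t. ca / 4 * S * (\<Sum>\<alpha>\<in>W1. (t \<alpha>)\<^sup>2) \<le> (\<Sum>d<DD. (\<Sum>\<alpha>\<in>W1. t \<alpha> * fw Y \<alpha> (U d) p)\<^sup>2)) \<and>
    (\<forall>p. \<forall>\<alpha>\<in>W1. (\<Sum>d<DD. (fw Y \<alpha> (U d) p)\<^sup>2) \<le> real DD * (Cp * B)\<^sup>2 * S)"

definition icoer :: "real \<Rightarrow> real \<Rightarrow> (nat \<Rightarrow> 'a \<Rightarrow> real) \<Rightarrow> bool" where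
  "icoer A S U \<longleftrightarrow> (\<forall>p t. ca / 128 * (\<Sum>\<alpha>\<in>WW. (t \<alpha>)\<^sup>2) \<le> (\<Sum>d<DD. (\<Sum>\<alpha>\<in>WW. t \<alpha> * (kap A S \<alpha> * fw Y \<alpha> (U d) p))\<^sup>2))"

definition good_field :: "real \<Rightarrow> (nat \<Rightarrow> 'a \<Rightarrow> real) \<Rightarrow> bool" where
  "good_field Cp \<phi> \<longleftrightarrow> (\<forall>d. smooth (\<phi> d)) \<and>
    (\<forall>d<DD. \<forall>w\<in>lists I. \<forall>p. \<bar>fw Y w (\<phi> d) p\<bar> \<le> Cp * B ^ (length w)\<^sup>2) \<and>
    (\<forall>p t. ca / 4 * (\<Sum>\<alpha>\<in>WW. (t \<alpha>)\<^sup>2) \<le> (\<Sum>d<DD. (\<Sum>\<alpha>\<in>WW. t \<alpha> * fw Y \<alpha> (\<phi> d) p)\<^sup>2))"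

definition hperp :: "(nat \<Rightarrow> 'a \<Rightarrow> real) \<Rightarrow> (nat \<Rightarrow> 'a \<Rightarrow> real) \<Rightarrow> bool" where
  "hperp \<phi> U \<longleftrightarrow> (\<forall>p. \<forall>\<alpha>\<in>W1. \<forall>\<beta>\<in>W1. (\<Sum>d<DD. fw Y \<alpha> (\<phi> d) p * fw Y \<beta> (U d) p) = 0)"

lemma sinvD:
  assumes "sinv Cp A S U"
  shows "smooth (U d)" "d < DD \<Longrightarrow> w \<in> lists I \<Longrightarrow> 2 \<le> wt w \<Longrightarrow> \<bar>fw Y w (U d) p\<bar> \<le> 2 * Cp / A ^ (wt w - 1) * B ^ (length w)\<^sup>2"
    "ca / 4 * S * (\<Sum>\<alpha>\<in>W1. (t \<alpha>)\<^sup>2) \<le> (\<Sum>d<DD. (\<Sum>\<alpha>\<in>W1. t \<alpha> * fw Y \<alpha> (U d) p)\<^sup>2)"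
    "\<alpha> \<in> W1 \<Longrightarrow> (\<Sum>d<DD. (fw Y \<alpha> (U d) p)\<^sup>2) \<le> real DD * (Cp * B)\<^sup>2 * S"
  using assms unfolding sinv_def by blast+

lemma good_fieldD:
  assumes "good_field Cp \<phi>"
  shows "smooth (\<phi> d)" "d < DD \<Longrightarrow> w \<in> lists I \<Longrightarrow> \<bar>fw Y w (\<phi> d) p\<bar> \<le> Cp * B ^ (length w)\<^sup>2"
    "ca / 4 * (\<Sum>\<alpha>\<in>WW. (t \<alpha>)\<^sup>2) \<le> (\<Sum>d<DD. (\<Sum>\<alpha>\<in>WW. t \<alpha> * fw Y \<alpha> (\<phi> d) p)\<^sup>2)"
  using assms unfolding good_field_def by blast+

text \<open>Adds the new scale and zooms in by \<open>A\<close>, so that the following scale has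
  unit size again. The prefactor \<open>A\<close> compensates the zoom for horizontal derivatives,
  and \<rho> is the damping \<open>A powr (- \<epsilon>)\<close> of the weighted sum.\<close>

definition "nextU A \<rho> U \<phi> d x = A * \<rho> * (U d (Lam (1 / A) x) + \<phi> d (Lam (1 / A) x))"

lemma fw_nextU:
  assumes "smooth (U d)" "smooth (\<phi> d)" "w \<in> lists I"
  shows "fw Y w (nextU A \<rho> U \<phi> d) x = A * \<rho> * (1 / A) ^ wt w * (fw Y w (U d) (Lam (1 / A) x) + fw Y w (\<phi> d) (Lam (1 / A) x))"
    and "smooth (nextU A \<rho> U \<phi> d)"
proof -
  let ?L = "Lam (1 / A)"
  have smL: "smooth ?L" by (rule smooth_linear[OF linear_Lam])
  have sm: "smooth (\<lambda>x. U d x + \<phi> d x)" by (intro smooth_add assms)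
  have smc: "smooth (\<lambda>x. U d (?L x) + \<phi> d (?L x))" using smooth_compose[OF sm smL] .
  show "smooth (nextU A \<rho> U \<phi> d)" unfolding nextU_def[abs_def] by (intro smooth_mult smooth_const smc)
  show "fw Y w (nextU A \<rho> U \<phi> d) x = A * \<rho> * (1 / A) ^ wt w * (fw Y w (U d) (?L x) + fw Y w (\<phi> d) (?L x))"
    unfolding nextU_def[abs_def] fw_cmult[OF smc] fw_Lam[OF assms(3) sm] fw_add[OF assms(1,2)] by simp
qed

lemma W1_ext_sum:
  "(\<Sum>\<alpha>\<in>WW. (if \<alpha> \<in> W1 then t \<alpha> else 0) * h \<alpha>) = (\<Sum>\<alpha>\<in>W1. t \<alpha> * (h \<alpha> :: real))"
  "(\<Sum>\<alpha>\<in>WW. (if \<alpha> \<in> W1 then t \<alpha> else (0::real))\<^sup>2) = (\<Sum>\<alpha>\<in>W1. (t \<alpha>)\<^sup>2)"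
proof -
  have W: "W1 = {\<alpha>\<in>WW. \<alpha> \<in> W1}" using W1_sub by auto
  show "(\<Sum>\<alpha>\<in>WW. (if \<alpha> \<in> W1 then t \<alpha> else 0) * h \<alpha>) = (\<Sum>\<alpha>\<in>W1. t \<alpha> * h \<alpha>)"
    by (subst (2) W, subst sum.inter_filter) (auto intro!: sum.cong)
  show "(\<Sum>\<alpha>\<in>WW. (if \<alpha> \<in> W1 then t \<alpha> else (0::real))\<^sup>2) = (\<Sum>\<alpha>\<in>W1. (t \<alpha>)\<^sup>2)"
    by (subst (2) W, subst sum.inter_filter) (auto intro!: sum.cong)
qed

text \<open>\<open>hperp\<close> removes the cross terms, so the squares of \<open>U\<close> and
  \<phi> add and both horizontal constants are reproduced without loss. For weight at least 2 the
  old part has dropped to half of \<open>2 * Cp\<close>, which leaves room for the new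
  \<open>Cp\<close>.\<close>

lemma next_sinv:
  assumes Cp: "Cp > 0" and A: "A \<ge> 2" and lam: "1/2 \<le> \<rho>" "\<rho> \<le> 1" and S: "S \<ge> 0"
    and U: "sinv Cp A S U" and \<phi>: "good_field Cp \<phi>" and perp: "hperp \<phi> U"
  shows "sinv Cp A (\<rho>\<^sup>2 * (S + 1)) (nextU A \<rho> U \<phi>)"
proof -
  have smU: "smooth (U d)" and smp: "smooth (\<phi> d)" for d using U \<phi> by (auto simp: sinv_def good_field_def)
  note fwn = fw_nextU[of U _ \<phi>, OF smU smp]
  have W1fw: "fw Y \<alpha> (nextU A \<rho> U \<phi> d) x = \<rho> * (fw Y \<alpha> (U d) (Lam (1 / A) x) + fw Y \<alpha> (\<phi> d) (Lam (1 / A) x))" if "\<alpha> \<in> W1" for \<alpha> d x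
    using that A Wset_lists by (subst fwn(1)) (auto simp: W1_def)
  have split: "(\<Sum>d<DD. (\<Sum>\<alpha>\<in>W1. t \<alpha> * fw Y \<alpha> (nextU A \<rho> U \<phi> d) x)\<^sup>2)
     = \<rho>\<^sup>2 * ((\<Sum>d<DD. (\<Sum>\<alpha>\<in>W1. t \<alpha> * fw Y \<alpha> (U d) (Lam (1 / A) x))\<^sup>2) + (\<Sum>d<DD. (\<Sum>\<alpha>\<in>W1. t \<alpha> * fw Y \<alpha> (\<phi> d) (Lam (1 / A) x))\<^sup>2))" for t x
  proof -
    let ?p = "Lam (1 / A) x"
    define u where "u d = (\<Sum>\<alpha>\<in>W1. t \<alpha> * fw Y \<alpha> (U d) ?p)" for d
    define v where "v d = (\<Sum>\<alpha>\<in>W1. t \<alpha> * fw Y \<alpha> (\<phi> d) ?p)" for d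
    have "(\<Sum>\<alpha>\<in>W1. t \<alpha> * fw Y \<alpha> (nextU A \<rho> U \<phi> d) x) = \<rho> * (u d + v d)" for d
      by (simp add: u_def v_def W1fw sum_distrib_left sum.distrib[symmetric] algebra_simps)
    then have "(\<Sum>d<DD. (\<Sum>\<alpha>\<in>W1. t \<alpha> * fw Y \<alpha> (nextU A \<rho> U \<phi> d) x)\<^sup>2) = \<rho>\<^sup>2 * ((\<Sum>d<DD. (u d)\<^sup>2) + (\<Sum>d<DD. (v d)\<^sup>2) + 2 * (\<Sum>d<DD. v d * u d))"
      by (simp add: power2_eq_square sum_distrib_left sum.distrib[symmetric] algebra_simps)
    moreover have "(\<Sum>d<DD. v d * u d) = 0"
    proof -
      have "(\<Sum>d<DD. v d * u d) = (\<Sum>d<DD. \<Sum>\<alpha>\<in>W1. \<Sum>\<beta>\<in>W1. t \<alpha> * t \<beta> * (fw Y \<alpha> (\<phi> d) ?p * fw Y \<beta> (U d) ?p))"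
        unfolding u_def v_def sum_product by (intro sum.cong refl) (simp add: algebra_simps)
      also have "\<dots> = (\<Sum>\<alpha>\<in>W1. \<Sum>\<beta>\<in>W1. \<Sum>d<DD. t \<alpha> * t \<beta> * (fw Y \<alpha> (\<phi> d) ?p * fw Y \<beta> (U d) ?p))"
        by (subst sum.swap) (intro sum.cong refl sum.swap)
      also have "\<dots> = 0" using perp by (simp add: hperp_def sum_distrib_left[symmetric])
      finally show ?thesis .
    qed
    ultimately show ?thesis by (simp add: u_def v_def)
  qed
  show ?thesis unfolding sinv_def
  proof (intro conjI allI ballI impI)
    show "smooth (nextU A \<rho> U \<phi> d)" for d by (rule fwn(2)[of "[]"]) auto
    fix d w p assume d: "d < DD" and w: "w \<in> lists I" and wt2: "2 \<le> wt w"
    let ?p = "Lam (1 / A) p"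
    have Apos: "A ^ n > 0" for n using A by simp
    have "A * (1 / A) ^ wt w = 1 / A ^ (wt w - 1)"
    proof -
      obtain n where "wt w = Suc n" using wt2 by (cases "wt w") auto
      then show ?thesis using A by (simp add: power_one_over)
    qed
    then have c: "A * \<rho> * (1 / A) ^ wt w = \<rho> * (1 / A ^ (wt w - 1))" by (metis mult.assoc mult.commute)
    have eq: "fw Y w (nextU A \<rho> U \<phi> d) p = \<rho> * (1 / A ^ (wt w - 1)) * (fw Y w (U d) ?p + fw Y w (\<phi> d) ?p)"
      by (subst fwn(1)[OF w]) (simp only: c)
    have "\<bar>fw Y w (U d) ?p + fw Y w (\<phi> d) ?p\<bar> \<le> 2 * Cp / A ^ (wt w - 1) * B ^ (length w)\<^sup>2 + Cp * B ^ (length w)\<^sup>2"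
    proof -
      have "\<bar>fw Y w (U d) ?p\<bar> \<le> 2 * Cp / A ^ (wt w - 1) * B ^ (length w)\<^sup>2" using U d w wt2 unfolding sinv_def by blast
      moreover have "\<bar>fw Y w (\<phi> d) ?p\<bar> \<le> Cp * B ^ (length w)\<^sup>2" using \<phi> d w unfolding good_field_def by blast
      ultimately show ?thesis by linarith
    qed
    also have "2 * Cp / A ^ (wt w - 1) * B ^ (length w)\<^sup>2 \<le> Cp * B ^ (length w)\<^sup>2"
    proof -
      have "A ^ 1 \<le> A ^ (wt w - 1)" using A wt2 by (intro power_increasing) auto
      then have "2 \<le> A ^ (wt w - 1)" using A by simp
      then have "2 * Cp / A ^ (wt w - 1) \<le> Cp" using Cp Apos[of "wt w - 1"] by (simp add: divide_le_eq mult.commute)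
      then show ?thesis using B2 by (intro mult_right_mono) auto
    qed
    finally have "\<bar>fw Y w (U d) ?p + fw Y w (\<phi> d) ?p\<bar> \<le> 2 * Cp * B ^ (length w)\<^sup>2" by simp
    moreover have "\<bar>\<rho> * (1 / A ^ (wt w - 1))\<bar> \<le> 1 / A ^ (wt w - 1)"
      using lam Apos[of "wt w - 1"] by (simp add: abs_mult divide_right_mono)
    ultimately have "\<bar>fw Y w (nextU A \<rho> U \<phi> d) p\<bar> \<le> (1 / A ^ (wt w - 1)) * (2 * Cp * B ^ (length w)\<^sup>2)"
      unfolding eq abs_mult[of "\<rho> * (1 / A ^ (wt w - 1))"] using Apos[of "wt w - 1"] by (intro mult_mono) auto
    then show "\<bar>fw Y w (nextU A \<rho> U \<phi> d) p\<bar> \<le> 2 * Cp / A ^ (wt w - 1) * B ^ (length w)\<^sup>2" by simp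
  next
    fix p t
    have "ca / 4 * S * (\<Sum>\<alpha>\<in>W1. (t \<alpha>)\<^sup>2) \<le> (\<Sum>d<DD. (\<Sum>\<alpha>\<in>W1. t \<alpha> * fw Y \<alpha> (U d) (Lam (1 / A) p))\<^sup>2)"
      using U unfolding sinv_def by blast
    moreover have "ca / 4 * (\<Sum>\<alpha>\<in>W1. (t \<alpha>)\<^sup>2) \<le> (\<Sum>d<DD. (\<Sum>\<alpha>\<in>W1. t \<alpha> * fw Y \<alpha> (\<phi> d) (Lam (1 / A) p))\<^sup>2)"
      using \<phi>[unfolded good_field_def, THEN conjunct2, THEN conjunct2, rule_format, of "\<lambda>\<alpha>. if \<alpha> \<in> W1 then t \<alpha> else 0" "Lam (1 / A) p"]
      unfolding W1_ext_sum .
    ultimately have "ca / 4 * (S + 1) * (\<Sum>\<alpha>\<in>W1. (t \<alpha>)\<^sup>2) \<le> 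
      (\<Sum>d<DD. (\<Sum>\<alpha>\<in>W1. t \<alpha> * fw Y \<alpha> (U d) (Lam (1 / A) p))\<^sup>2) + (\<Sum>d<DD. (\<Sum>\<alpha>\<in>W1. t \<alpha> * fw Y \<alpha> (\<phi> d) (Lam (1 / A) p))\<^sup>2)"
      by (simp add: algebra_simps)
    from mult_left_mono[OF this, of "\<rho>\<^sup>2"]
    show "ca / 4 * (\<rho>\<^sup>2 * (S + 1)) * (\<Sum>\<alpha>\<in>W1. (t \<alpha>)\<^sup>2) \<le> (\<Sum>d<DD. (\<Sum>\<alpha>\<in>W1. t \<alpha> * fw Y \<alpha> (nextU A \<rho> U \<phi> d) p)\<^sup>2)"
      unfolding split by (simp add: algebra_simps)
  next
    fix p \<alpha> assume a: "\<alpha> \<in> W1"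
    let ?p = "Lam (1 / A) p"
    have one: "(\<Sum>\<beta>\<in>W1. (if \<beta> = \<alpha> then 1 else 0) * h \<beta>) = h \<alpha>" for h :: "_ \<Rightarrow> real"
      using a fin_W1 by (simp add: if_distrib[of "\<lambda>x. x * _"] cong: if_cong)
    have "(\<Sum>d<DD. (fw Y \<alpha> (\<phi> d) ?p)\<^sup>2) \<le> (\<Sum>d<DD. (Cp * B)\<^sup>2)"
    proof (rule sum_mono)
      fix d assume "d \<in> {..<DD}"
      obtain b where b: "b \<in> I" "\<alpha> = [b]" using W1_single[OF a] by blast
      then have "\<alpha> \<in> lists I" by simp
      then have "\<bar>fw Y \<alpha> (\<phi> d) ?p\<bar> \<le> Cp * B ^ (length \<alpha>)\<^sup>2" using \<phi> \<open>d \<in> {..<DD}\<close> unfolding good_field_def by blast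
      then have "\<bar>fw Y \<alpha> (\<phi> d) ?p\<bar> \<le> \<bar>Cp * B\<bar>" using b Cp B2 by (simp del: fw.simps)
      then show "(fw Y \<alpha> (\<phi> d) ?p)\<^sup>2 \<le> (Cp * B)\<^sup>2" by (rule abs_le_square_iff[THEN iffD1])
    qed
    moreover have "(\<Sum>d<DD. (fw Y \<alpha> (U d) ?p)\<^sup>2) \<le> real DD * (Cp * B)\<^sup>2 * S" using U a unfolding sinv_def by blast
    ultimately have "\<rho>\<^sup>2 * ((\<Sum>d<DD. (fw Y \<alpha> (U d) ?p)\<^sup>2) + (\<Sum>d<DD. (fw Y \<alpha> (\<phi> d) ?p)\<^sup>2)) \<le> \<rho>\<^sup>2 * (real DD * (Cp * B)\<^sup>2 * (S + 1))"
      by (intro mult_left_mono) (auto simp: algebra_simps)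
    then show "(\<Sum>d<DD. (fw Y \<alpha> (nextU A \<rho> U \<phi> d) p)\<^sup>2) \<le> real DD * (Cp * B)\<^sup>2 * (\<rho>\<^sup>2 * (S + 1))"
      using split[of "\<lambda>\<beta>. if \<beta> = \<alpha> then 1 else 0" p] unfolding one by (simp add: algebra_simps)
  qed
qed

text \<open>The normalised derivatives split into the horizontal ones of \<open>U\<close>
  (\<open>x\<close>), all those of \<phi> (\<open>y\<close>), and those of \<open>U\<close> of
  weight at least 2 (\<open>z\<close>). The last are of order \<open>1 / A\<close>, while
  \<open>x\<close> and \<open>y\<close> are coercive and almost orthogonal by
  \<open>near\<close>.\<close>

lemma next_icoer:
  assumes Cp: "Cp > 0" and A: "A \<ge> 2" and lam: "1/2 \<le> \<rho>" "\<rho> \<le> 1" and S: "S \<ge> 0"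
    and U: "sinv Cp A S U" and \<phi>: "good_field Cp \<phi>" and eta: "\<eta> \<ge> 0"
    and near: "\<And>p \<alpha> \<beta>. \<alpha> \<in> W1 \<Longrightarrow> \<beta> \<in> WW \<Longrightarrow> \<bar>\<Sum>d<DD. fw Y \<alpha> (U d) p * fw Y \<beta> (\<phi> d) p\<bar> \<le> sqrt S * \<eta>"
    and small: "8 * real (card WW) * \<eta> \<le> ca / 8" "real DD * (real (card WW) * (2 * Cp / A * B ^ s\<^sup>2)\<^sup>2) \<le> ca / 32"
  shows "icoer A (\<rho>\<^sup>2 * (S + 1)) (nextU A \<rho> U \<phi>)"
  unfolding icoer_def
proof (intro allI)
  fix p and t :: "(nat \<times> nat) list \<Rightarrow> real"
  let ?p = "Lam (1 / A) p" and ?S = "\<rho>\<^sup>2 * (S + 1)" and ?T = "\<Sum>\<alpha>\<in>WW. (t \<alpha>)\<^sup>2"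
  have smU: "smooth (U d)" and smp: "smooth (\<phi> d)" for d using U \<phi> by (auto simp: sinv_def good_field_def)
  note fwn = fw_nextU[of U _ \<phi>, OF smU smp]
  have T: "?T \<ge> 0" by (intro sum_nonneg) auto
  have l2: "1/4 \<le> \<rho>\<^sup>2" "\<rho>\<^sup>2 \<le> 1" using power_mono[of "1/2" \<rho> 2] power_mono[of \<rho> 1 2] lam by (auto simp: power2_eq_square)
  have S14: "?S \<ge> 1/4" using mult_mono[of "1/4" "\<rho>\<^sup>2" 1 "S + 1"] l2 S by simp
  have Spos: "?S > 0" using S14 by linarith
  have sqS: "sqrt ?S \<ge> 1/2" using real_sqrt_le_mono[OF S14] by (simp add: real_sqrt_divide)
  \<comment> \<open>What remains of \<open>kap\<close> once its power of \<open>A\<close> has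
    cancelled against the rescaling in \<open>nextU\<close>.\<close>
  define \<sigma> where "\<sigma> \<alpha> = (if \<alpha> \<in> W1 then 1 / sqrt ?S else 1)" for \<alpha>
  have sig: "0 \<le> \<sigma> \<alpha>" "\<sigma> \<alpha> \<le> 2" for \<alpha>
    using sqS frac_le[of 1 1 "1/2" "sqrt ?S"] by (auto simp: \<sigma>_def simp del: real_sqrt_ge_0_iff)
  define x where "x d = (\<Sum>\<alpha>\<in>W1. (t \<alpha> * \<sigma> \<alpha>) * fw Y \<alpha> (U d) ?p)" for d
  define y where "y d = (\<Sum>\<alpha>\<in>WW. (t \<alpha> * \<sigma> \<alpha>) * fw Y \<alpha> (\<phi> d) ?p)" for d
  define z where "z d = (\<Sum>\<alpha>\<in>WW - W1. t \<alpha> * fw Y \<alpha> (U d) ?p)" for d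
  have kapfw: "kap A ?S \<alpha> * fw Y \<alpha> (nextU A \<rho> U \<phi> d) p = \<rho> * (\<sigma> \<alpha> * (fw Y \<alpha> (U d) ?p + fw Y \<alpha> (\<phi> d) ?p))" if aW: "\<alpha> \<in> WW" for \<alpha> d
  proof -
    have al: "\<alpha> \<in> lists I" using Wset_lists[OF aW] by simp
    show ?thesis
    proof (cases "\<alpha> \<in> W1")
      case True
      then show ?thesis using A by (subst fwn(1)[OF al]) (auto simp: W1_def kap_def \<sigma>_def)
    next
      case False
      obtain n where n: "wt \<alpha> = Suc n" using WW_wt[OF aW False] by (cases "wt \<alpha>") auto
      have "A ^ n * (A * (1 / A) ^ Suc n) = 1" using A by (simp add: power_one_over)
      moreover have "A ^ n * (A * \<rho> * (1 / A) ^ Suc n * q) = (A ^ n * (A * (1 / A) ^ Suc n)) * (\<rho> * q)" for q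
        by (simp only: ac_simps)
      ultimately have "A ^ n * (A * \<rho> * (1 / A) ^ Suc n * q) = \<rho> * q" for q by simp
      then show ?thesis using False n by (subst fwn(1)[OF al]) (simp add: kap_def \<sigma>_def)
    qed
  qed
  have V: "(\<Sum>\<alpha>\<in>WW. t \<alpha> * (kap A ?S \<alpha> * fw Y \<alpha> (nextU A \<rho> U \<phi> d) p)) = \<rho> * (x d + y d + z d)" for d
  proof -
    have "(\<Sum>\<alpha>\<in>WW. t \<alpha> * (kap A ?S \<alpha> * fw Y \<alpha> (nextU A \<rho> U \<phi> d) p))
       = \<rho> * ((\<Sum>\<alpha>\<in>WW. (t \<alpha> * \<sigma> \<alpha>) * fw Y \<alpha> (U d) ?p) + y d)"
      unfolding y_def sum.distrib[symmetric] sum_distrib_left by (rule sum.cong[OF refl], subst kapfw, assumption, simp add: algebra_simps)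
    also have "(\<Sum>\<alpha>\<in>WW. (t \<alpha> * \<sigma> \<alpha>) * fw Y \<alpha> (U d) ?p) = z d + x d"
    proof -
      have "(\<Sum>\<alpha>\<in>WW - W1. (t \<alpha> * \<sigma> \<alpha>) * fw Y \<alpha> (U d) ?p) = z d" by (auto simp: z_def \<sigma>_def intro!: sum.cong)
      then show ?thesis using sum.subset_diff[OF W1_sub finite_Wset, of "\<lambda>\<alpha>. (t \<alpha> * \<sigma> \<alpha>) * fw Y \<alpha> (U d) ?p"] by (simp add: x_def)
    qed
    finally show ?thesis by (simp add: add_ac)
  qed
  let ?T1 = "\<Sum>\<alpha>\<in>W1. (t \<alpha>)\<^sup>2"
  have X2: "ca / 4 * S * (?T1 / ?S) \<le> (\<Sum>d<DD. (x d)\<^sup>2)"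
  proof -
    have "(\<Sum>\<alpha>\<in>W1. (t \<alpha> * \<sigma> \<alpha>)\<^sup>2) = ?T1 / ?S"
      unfolding sum_divide_distrib using Spos by (intro sum.cong) (auto simp: \<sigma>_def power_mult_distrib power_divide)
    moreover have "ca / 4 * S * (\<Sum>\<alpha>\<in>W1. (t \<alpha> * \<sigma> \<alpha>)\<^sup>2) \<le> (\<Sum>d<DD. (x d)\<^sup>2)"
      unfolding x_def by (rule sinvD(3)[OF U])
    ultimately show ?thesis by simp
  qed
  have Y2: "ca / 4 * (?T1 / ?S + (\<Sum>\<alpha>\<in>WW - W1. (t \<alpha>)\<^sup>2)) \<le> (\<Sum>d<DD. (y d)\<^sup>2)"
  proof -
    have "(\<Sum>\<alpha>\<in>WW. (t \<alpha> * \<sigma> \<alpha>)\<^sup>2) = (\<Sum>\<alpha>\<in>WW - W1. (t \<alpha> * \<sigma> \<alpha>)\<^sup>2) + (\<Sum>\<alpha>\<in>W1. (t \<alpha> * \<sigma> \<alpha>)\<^sup>2)"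
      by (rule sum.subset_diff[OF W1_sub finite_Wset])
    also have "(\<Sum>\<alpha>\<in>WW - W1. (t \<alpha> * \<sigma> \<alpha>)\<^sup>2) = (\<Sum>\<alpha>\<in>WW - W1. (t \<alpha>)\<^sup>2)" by (rule sum.cong) (auto simp: \<sigma>_def)
    also have "(\<Sum>\<alpha>\<in>W1. (t \<alpha> * \<sigma> \<alpha>)\<^sup>2) = ?T1 / ?S"
      unfolding sum_divide_distrib using Spos by (intro sum.cong) (auto simp: \<sigma>_def power_mult_distrib power_divide)
    moreover have "ca / 4 * (\<Sum>\<alpha>\<in>WW. (t \<alpha> * \<sigma> \<alpha>)\<^sup>2) \<le> (\<Sum>d<DD. (y d)\<^sup>2)"
      unfolding y_def by (rule good_fieldD(3)[OF \<phi>])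
    ultimately show ?thesis by (simp add: add.commute)
  qed
  \<comment> \<open>On horizontal coefficients the coarse part supplies \<open>S / ?S\<close> and
    the new field \<open>1 / ?S\<close>; together these are at least 1 because
    \<open>\<rho> \<le> 1\<close>.\<close>
  have XY2: "ca / 4 * ?T \<le> (\<Sum>d<DD. (x d)\<^sup>2) + (\<Sum>d<DD. (y d)\<^sup>2)"
  proof -
    have "?T1 \<le> (S + 1) * (?T1 / ?S)"
    proof -
      have gen: "a \<le> b * (a / q)" if "a * q \<le> a * b" "q > 0" for a b q :: real
        using that by (simp add: field_simps)
      have "?T1 * ?S \<le> ?T1 * (S + 1)" using l2 S by (intro mult_left_mono) (auto simp: mult_left_le_one_le sum_nonneg)
      then show ?thesis by (rule gen[OF _ Spos])
    qed
    moreover have "?T = (\<Sum>\<alpha>\<in>WW - W1. (t \<alpha>)\<^sup>2) + ?T1" by (rule sum.subset_diff[OF W1_sub finite_Wset])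
    ultimately have "ca / 4 * ?T \<le> ca / 4 * ((S + 1) * (?T1 / ?S) + (\<Sum>\<alpha>\<in>WW - W1. (t \<alpha>)\<^sup>2))"
      using ca by (intro mult_left_mono) auto
    also have "\<dots> = ca / 4 * S * (?T1 / ?S) + ca / 4 * (?T1 / ?S + (\<Sum>\<alpha>\<in>WW - W1. (t \<alpha>)\<^sup>2))"
    proof -
      have "a * ((r + 1) * X + Z) = a * r * X + a * (X + Z)" for a r X Z :: real by (simp add: algebra_simps)
      then show ?thesis .
    qed
    also have "\<dots> \<le> (\<Sum>d<DD. (x d)\<^sup>2) + (\<Sum>d<DD. (y d)\<^sup>2)" by (intro add_mono X2 Y2)
    finally show ?thesis .
  qed
  have cross: "\<bar>\<Sum>d<DD. x d * y d\<bar> \<le> 4 * \<eta> * (real (card WW) * ?T)"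
  proof -
    define G where "G \<alpha> \<beta> = \<sigma> \<alpha> * \<sigma> \<beta> * (\<Sum>d<DD. fw Y \<alpha> (U d) ?p * fw Y \<beta> (\<phi> d) ?p)" for \<alpha> \<beta>
    have "(\<Sum>d<DD. x d * y d) = (\<Sum>d<DD. \<Sum>\<alpha>\<in>W1. \<Sum>\<beta>\<in>WW. t \<alpha> * t \<beta> * (\<sigma> \<alpha> * \<sigma> \<beta> * (fw Y \<alpha> (U d) ?p * fw Y \<beta> (\<phi> d) ?p)))"
      unfolding x_def y_def sum_product by (intro sum.cong refl) (simp add: algebra_simps)
    also have "\<dots> = (\<Sum>\<alpha>\<in>W1. \<Sum>\<beta>\<in>WW. \<Sum>d<DD. t \<alpha> * t \<beta> * (\<sigma> \<alpha> * \<sigma> \<beta> * (fw Y \<alpha> (U d) ?p * fw Y \<beta> (\<phi> d) ?p)))"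
      by (subst sum.swap) (intro sum.cong refl sum.swap)
    also have "\<dots> = (\<Sum>\<alpha>\<in>W1. \<Sum>\<beta>\<in>WW. t \<alpha> * t \<beta> * G \<alpha> \<beta>)" by (simp add: G_def sum_distrib_left)
    finally have eq: "(\<Sum>d<DD. x d * y d) = (\<Sum>\<alpha>\<in>W1. \<Sum>\<beta>\<in>WW. t \<alpha> * t \<beta> * G \<alpha> \<beta>)" .
    have G: "\<bar>G \<alpha> \<beta>\<bar> \<le> 4 * \<eta>" if a: "\<alpha> \<in> W1" and b: "\<beta> \<in> WW" for \<alpha> \<beta>
    proof -
      have "\<sigma> \<alpha> * sqrt S \<le> 2"
      proof -
        have "1/4 * S \<le> \<rho>\<^sup>2 * (S + 1)" using l2 S by (intro mult_mono) auto
        then have "S \<le> 4 * ?S" by simp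
        then have "sqrt S \<le> sqrt (4 * ?S)" by (rule real_sqrt_le_mono)
        also have "sqrt (4 * ?S) = 2 * sqrt ?S" by (subst real_sqrt_mult) simp
        finally have "sqrt S \<le> 2 * sqrt ?S" .
        moreover have "1 / q * r \<le> 2" if "r \<le> 2 * q" "1/2 \<le> q" for q r :: real using that by (simp add: field_simps)
        ultimately show ?thesis using a sqS by (auto simp only: \<sigma>_def if_True)
      qed
      have "\<bar>G \<alpha> \<beta>\<bar> = \<sigma> \<alpha> * \<sigma> \<beta> * \<bar>\<Sum>d<DD. fw Y \<alpha> (U d) ?p * fw Y \<beta> (\<phi> d) ?p\<bar>" using sig by (simp add: G_def abs_mult)
      also have "\<dots> \<le> \<sigma> \<alpha> * \<sigma> \<beta> * (sqrt S * \<eta>)" using sig by (intro mult_left_mono near a b) auto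
      also have "\<dots> = (\<sigma> \<alpha> * sqrt S) * \<sigma> \<beta> * \<eta>" by (simp add: algebra_simps)
      also have "\<dots> \<le> 2 * 2 * \<eta>" using \<open>\<sigma> \<alpha> * sqrt S \<le> 2\<close> sig eta S by (intro mult_mono) auto
      finally show ?thesis by simp
    qed
    show ?thesis unfolding eq by (rule sum_cross_bound[OF finite_Wset W1_sub G]) (use eta in auto)
  qed
  have Z2: "(\<Sum>d<DD. (z d)\<^sup>2) \<le> ca / 32 * ?T"
  proof -
    define \<delta> where "\<delta> = 2 * Cp / A * B ^ s\<^sup>2"
    have "(z d)\<^sup>2 \<le> ?T * (real (card WW) * \<delta>\<^sup>2)" if d: "d < DD" for d
    proof -
      have "(z d)\<^sup>2 \<le> (\<Sum>\<alpha>\<in>WW - W1. (t \<alpha>)\<^sup>2) * (\<Sum>\<alpha>\<in>WW - W1. (fw Y \<alpha> (U d) ?p)\<^sup>2)"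
        unfolding z_def by (rule Cauchy_Schwarz_ineq_sum)
      also have "\<dots> \<le> ?T * (\<Sum>\<alpha>\<in>WW. \<delta>\<^sup>2)"
      proof (intro mult_mono sum_mono2 T)
        have "(\<Sum>\<alpha>\<in>WW - W1. (fw Y \<alpha> (U d) ?p)\<^sup>2) \<le> (\<Sum>\<alpha>\<in>WW - W1. \<delta>\<^sup>2)"
        proof (rule sum_mono)
          fix \<alpha> assume al: "\<alpha> \<in> WW - W1"
          have w: "\<alpha> \<in> lists I" "length \<alpha> \<le> s" "2 \<le> wt \<alpha>" using Wset_lists[of \<alpha>] WW_wt[of \<alpha>] al by auto
          have "\<bar>fw Y \<alpha> (U d) ?p\<bar> \<le> 2 * Cp / A ^ (wt \<alpha> - 1) * B ^ (length \<alpha>)\<^sup>2" using U d w unfolding sinv_def by blast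
          also have "\<dots> \<le> 2 * Cp / A * B ^ s\<^sup>2"
          proof (intro mult_mono)
            have "A ^ 1 \<le> A ^ (wt \<alpha> - 1)" using A w by (intro power_increasing) auto
            then show "2 * Cp / A ^ (wt \<alpha> - 1) \<le> 2 * Cp / A" using A Cp by (intro divide_left_mono) auto
            show "B ^ (length \<alpha>)\<^sup>2 \<le> B ^ s\<^sup>2" using w B2 by (intro power_increasing power_mono) auto
          qed (use A Cp B2 in auto)
          finally have "\<bar>fw Y \<alpha> (U d) ?p\<bar> \<le> \<bar>\<delta>\<bar>" using A Cp B2 by (simp add: \<delta>_def)
          then show "(fw Y \<alpha> (U d) ?p)\<^sup>2 \<le> \<delta>\<^sup>2" by (rule abs_le_square_iff[THEN iffD1])
        qed
        also have "\<dots> \<le> (\<Sum>\<alpha>\<in>WW. \<delta>\<^sup>2)" by (intro sum_mono2) auto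
        finally show "(\<Sum>\<alpha>\<in>WW - W1. (fw Y \<alpha> (U d) ?p)\<^sup>2) \<le> (\<Sum>\<alpha>\<in>WW. \<delta>\<^sup>2)" .
      qed (auto intro: sum_nonneg)
      finally show ?thesis by simp
    qed
    then have "(\<Sum>d<DD. (z d)\<^sup>2) \<le> (\<Sum>d<DD. ?T * (real (card WW) * \<delta>\<^sup>2))" by (intro sum_mono) auto
    also have "\<dots> = ?T * (real DD * (real (card WW) * \<delta>\<^sup>2))" by simp
    also have "\<dots> \<le> ?T * (ca / 32)" using small(2) T unfolding \<delta>_def by (intro mult_left_mono)
    finally show ?thesis by (simp add: mult.commute)
  qed
  \<comment> \<open>The balance is \<open>ca / 8 - ca / 16 - ca / 32\<close>; the factor
    \<open>\<rho>\<^sup>2 \<ge> 1/4\<close> applied afterwards gives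
    \<open>ca / 128\<close>.\<close>
  have main: "ca / 32 * ?T \<le> (\<Sum>d<DD. (x d + y d + z d)\<^sup>2)"
  proof -
    have "4 * \<eta> * (real (card WW) * ?T) = (8 * real (card WW) * \<eta>) * ?T / 2" by simp
    also have "\<dots> \<le> (ca / 8) * ?T / 2" using small(1) T by (intro divide_right_mono mult_right_mono) auto
    finally have c: "\<bar>\<Sum>d<DD. x d * y d\<bar> \<le> ca / 16 * ?T" using cross by simp
    have gen: "c / 32 * T \<le> R" if "1/2 * (X + Y + 2 * P) - Z \<le> R" "c / 4 * T \<le> X + Y" "\<bar>P\<bar> \<le> c / 16 * T" "Z \<le> c / 32 * T" for c T X Y P Z R :: real
    proof -
      define q where "q = c * T"
      have q: "q / 4 \<le> X + Y" "\<bar>P\<bar> \<le> q / 16" "Z \<le> q / 32" using that by (auto simp: q_def)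
      have "- (q / 16) \<le> P" using q(2) by (simp add: abs_le_iff)
      moreover have "(X + Y) / 2 + P - Z \<le> R" using that(1) by (simp add: field_simps)
      ultimately have "q / 32 \<le> R" using q(1,3) by (simp add: field_simps)
      then show ?thesis by (simp add: q_def)
    qed
    show ?thesis by (rule gen[OF sum_sq_three XY2 c Z2])
  qed
  have "(\<Sum>d<DD. (\<Sum>\<alpha>\<in>WW. t \<alpha> * (kap A ?S \<alpha> * fw Y \<alpha> (nextU A \<rho> U \<phi> d) p))\<^sup>2) = \<rho>\<^sup>2 * (\<Sum>d<DD. (x d + y d + z d)\<^sup>2)"
    unfolding V by (simp add: power_mult_distrib sum_distrib_left)
  moreover have "1/4 * (ca / 32 * ?T) \<le> \<rho>\<^sup>2 * (\<Sum>d<DD. (x d + y d + z d)\<^sup>2)"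
    using l2 ca T by (intro mult_mono main) auto
  ultimately show "ca / 128 * ?T \<le> (\<Sum>d<DD. (\<Sum>\<alpha>\<in>WW. t \<alpha> * (kap A ?S \<alpha> * fw Y \<alpha> (nextU A \<rho> U \<phi> d) p))\<^sup>2)"
    by simp
qed

text \<open>Before the coarsest scale \<open>U\<close> and \<open>S\<close> are 0 and there is
  nothing to normalise; after one step \<open>\<rho> \<ge> 1/2\<close> gives
  \<open>S \<ge> 1/4\<close>.\<close>

definition scale_state :: "real \<Rightarrow> real \<Rightarrow> real \<Rightarrow> (nat \<Rightarrow> 'a \<Rightarrow> real) \<Rightarrow> bool" where
  "scale_state Cp A S U \<longleftrightarrow> sinv Cp A S U \<and> (1/4 \<le> S \<and> icoer A S U \<or> S = 0 \<and> U = (\<lambda>d x. 0))"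

lemma scale_state_0:
  assumes "Cp > 0" "A \<ge> 2"
  shows "scale_state Cp A 0 (\<lambda>d x. 0)"
proof -
  have z: "fw Y w (\<lambda>x. 0) = (\<lambda>x. 0)" for w
    by (cases "w = []") (auto simp: fw_const)
  show ?thesis using assms B2 by (auto simp: scale_state_def sinv_def z smooth_const)
qed

lemma kap_bounds:
  assumes "A \<ge> 2" "S \<ge> 1/4" "\<alpha> \<in> WW"
  shows "0 < kap A S \<alpha>" "kap A S \<alpha> \<le> 2 * A ^ (wt \<alpha> - 1)"
proof -
  have q: "1/2 \<le> sqrt S" using real_sqrt_le_mono[OF assms(2)] by (simp add: real_sqrt_divide)
  have q2: "1 / r \<le> 2" "0 < 1 / r" if "1/2 \<le> r" for r :: real using that by (auto simp: field_simps)
  have "A ^ (wt \<alpha> - 1) > 0" using assms by simp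
  then show "0 < kap A S \<alpha>" "kap A S \<alpha> \<le> 2 * A ^ (wt \<alpha> - 1)"
    using q2[OF q] by (auto simp: kap_def W1_def)
qed

text \<open>A further word \<open>w\<close> has weight at least its length \<open>n\<close>, which
  gains \<open>A ^ n\<close>, while the squared exponent grows from \<open>n\<^sup>2\<close> to at
  most \<open>n\<^sup>2 + 2 * s * n + s\<^sup>2\<close>. So \<open>A \<ge> B ^ (2 * s)\<close>
  suffices for all \<open>n\<close> at once. For horizontal \<alpha> the derivatives have weight at
  least 2 and \<open>kap\<close> is at most 2, so \<open>S\<close> does not enter them.\<close>

lemma slow_bad:
  assumes Cp: "Cp > 0" and A: "A \<ge> 2" "A \<ge> B ^ (2 * s)" and S: "S \<ge> 1/4" and U: "sinv Cp A S U" and al: "\<alpha> \<in> WW" and d: "d < DD"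
  shows "slow B A (sqrt (real DD) * (Cp * B) + 4 * Cp * B ^ s\<^sup>2 * B ^ (2 * s)) (\<lambda>p. kap A S \<alpha> * fw Y \<alpha> (U d) p)"
    (is "slow B A ?k ?h")
proof -
  have smU: "smooth (U d)" by (rule sinvD(1)[OF U])
  have alI: "\<alpha> \<in> lists I" "length \<alpha> \<le> s" "\<alpha> \<noteq> []" using Wset_lists[OF al] by auto
  have wta: "1 \<le> wt \<alpha>" using wt_ge_length[OF alI(1)] alI(3) by (cases \<alpha>) auto
  have Bp: "B ^ j > 0" "1 \<le> B ^ j" for j using B2 by auto
  have Ap: "A ^ j > 0" for j using A by simp
  note kb = kap_bounds[OF A(1) S al]
  have smh: "smooth ?h" by (intro smooth_mult smooth_const smooth_fw smU)
  have k1: "0 \<le> sqrt (real DD) * (Cp * B)" using Cp B2 by simp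
  have k2: "0 \<le> 4 * Cp * B ^ s\<^sup>2 * B ^ (2 * s)" using Cp Bp(1) by (simp add: less_imp_le)
  have val: "\<bar>?h p\<bar> \<le> ?k" for p
  proof (cases "\<alpha> \<in> W1")
    case True
    have "(fw Y \<alpha> (U d) p)\<^sup>2 \<le> (\<Sum>d<DD. (fw Y \<alpha> (U d) p)\<^sup>2)" using d by (intro member_le_sum) auto
    also have "\<dots> \<le> real DD * (Cp * B)\<^sup>2 * S" by (rule sinvD(4)[OF U True])
    finally have "sqrt ((fw Y \<alpha> (U d) p)\<^sup>2) \<le> sqrt (real DD * (Cp * B)\<^sup>2 * S)" by (rule real_sqrt_le_mono)
    also have "\<dots> = sqrt (real DD) * (Cp * B) * sqrt S" using Cp B2 by (simp add: real_sqrt_mult)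
    finally have "\<bar>fw Y \<alpha> (U d) p\<bar> \<le> sqrt (real DD) * (Cp * B) * sqrt S" by simp
    moreover have "sqrt S > 0" using S by simp
    moreover have "\<bar>1 / q * x\<bar> \<le> c" if "\<bar>x\<bar> \<le> c * q" "q > 0" for x c q :: real using that by (simp add: abs_mult field_simps)
    ultimately have "\<bar>1 / sqrt S * fw Y \<alpha> (U d) p\<bar> \<le> sqrt (real DD) * (Cp * B)" by blast
    moreover have "?h p = 1 / sqrt S * fw Y \<alpha> (U d) p" using True by (simp add: kap_def)
    ultimately show ?thesis using k2 by linarith
  next
    case False
    have "\<bar>?h p\<bar> = kap A S \<alpha> * \<bar>fw Y \<alpha> (U d) p\<bar>" using kb by (simp add: abs_mult)
    also have "\<dots> \<le> (2 * A ^ (wt \<alpha> - 1)) * (2 * Cp / A ^ (wt \<alpha> - 1) * B ^ (length \<alpha>)\<^sup>2)"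
      using kb Ap[of "wt \<alpha> - 1"] Cp Bp(1) by (intro mult_mono sinvD(2)[OF U d alI(1) WW_wt[OF al False]]) auto
    also have "\<dots> = 4 * Cp * B ^ (length \<alpha>)\<^sup>2" using A(1) by simp
    also have "\<dots> \<le> 4 * Cp * B ^ s\<^sup>2" using alI Cp B2 by (intro mult_left_mono power_increasing power_mono) auto
    also have "\<dots> \<le> 4 * Cp * B ^ s\<^sup>2 * B ^ (2 * s)" using Cp Bp(1)[of "s\<^sup>2"] Bp(2)[of "2 * s"] mult_left_mono[of 1 "B ^ (2 * s)" "4 * Cp * B ^ s\<^sup>2"] by simp
    finally show ?thesis using k1 by linarith
  qed
  have der: "\<bar>fw Y w ?h p\<bar> \<le> ?k / A * B ^ (length w)\<^sup>2" if w: "w \<in> lists I" "w \<noteq> []" for w p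
  proof -
    have eq: "fw Y w ?h p = kap A S \<alpha> * fw Y (w @ \<alpha>) (U d) p"
      by (simp add: fw_cmult smooth_fw smU fw_append)
    obtain n where n: "length w = Suc n" using w(2) by (cases w) auto
    have wtw: "length w \<le> wt w" by (rule wt_ge_length[OF w(1)])
    have wa: "w @ \<alpha> \<in> lists I" "2 \<le> wt (w @ \<alpha>)" using w alI wta wtw n by auto
    obtain m where m: "wt \<alpha> = Suc m" using wta by (cases "wt \<alpha>") auto
    have "\<bar>fw Y w ?h p\<bar> = kap A S \<alpha> * \<bar>fw Y (w @ \<alpha>) (U d) p\<bar>" using kb by (simp add: eq abs_mult)
    also have "\<dots> \<le> (2 * A ^ m) * (2 * Cp / A ^ (wt (w @ \<alpha>) - 1) * B ^ (length (w @ \<alpha>))\<^sup>2)"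
      using kb Ap Cp Bp(1) m by (intro mult_mono sinvD(2)[OF U d wa]) auto
    also have "wt (w @ \<alpha>) - 1 = wt w + m" using m by simp
    also have "(2 * A ^ m) * (2 * Cp / A ^ (wt w + m) * B ^ (length (w @ \<alpha>))\<^sup>2) = 4 * Cp * (B ^ (length (w @ \<alpha>))\<^sup>2 / A ^ wt w)"
      using A(1) by (simp add: power_add)
    also have "\<dots> \<le> 4 * Cp * ((B ^ (length w)\<^sup>2 * (B ^ (2 * s)) ^ Suc n * B ^ s\<^sup>2) / A ^ Suc n)"
    proof -
      have "(length (w @ \<alpha>))\<^sup>2 = (length w)\<^sup>2 + 2 * length \<alpha> * Suc n + (length \<alpha>)\<^sup>2"
        by (simp add: power2_eq_square n algebra_simps)
      also have "\<dots> \<le> (length w)\<^sup>2 + 2 * s * Suc n + s\<^sup>2"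
        using alI by (intro add_mono mult_le_mono power_mono) auto
      finally have "B ^ (length (w @ \<alpha>))\<^sup>2 \<le> B ^ ((length w)\<^sup>2 + 2 * s * Suc n + s\<^sup>2)" using B2 by (intro power_increasing) auto
      also have "\<dots> = B ^ (length w)\<^sup>2 * (B ^ (2 * s)) ^ Suc n * B ^ s\<^sup>2" by (simp only: power_add power_mult)
      finally have "B ^ (length (w @ \<alpha>))\<^sup>2 \<le> B ^ (length w)\<^sup>2 * (B ^ (2 * s)) ^ Suc n * B ^ s\<^sup>2" .
      moreover have "A ^ Suc n \<le> A ^ wt w" using wtw n A by (intro power_increasing) auto
      moreover have "0 \<le> B ^ (length w)\<^sup>2 * (B ^ (2 * s)) ^ Suc n * B ^ s\<^sup>2" using B2 by simp
      ultimately show ?thesis using Cp by (intro mult_left_mono frac_le Ap) auto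
    qed
    \<comment> \<open>Of the factors \<open>B ^ (2 * s) / A\<close>, all at most 1, one is kept: it
      is the gain \<open>1 / A\<close> required by \<open>slow\<close>.\<close>
    also have "\<dots> \<le> 4 * Cp * (B ^ (length w)\<^sup>2 * (B ^ (2 * s) / A) * B ^ s\<^sup>2)"
    proof -
      have "(B ^ (2 * s) / A) ^ Suc n \<le> (B ^ (2 * s) / A) ^ 1" using A Bp(1)[of "2 * s"] by (intro power_decreasing) auto
      then have "B ^ (length w)\<^sup>2 * (B ^ (2 * s) / A) ^ Suc n * B ^ s\<^sup>2 \<le> B ^ (length w)\<^sup>2 * (B ^ (2 * s) / A) * B ^ s\<^sup>2"
        using Bp(1) by (intro mult_right_mono mult_left_mono) (auto simp: less_imp_le)
      moreover have "(b * g ^ Suc n * c) / A ^ Suc n = b * (g / A) ^ Suc n * c" for b g c by (simp add: power_divide)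
      ultimately show ?thesis using Cp by (intro mult_left_mono) (auto simp only:)
    qed
    also have "\<dots> = (4 * Cp * B ^ s\<^sup>2 * B ^ (2 * s)) / A * B ^ (length w)\<^sup>2" by (simp add: mult_ac)
    also have "\<dots> \<le> ?k / A * B ^ (length w)\<^sup>2" using k1 A B2 by (intro mult_right_mono divide_right_mono) auto
    finally show ?thesis .
  qed
  show ?thesis unfolding slow_def jet_def using smh val der by blast
qed

text \<open>Differentiating the relation for the word \<open>[a]\<close> along \<open>Y b\<close>
  turns the wanted sum into minus the pairing of \<phi> with the word \<open>[b, a]\<close> of
  \<open>U\<close>. If that word is not sorted, \<open>[a, b]\<close> is, and their commutator
  consists of single letters, which are words of \<open>Wset s kk\<close> too.\<close>

lemma hperp_bad:
  assumes smU: "\<And>d. smooth (U d)" and smp: "\<And>d. smooth (\<phi> d)"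
    and orth: "\<And>\<alpha> p. \<alpha> \<in> WW \<Longrightarrow> (\<Sum>d<DD. \<phi> d p * fw Y \<alpha> (U d) p) = 0"
  shows "hperp \<phi> U"
  unfolding hperp_def
proof (intro allI ballI)
  fix p \<alpha> \<beta> assume "\<alpha> \<in> W1" "\<beta> \<in> W1"
  then obtain b a where b: "b \<in> I" "fst b = 1" "\<alpha> = [b]" and a: "a \<in> I" "fst a = 1" "\<beta> = [a]"
    using W1_single by metis
  have sing: "[c] \<in> WW" if "c \<in> I" for c using that s2 by (auto simp: Wset_def)
  have comm: "(\<Sum>d<DD. \<phi> d p * fw Y [b, a] (U d) p) = 0"
  proof (cases "pleq b a")
    case True
    then have "[b, a] \<in> WW" using a b s2 by (auto simp: Wset_def)
    then show ?thesis by (rule orth)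
  next
    case False
    then have W: "[a, b] \<in> WW" using a b s2 by (auto simp: Wset_def pleq_def)
    obtain k where k: "\<And>f x. smooth f \<Longrightarrow> fw Y [b, a] f x - fw Y [a, b] f x = (\<Sum>c\<in>{c\<in>I. fst c = 2}. k c * fw Y [c] f x)"
      using horizontal_commutator[OF b(1) a(1) b(2) a(2)] by auto
    have e: "fw Y [b, a] (U d) p = fw Y [a, b] (U d) p + (\<Sum>c\<in>{c\<in>I. fst c = 2}. k c * fw Y [c] (U d) p)" for d
      using k[OF smU[of d], of p] by linarith
    have "(\<Sum>d<DD. \<phi> d p * fw Y [b, a] (U d) p)
       = (\<Sum>d<DD. \<phi> d p * fw Y [a, b] (U d) p) + (\<Sum>d<DD. \<Sum>c\<in>{c\<in>I. fst c = 2}. k c * (\<phi> d p * fw Y [c] (U d) p))"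
      unfolding e by (simp add: distrib_left sum.distrib sum_distrib_left mult_ac del: fw.simps)
    also have "(\<Sum>d<DD. \<Sum>c\<in>{c\<in>I. fst c = 2}. k c * (\<phi> d p * fw Y [c] (U d) p)) = (\<Sum>c\<in>{c\<in>I. fst c = 2}. k c * (\<Sum>d<DD. \<phi> d p * fw Y [c] (U d) p))"
      unfolding sum_distrib_left by (rule sum.swap)
    also have "\<dots> = 0" by (intro sum.neutral) (auto simp: orth[OF sing] simp del: fw.simps)
    finally show ?thesis using orth[OF W] by simp
  qed
  have sm1: "smooth (\<lambda>x. \<phi> d x * fw Y [a] (U d) x)" for d by (intro smooth_mult smp smooth_fw smU)
  have "fw Y [b] (\<lambda>x. \<Sum>d<DD. \<phi> d x * fw Y [a] (U d) x) p = 0"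
    unfolding orth[OF sing[OF a(1)]] by (subst fw_const) auto
  then have "(\<Sum>d<DD. fw Y [b] (\<phi> d) p * fw Y [a] (U d) p + \<phi> d p * fw Y [b] (fw Y [a] (U d)) p) = 0"
    by (simp only: fw_sum[OF sm1] fw_mult1[OF smp smooth_fw[OF smU]])
  moreover have "fw Y [b] (fw Y [a] (U d)) = fw Y [b, a] (U d)" for d by simp
  ultimately show "(\<Sum>d<DD. fw Y \<alpha> (\<phi> d) p * fw Y \<beta> (U d) p) = 0"
    unfolding b(3) a(3) using comm by (simp only: sum.distrib)
qed

lemma sum_nth_distinct:
  assumes "distinct l" "set l = S"
  shows "(\<Sum>i<length l. g (l ! i)) = sum g S"
  using sum.reindex_bij_betw[OF bij_betw_nth[OF assms(1) refl assms(2)[symmetric]], of g] .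

lemma coer_bad:
  assumes "icoer A S U" "distinct l" "set l = WW"
  shows "coer DD (ca / 128) (map (\<lambda>\<alpha> d. kap A S \<alpha> * fw Y \<alpha> (U d) p) l)"
  unfolding coer_def
proof
  fix t :: "nat \<Rightarrow> real"
  let ?b = "\<lambda>\<alpha> d. kap A S \<alpha> * fw Y \<alpha> (U d) p"
  define \<tau> where "\<tau> \<alpha> = t (THE i. i < length l \<and> l ! i = \<alpha>)" for \<alpha>
  have \<tau>: "\<tau> (l ! i) = t i" if "i < length l" for i
  proof -
    have "(THE j. j < length l \<and> l ! j = l ! i) = i" using that assms(2) by (intro the_equality) (auto simp: nth_eq_iff_index_eq)
    then show ?thesis by (simp add: \<tau>_def)
  qed
  have "lincomb (map ?b l) t d = (\<Sum>i<length l. \<tau> (l ! i) * ?b (l ! i) d)" for d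
    unfolding lincomb_def by (simp add: \<tau>)
  then have lc: "lincomb (map ?b l) t d = (\<Sum>\<alpha>\<in>WW. \<tau> \<alpha> * ?b \<alpha> d)" for d
    using sum_nth_distinct[OF assms(2,3), of "\<lambda>\<alpha>. \<tau> \<alpha> * ?b \<alpha> d"] by simp
  have "(\<Sum>i<length (map ?b l). (t i)\<^sup>2) = (\<Sum>i<length l. (\<tau> (l ! i))\<^sup>2)" by (simp add: \<tau>)
  also have "\<dots> = (\<Sum>\<alpha>\<in>WW. (\<tau> \<alpha>)\<^sup>2)" by (rule sum_nth_distinct[OF assms(2,3)])
  finally show "ca / 128 * (\<Sum>i<length (map ?b l). (t i)\<^sup>2) \<le> vdot DD (lincomb (map ?b l) t) (lincomb (map ?b l) t)"
    using assms(1) unfolding vdot_def lc icoer_def by (simp add: power2_eq_square)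
qed

text \<open>The order of constants matters: \<open>Cp\<close> first, then the slowness constant
  \<open>k\<close> of the normalised derivatives, which depends on \<open>Cp\<close>, and only then
  \<open>C'\<close> and the threshold for \<open>A\<close>. None of them depends on the
  scale.\<close>

lemma step:
  "\<exists>Cp>0. \<exists>A0\<ge>2. \<forall>A\<ge>A0. \<forall>S U. scale_state Cp A S U \<longrightarrow> (\<exists>\<phi>. good_field Cp \<phi> \<and> hperp \<phi> U \<and>
     (\<forall>\<rho>. 1/2 \<le> \<rho> \<longrightarrow> \<rho> \<le> 1 \<longrightarrow> scale_state Cp A (\<rho>\<^sup>2 * (S + 1)) (nextU A \<rho> U \<phi>)))"
proof -
  define Q where "Q = (\<lambda>Cp C' A (bs :: ('a \<Rightarrow> nat \<Rightarrow> real) list). \<exists>\<phi>. (\<forall>d. smooth (\<phi> d)) \<and>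
       (\<forall>d<DD. \<forall>w\<in>lists I. \<forall>p. \<bar>fw Y w (\<phi> d) p\<bar> \<le> Cp * B ^ (length w)\<^sup>2) \<and>
       (\<forall>b\<in>set bs. \<forall>p. (\<Sum>d<DD. \<phi> d p * b p d) = 0) \<and>
       (\<forall>b\<in>set bs. \<forall>w\<in>lists I. \<forall>p. \<bar>\<Sum>d<DD. fw Y w (\<phi> d) p * b p d\<bar> \<le> C' / A * B ^ (length w)\<^sup>2) \<and>
       (\<forall>p t. ca / 4 * (\<Sum>\<alpha>\<in>WW. (t \<alpha>)\<^sup>2) \<le> (\<Sum>d<DD. (\<Sum>\<alpha>\<in>WW. t \<alpha> * fw Y \<alpha> (\<phi> d) p)\<^sup>2)))"
  have "\<exists>Cp>0. \<forall>n\<le>card WW. \<forall>k>0. \<forall>m>0. \<exists>A0\<ge>1. \<exists>C'>0. \<forall>A\<ge>A0. \<forall>bs. length bs = n \<longrightarrow>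
     (\<forall>b\<in>set bs. \<forall>d<DD. slow B A k (\<lambda>p. b p d)) \<longrightarrow> (\<forall>p. coer DD m (map (\<lambda>b. b p) bs)) \<longrightarrow> Q Cp C' A bs"
    unfolding Q_def by (rule step_field)
  then obtain Cp where Cp: "Cp > 0" and SF: "\<forall>n\<le>card WW. \<forall>k>0. \<forall>m>0. \<exists>A0\<ge>1. \<exists>C'>0. \<forall>A\<ge>A0. \<forall>bs. length bs = n \<longrightarrow>
     (\<forall>b\<in>set bs. \<forall>d<DD. slow B A k (\<lambda>p. b p d)) \<longrightarrow> (\<forall>p. coer DD m (map (\<lambda>b. b p) bs)) \<longrightarrow> Q Cp C' A bs"
    by (elim exE conjE)
  define k where "k = sqrt (real DD) * (Cp * B) + 4 * Cp * B ^ s\<^sup>2 * B ^ (2 * s)"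
  have k: "k > 0" unfolding k_def using Cp B2 by (intro add_nonneg_pos) auto
  have m: "ca / 128 > 0" using ca by simp
  obtain A1 C' where C': "C' > 0" and S1: "\<forall>A\<ge>A1. \<forall>bs. length bs = card WW \<longrightarrow>
     (\<forall>b\<in>set bs. \<forall>d<DD. slow B A k (\<lambda>p. b p d)) \<longrightarrow> (\<forall>p. coer DD (ca / 128) (map (\<lambda>b. b p) bs)) \<longrightarrow> Q Cp C' A bs"
    using SF[THEN spec, THEN mp, OF order_refl, THEN spec, THEN mp, OF k, THEN spec, THEN mp, OF m] by (elim exE conjE)
  have zos: "0 < (1 :: real)" by simp
  \<comment> \<open>For the coarsest scale, where there is nothing to be orthogonal to, the
    construction is applied to the empty list.\<close>
  obtain A2 C'' where "\<forall>A\<ge>A2. \<forall>bs. length bs = 0 \<longrightarrow>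
     (\<forall>b\<in>set bs. \<forall>d<DD. slow B A 1 (\<lambda>p. b p d)) \<longrightarrow> (\<forall>p. coer DD 1 (map (\<lambda>b. b p) bs)) \<longrightarrow> Q Cp C'' A bs"
    using SF[THEN spec, THEN mp, OF le0, THEN spec, THEN mp, OF zos, THEN spec, THEN mp, OF zos] by (elim exE conjE)
  then have S2: "Q Cp C'' A []" if "A \<ge> A2" for A
    using that by (simp add: coer_def lincomb_def vdot_def)
  \<comment> \<open>\<open>c1\<close> and \<open>c2\<close> are the thresholds for \<open>A\<close>
    beyond which \<open>small1\<close> and \<open>small2\<close> hold.\<close>
  define c1 where "c1 = 64 * real (card WW) * (C' * B ^ s\<^sup>2) / ca"
  define c2 where "c2 = 32 * real DD * real (card WW) * (2 * Cp * B ^ s\<^sup>2)\<^sup>2 / ca"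
  define A0 where "A0 = Max {2, A1, A2, B ^ (2 * s), c1, c2}"
  have A0: "A0 \<ge> 2" by (simp add: A0_def)
  show ?thesis
  proof (rule exI[of _ Cp], rule conjI[OF Cp], rule exI[of _ A0], rule conjI[OF A0], intro allI impI)
    fix A S U assume AA0: "A \<ge> A0" and st: "scale_state Cp A S U"
    have A: "A \<ge> 2" "A \<ge> A1" "A \<ge> A2" "A \<ge> B ^ (2 * s)" "A \<ge> c1" "A \<ge> c2" using AA0 by (auto simp: A0_def)
    have U: "sinv Cp A S U" using st by (simp add: scale_state_def)
    have S0: "S \<ge> 0" using st by (auto simp: scale_state_def)
    note smU = sinvD(1)[OF U]
    define \<eta> where "\<eta> = C' / A * B ^ s\<^sup>2"
    have eta: "\<eta> \<ge> 0" using C' A B2 by (simp add: \<eta>_def)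
    have small1: "8 * real (card WW) * \<eta> \<le> ca / 8"
    proof -
      have "64 * real (card WW) * (C' * B ^ s\<^sup>2) \<le> A * ca" using A(5) ca by (simp add: c1_def pos_divide_le_eq)
      then show ?thesis using A by (simp add: \<eta>_def field_simps)
    qed
    have small2: "real DD * (real (card WW) * (2 * Cp / A * B ^ s\<^sup>2)\<^sup>2) \<le> ca / 32"
    proof -
      define q where "q = real DD * real (card WW) * (2 * Cp * B ^ s\<^sup>2)\<^sup>2"
      have "32 * q \<le> A * ca" using A(6) ca by (simp add: c2_def q_def pos_divide_le_eq mult_ac)
      also have "A * ca \<le> (A * A) * ca" using A ca by simp
      finally have "q \<le> (ca / 32) * (A * A)" by (simp add: mult_ac)
      moreover have "A * A > 0" using A by simp
      ultimately have "q / (A * A) \<le> ca / 32" by (simp only: pos_divide_le_eq)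
      moreover have "real DD * (real (card WW) * (2 * Cp / A * B ^ s\<^sup>2)\<^sup>2) = q / (A * A)"
        by (simp add: q_def power2_eq_square)
      ultimately show ?thesis by simp
    qed
    have "\<exists>\<phi>. good_field Cp \<phi> \<and> hperp \<phi> U \<and> (\<forall>p \<alpha> \<beta>. \<alpha> \<in> W1 \<longrightarrow> \<beta> \<in> WW \<longrightarrow> \<bar>\<Sum>d<DD. fw Y \<alpha> (U d) p * fw Y \<beta> (\<phi> d) p\<bar> \<le> sqrt S * \<eta>)"
    proof (cases "S = 0")
      case True
      then have U0: "U = (\<lambda>d x. 0)" using st by (auto simp: scale_state_def)
      obtain \<phi> where "good_field Cp \<phi>" using S2[OF A(3)] unfolding good_field_def Q_def by blast
      moreover have "fw Y w (\<lambda>x. 0) p = 0" for w p by (cases "w = []") (auto simp: fw_const)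
      ultimately show ?thesis by (intro exI[of _ \<phi>]) (auto simp: U0 hperp_def True)
    next
      case False
      then have S: "S \<ge> 1/4" and ic: "icoer A S U" using st by (auto simp: scale_state_def)
      obtain l where l: "set l = WW" "distinct l" using finite_distinct_list[OF finite_Wset] by blast
      let ?b = "\<lambda>\<alpha> p d. kap A S \<alpha> * fw Y \<alpha> (U d) p"
      have "length (map ?b l) = card WW" using l distinct_card by fastforce
      moreover have "slow B A k (\<lambda>p. b p d)" if "b \<in> set (map ?b l)" "d < DD" for b d
        using that l slow_bad[OF Cp A(1) A(4) S U] by (auto simp: k_def)
      moreover have "coer DD (ca / 128) (map (\<lambda>b. b p) (map ?b l))" for p
        using coer_bad[OF ic l(2,1), of p] by (simp add: comp_def)
      ultimately have "Q Cp C' A (map ?b l)"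
        using S1[THEN spec, THEN mp, OF A(2), THEN spec, THEN mp] by blast
      then obtain \<phi> where smp: "\<And>d. smooth (\<phi> d)" and \<phi>: "good_field Cp \<phi>"
        and o1: "\<And>\<alpha> p. \<alpha> \<in> WW \<Longrightarrow> (\<Sum>d<DD. \<phi> d p * ?b \<alpha> p d) = 0"
        and o2: "\<And>\<alpha> w p. \<alpha> \<in> WW \<Longrightarrow> w \<in> lists I \<Longrightarrow> \<bar>\<Sum>d<DD. fw Y w (\<phi> d) p * ?b \<alpha> p d\<bar> \<le> C' / A * B ^ (length w)\<^sup>2"
        unfolding good_field_def Q_def set_map l(1) by (elim exE conjE) auto
      have kp: "kap A S \<alpha> > 0" if "\<alpha> \<in> WW" for \<alpha> by (rule kap_bounds(1)[OF A(1) S that])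
      have pull: "(\<Sum>d<DD. g d * ?b \<alpha> p d) = kap A S \<alpha> * (\<Sum>d<DD. g d * fw Y \<alpha> (U d) p)" for g \<alpha> p
        by (simp add: sum_distrib_left mult_ac)
      have "hperp \<phi> U"
      proof (rule hperp_bad[OF smU smp])
        fix \<alpha> p assume "\<alpha> \<in> WW"
        then show "(\<Sum>d<DD. \<phi> d p * fw Y \<alpha> (U d) p) = 0" using o1[of \<alpha> p] kp[of \<alpha>] unfolding pull by simp
      qed
      moreover have "\<bar>\<Sum>d<DD. fw Y \<alpha> (U d) p * fw Y \<beta> (\<phi> d) p\<bar> \<le> sqrt S * \<eta>" if al: "\<alpha> \<in> W1" and be: "\<beta> \<in> WW" for p \<alpha> \<beta>
      proof -
        have sq: "sqrt S > 0" using S by simp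
        let ?z = "\<Sum>d<DD. fw Y \<beta> (\<phi> d) p * fw Y \<alpha> (U d) p"
        have aW: "\<alpha> \<in> WW" using al W1_sub by auto
        have "\<bar>1 / sqrt S * ?z\<bar> \<le> C' / A * B ^ (length \<beta>)\<^sup>2"
          using o2[OF aW, of \<beta> p] Wset_lists[OF be] al unfolding pull by (simp add: kap_def)
        also have "\<dots> \<le> \<eta>" unfolding \<eta>_def using Wset_lists[OF be] C' A B2
          by (intro mult_left_mono power_increasing power_mono) auto
        finally have "\<bar>1 / sqrt S * ?z\<bar> \<le> \<eta>" .
        moreover have "\<bar>z\<bar> \<le> q * h" if "\<bar>1 / q * z\<bar> \<le> h" "q > 0" for z q h :: real using that by (simp add: abs_mult field_simps)
        ultimately have "\<bar>?z\<bar> \<le> sqrt S * \<eta>" using sq by blast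
        then show ?thesis by (simp add: mult.commute)
      qed
      ultimately show ?thesis using \<phi> by blast
    qed
    then obtain \<phi> where \<phi>: "good_field Cp \<phi>" "hperp \<phi> U"
      and near: "\<And>p \<alpha> \<beta>. \<alpha> \<in> W1 \<Longrightarrow> \<beta> \<in> WW \<Longrightarrow> \<bar>\<Sum>d<DD. fw Y \<alpha> (U d) p * fw Y \<beta> (\<phi> d) p\<bar> \<le> sqrt S * \<eta>" by blast
    have "scale_state Cp A (\<rho>\<^sup>2 * (S + 1)) (nextU A \<rho> U \<phi>)" if r: "1/2 \<le> \<rho>" "\<rho> \<le> 1" for \<rho>
    proof -
      have "1/4 \<le> \<rho>\<^sup>2" using power_mono[of "1/2" \<rho> 2] r by (simp add: power2_eq_square)
      then have "1/4 \<le> \<rho>\<^sup>2 * (S + 1)" using mult_mono[of "1/4" "\<rho>\<^sup>2" 1 "S + 1"] S0 by simp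
      then show ?thesis unfolding scale_state_def
        using next_sinv[OF Cp A(1) r S0 U \<phi>] next_icoer[OF Cp A(1) r S0 U \<phi>(1) eta near small1 small2] by blast
    qed
    then show "\<exists>\<phi>. good_field Cp \<phi> \<and> hperp \<phi> U \<and>
     (\<forall>\<rho>. 1/2 \<le> \<rho> \<longrightarrow> \<rho> \<le> 1 \<longrightarrow> scale_state Cp A (\<rho>\<^sup>2 * (S + 1)) (nextU A \<rho> U \<phi>))" using \<phi> by blast
  qed
qed

end

section \<open>Lower bounds for wedge products\<close>

lemma quadratic_form_mat:
  fixes A :: "real mat"
  assumes "A \<in> carrier_mat n n" "v \<in> carrier_vec n"
  shows "v \<bullet> (A *\<^sub>v v) = (\<Sum>i<n. \<Sum>j<n. v $ i * v $ j * A $$ (i, j))"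
  using assms by (auto simp: scalar_prod_def sum_distrib_left atLeast0LessThan algebra_simps intro!: sum.cong)

lemma coercive_det_nz:
  fixes A :: "real mat"
  assumes A: "A \<in> carrier_mat n n" and c: "c > 0"
    and coer: "\<And>t. c * (\<Sum>i<n. (t i)\<^sup>2) \<le> (\<Sum>i<n. \<Sum>j<n. t i * t j * A $$ (i, j))"
  shows "det A \<noteq> 0"
proof
  assume "det A = 0"
  then obtain v where v: "v \<in> carrier_vec n" "v \<noteq> 0\<^sub>v n" "A *\<^sub>v v = 0\<^sub>v n"
    using det_0_iff_vec_prod_zero_field[OF A] by blast
  have "c * (\<Sum>i<n. (v $ i)\<^sup>2) \<le> 0"
    using coer[of "\<lambda>i. v $ i"] quadratic_form_mat[OF A v(1)] v by simp
  then have "(\<Sum>i<n. (v $ i)\<^sup>2) \<le> 0" using c by (simp add: mult_le_0_iff)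
  then have "(\<Sum>i<n. (v $ i)\<^sup>2) = 0" by (intro antisym sum_nonneg) auto
  then have "\<forall>i<n. v $ i = 0" by (subst (asm) sum_nonneg_eq_0_iff) auto
  then have "v = 0\<^sub>v n" using v(1) by (intro eq_vecI) auto
  with v(2) show False by simp
qed

text \<open>On the segment from the identity to \<open>A\<close> all matrices are coercive, hence
  invertible, so \<open>det A\<close> is positive. Coercivity bounds every entry of the inverse by
  \<open>1 / c\<close>, and expanding its determinant gives at most
  \<open>fact n / c ^ n\<close>.\<close>

lemma coercive_det_lower:
  fixes A :: "real mat"
  assumes A: "A \<in> carrier_mat n n" and c: "c > 0"
    and coer: "\<And>t. c * (\<Sum>i<n. (t i)\<^sup>2) \<le> (\<Sum>i<n. \<Sum>j<n. t i * t j * A $$ (i, j))"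
  shows "c ^ n / fact n \<le> det A"
proof -
  define G where "G x = mat n n (\<lambda>(i, j). (1 - x) * (if i = j then 1 else 0) + x * A $$ (i, j))" for x :: real
  have Gc: "G x \<in> carrier_mat n n" for x by (simp add: G_def)
  have diag: "(\<Sum>i<n. \<Sum>j<n. t i * t j * (if i = j then 1 else 0)) = (\<Sum>i<n. (t i)\<^sup>2)" for t :: "nat \<Rightarrow> real"
    by (intro sum.cong refl) (simp add: power2_eq_square if_distrib[of "\<lambda>x. _ * x"] sum.delta cong: if_cong)
  have nz: "det (G x) \<noteq> 0" if x: "0 \<le> x" "x \<le> 1" for x
  proof (rule coercive_det_nz[OF Gc])
    show "min 1 c > 0" using c by simp
    fix t :: "nat \<Rightarrow> real"
    let ?q = "\<Sum>i<n. (t i)\<^sup>2"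
    have q: "?q \<ge> 0" by (intro sum_nonneg) auto
    have "(\<Sum>i<n. \<Sum>j<n. t i * t j * G x $$ (i, j))
       = (1 - x) * (\<Sum>i<n. \<Sum>j<n. t i * t j * (if i = j then 1 else 0)) + x * (\<Sum>i<n. \<Sum>j<n. t i * t j * A $$ (i, j))"
      unfolding sum_distrib_left sum.distrib[symmetric] by (intro sum.cong refl) (simp add: G_def algebra_simps)
    also have "\<dots> \<ge> (1 - x) * (min 1 c * ?q) + x * (min 1 c * ?q)"
    proof (intro add_mono mult_left_mono)
      show "min 1 c * ?q \<le> (\<Sum>i<n. \<Sum>j<n. t i * t j * (if i = j then 1 else 0))"
        unfolding diag using mult_right_mono[of "min 1 c" 1 ?q] q by simp
      have "min 1 c * ?q \<le> c * ?q" using q by (intro mult_right_mono) auto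
      then show "min 1 c * ?q \<le> (\<Sum>i<n. \<Sum>j<n. t i * t j * A $$ (i, j))" using coer[of t] by simp
    qed (use x in auto)
    finally show "min 1 c * ?q \<le> (\<Sum>i<n. \<Sum>j<n. t i * t j * G x $$ (i, j))" by (simp add: algebra_simps)
  qed
  have cont: "continuous_on {0..1} (\<lambda>x. det (G x))"
  proof -
    have e: "det (G x) = (\<Sum>p\<in>{p. p permutes {0..<n}}. signof p * (\<Prod>i = 0..<n. (1 - x) * (if i = p i then 1 else 0) + x * A $$ (i, p i)))" for x
      unfolding det_def'[OF Gc] by (intro sum.cong refl arg_cong[where f = "times r" for r] prod.cong) (auto simp: G_def permutes_in_image)
    show ?thesis unfolding e by (intro continuous_intros)
  qed
  have "G 0 = 1\<^sub>m n" "G 1 = A" using A by (auto simp: G_def intro!: eq_matI)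
  then have G01: "det (G 0) = 1" "det (G 1) = det A" by simp_all
  have pos: "det A > 0"
  proof (rule ccontr)
    assume "\<not> det A > 0"
    then obtain x where "0 \<le> x" "x \<le> 1" "det (G x) = 0"
      using IVT2'[of "\<lambda>x. det (G x)" 1 0 0, OF _ _ _ cont] G01 by auto
    then show False using nz by blast
  qed
  have "A \<in> Units (ring_mat TYPE(real) n ())" using pos by (intro det_non_zero_imp_unit[OF A]) simp
  then obtain B where AB: "A * B = 1\<^sub>m n" and B: "B \<in> carrier_mat n n"
    unfolding Units_def ring_mat_def by auto
  \<comment> \<open>Column \<open>k\<close> of the inverse solves \<open>A v = unit_vec n k\<close>,
    so \<open>c * q \<le> v $ k \<le> sqrt q\<close> for its squared length
    \<open>q\<close>.\<close>
  have ent: "\<bar>B $$ (i, k)\<bar> \<le> 1 / c" if i: "i < n" and k: "k < n" for i k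
  proof -
    define v where "v = Matrix.col B k"
    have v: "v \<in> carrier_vec n" "\<And>i. i < n \<Longrightarrow> v $ i = B $$ (i, k)" using B k by (auto simp: v_def)
    have Av: "A *\<^sub>v v = unit_vec n k" using col_mult2[OF A B k] AB k by (simp add: v_def)
    define q where "q = (\<Sum>i<n. (v $ i)\<^sup>2)"
    have "c * q \<le> v \<bullet> (A *\<^sub>v v)" unfolding quadratic_form_mat[OF A v(1)] q_def by (rule coer)
    also have "\<dots> = v $ k" unfolding Av using v k by simp
    finally have cq: "c * q \<le> v $ k" .
    have le: "(v $ j)\<^sup>2 \<le> q" if "j < n" for j unfolding q_def using that by (intro member_le_sum) auto
    have q0: "q \<ge> 0" unfolding q_def by (intro sum_nonneg) auto
    have vk: "v $ k \<le> sqrt q" using le[OF k] real_le_rsqrt by blast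
    have "c * sqrt q * sqrt q \<le> 1 * sqrt q" using cq vk q0 by (simp add: mult.assoc)
    then have "c * sqrt q \<le> 1"
      using mult_right_le_imp_le[of "c * sqrt q" "sqrt q" 1] q0 by (cases "q = 0") auto
    moreover have "\<bar>v $ i\<bar> \<le> sqrt q" using real_sqrt_le_mono[OF le[OF i]] by simp
    then have "c * \<bar>v $ i\<bar> \<le> c * sqrt q" using c by simp
    ultimately have "c * \<bar>v $ i\<bar> \<le> 1" by linarith
    then show ?thesis using c v(2)[OF i] by (simp add: pos_le_divide_eq mult.commute)
  qed
  have "\<bar>det B\<bar> \<le> (\<Sum>p\<in>{p. p permutes {0..<n}}. \<bar>signof p * (\<Prod>i = 0..<n. B $$ (i, p i))\<bar>)"
    unfolding det_def'[OF B] by (rule sum_abs)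
  also have "\<dots> \<le> (\<Sum>p\<in>{p. p permutes {0..<n}}. (1 / c) ^ n)"
  proof (rule sum_mono)
    fix p assume p: "p \<in> {p. p permutes {0..<n}}"
    have "\<bar>signof p * (\<Prod>i = 0..<n. B $$ (i, p i))\<bar> = (\<Prod>i = 0..<n. \<bar>B $$ (i, p i)\<bar>)"
      by (auto simp: abs_mult abs_prod sign_def)
    also have "\<dots> \<le> (\<Prod>i = 0..<n. 1 / c)" using p by (intro prod_mono) (auto intro!: ent simp: permutes_in_image)
    finally show "\<bar>signof p * (\<Prod>i = 0..<n. B $$ (i, p i))\<bar> \<le> (1 / c) ^ n" by simp
  qed
  also have "\<dots> = fact n / c ^ n" by (simp add: card_permutations[OF refl] power_one_over)
  finally have dB: "\<bar>det B\<bar> \<le> fact n / c ^ n" .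
  have "det A * det B = 1" using det_mult[OF A B] AB by simp
  then have "1 = det A * \<bar>det B\<bar>" using pos by (metis abs_mult abs_of_pos abs_one)
  also have "\<dots> \<le> det A * (fact n / c ^ n)" using dB pos by (intro mult_left_mono) auto
  finally show ?thesis using c by (simp add: field_simps)
qed

text \<open>\<open>wedge_norm\<close> sums over permutations of an unordered index set; numbering
  that set by \<open>h\<close> turns the Gram sum into a matrix determinant.\<close>

lemma permutation_sum_det:
  fixes Q :: "'i \<Rightarrow> 'i \<Rightarrow> real"
  assumes h: "bij_betw h {0..<n} S"
  shows "(\<Sum>\<pi>\<in>{\<pi>. \<pi> permutes S}. of_int (sign \<pi>) * (\<Prod>a\<in>S. Q a (\<pi> a))) = det (mat n n (\<lambda>(i, j). Q (h i) (h j)))"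
proof -
  let ?m = "map_permutation {0..<n} h"
  have bij: "bij_betw ?m {\<pi>. \<pi> permutes {0..<n}} {\<pi>. \<pi> permutes S}"
  proof -
    have "(\<lambda>\<pi> x. if x \<in> S then h (\<pi> (inv_into {0..<n} h x)) else x) = ?m"
      using h by (auto simp: map_permutation_def restrict_id_def fun_eq_iff bij_betw_def)
    then show ?thesis using bij_betw_permutations[OF h] by simp
  qed
  have "(\<Sum>\<pi>\<in>{\<pi>. \<pi> permutes S}. of_int (sign \<pi>) * (\<Prod>a\<in>S. Q a (\<pi> a)))
      = (\<Sum>\<pi>\<in>{\<pi>. \<pi> permutes {0..<n}}. of_int (sign (?m \<pi>)) * (\<Prod>a\<in>S. Q a (?m \<pi> a)))"
    by (rule sum.reindex_bij_betw[OF bij, symmetric])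
  also have "\<dots> = (\<Sum>\<pi>\<in>{\<pi>. \<pi> permutes {0..<n}}. of_int (sign \<pi>) * (\<Prod>i = 0..<n. Q (h i) (h (\<pi> i))))"
  proof (intro sum.cong refl)
    fix \<pi> assume p: "\<pi> \<in> {\<pi>. \<pi> permutes {0..<n}}"
    have inj: "inj_on h {0..<n}" and img: "h ` {0..<n} = S" using h by (auto simp: bij_betw_def)
    have "sign (?m \<pi>) = sign \<pi>" using p inj by (intro sign_map_permutation) auto
    moreover have "(\<Prod>a\<in>S. Q a (?m \<pi> a)) = (\<Prod>i = 0..<n. Q (h i) (?m \<pi> (h i)))"
      by (rule prod.reindex_bij_betw[OF h, symmetric])
    moreover have "?m \<pi> (h i) = h (\<pi> i)" if "i \<in> {0..<n}" for i
      using that inj by (simp add: map_permutation_def restrict_id_def)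
    ultimately show "of_int (sign (?m \<pi>)) * (\<Prod>a\<in>S. Q a (?m \<pi> a)) = of_int (sign \<pi>) * (\<Prod>i = 0..<n. Q (h i) (h (\<pi> i)))"
      by simp
  qed
  also have "\<dots> = det (mat n n (\<lambda>(i, j). Q (h i) (h j)))"
    by (subst det_def'[of _ n]) (auto simp: permutes_in_image sign_def intro!: sum.cong prod.cong)
  finally show ?thesis .
qed

lemma wedge_norm_scale:
  assumes "\<And>a. a \<in> S \<Longrightarrow> r a \<ge> 0"
  shows "wedge_norm D S (\<lambda>a c. r a * v a c) = (\<Prod>a\<in>S. r a) * wedge_norm D S v"
proof -
  have "(\<Prod>a\<in>S. vdot D (\<lambda>c. r a * v a c) (\<lambda>c. r (\<pi> a) * v (\<pi> a) c)) = (\<Prod>a\<in>S. r a)\<^sup>2 * (\<Prod>a\<in>S. vdot D (v a) (v (\<pi> a)))"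
    if "\<pi> permutes S" for \<pi>
  proof -
    have "vdot D (\<lambda>c. r a * v a c) (\<lambda>c. r b * v b c) = (r a * r b) * vdot D (v a) (v b)" for a b
      by (simp add: vdot_def sum_distrib_left mult_ac)
    then have "(\<Prod>a\<in>S. vdot D (\<lambda>c. r a * v a c) (\<lambda>c. r (\<pi> a) * v (\<pi> a) c))
        = (\<Prod>a\<in>S. r a) * (\<Prod>a\<in>S. r (\<pi> a)) * (\<Prod>a\<in>S. vdot D (v a) (v (\<pi> a)))" by (simp add: prod.distrib)
    also have "(\<Prod>a\<in>S. r (\<pi> a)) = (\<Prod>a\<in>S. r a)" using prod.permute[OF that, of r] by (simp add: comp_def)
    finally show ?thesis by (simp add: power2_eq_square)
  qed
  then have "(\<Sum>\<pi>\<in>{\<pi>. \<pi> permutes S}. of_int (sign \<pi>) * (\<Prod>a\<in>S. vdot D (\<lambda>c. r a * v a c) (\<lambda>c. r (\<pi> a) * v (\<pi> a) c)))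
     = (\<Prod>a\<in>S. r a)\<^sup>2 * (\<Sum>\<pi>\<in>{\<pi>. \<pi> permutes S}. of_int (sign \<pi>) * (\<Prod>a\<in>S. vdot D (v a) (v (\<pi> a))))"
    by (simp add: sum_distrib_left mult_ac)
  then show ?thesis unfolding wedge_norm_def using prod_nonneg[of S r] assms by (simp add: real_sqrt_mult)
qed

lemma vnorm_scale: "r \<ge> 0 \<Longrightarrow> vnorm D (\<lambda>c. r * v c) = r * vnorm D v"
  by (simp add: vnorm_def power_mult_distrib sum_distrib_left[symmetric] real_sqrt_mult)

lemma vnorm_nonneg: "vnorm D v \<ge> 0"
  by (simp add: vnorm_def sum_nonneg)

text \<open>Both sides are homogeneous of degree one in each vector, so the factors \<open>r\<close>
  cancel. They may be chosen to bring the vectors to unit size, where the Gram determinant is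
  bounded below.\<close>

lemma wedge_norm_lower:
  fixes v :: "'i \<Rightarrow> nat \<Rightarrow> real"
  assumes S: "finite S" and c: "c > 0" and C: "C > 0" and r: "\<And>a. a \<in> S \<Longrightarrow> r a > 0"
    and coer: "\<And>t. c * (\<Sum>a\<in>S. (t a)\<^sup>2) \<le> (\<Sum>d<D. (\<Sum>a\<in>S. t a * (r a * v a d))\<^sup>2)"
    and bd: "\<And>a. a \<in> S \<Longrightarrow> vnorm D (\<lambda>d. r a * v a d) \<le> C"
  shows "sqrt (c ^ card S / fact (card S)) / C ^ card S * (\<Prod>a\<in>S. vnorm D (v a)) \<le> wedge_norm D S v"
proof -
  define b where "b a d = r a * v a d" for a d
  define n where "n = card S"
  obtain h where h: "bij_betw h {0..<n} S" using ex_bij_betw_nat_finite[OF S] n_def by blast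
  let ?A = "mat n n (\<lambda>(i, j). vdot D (b (h i)) (b (h j)))"
  have "c ^ n / fact n \<le> det ?A"
  proof (rule coercive_det_lower[OF _ c])
    fix t :: "nat \<Rightarrow> real"
    define \<tau> where "\<tau> a = t (inv_into {0..<n} h a)" for a
    have \<tau>: "\<tau> (h i) = t i" if "i < n" for i using h that by (simp add: \<tau>_def bij_betw_def)
    have re: "(\<Sum>i<n. g (h i)) = (\<Sum>a\<in>S. g a)" for g :: "'i \<Rightarrow> real"
      using sum.reindex_bij_betw[OF h, of g] by (simp add: atLeast0LessThan)
    have "(\<Sum>i<n. \<Sum>j<n. t i * t j * ?A $$ (i, j)) = (\<Sum>i<n. \<Sum>j<n. \<Sum>d<D. (\<tau> (h i) * b (h i) d) * (\<tau> (h j) * b (h j) d))"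
      by (intro sum.cong refl) (simp add: \<tau> vdot_def sum_distrib_left mult_ac)
    also have "\<dots> = (\<Sum>a\<in>S. \<Sum>a'\<in>S. \<Sum>d<D. (\<tau> a * b a d) * (\<tau> a' * b a' d))"
      unfolding re[of "\<lambda>a'. \<Sum>d<D. (\<tau> _ * b _ d) * (\<tau> a' * b a' d)"] by (rule re)
    also have "\<dots> = (\<Sum>d<D. \<Sum>a\<in>S. \<Sum>a'\<in>S. (\<tau> a * b a d) * (\<tau> a' * b a' d))"
    proof -
      have "(\<Sum>a\<in>S. \<Sum>a'\<in>S. \<Sum>d<D. (\<tau> a * b a d) * (\<tau> a' * b a' d)) = (\<Sum>a\<in>S. \<Sum>d<D. \<Sum>a'\<in>S. (\<tau> a * b a d) * (\<tau> a' * b a' d))"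
        by (intro sum.cong refl sum.swap)
      also have "\<dots> = (\<Sum>d<D. \<Sum>a\<in>S. \<Sum>a'\<in>S. (\<tau> a * b a d) * (\<tau> a' * b a' d))" by (rule sum.swap)
      finally show ?thesis .
    qed
    also have "\<dots> = (\<Sum>d<D. (\<Sum>a\<in>S. \<tau> a * b a d)\<^sup>2)" by (simp add: power2_eq_square sum_product)
    also have "\<dots> \<ge> c * (\<Sum>a\<in>S. (\<tau> a)\<^sup>2)" using coer[of \<tau>] by (simp add: b_def)
    also have "(\<Sum>a\<in>S. (\<tau> a)\<^sup>2) = (\<Sum>i<n. (t i)\<^sup>2)" by (subst re[symmetric]) (simp add: \<tau>)
    finally show "c * (\<Sum>i<n. (t i)\<^sup>2) \<le> (\<Sum>i<n. \<Sum>j<n. t i * t j * ?A $$ (i, j))" .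
  qed simp
  then have "sqrt (c ^ n / fact n) \<le> wedge_norm D S b"
    unfolding wedge_norm_def permutation_sum_det[OF h, of "\<lambda>x y. vdot D (b x) (b y)"] by (rule real_sqrt_le_mono)
  moreover have "(\<Prod>a\<in>S. vnorm D (b a)) \<le> C ^ n"
    using prod_mono[of S "\<lambda>a. vnorm D (b a)" "\<lambda>_. C"] bd vnorm_nonneg by (simp add: b_def[abs_def] n_def)
  moreover have "x / y * P \<le> z" if "x \<le> z" "P \<le> y" "0 < y" "0 \<le> x" for x y z P :: real
  proof -
    have "x / y * P \<le> x / y * y" using that by (intro mult_left_mono) auto
    then show ?thesis using that by simp
  qed
  moreover have "C ^ n > 0" "0 \<le> sqrt (c ^ n / fact n)" using C c by auto
  ultimately have "sqrt (c ^ n / fact n) / C ^ n * (\<Prod>a\<in>S. vnorm D (b a)) \<le> wedge_norm D S b" by blast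
  moreover have "wedge_norm D S b = (\<Prod>a\<in>S. r a) * wedge_norm D S v"
    unfolding b_def[abs_def] using r by (intro wedge_norm_scale) (auto intro: less_imp_le)
  moreover have "(\<Prod>a\<in>S. vnorm D (b a)) = (\<Prod>a\<in>S. r a) * (\<Prod>a\<in>S. vnorm D (v a))"
    unfolding b_def[abs_def] prod.distrib[symmetric] using r by (intro prod.cong refl vnorm_scale) (auto intro: less_imp_le)
  ultimately have "(\<Prod>a\<in>S. r a) * (sqrt (c ^ n / fact n) / C ^ n * (\<Prod>a\<in>S. vnorm D (v a))) \<le> (\<Prod>a\<in>S. r a) * wedge_norm D S v"
    by (simp add: mult_ac)
  moreover have "(\<Prod>a\<in>S. r a) > 0" using r by (intro prod_pos)
  ultimately show ?thesis by (simp only: mult_le_cancel_left_pos n_def)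
qed

section \<open>Finitely many scales\<close>

context test_bounds
begin

lemma Lam_Lam: "Lam a (Lam b x) = Lam (a * b) x"
  by (rule vec_eqI) (simp add: power_mult_distrib)

lemma Lam_1: "Lam 1 x = x"
  by (rule vec_eqI) simp

text \<open>The field is selected as a function of the state, so plain recursion on the pair
  \<open>(S, U)\<close> applies, started from the zero state.\<close>

lemma scale_sequence:
  assumes Cp: "Cp > 0" and A: "A \<ge> 2" and \<rho>: "1/2 \<le> \<rho>" "\<rho> \<le> 1"
    and step: "\<And>S U. scale_state Cp A S U \<Longrightarrow> \<exists>\<phi>. good_field Cp \<phi> \<and> hperp \<phi> U \<and>
      (\<forall>\<rho>. 1/2 \<le> \<rho> \<longrightarrow> \<rho> \<le> 1 \<longrightarrow> scale_state Cp A (\<rho>\<^sup>2 * (S + 1)) (nextU A \<rho> U \<phi>))"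
  shows "\<exists>S U \<phi>. U 0 = (\<lambda>d x. 0) \<and> (\<forall>n. scale_state Cp A (S n) (U n) \<and> good_field Cp (\<phi> n) \<and> hperp (\<phi> n) (U n) \<and>
      S (Suc n) > 0 \<and> U (Suc n) = nextU A \<rho> (U n) (\<phi> n))"
proof -
  define P where "P S U \<phi> \<longleftrightarrow> good_field Cp \<phi> \<and> hperp \<phi> U \<and>
      (\<forall>\<rho>. 1/2 \<le> \<rho> \<longrightarrow> \<rho> \<le> 1 \<longrightarrow> scale_state Cp A (\<rho>\<^sup>2 * (S + 1)) (nextU A \<rho> U \<phi>))" for S U \<phi>
  define \<Phi> where "\<Phi> S U = (SOME \<phi>. P S U \<phi>)" for S U
  have \<Phi>: "P S U (\<Phi> S U)" if "scale_state Cp A S U" for S U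
  proof -
    have "\<exists>\<phi>. P S U \<phi>" unfolding P_def by (rule step[OF that])
    then show ?thesis unfolding \<Phi>_def by (rule someI_ex)
  qed
  define X where "X = rec_nat (0 :: real, \<lambda>d x. 0) (\<lambda>n (S, U). (\<rho>\<^sup>2 * (S + 1), nextU A \<rho> U (\<Phi> S U)))"
  define S where "S n = fst (X n)" for n
  define U where "U n = snd (X n)" for n
  have X0: "S 0 = 0" "U 0 = (\<lambda>d x. 0)" by (simp_all add: S_def U_def X_def)
  have XS: "S (Suc n) = \<rho>\<^sup>2 * (S n + 1)" "U (Suc n) = nextU A \<rho> (U n) (\<Phi> (S n) (U n))" for n
    by (simp_all add: S_def U_def X_def case_prod_beta)
  have st: "scale_state Cp A (S n) (U n)" for n
  proof (induction n)
    case 0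
    show ?case unfolding X0 by (rule scale_state_0[OF Cp A])
  next
    case (Suc n)
    show ?case using \<Phi>[OF Suc] \<rho> unfolding XS P_def by blast
  qed
  have "S n \<ge> 0" for n using st[of n] by (auto simp: scale_state_def)
  then have "S (Suc n) > 0" for n using \<rho> unfolding XS by (intro mult_pos_pos) (auto simp: add_nonneg_pos)
  then show ?thesis using X0(2) st \<Phi>[OF st] XS(2) unfolding P_def
    by (intro exI[of _ S] exI[of _ U] exI[of _ "\<lambda>n. \<Phi> (S n) (U n)"]) blast
qed

text \<open>The recursion unrolled: the field added \<open>i + 1\<close> steps ago has been rescaled
  \<open>i + 1\<close> times.\<close>

lemma fw_U_sum:
  assumes U0: "U 0 = (\<lambda>d x. 0)" and US: "\<And>n. U (Suc n) = nextU A \<rho> (U n) (\<phi> n)"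
    and sm: "\<And>n d. smooth (U n d)" "\<And>n d. smooth (\<phi> n d)" and w: "w \<in> lists I"
  shows "fw Y w (U n d) x = (\<Sum>i<n. (A * \<rho> * (1 / A) ^ wt w) ^ Suc i * fw Y w (\<phi> (n - Suc i) d) (Lam ((1 / A) ^ Suc i) x))"
proof (induction n arbitrary: x)
  case 0
  show ?case unfolding U0 by (cases "w = []") (auto simp: fw_const)
next
  case (Suc n)
  let ?q = "A * \<rho> * (1 / A) ^ wt w" and ?y = "Lam (1 / A) x"
  have "fw Y w (U (Suc n) d) x = ?q * (fw Y w (U n d) ?y + fw Y w (\<phi> n d) ?y)"
    unfolding US by (rule fw_nextU(1)[OF sm w])
  also have "fw Y w (U n d) ?y = (\<Sum>i<n. ?q ^ Suc i * fw Y w (\<phi> (n - Suc i) d) (Lam ((1 / A) ^ Suc (Suc i)) x))"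
    unfolding Suc Lam_Lam by (simp add: mult_ac)
  finally show ?case unfolding sum.lessThan_Suc_shift
    by (simp add: sum_distrib_left algebra_simps del: power_Suc) (simp add: mult_ac)
qed

text \<open>The family cut off above scale \<open>mx\<close>, where it vanishes, so that all series
  are finite sums. \<open>A powi m * (A powi (- m)) ^ wt w\<close> is the natural size at scale
  \<open>m\<close> of a word of weight \<open>wt w\<close>.\<close>

definition scale_family :: "real \<Rightarrow> real \<Rightarrow> real \<Rightarrow> real \<Rightarrow> int \<Rightarrow> (int \<Rightarrow> nat \<Rightarrow> 'a \<Rightarrow> real) \<Rightarrow> bool" where
  "scale_family Cp \<kappa> A \<rho> mx F \<longleftrightarrow> (\<forall>m.
   (\<forall>d. smooth (F m d)) \<and> (mx < m \<longrightarrow> (\<forall>d x. F m d x = 0)) \<and>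
   (\<forall>d<DD. \<forall>w\<in>lists I. \<forall>x. \<bar>fw Y w (F m d) x\<bar> \<le> A powi m * (A powi (- m)) ^ wt w * (Cp * B ^ (length w)\<^sup>2)) \<and>
   (m \<le> mx \<longrightarrow> (\<forall>x.
     (\<forall>\<alpha>\<in>W1. \<forall>\<beta>\<in>W1. (\<Sum>n<nat (mx - m). \<rho> ^ Suc n * (\<Sum>d<DD. fw Y \<alpha> (F m d) x * fw Y \<beta> (F (m + 1 + int n) d) x)) = 0) \<and>
     (\<forall>\<alpha>\<in>W1. ca / 4 \<le> (\<Sum>d<DD. (fw Y \<alpha> (F m d) x)\<^sup>2)) \<and>
     \<kappa> * (\<Prod>\<alpha>\<in>WW. vnorm DD (\<lambda>d. \<Sum>n<Suc (nat (mx - m)). \<rho> ^ n * fw Y \<alpha> (F (m + int n) d) x))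
       \<le> wedge_norm DD WW (\<lambda>\<alpha> d. \<Sum>n<Suc (nat (mx - m)). \<rho> ^ n * fw Y \<alpha> (F (m + int n) d) x))))"

lemma scale_family_exists:
  "\<exists>Cp>0. \<exists>\<kappa>>0. \<exists>A0\<ge>2. \<forall>A\<ge>A0. \<forall>\<rho>. 1/2 \<le> \<rho> \<longrightarrow> \<rho> \<le> 1 \<longrightarrow> (\<forall>mx. \<exists>F. scale_family Cp \<kappa> A \<rho> mx F)"
proof -
  obtain Cp A1 where Cp: "Cp > 0" and A1: "A1 \<ge> 2" and step: "\<forall>A\<ge>A1. \<forall>S U. scale_state Cp A S U \<longrightarrow> (\<exists>\<phi>. good_field Cp \<phi> \<and> hperp \<phi> U \<and>
     (\<forall>\<rho>. 1/2 \<le> \<rho> \<longrightarrow> \<rho> \<le> 1 \<longrightarrow> scale_state Cp A (\<rho>\<^sup>2 * (S + 1)) (nextU A \<rho> U \<phi>)))"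
    using step by (elim exE conjE)
  define k where "k = sqrt (real DD) * (Cp * B) + 4 * Cp * B ^ s\<^sup>2 * B ^ (2 * s)"
  have k: "k > 0" unfolding k_def using Cp B2 by (intro add_nonneg_pos) auto
  have DD0: "DD > 0" by (simp add: Dim_def)
  define C where "C = sqrt (real DD) * k"
  have C: "C > 0" using k DD0 by (simp add: C_def)
  define \<kappa> where "\<kappa> = sqrt ((ca / 128) ^ card WW / fact (card WW)) / C ^ card WW"
  have kap0: "\<kappa> > 0" using C ca by (simp add: \<kappa>_def)
  have "\<exists>F. scale_family Cp \<kappa> A \<rho> mx F" if AA: "A \<ge> max A1 (B ^ (2 * s))" and \<rho>: "1/2 \<le> \<rho>" "\<rho> \<le> 1" for A \<rho> mx
  proof -
    have A: "A \<ge> 2" "A \<ge> A1" "A \<ge> B ^ (2 * s)" using AA A1 by auto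
    have A0: "A > 0" "A \<noteq> 0" using A by auto
    have "\<exists>S U \<phi>. U 0 = (\<lambda>d x. 0) \<and> (\<forall>n. scale_state Cp A (S n) (U n) \<and> good_field Cp (\<phi> n) \<and> hperp (\<phi> n) (U n) \<and>
      S (Suc n) > 0 \<and> U (Suc n) = nextU A \<rho> (U n) (\<phi> n))"
      by (rule scale_sequence[OF Cp A(1) \<rho>]) (use step A(2) in blast)
    then obtain S U \<phi> where U0: "U 0 = (\<lambda>d x. 0)" and all: "\<forall>n. scale_state Cp A (S n) (U n) \<and> good_field Cp (\<phi> n) \<and> hperp (\<phi> n) (U n) \<and>
      S (Suc n) > 0 \<and> U (Suc n) = nextU A \<rho> (U n) (\<phi> n)"
      by (elim exE conjE)
    have st: "\<And>n. scale_state Cp A (S n) (U n)" and gf: "\<And>n. good_field Cp (\<phi> n)" and hp: "\<And>n. hperp (\<phi> n) (U n)"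
      and Sp: "\<And>n. S (Suc n) > 0" and US: "\<And>n. U (Suc n) = nextU A \<rho> (U n) (\<phi> n)" using all by blast+
    have sU: "sinv Cp A (S n) (U n)" for n using st by (simp add: scale_state_def)
    have smU: "smooth (U n d)" for n d by (rule sinvD(1)[OF sU])
    have smp: "smooth (\<phi> n d)" for n d by (rule good_fieldD(1)[OF gf])
    \<comment> \<open>Step \<open>n\<close> of the recursion becomes scale \<open>mx - n\<close>,
      from the coarsest scale downwards.\<close>
    define F where "F m d x = (if m \<le> mx then A powi m * \<phi> (nat (mx - m)) d (Lam (A powi (- m)) x) else 0)" for m d x
    have Fle: "F m d = (\<lambda>x. A powi m * \<phi> (nat (mx - m)) d (Lam (A powi (- m)) x))" if "m \<le> mx" for m d
      using that by (auto simp: F_def)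
    have Fgt: "F m d = (\<lambda>x. 0)" if "\<not> m \<le> mx" for m d using that by (auto simp: F_def)
    have smc: "smooth (\<lambda>x. \<phi> n d (Lam q x))" for n d q by (rule smooth_compose[OF smp smooth_linear[OF linear_Lam]])
    have smF: "smooth (F m d)" for m d
      by (cases "m \<le> mx") (auto simp: Fle Fgt intro!: smooth_mult smooth_const smc)
    define q where "q m w = A powi m * (A powi (- m)) ^ wt w" for m and w :: "(nat \<times> nat) list"
    have qpos: "q m w > 0" for m w using A0 by (simp add: q_def)
    have q1: "q m \<alpha> = 1" if "\<alpha> \<in> W1" for m \<alpha> using that A0 by (simp add: q_def W1_def power_int_minus)
    have fwF: "fw Y w (F m d) x = q m w * fw Y w (\<phi> (nat (mx - m)) d) (Lam (A powi (- m)) x)" if "w \<in> lists I" "m \<le> mx" for w m d x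
      unfolding Fle[OF that(2)] fw_cmult[OF smc] fw_Lam[OF that(1) smp] by (simp add: q_def)
    \<comment> \<open>In the units of scale \<open>m\<close>, the weighted sum of the coarser scales
      is the state on which the field of scale \<open>m\<close> was built; \<open>hperp\<close> for
      that state is the orthogonality of the family.\<close>
    have tail: "(\<Sum>n<nat (mx - m). \<rho> ^ Suc n * fw Y w (F (m + 1 + int n) d) x) = q m w * fw Y w (U (nat (mx - m)) d) (Lam (A powi (- m)) x)"
      if w: "w \<in> lists I" and m: "m \<le> mx" for w m d x
      unfolding fw_U_sum[OF U0 US smU smp w] sum_distrib_left
    proof (intro sum.cong refl)
      fix n assume "n \<in> {..<nat (mx - m)}"
      then have n: "m + 1 + int n \<le> mx" "nat (mx - (m + 1 + int n)) = nat (mx - m) - Suc n" by auto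
      have e1: "A powi (m + 1 + int n) = A powi m * A ^ Suc n"
      proof -
        have "m + 1 + int n = m + int (Suc n)" by simp
        then show ?thesis using power_int_add[of A m "int (Suc n)"] A0 by (simp only: power_int_of_nat) simp
      qed
      have e2: "A powi (- (m + 1 + int n)) = (1 / A) ^ Suc n * A powi (- m)"
        unfolding power_int_minus e1 by (simp add: power_one_over inverse_eq_divide)
      have "q (m + 1 + int n) w = q m w * (A * (1 / A) ^ wt w) ^ Suc n"
      proof -
        have h: "((1 / A) ^ Suc n) ^ k = ((1 / A) ^ k) ^ Suc n" for k by (simp only: power_mult[symmetric] mult.commute)
        show ?thesis unfolding q_def e1 e2 power_mult_distrib h by (simp only: mult_ac)
      qed
      then show "\<rho> ^ Suc n * fw Y w (F (m + 1 + int n) d) x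
        = q m w * ((A * \<rho> * (1 / A) ^ wt w) ^ Suc n * fw Y w (\<phi> (nat (mx - m) - Suc n) d) (Lam ((1 / A) ^ Suc n) (Lam (A powi - m) x)))"
        unfolding fwF[OF w n(1)] n(2) Lam_Lam e2 by (simp add: power_mult_distrib)
    qed
    \<comment> \<open>Including scale \<open>m\<close> itself gives the next state, evaluated after
      undoing its zoom by \<open>A\<close>; \<open>icoer\<close> for that state then yields the
      wedge bound.\<close>
    have full: "(\<Sum>n<Suc (nat (mx - m)). \<rho> ^ n * fw Y w (F (m + int n) d) x)
       = q m w / (A * \<rho> * (1 / A) ^ wt w) * fw Y w (U (Suc (nat (mx - m))) d) (Lam A (Lam (A powi (- m)) x))"
      if w: "w \<in> lists I" and m: "m \<le> mx" for w m d x
    proof -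
      have "Lam (1 / A) (Lam A y) = y" for y using A0 by (simp add: Lam_Lam Lam_1)
      then have "fw Y w (U (Suc (nat (mx - m))) d) (Lam A y) = A * \<rho> * (1 / A) ^ wt w * (fw Y w (U (nat (mx - m)) d) y + fw Y w (\<phi> (nat (mx - m)) d) y)" for y
        unfolding US fw_nextU(1)[OF smU smp w] by simp
      moreover have "A * \<rho> * (1 / A) ^ wt w \<noteq> 0" using A0 \<rho> by simp
      moreover have "(\<Sum>n<Suc (nat (mx - m)). \<rho> ^ n * fw Y w (F (m + int n) d) x)
         = fw Y w (F m d) x + (\<Sum>n<nat (mx - m). \<rho> ^ Suc n * fw Y w (F (m + 1 + int n) d) x)"
        unfolding sum.lessThan_Suc_shift by (simp add: add.assoc)
      ultimately show ?thesis unfolding tail[OF w m] fwF[OF w m] by (simp add: algebra_simps)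
    qed
    have "scale_family Cp \<kappa> A \<rho> mx F" unfolding scale_family_def
    proof (intro allI conjI impI ballI)
      show "smooth (F m d)" for m d by (rule smF)
      show "F m d x = 0" if "mx < m" for m d x using that by (simp add: F_def)
      show "\<bar>fw Y w (F m d) x\<bar> \<le> A powi m * (A powi (- m)) ^ wt w * (Cp * B ^ (length w)\<^sup>2)" if d: "d < DD" and w: "w \<in> lists I" for m d w x
      proof (cases "m \<le> mx")
        case True
        show ?thesis unfolding fwF[OF w True] abs_mult using good_fieldD(2)[OF gf d w] qpos[of m w]
          by (auto simp: q_def[symmetric] intro!: mult_left_mono)
      next
        case False
        have "fw Y w (\<lambda>x. 0) x = 0" by (cases "w = []") (auto simp: fw_const)
        then show ?thesis unfolding Fgt[OF False] using Cp A0 B2 by simp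
      qed
      fix m x assume m: "m \<le> mx"
      let ?k = "nat (mx - m)" and ?y = "Lam (A powi (- m)) x"
      have WI: "\<alpha> \<in> lists I" if "\<alpha> \<in> WW" for \<alpha> using Wset_lists[OF that] by simp
      show "(\<Sum>n<?k. \<rho> ^ Suc n * (\<Sum>d<DD. fw Y \<alpha> (F m d) x * fw Y \<beta> (F (m + 1 + int n) d) x)) = 0" if al: "\<alpha> \<in> W1" and be: "\<beta> \<in> W1" for \<alpha> \<beta>
      proof -
        have aI: "\<alpha> \<in> lists I" "\<beta> \<in> lists I" using WI W1_sub al be by auto
        have "(\<Sum>n<?k. \<rho> ^ Suc n * (\<Sum>d<DD. fw Y \<alpha> (F m d) x * fw Y \<beta> (F (m + 1 + int n) d) x))
          = (\<Sum>d<DD. \<Sum>n<?k. fw Y \<alpha> (F m d) x * (\<rho> ^ Suc n * fw Y \<beta> (F (m + 1 + int n) d) x))"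
          unfolding sum_distrib_left by (subst sum.swap) (simp add: mult_ac)
        also have "\<dots> = (\<Sum>d<DD. fw Y \<alpha> (\<phi> ?k d) ?y * fw Y \<beta> (U ?k d) ?y)"
          unfolding sum_distrib_left[symmetric] tail[OF aI(2) m] fwF[OF aI(1) m] by (simp add: q1 al be)
        also have "\<dots> = 0" using hp[of ?k] al be by (simp add: hperp_def)
        finally show ?thesis .
      qed
      show "ca / 4 \<le> (\<Sum>d<DD. (fw Y \<alpha> (F m d) x)\<^sup>2)" if al: "\<alpha> \<in> W1" for \<alpha>
      proof -
        have aW: "\<alpha> \<in> WW" using al W1_sub by auto
        have "ca / 4 * (\<Sum>\<beta>\<in>WW. (if \<beta> = \<alpha> then 1 else 0)\<^sup>2) \<le> (\<Sum>d<DD. (\<Sum>\<beta>\<in>WW. (if \<beta> = \<alpha> then 1 else 0) * fw Y \<beta> (\<phi> ?k d) ?y)\<^sup>2)"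
          by (rule good_fieldD(3)[OF gf])
        moreover have "(\<Sum>\<beta>\<in>WW. (if \<beta> = \<alpha> then 1 else (0::real))\<^sup>2) = 1"
          using aW by (simp add: if_distrib[of "\<lambda>x. x\<^sup>2"] sum.delta cong: if_cong)
        moreover have "(\<Sum>\<beta>\<in>WW. (if \<beta> = \<alpha> then 1 else 0) * fw Y \<beta> (\<phi> ?k d) ?y) = fw Y \<alpha> (\<phi> ?k d) ?y" for d
          using aW by (simp add: if_distrib[of "\<lambda>x. x * _"] sum.delta cong: if_cong)
        ultimately show ?thesis unfolding fwF[OF WI[OF aW] m] by (simp add: q1[OF al])
      qed
      define v where "v \<alpha> d = (\<Sum>n<Suc ?k. \<rho> ^ n * fw Y \<alpha> (F (m + int n) d) x)" for \<alpha> d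
      \<comment> \<open>The scaling factor of each word. It can be divided out, since the wedge
        bound is invariant under positive factors.\<close>
      define g where "g \<alpha> = q m \<alpha> / (A * \<rho> * (1 / A) ^ wt \<alpha>)" for \<alpha>
      have g: "g \<alpha> > 0" for \<alpha> using qpos A0 \<rho> by (simp add: g_def)
      let ?S = "S (Suc ?k)" and ?z = "Lam A ?y"
      have stS: "?S \<ge> 1/4" "icoer A ?S (U (Suc ?k))" using st[of "Suc ?k"] Sp[of ?k] by (auto simp: scale_state_def)
      have rv: "kap A ?S \<alpha> / g \<alpha> * v \<alpha> d = kap A ?S \<alpha> * fw Y \<alpha> (U (Suc ?k) d) ?z" if "\<alpha> \<in> WW" for \<alpha> d
        unfolding v_def full[OF WI[OF that] m] g_def[symmetric] using g[of \<alpha>] by simp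
      have "\<kappa> * (\<Prod>\<alpha>\<in>WW. vnorm DD (v \<alpha>)) \<le> wedge_norm DD WW v"
        unfolding \<kappa>_def
      proof (rule wedge_norm_lower[where r = "\<lambda>\<alpha>. kap A ?S \<alpha> / g \<alpha>"])
        show "finite WW" by (rule finite_Wset)
        show "kap A ?S \<alpha> / g \<alpha> > 0" if "\<alpha> \<in> WW" for \<alpha> using kap_bounds(1)[OF A(1) stS(1) that] g by simp
        have "ca / 128 * (\<Sum>\<alpha>\<in>WW. (t \<alpha>)\<^sup>2) \<le> (\<Sum>d<DD. (\<Sum>\<alpha>\<in>WW. t \<alpha> * (kap A ?S \<alpha> * fw Y \<alpha> (U (Suc ?k) d) ?z))\<^sup>2)" for t
          using stS(2) unfolding icoer_def by blast
        moreover have "(\<Sum>\<alpha>\<in>WW. t \<alpha> * (kap A ?S \<alpha> / g \<alpha> * v \<alpha> d)) = (\<Sum>\<alpha>\<in>WW. t \<alpha> * (kap A ?S \<alpha> * fw Y \<alpha> (U (Suc ?k) d) ?z))" for t d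
          by (rule sum.cong[OF refl]) (simp only: rv)
        ultimately show "ca / 128 * (\<Sum>\<alpha>\<in>WW. (t \<alpha>)\<^sup>2) \<le> (\<Sum>d<DD. (\<Sum>\<alpha>\<in>WW. t \<alpha> * (kap A ?S \<alpha> / g \<alpha> * v \<alpha> d))\<^sup>2)" for t
          by presburger
        show "vnorm DD (\<lambda>d. kap A ?S \<alpha> / g \<alpha> * v \<alpha> d) \<le> C" if al: "\<alpha> \<in> WW" for \<alpha>
        proof -
          have "\<bar>kap A ?S \<alpha> * fw Y \<alpha> (U (Suc ?k) d) ?z\<bar> \<le> k" if "d < DD" for d
            using slow_bad[OF Cp A(1,3) stS(1) sU al that] jet_val unfolding slow_def k_def by blast
          then have "(kap A ?S \<alpha> * fw Y \<alpha> (U (Suc ?k) d) ?z)\<^sup>2 \<le> k\<^sup>2" if "d < DD" for d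
            using that k abs_le_square_iff[of _ k] by simp
          then have "(\<Sum>d<DD. (kap A ?S \<alpha> * fw Y \<alpha> (U (Suc ?k) d) ?z)\<^sup>2) \<le> (\<Sum>d<DD. k\<^sup>2)" by (intro sum_mono) simp
          then have "vnorm DD (\<lambda>d. kap A ?S \<alpha> / g \<alpha> * v \<alpha> d) \<le> sqrt (\<Sum>d<DD. k\<^sup>2)"
            unfolding vnorm_def rv[OF al] by (rule real_sqrt_le_mono)
          then show ?thesis using k by (simp add: C_def real_sqrt_mult)
        qed
      qed (use ca C in auto)
      then show "\<kappa> * (\<Prod>\<alpha>\<in>WW. vnorm DD (\<lambda>d. \<Sum>n<Suc ?k. \<rho> ^ n * fw Y \<alpha> (F (m + int n) d) x))
       \<le> wedge_norm DD WW (\<lambda>\<alpha> d. \<Sum>n<Suc ?k. \<rho> ^ n * fw Y \<alpha> (F (m + int n) d) x)"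
        unfolding v_def[abs_def] .
    qed
    then show ?thesis by blast
  qed
  moreover have "max A1 (B ^ (2 * s)) \<ge> 2" using A1 by simp
  ultimately show ?thesis using Cp kap0 by blast
qed

end

section \<open>Passage to the limit\<close>

text \<open>Tychonoff. The index will include the points of the space, so it is uncountable and no
  subsequence need converge; a finer filter along which every coordinate converges takes its
  place.\<close>

lemma pointwise_cluster:
  fixes H :: "nat \<Rightarrow> 'i \<Rightarrow> real"
  assumes bd: "\<And>n i. \<bar>H n i\<bar> \<le> b i"
  shows "\<exists>\<Phi> g. \<Phi> \<noteq> bot \<and> \<Phi> \<le> sequentially \<and> (\<forall>i. ((\<lambda>n. H n i) \<longlongrightarrow> g i) \<Phi>)"
proof -
  have "compact (PiE UNIV (\<lambda>i. {- b i..b i}))" by (rule compact_PiE_UNIV) simp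
  moreover have "eventually (\<lambda>x. x \<in> PiE UNIV (\<lambda>i. {- b i..b i})) (filtermap H sequentially)"
    using bd by (auto simp: eventually_filtermap abs_le_iff minus_le_iff intro!: always_eventually)
  moreover have "filtermap H sequentially \<noteq> bot" by (simp add: filtermap_bot_iff)
  ultimately obtain g where g: "inf (nhds g) (filtermap H sequentially) \<noteq> bot" unfolding compact_filter by blast
  define \<Phi> where "\<Phi> = inf sequentially (filtercomap H (nhds g))"
  have "\<Phi> \<noteq> bot"
  proof
    assume "\<Phi> = bot"
    then obtain P Q where P: "eventually P sequentially" and Q: "eventually Q (filtercomap H (nhds g))" and PQ: "\<forall>n. P n \<and> Q n \<longrightarrow> False"
      unfolding trivial_limit_def \<Phi>_def eventually_inf by blast
    obtain R where R: "eventually R (nhds g)" "\<And>n. R (H n) \<Longrightarrow> Q n" using Q unfolding eventually_filtercomap by blast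
    have "eventually (\<lambda>x. \<not> R x) (filtermap H sequentially)"
      unfolding eventually_filtermap using P by (rule eventually_mono) (use PQ R(2) in blast)
    then have "eventually (\<lambda>x. False) (inf (nhds g) (filtermap H sequentially))"
      unfolding eventually_inf using R(1) by blast
    then show False using g by (simp add: trivial_limit_def)
  qed
  moreover have "\<Phi> \<le> sequentially" by (simp add: \<Phi>_def)
  moreover have "((\<lambda>n. H n i) \<longlongrightarrow> g i) \<Phi>" for i
  proof -
    have "filterlim H (nhds g) \<Phi>"
      unfolding \<Phi>_def by (rule filterlim_mono[OF filterlim_filtercomap order_refl]) simp
    moreover have "((\<lambda>f. f i) \<longlongrightarrow> g i) (nhds g)"
    proof -
      have "continuous_on UNIV (\<lambda>f :: 'i \<Rightarrow> real. f i)" by (rule continuous_on_product_coordinates)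
      then show ?thesis by (simp add: continuous_on_def tendsto_nhds_iff)
    qed
    ultimately show ?thesis by (rule filterlim_compose[rotated])
  qed
  ultimately show ?thesis by blast
qed

section \<open>Limits of word derivatives\<close>

context graded_lie
begin

lemma fr_Y: "b \<in> I \<Longrightarrow> b' \<in> I \<Longrightarrow> fr b' x (Y b x) = (if b' = b then 1 else 0)"
  by (auto simp: fr_def Y_def Yv_def idx_def)

text \<open>Convergence is merely pointwise along a filter, so uniformity has to come from the
  bounds: those on words two letters longer control the variation of the differentials uniformly in
  \<open>n\<close>. The resulting Taylor estimate is an inequality between values at two fixed
  points and passes to the limit.\<close>

lemma fw_limit_has_derivative:
  fixes f :: "nat \<Rightarrow> 'a \<Rightarrow> real"
  assumes sm: "\<And>n. smooth (f n)" and bd: "\<And>n w x. w \<in> lists I \<Longrightarrow> \<bar>fw Y w (f n) x\<bar> \<le> bd w"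
    and \<Phi>: "\<Phi> \<noteq> bot" and lim: "\<And>w x. w \<in> lists I \<Longrightarrow> ((\<lambda>n. fw Y w (f n) x) \<longlongrightarrow> g w x) \<Phi>"
    and w: "w \<in> lists I"
  shows "(g w has_derivative (\<lambda>u. \<Sum>b\<in>I. fr b x u * g (b # w) x)) (at x)"
proof -
  define p where "p b y = (\<Sum>e\<in>Basis. \<bar>fr b y e\<bar>)" for b y
  define \<delta> where "\<delta> b y = (\<Sum>e\<in>Basis. \<bar>fr b y e - fr b x e\<bar>)" for b y
  have ex: "l u = (\<Sum>e\<in>Basis. (u \<bullet> e) * l e)" if "linear l" for l :: "'a \<Rightarrow> real" and u
    by (subst euclidean_representation[of u, symmetric]) (simp add: linear_sum[OF that] linear_scale[OF that])
  have lb: "\<bar>l u\<bar> \<le> (\<Sum>e\<in>Basis. \<bar>l e\<bar>) * norm u" if "linear l" for l :: "'a \<Rightarrow> real" and u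
  proof -
    have "\<bar>(u \<bullet> e) * l e\<bar> \<le> \<bar>l e\<bar> * norm u" if "e \<in> Basis" for e
      unfolding abs_mult mult.commute[of "\<bar>u \<bullet> e\<bar>"] by (intro mult_left_mono Basis_le_norm that) simp
    then show ?thesis unfolding ex[OF that, of u] sum_distrib_right by (intro order_trans[OF sum_abs] sum_mono)
  qed
  have p: "\<bar>fr b y u\<bar> \<le> p b y * norm u" for b y u unfolding p_def by (rule lb[OF linear_fr])
  have d: "\<bar>fr b y u - fr b x u\<bar> \<le> \<delta> b y * norm u" for b y u
    unfolding \<delta>_def by (rule lb[of "\<lambda>u. fr b y u - fr b x u"]) (intro linear_compose_sub linear_fr)
  have cfr: "continuous_on UNIV (\<lambda>y. fr b y u)" for b u by (rule Cn_imp_continuous[OF smooth_Cn[OF smooth_fr]])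
  have cp: "continuous_on UNIV (p b)" and cd: "continuous_on UNIV (\<delta> b)" for b
    unfolding p_def[abs_def] \<delta>_def[abs_def] by (intro continuous_intros cfr)+
  have "\<exists>R. \<forall>y\<in>cball x 1. p b y \<le> R" for b
    using compact_continuous_image[OF continuous_on_subset[OF cp[of b] subset_UNIV] compact_cball[of x 1]]
    by (auto dest!: compact_imp_bounded bounded_imp_bdd_above simp: bdd_above_def)
  then obtain R where R: "\<And>b y. y \<in> cball x 1 \<Longrightarrow> p b y \<le> R b" by metis
  have pn: "p b y \<ge> 0" and dn: "\<delta> b y \<ge> 0" for b y unfolding p_def \<delta>_def by (intro sum_nonneg; simp)+
  have Rn: "R b \<ge> 0" for b using R[of x b] pn[of b x] by auto
  have bn: "bd v \<ge> 0" if "v \<in> lists I" for v using bd[OF that, of 0 x] by linarith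
  have der: "(fw Y v (f n) has_derivative (\<lambda>u. \<Sum>b\<in>I. fr b y u * fw Y (b # v) (f n) y)) (at y within S)" for v n y S
  proof -
    have sv: "smooth (fw Y v (f n))" by (rule smooth_fw[OF sm])
    have "(fw Y v (f n) has_derivative frechet_derivative (fw Y v (f n)) (at y)) (at y)"
      using smooth_Cn[OF sv, of 1] by (simp add: frechet_derivative_works)
    moreover have "frechet_derivative (fw Y v (f n)) (at y) = (\<lambda>u. \<Sum>b\<in>I. fr b y u * fw Y (b # v) (f n) y)"
      by (rule ext, subst fd_frame[OF sv]) simp
    ultimately have "(fw Y v (f n) has_derivative (\<lambda>u. \<Sum>b\<in>I. fr b y u * fw Y (b # v) (f n) y)) (at y)" by (simp only:)
    then show ?thesis by (rule has_derivative_at_withinI)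
  qed
  have lip: "\<bar>fw Y v (f n) y - fw Y v (f n) x\<bar> \<le> (\<Sum>b\<in>I. R b * bd (b # v)) * norm (y - x)"
    if v: "v \<in> lists I" and y: "y \<in> cball x 1" for v n y
  proof -
    have "norm (fw Y v (f n) y - fw Y v (f n) x) \<le> (\<Sum>b\<in>I. R b * bd (b # v)) * norm (y - x)"
    proof (rule differentiable_bound[OF convex_cball der])
      fix z assume z: "z \<in> cball x 1"
      show "onorm (\<lambda>u. \<Sum>b\<in>I. fr b z u * fw Y (b # v) (f n) z) \<le> (\<Sum>b\<in>I. R b * bd (b # v))"
      proof (rule onorm_le)
        fix u
        have "\<bar>\<Sum>b\<in>I. fr b z u * fw Y (b # v) (f n) z\<bar> \<le> (\<Sum>b\<in>I. (R b * norm u) * bd (b # v))"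
        proof (intro order_trans[OF sum_abs] sum_mono)
          fix b assume b: "b \<in> I"
          have "\<bar>fr b z u\<bar> \<le> R b * norm u" using p[of b z u] mult_right_mono[OF R[OF z, of b], of "norm u"] by simp
          then show "\<bar>fr b z u * fw Y (b # v) (f n) z\<bar> \<le> (R b * norm u) * bd (b # v)"
            unfolding abs_mult using bd[of "b # v" n z] b v Rn by (intro mult_mono) auto
        qed
        then show "norm (\<Sum>b\<in>I. fr b z u * fw Y (b # v) (f n) z) \<le> (\<Sum>b\<in>I. R b * bd (b # v)) * norm u"
          unfolding sum_distrib_right real_norm_def by (simp only: mult_ac)
      qed
    qed (use y in auto)
    then show ?thesis by simp
  qed
  \<comment> \<open>A modulus of continuity at \<open>x\<close> for the differentials, from the
    change of the coframe and the change of the longer words. It does not depend on \<open>n\<close>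
    and vanishes at \<open>x\<close>.\<close>
  define Eb where "Eb y = (\<Sum>b\<in>I. \<delta> b y * bd (b # w) + p b x * ((\<Sum>b'\<in>I. R b' * bd (b' # b # w)) * norm (y - x)))" for y
  have E: "\<bar>(\<Sum>b\<in>I. fr b y u * fw Y (b # w) (f n) y) - (\<Sum>b\<in>I. fr b x u * fw Y (b # w) (f n) x)\<bar> \<le> Eb y * norm u"
    if y: "y \<in> cball x 1" for n y u
  proof -
    have "\<bar>(\<Sum>b\<in>I. fr b y u * fw Y (b # w) (f n) y) - (\<Sum>b\<in>I. fr b x u * fw Y (b # w) (f n) x)\<bar>
      = \<bar>\<Sum>b\<in>I. (fr b y u - fr b x u) * fw Y (b # w) (f n) y + fr b x u * (fw Y (b # w) (f n) y - fw Y (b # w) (f n) x)\<bar>"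
      by (simp add: sum_subtractf[symmetric] algebra_simps del: fw.simps)
    also have "\<dots> \<le> (\<Sum>b\<in>I. (\<delta> b y * norm u) * bd (b # w) + (p b x * norm u) * ((\<Sum>b'\<in>I. R b' * bd (b' # b # w)) * norm (y - x)))"
    proof (intro order_trans[OF sum_abs] sum_mono order_trans[OF abs_triangle_ineq] add_mono)
      fix b assume b: "b \<in> I"
      show "\<bar>(fr b y u - fr b x u) * fw Y (b # w) (f n) y\<bar> \<le> (\<delta> b y * norm u) * bd (b # w)"
        unfolding abs_mult using d bd[of "b # w" n y] b w dn by (intro mult_mono) auto
      show "\<bar>fr b x u * (fw Y (b # w) (f n) y - fw Y (b # w) (f n) x)\<bar> \<le> (p b x * norm u) * ((\<Sum>b'\<in>I. R b' * bd (b' # b # w)) * norm (y - x))"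
        unfolding abs_mult using p lip[of "b # w" y n] b w y pn by (intro mult_mono) auto
    qed
    also have "\<dots> = Eb y * norm u" unfolding Eb_def sum_distrib_right by (intro sum.cong refl) (simp add: algebra_simps sum_distrib_left)
    finally show ?thesis .
  qed
  have contE: "continuous_on UNIV Eb" unfolding Eb_def[abs_def] by (intro continuous_intros cd)
  have E0: "Eb x = 0" by (simp add: Eb_def \<delta>_def)
  show ?thesis unfolding has_derivative_at_alt
  proof (intro conjI allI impI)
    have "linear (\<lambda>u. \<Sum>b\<in>I. fr b x u * g (b # w) x)"
      by (rule linearI) (simp_all add: linear_add[OF linear_fr] linear_scale[OF linear_fr] algebra_simps sum.distrib sum_distrib_left)
    then show "bounded_linear (\<lambda>u. \<Sum>b\<in>I. fr b x u * g (b # w) x)" by (simp add: linear_conv_bounded_linear)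
    fix \<epsilon> :: real assume e: "\<epsilon> > 0"
    obtain r0 where r0: "r0 > 0" "\<And>y. dist y x < r0 \<Longrightarrow> dist (Eb y) (Eb x) < \<epsilon>"
      using contE e unfolding continuous_on_iff by (metis UNIV_I)
    define r where "r = min (r0 / 2) 1"
    have r: "r > 0" "cball x r \<subseteq> cball x 1" using r0 by (auto simp: r_def)
    have Ee: "Eb y \<le> \<epsilon>" if "y \<in> cball x r" for y
      using r0(2)[of y] r0(1) that by (auto simp: r_def E0 dist_commute dist_real_def)
    show "\<exists>d>0. \<forall>y. norm (y - x) < d \<longrightarrow> norm (g w y - g w x - (\<Sum>b\<in>I. fr b x (y - x) * g (b # w) x)) \<le> \<epsilon> * norm (y - x)"
    proof (intro exI[of _ r] conjI allI impI r(1))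
      fix y assume "norm (y - x) < r"
      then have y: "y \<in> cball x r" by (simp add: dist_norm norm_minus_commute)
      let ?L = "\<lambda>n u. \<Sum>b\<in>I. fr b x u * fw Y (b # w) (f n) x"
      have linL: "linear (?L n)" for n
        by (rule linearI) (simp_all add: linear_add[OF linear_fr] linear_scale[OF linear_fr] algebra_simps sum.distrib sum_distrib_left del: fw.simps)
      have "norm ((fw Y w (f n) y - ?L n y) - (fw Y w (f n) x - ?L n x)) \<le> \<epsilon> * norm (y - x)" for n
      proof (rule differentiable_bound[OF convex_cball])
        show "((\<lambda>y. fw Y w (f n) y - ?L n y) has_derivative (\<lambda>u. (\<Sum>b\<in>I. fr b z u * fw Y (b # w) (f n) z) - ?L n u)) (at z within cball x r)" for z
          by (intro has_derivative_diff der linear_imp_has_derivative linL)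
        show "onorm (\<lambda>u. (\<Sum>b\<in>I. fr b z u * fw Y (b # w) (f n) z) - ?L n u) \<le> \<epsilon>" if z: "z \<in> cball x r" for z
        proof (rule onorm_le)
          fix u :: 'a
          have zz: "z \<in> cball x 1" using z r(2) by auto
          have "Eb z * norm u \<le> \<epsilon> * norm u" using Ee[OF z] by (intro mult_right_mono) auto
          then show "norm ((\<Sum>b\<in>I. fr b z u * fw Y (b # w) (f n) z) - ?L n u) \<le> \<epsilon> * norm u"
            unfolding real_norm_def by (rule order_trans[OF E[OF zz]])
        qed
      qed (use y r in auto)
      moreover have "(fw Y w (f n) y - ?L n y) - (fw Y w (f n) x - ?L n x) = fw Y w (f n) y - fw Y w (f n) x - ?L n (y - x)" for n
        using linear_diff[OF linL[of n], of y x] by simp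
      ultimately have bdn: "norm (fw Y w (f n) y - fw Y w (f n) x - ?L n (y - x)) \<le> \<epsilon> * norm (y - x)" for n by (simp only:)
      have "((\<lambda>n. norm (fw Y w (f n) y - fw Y w (f n) x - ?L n (y - x))) \<longlongrightarrow>
         norm (g w y - g w x - (\<Sum>b\<in>I. fr b x (y - x) * g (b # w) x))) \<Phi>"
        using w by (intro tendsto_intros lim) auto
      then show "norm (g w y - g w x - (\<Sum>b\<in>I. fr b x (y - x) * g (b # w) x)) \<le> \<epsilon> * norm (y - x)"
        by (rule tendsto_upperbound[OF _ always_eventually \<Phi>]) (use bdn in blast)
    qed
  qed
qed

text \<open>The limits \<open>g w\<close> form a family closed under frame derivatives, to which
  \<open>Cn_frame\<close> applies; on the vector \<open>Y b\<close> the coframe singles out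
  \<open>g (b # w)\<close>.\<close>

lemma fw_limit:
  fixes f :: "nat \<Rightarrow> 'a \<Rightarrow> real"
  assumes sm: "\<And>n. smooth (f n)" and bd: "\<And>n w x. w \<in> lists I \<Longrightarrow> \<bar>fw Y w (f n) x\<bar> \<le> bd w"
    and \<Phi>: "\<Phi> \<noteq> bot" and lim: "\<And>w x. w \<in> lists I \<Longrightarrow> ((\<lambda>n. fw Y w (f n) x) \<longlongrightarrow> g w x) \<Phi>"
  shows "smooth (g [])" and "w \<in> lists I \<Longrightarrow> fw Y w (g []) x = g w x"
proof -
  note D = fw_limit_has_derivative[of f bd \<Phi> g, OF sm bd \<Phi> lim]
  have "Cn n (g [])" for n
    by (rule Cn_frame[where A = "lists I" and S = I and F = g and co = fr and nx = "\<lambda>w b. b # w", OF D])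
      (auto intro: smooth_Cn smooth_fr)
  then show "smooth (g [])" by (simp add: smooth_def)
  show "w \<in> lists I \<Longrightarrow> fw Y w (g []) x = g w x"
  proof (induction w arbitrary: x rule: list.induct)
    case (Cons b w)
    then have w: "w \<in> lists I" and b: "b \<in> I" by auto
    have eq: "fw Y w (g []) = g w" using Cons(1)[OF w] by (rule ext)
    have "fw Y (b # w) (g []) x = (\<Sum>b'\<in>I. fr b' x (Y b x) * g (b' # w) x)"
      by (simp add: eq fd_eqI[OF D[OF _ _ w]] assms)
    also have "\<dots> = (\<Sum>b'\<in>I. if b' = b then g (b' # w) x else 0)" using b by (intro sum.cong) (auto simp: fr_Y)
    also have "\<dots> = g (b # w) x" using b by simp
    finally show ?case .
  qed simp
qed

end

text \<open>For weight at least 1 the size bounds do not grow towards coarser scales, so the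
  weighted sums are dominated by a geometric series.\<close>

lemma power_int_weight_le:
  fixes A :: real
  assumes A: "A \<ge> 1" and k: "1 \<le> k"
  shows "A powi (m + int n) * (A powi (- (m + int n))) ^ k \<le> A powi m * (A powi (- m)) ^ k"
proof -
  obtain j where j: "k = Suc j" using k by (cases k) auto
  have e: "A powi i * (A powi (- i)) ^ k = (A powi (- i)) ^ j" for i
    using A by (simp add: j power_int_minus)
  have "A powi (- (m + int n)) \<le> A powi (- m)" using A by (intro power_int_increasing) auto
  then show ?thesis unfolding e using A by (intro power_mono) auto
qed

lemma tendsto_vnorm:
  assumes "\<And>d. d < D \<Longrightarrow> ((\<lambda>n. v n d) \<longlongrightarrow> u d) \<Phi>"
  shows "((\<lambda>n. vnorm D (v n)) \<longlongrightarrow> vnorm D u) \<Phi>"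
  unfolding vnorm_def using assms by (intro tendsto_intros) auto

lemma tendsto_wedge_norm:
  assumes "\<And>a d. a \<in> S \<Longrightarrow> d < D \<Longrightarrow> ((\<lambda>n. v n a d) \<longlongrightarrow> u a d) \<Phi>"
  shows "((\<lambda>n. wedge_norm D S (v n)) \<longlongrightarrow> wedge_norm D S u) \<Phi>"
  unfolding wedge_norm_def vdot_def using assms by (intro tendsto_intros) (auto simp: permutes_in_image)

section \<open>The family over all scales\<close>

context test_bounds
begin

definition full_family :: "real \<Rightarrow> real \<Rightarrow> real \<Rightarrow> real \<Rightarrow> (int \<Rightarrow> nat \<Rightarrow> 'a \<Rightarrow> real) \<Rightarrow> bool" where
  "full_family Cp \<kappa> A \<rho> F \<longleftrightarrow> (\<forall>m.
   (\<forall>d<DD. smooth (F m d)) \<and>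
   (\<forall>d<DD. \<forall>w\<in>lists I. \<forall>x. \<bar>fw Y w (F m d) x\<bar> \<le> A powi m * (A powi (- m)) ^ wt w * (Cp * B ^ (length w)\<^sup>2)) \<and>
   (\<forall>x. (\<forall>\<alpha>\<in>W1. \<forall>\<beta>\<in>W1.
       summable (\<lambda>n. \<bar>\<rho> ^ Suc n * (\<Sum>d<DD. fw Y \<alpha> (F m d) x * fw Y \<beta> (F (m + 1 + int n) d) x)\<bar>) \<and>
       (\<Sum>n. \<rho> ^ Suc n * (\<Sum>d<DD. fw Y \<alpha> (F m d) x * fw Y \<beta> (F (m + 1 + int n) d) x)) = 0) \<and>
     (\<forall>\<alpha>\<in>W1. ca / 4 \<le> (\<Sum>d<DD. (fw Y \<alpha> (F m d) x)\<^sup>2)) \<and>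
     \<kappa> * (\<Prod>\<alpha>\<in>WW. vnorm DD (\<lambda>d. \<Sum>n. \<rho> ^ n * fw Y \<alpha> (F (m + int n) d) x))
       \<le> wedge_norm DD WW (\<lambda>\<alpha> d. \<Sum>n. \<rho> ^ n * fw Y \<alpha> (F (m + int n) d) x)))"

text \<open>The truncations at \<open>mx = int N\<close> converge along a filter finer than
  \<open>sequentially\<close>. Their series are dominated by multiples of \<open>\<rho> ^ n\<close>,
  so Tannery's theorem exchanges limit and sum, and for fixed \<open>N\<close> the series are the
  finite sums of \<open>scale_family\<close>.\<close>

lemma full_family_exists:
  assumes Cp: "Cp > 0" and A: "A \<ge> 2" and \<rho>: "0 < \<rho>" "\<rho> < 1"
    and ex: "\<And>N. \<exists>F. scale_family Cp \<kappa> A \<rho> (int N) F"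
  shows "\<exists>F. full_family Cp \<kappa> A \<rho> F"
proof -
  obtain G where G: "\<And>N. scale_family Cp \<kappa> A \<rho> (int N) (G N)"
    using choice[of "\<lambda>N F. scale_family Cp \<kappa> A \<rho> (int N) F"] ex by blast
  have smG: "smooth (G N m d)" and G0: "int N < m \<Longrightarrow> G N m d = (\<lambda>x. 0)"
    and bdG: "d < DD \<Longrightarrow> w \<in> lists I \<Longrightarrow> \<bar>fw Y w (G N m d) x\<bar> \<le> A powi m * (A powi (- m)) ^ wt w * (Cp * B ^ (length w)\<^sup>2)"
    and orthG: "m \<le> int N \<Longrightarrow> \<alpha> \<in> W1 \<Longrightarrow> \<beta> \<in> W1 \<Longrightarrow> (\<Sum>n<nat (int N - m). \<rho> ^ Suc n * (\<Sum>d<DD. fw Y \<alpha> (G N m d) x * fw Y \<beta> (G N (m + 1 + int n) d) x)) = 0"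
    and lowG: "m \<le> int N \<Longrightarrow> \<alpha> \<in> W1 \<Longrightarrow> ca / 4 \<le> (\<Sum>d<DD. (fw Y \<alpha> (G N m d) x)\<^sup>2)"
    and wedgeG: "m \<le> int N \<Longrightarrow> \<kappa> * (\<Prod>\<alpha>\<in>WW. vnorm DD (\<lambda>d. \<Sum>n<Suc (nat (int N - m)). \<rho> ^ n * fw Y \<alpha> (G N (m + int n) d) x))
       \<le> wedge_norm DD WW (\<lambda>\<alpha> d. \<Sum>n<Suc (nat (int N - m)). \<rho> ^ n * fw Y \<alpha> (G N (m + int n) d) x)"
    for N m d w x \<alpha> \<beta>
    using G[of N] unfolding scale_family_def fun_eq_iff by blast+
  define bdf where "bdf m w = A powi m * (A powi (- m)) ^ wt w * (Cp * B ^ (length w)\<^sup>2)" for m and w :: "(nat \<times> nat) list"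
  have bdf0: "bdf m w \<ge> 0" for m w using A Cp B2 by (simp add: bdf_def)
  \<comment> \<open>Scales, components, words and points form one index, so that a single filter
    serves them all.\<close>
  define H where "H N i = (case i of (m, d, w, x) \<Rightarrow> if d < DD \<and> w \<in> lists I then fw Y w (G N m d) x else 0)" for N i
  have "\<bar>H N i\<bar> \<le> (case i of (m, d, w, x) \<Rightarrow> bdf m w)" for N i
    using bdG bdf0 by (auto simp: H_def bdf_def split: prod.split)
  from pointwise_cluster[of H, OF this] obtain \<Phi> g where \<Phi>: "\<Phi> \<noteq> bot" "\<Phi> \<le> sequentially" and gl: "\<And>i. ((\<lambda>N. H N i) \<longlongrightarrow> g i) \<Phi>" by blast
  have gl': "((\<lambda>N. fw Y w (G N m d) x) \<longlongrightarrow> g (m, d, w, x)) \<Phi>" if "d < DD" "w \<in> lists I" for m d w x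
    using gl[of "(m, d, w, x)"] that by (simp add: H_def)
  define F where "F m d x = g (m, d, [], x)" for m d x
  have smF: "smooth (F m d)" and fwF: "w \<in> lists I \<Longrightarrow> fw Y w (F m d) x = g (m, d, w, x)" if d: "d < DD" for m d w x
    using fw_limit[of "\<lambda>N. G N m d" "bdf m" \<Phi> "\<lambda>w x. g (m, d, w, x)", OF smG _ \<Phi>(1) gl'[OF d]] bdG[OF d]
    unfolding F_def[abs_def] bdf_def by blast+
  have L: "((\<lambda>N. fw Y w (G N m d) x) \<longlongrightarrow> fw Y w (F m d) x) \<Phi>" if "d < DD" "w \<in> lists I" for m d w x
    unfolding fwF[OF that] by (rule gl'[OF that])
  have ev: "eventually (\<lambda>N. m \<le> int N) \<Phi>" for m
  proof -
    have "eventually (\<lambda>N. m \<le> int N) sequentially" using eventually_ge_at_top[of "nat m"] by eventually_elim linarith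
    then show ?thesis by (rule filter_leD[OF \<Phi>(2)])
  qed
  have W1I: "\<alpha> \<in> lists I" "wt \<alpha> = 1" "length \<alpha> = 1" if "\<alpha> \<in> W1" for \<alpha> using W1_single[OF that] by auto
  have WI: "\<alpha> \<in> lists I" "1 \<le> wt \<alpha>" if "\<alpha> \<in> WW" for \<alpha>
    using Wset_lists[OF that] wt_ge_length[of \<alpha>] by (auto simp: Suc_le_eq intro: order_less_le_trans)
  have fw0: "fw Y w (\<lambda>x. 0) = (\<lambda>x. 0)" for w by (cases "w = []") (auto simp: fw_const)
  have "full_family Cp \<kappa> A \<rho> F" unfolding full_family_def
  proof (intro allI conjI impI ballI)
    show "smooth (F m d)" if "d < DD" for m d by (rule smF[OF that])
    show "\<bar>fw Y w (F m d) x\<bar> \<le> A powi m * (A powi (- m)) ^ wt w * (Cp * B ^ (length w)\<^sup>2)" if d: "d < DD" and w: "w \<in> lists I" for m d w x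
      by (rule tendsto_upperbound[OF tendsto_rabs[OF L[OF d w]] always_eventually \<Phi>(1)]) (use bdG[OF d w] in blast)
    fix m x
    show "ca / 4 \<le> (\<Sum>d<DD. (fw Y \<alpha> (F m d) x)\<^sup>2)" if al: "\<alpha> \<in> W1" for \<alpha>
    proof (rule tendsto_lowerbound[OF _ _ \<Phi>(1)])
      show "((\<lambda>N. \<Sum>d<DD. (fw Y \<alpha> (G N m d) x)\<^sup>2) \<longlongrightarrow> (\<Sum>d<DD. (fw Y \<alpha> (F m d) x)\<^sup>2)) \<Phi>"
        using W1I(1)[OF al] by (intro tendsto_intros L) auto
      show "eventually (\<lambda>N. ca / 4 \<le> (\<Sum>d<DD. (fw Y \<alpha> (G N m d) x)\<^sup>2)) \<Phi>"
        using ev[of m] by eventually_elim (rule lowG[OF _ al])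
    qed
    fix \<alpha> \<beta> assume al: "\<alpha> \<in> W1" and be: "\<beta> \<in> W1"
    define a where "a n N = \<rho> ^ Suc n * (\<Sum>d<DD. fw Y \<alpha> (G N m d) x * fw Y \<beta> (G N (m + 1 + int n) d) x)" for n N
    define b where "b n = \<rho> ^ Suc n * (\<Sum>d<DD. fw Y \<alpha> (F m d) x * fw Y \<beta> (F (m + 1 + int n) d) x)" for n
    have lim: "((\<lambda>N. a n N) \<longlongrightarrow> b n) \<Phi>" for n
      unfolding a_def b_def using W1I(1)[OF al] W1I(1)[OF be] by (intro tendsto_intros L) auto
    have G1: "\<bar>fw Y \<gamma> (G N m' d) x\<bar> \<le> Cp * B" if "\<gamma> \<in> W1" "d < DD" for \<gamma> d N m'
      using bdG[OF that(2) W1I(1)[OF that(1)], of N m' x] A by (simp add: W1I[OF that(1)] power_int_minus)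
    have bd: "norm (a n N) \<le> \<rho> ^ Suc n * (real DD * (Cp * B)\<^sup>2)" for n N
    proof -
      have "\<bar>\<Sum>d<DD. fw Y \<alpha> (G N m d) x * fw Y \<beta> (G N (m + 1 + int n) d) x\<bar> \<le> (\<Sum>d<DD. (Cp * B)\<^sup>2)"
        unfolding power2_eq_square using Cp B2
        by (intro order_trans[OF sum_abs] sum_mono, subst abs_mult) (intro mult_mono G1 al be; simp)
      then show ?thesis using \<rho> by (simp add: a_def abs_mult mult_left_mono)
    qed
    have sumM: "summable (\<lambda>n. \<rho> ^ Suc n * (real DD * (Cp * B)\<^sup>2))"
      using \<rho> by (intro summable_mult2 summable_Suc_iff[THEN iffD2] summable_geometric) auto
    have T: "summable (\<lambda>n. norm (b n))" "((\<lambda>N. suminf (\<lambda>n. a n N)) \<longlongrightarrow> suminf b) \<Phi>"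
      using tannerys_theorem[where a = a and b = b and F = \<Phi> and M = "\<lambda>n. \<rho> ^ Suc n * (real DD * (Cp * B)\<^sup>2)", OF lim always_eventually sumM \<Phi>(1)] bd by auto
    have "suminf (\<lambda>n. a n N) = 0" if N: "m \<le> int N" for N
    proof -
      have "suminf (\<lambda>n. a n N) = (\<Sum>n<nat (int N - m). a n N)"
        by (rule suminf_finite) (use N in \<open>auto simp: a_def G0 fw0\<close>)
      then show ?thesis unfolding a_def using orthG[OF N al be] by simp
    qed
    then have "eventually (\<lambda>N. suminf (\<lambda>n. a n N) = 0) \<Phi>" using ev[of m] by (auto elim: eventually_mono)
    then have "((\<lambda>N. suminf (\<lambda>n. a n N)) \<longlongrightarrow> 0) \<Phi>" by (rule tendsto_eventually)
    then have "suminf b = 0" using T(2) tendsto_unique \<Phi>(1) by blast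
    then show "(\<Sum>n. \<rho> ^ Suc n * (\<Sum>d<DD. fw Y \<alpha> (F m d) x * fw Y \<beta> (F (m + 1 + int n) d) x)) = 0"
      unfolding b_def[abs_def] .
    show "summable (\<lambda>n. \<bar>\<rho> ^ Suc n * (\<Sum>d<DD. fw Y \<alpha> (F m d) x * fw Y \<beta> (F (m + 1 + int n) d) x)\<bar>)"
      using T(1) unfolding b_def[abs_def] real_norm_def .
  next
    fix m x
    define v where "v N \<alpha> d = (\<Sum>n<Suc (nat (int N - m)). \<rho> ^ n * fw Y \<alpha> (G N (m + int n) d) x)" for N \<alpha> d
    define u where "u \<alpha> d = (\<Sum>n. \<rho> ^ n * fw Y \<alpha> (F (m + int n) d) x)" for \<alpha> d
    have lim: "((\<lambda>N. v N \<alpha> d) \<longlongrightarrow> u \<alpha> d) \<Phi>" if al: "\<alpha> \<in> WW" and d: "d < DD" for \<alpha> d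
    proof -
      define a where "a n N = \<rho> ^ n * fw Y \<alpha> (G N (m + int n) d) x" for n N
      define b where "b n = \<rho> ^ n * fw Y \<alpha> (F (m + int n) d) x" for n
      have lim: "((\<lambda>N. a n N) \<longlongrightarrow> b n) \<Phi>" for n
        unfolding a_def b_def using WI(1)[OF al] d by (intro tendsto_intros L)
      have bd: "norm (a n N) \<le> \<rho> ^ n * bdf m \<alpha>" for n N
      proof -
        have "A powi (m + int n) * (A powi (- (m + int n))) ^ wt \<alpha> * (Cp * B ^ (length \<alpha>)\<^sup>2) \<le> bdf m \<alpha>"
          unfolding bdf_def using power_int_weight_le[of A "wt \<alpha>" m n] A Cp B2 WI(2)[OF al] by (intro mult_right_mono) auto
        then have "\<bar>fw Y \<alpha> (G N (m + int n) d) x\<bar> \<le> bdf m \<alpha>" using bdG[OF d WI(1)[OF al]] order_trans by blast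
        then show ?thesis using \<rho> by (simp add: a_def abs_mult mult_left_mono)
      qed
      have sumM: "summable (\<lambda>n. \<rho> ^ n * bdf m \<alpha>)"
        using \<rho> by (intro summable_mult2 summable_geometric) auto
      have T: "((\<lambda>N. suminf (\<lambda>n. a n N)) \<longlongrightarrow> suminf b) \<Phi>"
        using tannerys_theorem[where a = a and b = b and F = \<Phi> and M = "\<lambda>n. \<rho> ^ n * bdf m \<alpha>", OF lim always_eventually sumM \<Phi>(1)] bd by auto
      have "suminf (\<lambda>n. a n N) = v N \<alpha> d" if N: "m \<le> int N" for N
        unfolding v_def a_def[symmetric] by (rule suminf_finite) (use N in \<open>auto simp: a_def G0 fw0\<close>)
      then have "eventually (\<lambda>N. suminf (\<lambda>n. a n N) = v N \<alpha> d) \<Phi>" using ev[of m] by (auto elim: eventually_mono)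
      from tendsto_cong[OF this] T show ?thesis unfolding u_def b_def[abs_def] by simp
    qed
    have "\<kappa> * (\<Prod>\<alpha>\<in>WW. vnorm DD (u \<alpha>)) \<le> wedge_norm DD WW u"
    proof (rule tendsto_le[OF \<Phi>(1)])
      show "((\<lambda>N. wedge_norm DD WW (v N)) \<longlongrightarrow> wedge_norm DD WW u) \<Phi>" by (rule tendsto_wedge_norm) (rule lim)
      show "((\<lambda>N. \<kappa> * (\<Prod>\<alpha>\<in>WW. vnorm DD (v N \<alpha>))) \<longlongrightarrow> \<kappa> * (\<Prod>\<alpha>\<in>WW. vnorm DD (u \<alpha>))) \<Phi>"
        by (intro tendsto_intros tendsto_vnorm lim)
      show "eventually (\<lambda>N. \<kappa> * (\<Prod>\<alpha>\<in>WW. vnorm DD (v N \<alpha>)) \<le> wedge_norm DD WW (v N)) \<Phi>"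
        using ev[of m] unfolding v_def[abs_def] by eventually_elim (rule wedgeG)
    qed
    then show "\<kappa> * (\<Prod>\<alpha>\<in>WW. vnorm DD (\<lambda>d. \<Sum>n. \<rho> ^ n * fw Y \<alpha> (F (m + int n) d) x))
       \<le> wedge_norm DD WW (\<lambda>\<alpha> d. \<Sum>n. \<rho> ^ n * fw Y \<alpha> (F (m + int n) d) x)"
      unfolding u_def[abs_def] .
  qed
  then show ?thesis by blast
qed

end

section \<open>Transfer to the group\<close>

lemma wedge_norm_cong:
  assumes "\<And>a d. a \<in> S \<Longrightarrow> d < D \<Longrightarrow> v a d = u a d"
  shows "wedge_norm D S v = wedge_norm D S u"
  unfolding wedge_norm_def vdot_def using assms by (auto simp: permutes_in_image intro!: sum.cong prod.cong arg_cong[where f = sqrt])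

lemma vnorm_cong: "(\<And>d. d < D \<Longrightarrow> v d = u d) \<Longrightarrow> vnorm D v = vnorm D u"
  by (simp add: vnorm_def)

lemma vnorm_le:
  assumes "\<And>d. d < D \<Longrightarrow> \<bar>v d\<bar> \<le> K" "K \<ge> 0"
  shows "vnorm D v \<le> sqrt (real D) * K"
proof -
  have "(v d)\<^sup>2 \<le> K\<^sup>2" if "d < D" for d using assms(1)[OF that] assms(2) abs_le_square_iff[of "v d" K] by simp
  then have "(\<Sum>d<D. (v d)\<^sup>2) \<le> (\<Sum>d<D. K\<^sup>2)" by (intro sum_mono) simp
  then have "vnorm D v \<le> sqrt (\<Sum>d<D. K\<^sup>2)" unfolding vnorm_def by (rule real_sqrt_le_mono)
  then show ?thesis using assms(2) by (simp add: real_sqrt_mult)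
qed

text \<open>\<open>ln A \<le> A / 2\<close> follows from \<open>ln t \<le> t - 1\<close> at
  \<open>A / 2\<close> and at 2, hence \<open>\<epsilon> * ln A \<le> 1/2\<close>. The lower bound
  makes the constants independent of \<epsilon>, the strict upper bound makes the sums over scales
  converge.\<close>

lemma powr_neg_inverse_bounds:
  fixes A \<epsilon> :: real
  assumes A: "A \<ge> 2" and e: "0 < \<epsilon>" "\<epsilon> \<le> 1 / A"
  shows "1/2 \<le> A powr (- \<epsilon>)" "A powr (- \<epsilon>) < 1"
proof -
  have "ln A = ln (A / 2) + ln 2" using A by (simp add: ln_div)
  also have "\<dots> \<le> (A / 2 - 1) + (2 - 1)" using A by (intro add_mono ln_le_minus_one) auto
  finally have l: "ln A \<le> A / 2" by simp
  have "\<epsilon> * ln A \<le> 1 / A * (A / 2)" using e l A by (intro mult_mono) auto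
  then have "1/2 \<le> 1 + - \<epsilon> * ln A" using A by simp
  also have "\<dots> \<le> exp (- \<epsilon> * ln A)" by (rule exp_ge_add_one_self)
  also have "\<dots> = A powr (- \<epsilon>)" using A by (simp add: powr_def)
  finally show "1/2 \<le> A powr (- \<epsilon>)" .
  show "A powr (- \<epsilon>) < 1" using A e powr_less_mono[of "- \<epsilon>" 0 A] by simp
qed

section \<open>Evaluation of the conclusion on the group\<close>

context carnot_group
begin

text \<open>The weight \<open>R ^ j\<close> of the norm cancels the factor
  \<open>(1 / R) ^ j\<close> of the hypothesis, so every order contributes a constant times
  \<open>R\<close>.\<close>

lemma Cnorm_le_words:
  assumes R: "R > 0" and C: "\<And>j. C j \<ge> 0"
    and bd: "\<And>j is d p. length is = j \<Longrightarrow> set is \<subseteq> {1..k} \<Longrightarrow> d < D \<Longrightarrow> \<bar>Lword mul e (map (Xb 1) is) (\<phi> d) p\<bar> \<le> R * (1 / R) ^ j * C j"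
  shows "Cnorm_le mul e Xb k D l R \<phi> ((\<Sum>j\<le>l. C j * sqrt (real k ^ j * real D)) * R)"
proof -
  have nb: "nabla_norm mul e Xb k D j \<phi> p \<le> R * (1 / R) ^ j * (C j * sqrt (real k ^ j * real D))" for j p
  proof -
    let ?S = "{is. length is = j \<and> set is \<subseteq> {1..k}}"
    define b where "b = R * (1 / R) ^ j * C j"
    have b: "b \<ge> 0" using R C by (simp add: b_def)
    have "(Lword mul e (map (Xb 1) is) (\<phi> d) p)\<^sup>2 \<le> b\<^sup>2" if "is \<in> ?S" "d < D" for "is" d
      using bd[of "is" j d p] that b abs_le_square_iff[of _ b] unfolding b_def[symmetric] by simp
    then have "(\<Sum>is\<in>?S. \<Sum>d<D. (Lword mul e (map (Xb 1) is) (\<phi> d) p)\<^sup>2) \<le> (\<Sum>is\<in>?S. \<Sum>d<D. b\<^sup>2)"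
      by (intro sum_mono) auto
    also have "\<dots> = real (card ?S) * (real D * b\<^sup>2)" by simp
    also have "card ?S = k ^ j" using card_lists_length_eq[of "{1..k}" j] by (simp add: conj_commute)
    finally have "nabla_norm mul e Xb k D j \<phi> p \<le> sqrt (real (k ^ j) * (real D * b\<^sup>2))"
      unfolding nabla_norm_def by (rule real_sqrt_le_mono)
    also have "\<dots> = b * sqrt (real k ^ j * real D)" using b by (simp add: real_sqrt_mult)
    finally show ?thesis by (simp add: b_def mult_ac)
  qed
  have "R ^ j * (SUP p. nabla_norm mul e Xb k D j \<phi> p) \<le> C j * sqrt (real k ^ j * real D) * R" for j
  proof -
    have "(SUP p. nabla_norm mul e Xb k D j \<phi> p) \<le> R * (1 / R) ^ j * (C j * sqrt (real k ^ j * real D))"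
      by (rule cSUP_least) (auto intro: nb)
    then have "R ^ j * (SUP p. nabla_norm mul e Xb k D j \<phi> p) \<le> R ^ j * (R * (1 / R) ^ j * (C j * sqrt (real k ^ j * real D)))"
      using R by (intro mult_left_mono) auto
    also have "\<dots> = C j * sqrt (real k ^ j * real D) * R" using R by (simp add: power_one_over)
    finally show ?thesis .
  qed
  then have "(\<Sum>j\<le>l. R ^ j * (SUP p. nabla_norm mul e Xb k D j \<phi> p)) \<le> (\<Sum>j\<le>l. C j * sqrt (real k ^ j * real D) * R)"
    by (intro sum_mono)
  then show ?thesis unfolding Cnorm_le_def using nb by (auto simp: bdd_above_def sum_distrib_right)
qed

text \<open>The fields are pulled back by the chart \<open>c\<close>. Every quantity in the
  conclusion is built from word derivatives, which by \<open>Lword_chart\<close> are those of the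
  model evaluated at \<open>c p\<close>.\<close>

lemma concl_exists:
  "\<exists>K>0. \<exists>A0. \<forall>A\<ge>A0. \<forall>\<epsilon>. 0 < \<epsilon> \<and> \<epsilon> \<le> 1 / A \<longrightarrow> (\<exists>\<phi>. thm62_concl mul e s kk Xb K A \<epsilon> \<phi>)"
proof -
  obtain B Ca where B: "B \<ge> 2" "Ca > 0" "\<forall>l\<in>Ls. \<forall>w\<in>lists I. \<forall>p. \<bar>fw Y w (tf l) p\<bar> \<le> Ca * B ^ (length w)\<^sup>2"
    using f_jet_bound by blast
  obtain ca where ca: "ca > 0" "\<forall>y\<in>cube (1/2). \<forall>t. ca * (\<Sum>\<alpha>\<in>Wset s kk. (t \<alpha>)\<^sup>2) \<le> (\<Sum>l\<in>Ls. (\<Sum>\<alpha>\<in>Wset s kk. t \<alpha> * fw Y \<alpha> (tf l) y)\<^sup>2)"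
    using f_coercive by blast
  interpret test_bounds "lie_br mul e" s kk Xb B Ca ca
    using B ca by unfold_locales blast+
  obtain c where smc: "smooth c" and c: "\<And>p v. frechet_derivative c (at p) (J p v) = Yv v (c p)" using chart by blast
  obtain Cp \<kappa> A0 where Cp: "Cp > 0" and kap: "\<kappa> > 0" and A0: "A0 \<ge> 2"
    and fam: "\<forall>A\<ge>A0. \<forall>\<rho>. 1/2 \<le> \<rho> \<longrightarrow> \<rho> \<le> 1 \<longrightarrow> (\<forall>mx. \<exists>F. scale_family Cp \<kappa> A \<rho> mx F)"
    using scale_family_exists by (elim exE conjE)
  \<comment> \<open>One constant for each estimate: \<open>K1\<close> for the norm,
    \<open>K2\<close> for single derivatives, \<open>K3\<close> for the lower bound on horizontal
    ones, and \<open>1 / \<kappa>\<close> for the wedge. All are fixed before \<open>A\<close> and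
    \<epsilon>.\<close>
  define K1 where "K1 = (\<Sum>j\<le>s\<^sup>2 + s. Cp * B ^ j\<^sup>2 * sqrt (real (kk 1) ^ j * real DD))"
  define K2 where "K2 = sqrt (real DD) * (Cp * B)"
  define K3 where "K3 = 1 / sqrt (ca / 4)"
  define K where "K = K1 + K2 + K3 + 1 / \<kappa>"
  have K1: "K1 \<ge> 0" unfolding K1_def using Cp B2 by (intro sum_nonneg) auto
  have K2: "K2 \<ge> 0" unfolding K2_def using Cp B2 by auto
  have K3: "K3 > 0" unfolding K3_def using ca by auto
  have Kp: "K > 0" and KK: "K1 \<le> K" "K2 \<le> K" "K3 \<le> K" "1 / \<kappa> \<le> K"
    using K1 K2 K3 kap by (auto simp: K_def add_nonneg_pos)
  have Kinv: "1 / K \<le> sqrt (ca / 4)" "1 / K \<le> \<kappa>"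
  proof -
    have "1 / y \<le> x" if "1 / x \<le> y" "x > 0" for x y :: real
    proof -
      have "0 < 1 / x" using that by simp
      then have "0 < y" using that(1) by linarith
      then show ?thesis using that by (simp add: pos_divide_le_eq mult.commute)
    qed
    then show "1 / K \<le> sqrt (ca / 4)" "1 / K \<le> \<kappa>" using KK kap ca by (auto simp: K3_def)
  qed
  have "\<exists>\<phi>. thm62_concl mul e s kk Xb K A \<epsilon> \<phi>" if AA: "A \<ge> A0" and e: "0 < \<epsilon>" "\<epsilon> \<le> 1 / A" for A \<epsilon>
  proof -
    have A: "A \<ge> 2" using AA A0 by simp
    define \<rho> where "\<rho> = A powr (- \<epsilon>)"
    have \<rho>: "1/2 \<le> \<rho>" "\<rho> < 1" unfolding \<rho>_def by (rule powr_neg_inverse_bounds[OF A e])+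
    have rpow: "A powr (- \<epsilon> * real n) = \<rho> ^ n" for n using A by (simp add: \<rho>_def powr_power mult.commute)
    have Api: "A powr real_of_int m = A powi m" for m using A by (simp add: powr_real_of_int')
    obtain F where FF: "full_family Cp \<kappa> A \<rho> F"
      using full_family_exists[OF Cp A _ \<rho>(2), of \<kappa>] fam AA \<rho> by auto
    have smF: "d < DD \<Longrightarrow> smooth (F m d)"
      and bdF: "d < DD \<Longrightarrow> w \<in> lists I \<Longrightarrow> \<bar>fw Y w (F m d) x\<bar> \<le> A powi m * (A powi (- m)) ^ wt w * (Cp * B ^ (length w)\<^sup>2)"
      and sumF: "\<alpha> \<in> W1 \<Longrightarrow> \<beta> \<in> W1 \<Longrightarrow> summable (\<lambda>n. \<bar>\<rho> ^ Suc n * (\<Sum>d<DD. fw Y \<alpha> (F m d) x * fw Y \<beta> (F (m + 1 + int n) d) x)\<bar>)"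
      and zeroF: "\<alpha> \<in> W1 \<Longrightarrow> \<beta> \<in> W1 \<Longrightarrow> (\<Sum>n. \<rho> ^ Suc n * (\<Sum>d<DD. fw Y \<alpha> (F m d) x * fw Y \<beta> (F (m + 1 + int n) d) x)) = 0"
      and lowF: "\<alpha> \<in> W1 \<Longrightarrow> ca / 4 \<le> (\<Sum>d<DD. (fw Y \<alpha> (F m d) x)\<^sup>2)"
      and wedgeF: "\<kappa> * (\<Prod>\<alpha>\<in>WW. vnorm DD (\<lambda>d. \<Sum>n. \<rho> ^ n * fw Y \<alpha> (F (m + int n) d) x))
       \<le> wedge_norm DD WW (\<lambda>\<alpha> d. \<Sum>n. \<rho> ^ n * fw Y \<alpha> (F (m + int n) d) x)" for m d w x \<alpha> \<beta>
      using FF unfolding full_family_def by blast+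
    define \<phi> where "\<phi> m d p = F m d (c p)" for m d p
    have LW: "Lword mul e (map (\<lambda>(r, i). Xb r i) w) (\<phi> m d) p = fw Y w (F m d) (c p)" if "w \<in> lists I" "d < DD" for w m d p
      using fun_cong[OF Lword_chart[OF smc c smF[OF that(2)] that(1)]] unfolding \<phi>_def[abs_def] .
    have LD: "Lder mul e (Xb r i) (\<phi> m d) p = fw Y [(r, i)] (F m d) (c p)" if "(r, i) \<in> I" "d < DD" for r i m d p
      using LW[of "[(r, i)]" d m p] that by simp
    have h1: "(1, i) \<in> I" "[(1, i)] \<in> W1" if "i \<in> {1..kk 1}" for i
      using that s2 by (auto simp: idx_def W1_def Wset_def)
    have "thm62_concl mul e s kk Xb K A \<epsilon> \<phi>"
      unfolding thm62_concl_def Let_def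
    proof (intro allI conjI impI ballI)
      show "Cn (s\<^sup>2 + s) (\<phi> m d)" if "d < DD" for m d
        unfolding \<phi>_def[abs_def] by (rule smooth_Cn[OF smooth_compose[OF smF[OF that] smc]])
      fix m
      have Am: "A powi m > 0" "A powi (- m) = 1 / A powi m" using A by (auto simp: power_int_minus inverse_eq_divide)
      have "Cnorm_le mul e Xb (kk 1) DD (s\<^sup>2 + s) (A powi m) (\<phi> m) (K1 * A powi m)"
        unfolding K1_def
      proof (rule Cnorm_le_words[OF Am(1)])
        fix j d p and "is" :: "nat list" assume l: "length is = j" "set is \<subseteq> {1..kk 1}" and d: "d < DD"
        let ?w = "map (Pair 1) is"
        have "\<forall>i\<in>set is. (1, i) \<in> I" using l(2) h1(1) by blast
        then have w: "?w \<in> lists I" by auto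
        have m: "map (Xb 1) is = map (\<lambda>(r, i). Xb r i) ?w" by simp
        have "wt ?w = j" unfolding l(1)[symmetric] by (induction "is") auto
        then show "\<bar>Lword mul e (map (Xb 1) is) (\<phi> m d) p\<bar> \<le> A powi m * (1 / A powi m) ^ j * (Cp * B ^ j\<^sup>2)"
          using bdF[OF d w, of m "c p"] unfolding m LW[OF w d] Am(2) by (simp add: l(1))
      qed (use Cp B2 in auto)
      moreover have "K1 * A powi m \<le> K * A powi m" using KK Am by (intro mult_right_mono) auto
      ultimately show "Cnorm_le mul e Xb (kk 1) DD (s\<^sup>2 + s) (A powr real_of_int m) (\<phi> m) (K * A powr real_of_int m)"
        unfolding Cnorm_le_def Api by (meson order_trans)
      show "case a of (r, i) \<Rightarrow> \<forall>p. vnorm DD (\<lambda>d. Lder mul e (Xb r i) (\<phi> m d) p) \<le> K * A powr (- real_of_int m * (real r - 1))"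
        if "a \<in> idx s kk" for a
      proof -
        obtain r i where a: "a = (r, i)" by (cases a)
        have ri: "(r, i) \<in> I" "1 \<le> r" using that by (auto simp: a idx_def)
        have pw: "A powr (- real_of_int m * (real r - 1)) = A powi m * (A powi (- m)) ^ r"
        proof -
          have "A powr (- real_of_int m * (real r - 1)) = A powr real_of_int m * A powr (real_of_int (- m) * real r)"
            unfolding powr_add[symmetric] by (simp add: algebra_simps)
          also have "A powr (real_of_int (- m) * real r) = (A powr real_of_int (- m)) ^ r" using A by (subst powr_power) (auto simp: mult.commute)
          finally show ?thesis by (simp only: Api)
        qed
        have "vnorm DD (\<lambda>d. Lder mul e (Xb r i) (\<phi> m d) p) \<le> K * A powr (- real_of_int m * (real r - 1))" for p
        proof -
          have "vnorm DD (\<lambda>d. Lder mul e (Xb r i) (\<phi> m d) p) \<le> sqrt (real DD) * (A powi m * (A powi (- m)) ^ r * (Cp * B))"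
          proof (rule vnorm_le)
            show "\<bar>Lder mul e (Xb r i) (\<phi> m d) p\<bar> \<le> A powi m * (A powi (- m)) ^ r * (Cp * B)" if "d < DD" for d
              unfolding LD[OF ri(1) that] using bdF[OF that, of "[(r, i)]" m "c p"] ri by simp
          qed (use Cp B2 Am in auto)
          also have "\<dots> = K2 * (A powi m * (A powi (- m)) ^ r)" by (simp add: K2_def)
          also have "\<dots> \<le> K * (A powi m * (A powi (- m)) ^ r)" using KK Am by (intro mult_right_mono) auto
          finally show ?thesis unfolding pw .
        qed
        then show ?thesis by (simp add: a)
      qed
      fix p
      show "1 / K \<le> vnorm DD (\<lambda>d. Lder mul e (Xb 1 i) (\<phi> m d) p)" if i: "i \<in> {1..kk 1}" for i
      proof -
        have "vnorm DD (\<lambda>d. Lder mul e (Xb 1 i) (\<phi> m d) p) = vnorm DD (\<lambda>d. fw Y [(1, i)] (F m d) (c p))"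
          by (rule vnorm_cong) (rule LD[OF h1(1)[OF i]])
        also have "\<dots> \<ge> sqrt (ca / 4)" unfolding vnorm_def by (rule real_sqrt_le_mono) (rule lowF[OF h1(2)[OF i]])
        finally show ?thesis using Kinv by linarith
      qed
      show "1 / K * (\<Prod>ws\<in>WW. vnorm DD (Wgeq mul e Xb A \<epsilon> \<phi> m ws p)) \<le> wedge_norm DD WW (\<lambda>ws. Wgeq mul e Xb A \<epsilon> \<phi> m ws p)"
      proof -
        define u where "u \<alpha> d = (\<Sum>n. \<rho> ^ n * fw Y \<alpha> (F (m + int n) d) (c p))" for \<alpha> d
        have W: "Wgeq mul e Xb A \<epsilon> \<phi> m \<alpha> p d = u \<alpha> d" if "\<alpha> \<in> WW" "d < DD" for \<alpha> d
          unfolding Wgeq_def Wop_def u_def rpow using LW[of \<alpha> d] Wset_lists[OF that(1)] that(2) by simp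
        have "1 / K * (\<Prod>\<alpha>\<in>WW. vnorm DD (u \<alpha>)) \<le> \<kappa> * (\<Prod>\<alpha>\<in>WW. vnorm DD (u \<alpha>))"
          using Kinv by (intro mult_right_mono prod_nonneg) (auto simp: vnorm_nonneg)
        also have "\<dots> \<le> wedge_norm DD WW u" unfolding u_def[abs_def] by (rule wedgeF)
        also have "\<dots> = wedge_norm DD WW (\<lambda>ws. Wgeq mul e Xb A \<epsilon> \<phi> m ws p)" by (rule wedge_norm_cong) (simp add: W)
        also have "(\<Prod>\<alpha>\<in>WW. vnorm DD (u \<alpha>)) = (\<Prod>ws\<in>WW. vnorm DD (Wgeq mul e Xb A \<epsilon> \<phi> m ws p))"
          by (intro prod.cong refl vnorm_cong) (simp add: W)
        finally show ?thesis .
      qed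
    next
      fix m i j p assume i: "i \<in> {1..kk 1}" and j: "j \<in> {1..kk 1}"
      define a where "a i j n = \<rho> ^ Suc n * (\<Sum>d<DD. fw Y [(1, i)] (F m d) (c p) * fw Y [(1, j)] (F (m + 1 + int n) d) (c p))" for i j :: nat and n
      have sa: "summable (\<lambda>n. \<bar>a i j n\<bar>)" "suminf (a i j) = 0" if "i \<in> {1..kk 1}" "j \<in> {1..kk 1}" for i j
        unfolding a_def[abs_def] by (rule sumF zeroF, (rule h1, rule that)+)+
      have s0: "summable (a i j)" if "i \<in> {1..kk 1}" "j \<in> {1..kk 1}" for i j
        using summable_rabs_cancel[OF sa(1)[OF that]] .
      have vd: "vdot DD (\<lambda>d. Lder mul e (Xb 1 i) (\<phi> m d) p) (\<lambda>d. Lder mul e (Xb 1 j) (\<phi> m' d) p)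
          = (\<Sum>d<DD. fw Y [(1, i)] (F m d) (c p) * fw Y [(1, j)] (F m' d) (c p))" if "i \<in> {1..kk 1}" "j \<in> {1..kk 1}" for i j m'
        unfolding vdot_def using h1(1)[OF that(1)] h1(1)[OF that(2)] by (intro sum.cong refl) (simp add: LD del: fw.simps)
      \<comment> \<open>\<open>Bent\<close> averages the two orders of \<open>i\<close> and
        \<open>j\<close>, and the series vanishes for each order separately.\<close>
      have eq: "A powr (- \<epsilon> * real (n + 1)) * Bent mul e Xb DD (\<phi> m) (\<phi> (m + 1 + int n)) i j p = (a i j n + a j i n) / 2" for n
        unfolding rpow Bent_def vd[OF i j] vd[OF j i] a_def by (simp add: algebra_simps del: fw.simps)
      have "summable (\<lambda>n. (\<bar>a i j n\<bar> + \<bar>a j i n\<bar>) / 2)" by (intro summable_divide summable_add sa i j)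
      then show "summable (\<lambda>n. \<bar>A powr (- \<epsilon> * real (n + 1)) * Bent mul e Xb DD (\<phi> m) (\<phi> (m + 1 + int n)) i j p\<bar>)"
        unfolding eq by (rule summable_comparison_test') (auto simp: abs_triangle_ineq)
      have "(\<Sum>n. (a i j n + a j i n) / 2) = (suminf (a i j) + suminf (a j i)) / 2"
        unfolding suminf_divide[OF summable_add[OF s0[OF i j] s0[OF j i]]] suminf_add[OF s0[OF i j] s0[OF j i]] ..
      then show "(\<Sum>n. A powr (- \<epsilon> * real (n + 1)) * Bent mul e Xb DD (\<phi> m) (\<phi> (m + 1 + int n)) i j p) = 0"
        unfolding eq using sa(2) i j by simp
    qed
    then show ?thesis by blast
  qed
  then show ?thesis using Kp by blast
qed

end

theorem theorem6p2:
  fixes mul :: "'a::euclidean_space \<Rightarrow> 'a \<Rightarrow> 'a" and e :: 'a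
    and s :: nat and kk :: "nat \<Rightarrow> nat" and Xb :: "nat \<Rightarrow> nat \<Rightarrow> 'a"
  assumes "carnot mul e s kk Xb"
  shows "\<exists>C0min. \<forall>C0::real. C0 \<ge> C0min \<longrightarrow>
           (\<exists>K>0. \<exists>Nmin. \<forall>N0. dyadic N0 \<and> N0 \<ge> Nmin \<longrightarrow>
              (\<exists>Amin. \<forall>A. dyadic A \<and> A \<ge> Amin \<longrightarrow>
                 (\<forall>\<epsilon>. 0 < \<epsilon> \<and> \<epsilon> \<le> 1 / A \<longrightarrow>
                    (\<exists>\<phi>. thm62_concl mul e s kk Xb K A \<epsilon> \<phi>))))"
proof -
  interpret carnot_group mul e s kk Xb by unfold_locales (rule assms)
  show ?thesis using concl_exists by blast
qed

end
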